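(* Let $R$ be a Gorenstein (commutative Noetherian) local ring and let $R^h$ be its Henselization. Then $$\mathrm{ca}(R)\subseteq \mathrm{ca}(R^h),$$ i.e. the image of $\mathrm{ca}(R)$ under the inclusion $R\hookrightarrow R^h$ is contained in $\mathrm{ca}(R^h)$.
   Context: The cohomology annihilator of a commutative Noetherian ring $R$ is $\mathrm{ca}(R)=\bigcup_{n\ge 0}\mathrm{ca}^n(R)$, where $\mathrm{ca}^n(R)=\bigcap_{M,N}\mathrm{ann}_R\mathrm{Ext}_R^n(M,N)$, the intersection running over all finitely generated $R$-modules $M,N$. Gorenstein means of finite injective dimension as a module over itself. *)

theory Defs
  imports
    "HOL-Algebra.Module"
    "HOL-Algebra.QuotRing"
    "HOL-Algebra.Ring_Divisibility"
    "HOL-Algebra.UnivPoly"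
begin

section \<open>Modules and homomorphisms\<close>

text \<open>
  HOL cannot quantify over types, so "all modules" has to mean "all modules whose carrier lies in
  a fixed, sufficiently large type". For a ring with elements in \<^typ>\<open>'a\<close> this is the type
  \<^emph>\<open>'a univ\<close> below. If the ring is nonzero then \<^emph>\<open>'a univ\<close> is infinite, of cardinality at least
  \<^emph>\<open>2^|R|\<close>. Hence, up to isomorphism,
  \<^item> every finitely generated module (a quotient of some \<^emph>\<open>R^n\<close>) has its carrier in this type;
    this is proved as \<^emph>\<open>fg_module_univ\<close> below;
  \<^item> with a module also the free module on its underlying set has its carrier in this type, so that
    every module has a free resolution there, and lifting against surjections between modules
    of this type is the same as projectivity;
  \<^item> \<^emph>\<open>R\<close> and its ideals have their carriers in this type, so that by Baer's criterion extension along
    injections between modules of this type is the same as injectivity;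
  \<^item> if \<^emph>\<open>R\<close> is Noetherian, the minimal injective resolution of \<^emph>\<open>R\<close> consists of modules of
    cardinality at most the maximum of \<^emph>\<open>|R|\<close> and \<^emph>\<open>aleph_0\<close>, and so has its carriers in this type.
\<close>

type_synonym 'a univ = "(nat \<Rightarrow> 'a) set"

definition module_hom ::
  "('a, 'm) ring_scheme \<Rightarrow> ('a, 'b) module \<Rightarrow> ('a, 'c) module \<Rightarrow> ('b \<Rightarrow> 'c) set" where
  "module_hom R M N =
    {f \<in> carrier M \<rightarrow> carrier N.
       (\<forall>x\<in>carrier M. \<forall>y\<in>carrier M. f (x \<oplus>\<^bsub>M\<^esub> y) = f x \<oplus>\<^bsub>N\<^esub> f y) \<and>
       (\<forall>a\<in>carrier R. \<forall>x\<in>carrier M. f (a \<odot>\<^bsub>M\<^esub> x) = a \<odot>\<^bsub>N\<^esub> f x)}"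

definition fg_module :: "('a, 'm) ring_scheme \<Rightarrow> ('a, 'b) module \<Rightarrow> bool" where
  "fg_module R M \<longleftrightarrow> module R M \<and>
    (\<exists>S. finite S \<and> S \<subseteq> carrier M \<and> (\<forall>H. submodule H R M \<and> S \<subseteq> H \<longrightarrow> H = carrier M))"

lemma module_transport:
  fixes M :: "('a, 'b) module" and \<phi> :: "'b \<Rightarrow> 'c"
  assumes M: "module R M" and inj: "inj_on \<phi> (carrier M)"
  shows "\<exists>N :: ('a, 'c) module.
    module R N \<and> \<phi> \<in> module_hom R M N \<and> bij_betw \<phi> (carrier M) (carrier N)"
proof -
  interpret module R M by fact
  let ?\<psi> = "inv_into (carrier M) \<phi>"
  define N :: "('a, 'c) module" where
    "N = \<lparr>carrier = \<phi> ` carrier M, mult = undefined, one = undefined, zero = \<phi> \<zero>\<^bsub>M\<^esub>,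
          add = (\<lambda>u v. \<phi> (?\<psi> u \<oplus>\<^bsub>M\<^esub> ?\<psi> v)), smult = (\<lambda>a u. \<phi> (a \<odot>\<^bsub>M\<^esub> ?\<psi> u))\<rparr>"
  have [simp]: "?\<psi> (\<phi> x) = x" if "x \<in> carrier M" for x
    using that inj by simp
  have "abelian_group N"
  proof (rule abelian_groupI)
    fix u assume "u \<in> carrier N"
    then obtain x where "u = \<phi> x" "x \<in> carrier M" by (auto simp: N_def)
    then show "\<exists>v\<in>carrier N. v \<oplus>\<^bsub>N\<^esub> u = \<zero>\<^bsub>N\<^esub>"
      by (intro bexI[of _ "\<phi> (\<ominus>\<^bsub>M\<^esub> x)"]) (auto simp: N_def M.l_neg)
  qed (auto simp: N_def M.a_ac)
  then have "module R N"
    by (intro moduleI R.is_cring) (auto simp: N_def smult_l_distr smult_r_distr smult_assoc1)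
  moreover have "\<phi> \<in> module_hom R M N"
    by (auto simp: module_hom_def N_def)
  moreover have "bij_betw \<phi> (carrier M) (carrier N)"
    using inj by (simp add: N_def bij_betw_def)
  ultimately show ?thesis by blast
qed

lemma fg_module_univ:
  fixes M :: "('a, 'b) module"
  assumes fg: "fg_module R M"
  shows "\<exists>(N :: ('a, 'a univ) module) \<phi>.
    module R N \<and> \<phi> \<in> module_hom R M N \<and> bij_betw \<phi> (carrier M) (carrier N)"
proof -
  interpret module R M using fg by (simp add: fg_module_def)
  obtain S where S: "finite S" "S \<subseteq> carrier M"
    and gen: "\<And>H. submodule H R M \<Longrightarrow> S \<subseteq> H \<Longrightarrow> H = carrier M"
    using fg unfolding fg_module_def by blast
  obtain s and n :: nat where s: "S = s ` {i. i < n}"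
    using S(1) finite_imp_nat_seg_image_inj_on by metis
  have sM [simp]: "s i \<in> carrier M" if "i < n" for i using that S(2) s by auto
  define V where "V = (UNIV :: nat set) \<rightarrow> carrier R"
  define c where "c v = (\<Oplus>\<^bsub>M\<^esub>i\<in>{..<n}. v i \<odot>\<^bsub>M\<^esub> s i)" for v
  have V: "v i \<in> carrier R" if "v \<in> V" for v i using that by (auto simp: V_def)
  have cM: "c v \<in> carrier M" if "v \<in> V" for v
    using that by (auto simp: c_def V intro!: M.finsum_closed)
  have c_add: "c (\<lambda>i. v i \<oplus>\<^bsub>R\<^esub> w i) = c v \<oplus>\<^bsub>M\<^esub> c w" if "v \<in> V" "w \<in> V" for v w
  proof -
    have "c v \<oplus>\<^bsub>M\<^esub> c w = (\<Oplus>\<^bsub>M\<^esub>i\<in>{..<n}. v i \<odot>\<^bsub>M\<^esub> s i \<oplus>\<^bsub>M\<^esub> w i \<odot>\<^bsub>M\<^esub> s i)"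
      unfolding c_def using that by (intro M.finsum_addf[symmetric]) (auto simp: V)
    also have "\<dots> = c (\<lambda>i. v i \<oplus>\<^bsub>R\<^esub> w i)"
      unfolding c_def using that by (intro M.finsum_cong') (auto simp: V smult_l_distr)
    finally show ?thesis ..
  qed
  have c_smult: "c (\<lambda>i. a \<otimes>\<^bsub>R\<^esub> v i) = a \<odot>\<^bsub>M\<^esub> c v" if "v \<in> V" "a \<in> carrier R" for v a
  proof -
    have "a \<odot>\<^bsub>M\<^esub> c v = (\<Oplus>\<^bsub>M\<^esub>i\<in>{..<n}. a \<odot>\<^bsub>M\<^esub> (v i \<odot>\<^bsub>M\<^esub> s i))"
      unfolding c_def using that by (intro finsum_smult_ldistr) (auto simp: V)
    also have "\<dots> = c (\<lambda>i. a \<otimes>\<^bsub>R\<^esub> v i)"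
      unfolding c_def using that by (intro M.finsum_cong') (auto simp: V smult_assoc1)
    finally show ?thesis ..
  qed
  have zeroV: "(\<lambda>i. \<zero>\<^bsub>R\<^esub>) \<in> V" by (simp add: V_def)
  have c_zero: "c (\<lambda>i. \<zero>\<^bsub>R\<^esub>) = \<zero>\<^bsub>M\<^esub>"
    unfolding c_def by (intro M.add.finprod_one_eqI) simp
  have sub: "submodule (c ` V) R M"
  proof (rule submoduleI)
    show "c ` V \<subseteq> carrier M" using cM by auto
    show "\<zero>\<^bsub>M\<^esub> \<in> c ` V" using zeroV c_zero by (metis image_eqI)
    show add: "a \<oplus>\<^bsub>M\<^esub> b \<in> c ` V" if "a \<in> c ` V" "b \<in> c ` V" for a b
      using that by (force simp: c_add[symmetric] V_def)
    show sm: "a \<odot>\<^bsub>M\<^esub> x \<in> c ` V" if "a \<in> carrier R" "x \<in> c ` V" for a x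
      using that by (force simp: c_smult[symmetric] V_def)
    show "\<ominus>\<^bsub>M\<^esub> a \<in> c ` V" if "a \<in> c ` V" for a
    proof -
      have "a \<in> carrier M" using that cM by auto
      then have "\<ominus>\<^bsub>M\<^esub> a = (\<ominus>\<^bsub>R\<^esub> \<one>\<^bsub>R\<^esub>) \<odot>\<^bsub>M\<^esub> a" by (simp add: smult_l_minus)
      then show ?thesis using sm[OF _ that] by simp
    qed
  qed
  have "S \<subseteq> c ` V"
  proof
    fix x assume "x \<in> S"
    then obtain j where j: "j < n" "x = s j" using s by auto
    let ?v = "\<lambda>i. if i = j then \<one>\<^bsub>R\<^esub> else \<zero>\<^bsub>R\<^esub>"
    have "c ?v = (\<Oplus>\<^bsub>M\<^esub>i\<in>{..<n}. if j = i then s i else \<zero>\<^bsub>M\<^esub>)"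
      unfolding c_def by (intro M.finsum_cong') auto
    also have "\<dots> = s j" using j by (intro M.finsum_singleton) auto
    finally show "x \<in> c ` V" using j by (auto simp: V_def intro!: image_eqI[of _ c ?v])
  qed
  with sub gen have span: "c ` V = carrier M" by blast
  have "inj_on (\<lambda>x. {v \<in> V. c v = x}) (carrier M)"
    unfolding inj_on_def span[symmetric] by blast
  from module_transport[OF module_axioms this] show ?thesis by blast
qed

definition self_module :: "('a, 'm) ring_scheme \<Rightarrow> ('a, 'a) module" where
  "self_module R =
    \<lparr>carrier = carrier R, mult = mult R, one = one R, zero = zero R, add = add R, smult = mult R\<rparr>"

definition annihilator :: "('a, 'm) ring_scheme \<Rightarrow> ('a, 'b) module \<Rightarrow> 'a set" where
  "annihilator R M = {a \<in> carrier R. \<forall>x\<in>carrier M. a \<odot>\<^bsub>M\<^esub> x = \<zero>\<^bsub>M\<^esub>}"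

text \<open>
  The fields \<^emph>\<open>mult\<close> and \<^emph>\<open>one\<close>, which \<^typ>\<open>('a, 'b) module\<close> inherits from rings, carry no
  information for a module and are left undefined in the next two constructions. The elements of
  a Hom module are extensional on the domain, so that equality in the carrier is equality of maps.
\<close>

definition hom_module ::
  "('a, 'm) ring_scheme \<Rightarrow> ('a, 'b) module \<Rightarrow> ('a, 'c) module \<Rightarrow> ('a, 'b \<Rightarrow> 'c) module" where
  "hom_module R M N =
    \<lparr>carrier = module_hom R M N \<inter> extensional (carrier M),
     mult = undefined, one = undefined,
     zero = (\<lambda>x\<in>carrier M. \<zero>\<^bsub>N\<^esub>),
     add = (\<lambda>f g. \<lambda>x\<in>carrier M. f x \<oplus>\<^bsub>N\<^esub> g x),
     smult = (\<lambda>a f. \<lambda>x\<in>carrier M. a \<odot>\<^bsub>N\<^esub> f x)\<rparr>"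

definition quot_module :: "('a, 'b) module \<Rightarrow> 'b set \<Rightarrow> ('a, 'b set) module" where
  "quot_module M K =
    \<lparr>carrier = a_rcosets\<^bsub>M\<^esub> K,
     mult = undefined, one = undefined,
     zero = K,
     add = set_add M,
     smult = (\<lambda>a X. \<Union>x\<in>X. K +>\<^bsub>M\<^esub> (a \<odot>\<^bsub>M\<^esub> x))\<rparr>"

lemma hom_module_module:
  assumes M: "module R M" and N: "module R N"
  shows "module R (hom_module R M N)"
proof -
  interpret M: module R M by fact
  interpret N: module R N by fact
  let ?H = "hom_module R M N"
  have "abelian_group ?H"
  proof (rule abelian_groupI)
    fix f assume f: "f \<in> carrier ?H"
    show "\<zero>\<^bsub>?H\<^esub> \<oplus>\<^bsub>?H\<^esub> f = f"
      using f by (auto simp: hom_module_def module_hom_def extensional_def Pi_iff fun_eq_iff)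
    have cl: "f x \<in> carrier N" if "x \<in> carrier M" for x
      using f that by (auto simp: hom_module_def module_hom_def)
    show "\<exists>g\<in>carrier ?H. g \<oplus>\<^bsub>?H\<^esub> f = \<zero>\<^bsub>?H\<^esub>"
      using f cl
      by (intro bexI[of _ "\<lambda>x\<in>carrier M. \<ominus>\<^bsub>N\<^esub> f x"])
        (auto simp: hom_module_def module_hom_def fun_eq_iff N.M.minus_add N.smult_r_minus N.M.l_neg)
  qed (auto simp: hom_module_def module_hom_def fun_eq_iff Pi_iff N.M.a_ac N.smult_r_distr)
  then show ?thesis
    by (rule moduleI[OF M.R.is_cring])
      (auto simp: hom_module_def module_hom_def Pi_iff fun_eq_iff N.smult_r_distr N.smult_l_distr
         N.smult_assoc1[symmetric] M.R.m_comm extensional_def)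
qed

lemma quot_module_module:
  assumes M: "module R M" and K: "submodule K R M"
  shows "module R (quot_module M K)"
proof -
  interpret M: module R M by fact
  interpret K: submodule K R M by fact
  interpret K: abelian_subgroup K M
    by (rule abelian_subgroupI3) (auto intro!: additive_subgroup.intro K.subgroup_axioms M.abelian_group_axioms)
  have sm: "(\<Union>x\<in>K +>\<^bsub>M\<^esub> y. K +>\<^bsub>M\<^esub> (a \<odot>\<^bsub>M\<^esub> x)) = K +>\<^bsub>M\<^esub> (a \<odot>\<^bsub>M\<^esub> y)"
    if "a \<in> carrier R" "y \<in> carrier M" for a y
  proof -
    have "K +>\<^bsub>M\<^esub> (a \<odot>\<^bsub>M\<^esub> x) = K +>\<^bsub>M\<^esub> (a \<odot>\<^bsub>M\<^esub> y)" if x: "x \<in> K +>\<^bsub>M\<^esub> y" for x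
    proof -
      from x obtain k where k: "k \<in> K" "x = k \<oplus>\<^bsub>M\<^esub> y" by (auto simp: a_r_coset_def')
      then have "a \<odot>\<^bsub>M\<^esub> x = a \<odot>\<^bsub>M\<^esub> k \<oplus>\<^bsub>M\<^esub> a \<odot>\<^bsub>M\<^esub> y" "a \<odot>\<^bsub>M\<^esub> k \<in> K"
        using \<open>a \<in> carrier R\<close> \<open>y \<in> carrier M\<close> by (auto simp: M.smult_r_distr)
      then have "a \<odot>\<^bsub>M\<^esub> x \<in> K +>\<^bsub>M\<^esub> (a \<odot>\<^bsub>M\<^esub> y)" by (auto simp: a_r_coset_def')
      then show ?thesis
        using M.a_repr_independence[OF _ _ K.subgroup_axioms]
          M.smult_closed[OF \<open>a \<in> carrier R\<close> \<open>y \<in> carrier M\<close>] by blast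
    qed
    moreover have "y \<in> K +>\<^bsub>M\<^esub> y" using that K.a_rcos_self by simp
    ultimately show ?thesis by blast
  qed
  have rc: "X \<in> a_rcosets\<^bsub>M\<^esub> K \<longleftrightarrow> (\<exists>x\<in>carrier M. X = K +>\<^bsub>M\<^esub> x)" for X
    by (auto simp: A_RCOSETS_def' )
  have K0: "K = K +>\<^bsub>M\<^esub> \<zero>\<^bsub>M\<^esub>" using K.subset by (auto simp: a_r_coset_def')
  have "abelian_group (quot_module M K)"
  proof (rule abelian_groupI)
    show "\<zero>\<^bsub>quot_module M K\<^esub> \<in> carrier (quot_module M K)"
      using K0 by (auto simp: quot_module_def rc)
  next
    fix X assume "X \<in> carrier (quot_module M K)"
    then obtain x where x: "x \<in> carrier M" "X = K +>\<^bsub>M\<^esub> x" by (auto simp: quot_module_def rc)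
    then show "\<exists>Y\<in>carrier (quot_module M K).
        Y \<oplus>\<^bsub>quot_module M K\<^esub> X = \<zero>\<^bsub>quot_module M K\<^esub>"
      using K0 by (intro bexI[of _ "K +>\<^bsub>M\<^esub> (\<ominus>\<^bsub>M\<^esub> x)"])
        (auto simp: quot_module_def rc K.a_rcos_sum M.M.l_neg)
    have "(K +>\<^bsub>M\<^esub> \<zero>\<^bsub>M\<^esub>) <+>\<^bsub>M\<^esub> X = X"
      using x by (simp add: K.a_rcos_sum)
    then show "\<zero>\<^bsub>quot_module M K\<^esub> \<oplus>\<^bsub>quot_module M K\<^esub> X = X"
      using K0 by (simp add: quot_module_def)
  qed (auto simp: quot_module_def rc K.a_rcos_sum M.M.a_ac)
  moreover have "carrier (quot_module M K) = (+>\<^bsub>M\<^esub>) K ` carrier M"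
    by (auto simp: quot_module_def rc)
  moreover have "a \<odot>\<^bsub>quot_module M K\<^esub> (K +>\<^bsub>M\<^esub> y) = K +>\<^bsub>M\<^esub> (a \<odot>\<^bsub>M\<^esub> y)"
    if "a \<in> carrier R" "y \<in> carrier M" for a y
    using sm[OF that] by (simp add: quot_module_def)
  moreover have "(K +>\<^bsub>M\<^esub> x) \<oplus>\<^bsub>quot_module M K\<^esub> (K +>\<^bsub>M\<^esub> y) = K +>\<^bsub>M\<^esub> (x \<oplus>\<^bsub>M\<^esub> y)"
    if "x \<in> carrier M" "y \<in> carrier M" for x y
    using that by (simp add: quot_module_def K.a_rcos_sum)
  ultimately show ?thesis
    by (intro moduleI M.R.is_cring)
      (auto simp: M.smult_l_distr M.smult_r_distr M.smult_assoc1)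
qed


section \<open>Ext\<close>

definition projective_module :: "('a, 'm) ring_scheme \<Rightarrow> ('a, 'a univ) module \<Rightarrow> bool" where
  "projective_module R P \<longleftrightarrow> module R P \<and>
    (\<forall>(A :: ('a, 'a univ) module) (B :: ('a, 'a univ) module) g f.
       module R A \<and> module R B \<and>
       g \<in> module_hom R A B \<and> g ` carrier A = carrier B \<and> f \<in> module_hom R P B \<longrightarrow>
       (\<exists>h \<in> module_hom R P A. \<forall>x\<in>carrier P. g (h x) = f x))"

text \<open>
  \<^emph>\<open>projective_resolution R M P d e\<close>:
  the complex \<^emph>\<open>\<dots> --d 1--> P 1 --d 0--> P 0 --e--> M --> 0\<close> is exact with all \<^emph>\<open>P n\<close> projective.
\<close>

definition projective_resolution ::
  "('a, 'm) ring_scheme \<Rightarrow> ('a, 'b) module \<Rightarrow> (nat \<Rightarrow> ('a, 'a univ) module) \<Rightarrow>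
   (nat \<Rightarrow> 'a univ \<Rightarrow> 'a univ) \<Rightarrow> ('a univ \<Rightarrow> 'b) \<Rightarrow> bool" where
  "projective_resolution R M P d e \<longleftrightarrow>
    (\<forall>n. projective_module R (P n)) \<and>
    e \<in> module_hom R (P 0) M \<and>
    (\<forall>n. d n \<in> module_hom R (P (Suc n)) (P n)) \<and>
    e ` carrier (P 0) = carrier M \<and>
    d 0 ` carrier (P 1) = a_kernel (P 0) M e \<and>
    (\<forall>n. d (Suc n) ` carrier (P (Suc (Suc n))) = a_kernel (P (Suc n)) (P n) (d n))"

definition coboundary ::
  "(nat \<Rightarrow> ('a, 'b) module) \<Rightarrow> (nat \<Rightarrow> 'b \<Rightarrow> 'b) \<Rightarrow> nat \<Rightarrow> ('b \<Rightarrow> 'c) \<Rightarrow> ('b \<Rightarrow> 'c)" where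
  "coboundary P d n f = (\<lambda>x\<in>carrier (P (Suc n)). f (d n x))"

definition cocycles ::
  "('a, 'm) ring_scheme \<Rightarrow> (nat \<Rightarrow> ('a, 'b) module) \<Rightarrow> (nat \<Rightarrow> 'b \<Rightarrow> 'b) \<Rightarrow> ('a, 'c) module \<Rightarrow>
   nat \<Rightarrow> ('b \<Rightarrow> 'c) set" where
  "cocycles R P d N n =
    a_kernel (hom_module R (P n) N) (hom_module R (P (Suc n)) N) (coboundary P d n)"

fun coboundaries ::
  "('a, 'm) ring_scheme \<Rightarrow> (nat \<Rightarrow> ('a, 'b) module) \<Rightarrow> (nat \<Rightarrow> 'b \<Rightarrow> 'b) \<Rightarrow> ('a, 'c) module \<Rightarrow>
   nat \<Rightarrow> ('b \<Rightarrow> 'c) set" where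
  "coboundaries R P d N 0 = {\<zero>\<^bsub>hom_module R (P 0) N\<^esub>}"
| "coboundaries R P d N (Suc n) = coboundary P d n ` carrier (hom_module R (P n) N)"

definition hom_cohomology ::
  "('a, 'm) ring_scheme \<Rightarrow> (nat \<Rightarrow> ('a, 'b) module) \<Rightarrow> (nat \<Rightarrow> 'b \<Rightarrow> 'b) \<Rightarrow> ('a, 'c) module \<Rightarrow>
   nat \<Rightarrow> ('a, ('b \<Rightarrow> 'c) set) module" where
  "hom_cohomology R P d N n =
    quot_module ((hom_module R (P n) N)\<lparr>carrier := cocycles R P d N n\<rparr>) (coboundaries R P d N n)"

text \<open>
  \<^emph>\<open>Ext\<close> is computed from a chosen projective resolution of the first argument; as usual, another
  choice gives an isomorphic module.
\<close>

definition Ext ::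
  "('a, 'm) ring_scheme \<Rightarrow> nat \<Rightarrow> ('a, 'b) module \<Rightarrow> ('a, 'c) module \<Rightarrow>
   ('a, ('a univ \<Rightarrow> 'c) set) module" where
  "Ext R n M N =
    (let (P, d, e) = (SOME (P, d, e). projective_resolution R M P d e) in hom_cohomology R P d N n)"


section \<open>The cohomology annihilator\<close>

definition ca_n :: "('a, 'm) ring_scheme \<Rightarrow> nat \<Rightarrow> 'a set" where
  "ca_n R n =
    {a \<in> carrier R. \<forall>(M :: ('a, 'a univ) module) (N :: ('a, 'a univ) module).
       fg_module R M \<and> fg_module R N \<longrightarrow> a \<in> annihilator R (Ext R n M N)}"

definition ca :: "('a, 'm) ring_scheme \<Rightarrow> 'a set" where
  "ca R = (\<Union>n. ca_n R n)"


section \<open>Gorenstein rings\<close>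

definition injective_module :: "('a, 'm) ring_scheme \<Rightarrow> ('a, 'a univ) module \<Rightarrow> bool" where
  "injective_module R E \<longleftrightarrow> module R E \<and>
    (\<forall>(A :: ('a, 'a univ) module) (B :: ('a, 'a univ) module) g f.
       module R A \<and> module R B \<and>
       g \<in> module_hom R A B \<and> inj_on g (carrier A) \<and> f \<in> module_hom R A E \<longrightarrow>
       (\<exists>h \<in> module_hom R B E. \<forall>x\<in>carrier A. h (g x) = f x))"

text \<open>
  \<^emph>\<open>injective_resolution R M I d i\<close>:
  the complex \<^emph>\<open>0 --> M --i--> I 0 --d 0--> I 1 --d 1--> \<dots>\<close> is exact with all \<^emph>\<open>I n\<close> injective.
\<close>

definition injective_resolution ::
  "('a, 'm) ring_scheme \<Rightarrow> ('a, 'b) module \<Rightarrow> (nat \<Rightarrow> ('a, 'a univ) module) \<Rightarrow>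
   (nat \<Rightarrow> 'a univ \<Rightarrow> 'a univ) \<Rightarrow> ('b \<Rightarrow> 'a univ) \<Rightarrow> bool" where
  "injective_resolution R M I d i \<longleftrightarrow>
    (\<forall>n. injective_module R (I n)) \<and>
    i \<in> module_hom R M (I 0) \<and>
    (\<forall>n. d n \<in> module_hom R (I n) (I (Suc n))) \<and>
    inj_on i (carrier M) \<and>
    i ` carrier M = a_kernel (I 0) (I 1) (d 0) \<and>
    (\<forall>n. d n ` carrier (I n) = a_kernel (I (Suc n)) (I (Suc (Suc n))) (d (Suc n)))"

definition finite_injective_dimension ::
  "('a, 'm) ring_scheme \<Rightarrow> ('a, 'b) module \<Rightarrow> bool" where
  "finite_injective_dimension R M \<longleftrightarrow>
    (\<exists>I d i n. injective_resolution R M I d i \<and> (\<forall>k>n. carrier (I k) = {\<zero>\<^bsub>I k\<^esub>}))"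

definition gorenstein_ring :: "('a, 'm) ring_scheme \<Rightarrow> bool" where
  "gorenstein_ring R \<longleftrightarrow>
    cring R \<and> noetherian_ring R \<and> finite_injective_dimension R (self_module R)"


section \<open>Henselization\<close>

definition local_ring :: "('a, 'm) ring_scheme \<Rightarrow> bool" where
  "local_ring R \<longleftrightarrow> cring R \<and> (\<exists>!m. maximalideal m R)"

definition max_ideal :: "('a, 'm) ring_scheme \<Rightarrow> 'a set" where
  "max_ideal R = (THE m. maximalideal m R)"

definition local_hom :: "('a, 'm) ring_scheme \<Rightarrow> ('b, 'n) ring_scheme \<Rightarrow> ('a \<Rightarrow> 'b) \<Rightarrow> bool" where
  "local_hom R S f \<longleftrightarrow> f \<in> ring_hom R S \<and> f ` max_ideal R \<subseteq> max_ideal S"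

definition residue_field :: "('a, 'm) ring_scheme \<Rightarrow> 'a set ring" where
  "residue_field R = R Quot max_ideal R"

definition residue_map :: "('a, 'm) ring_scheme \<Rightarrow> 'a \<Rightarrow> 'a set" where
  "residue_map R a = max_ideal R +>\<^bsub>R\<^esub> a"

definition poly_deriv :: "('a, 'm) ring_scheme \<Rightarrow> (nat \<Rightarrow> 'a) \<Rightarrow> nat \<Rightarrow> 'a" where
  "poly_deriv R f = (\<lambda>n. [Suc n] \<cdot>\<^bsub>R\<^esub> coeff (UP R) f (Suc n))"

text \<open>
  A local ring is Henselian if for every monic \<^emph>\<open>f\<close>, every simple root in the residue field of the
  reduction of \<^emph>\<open>f\<close> lifts to a root of \<^emph>\<open>f\<close>. Evaluation along \<^const>\<open>residue_map\<close> reduces the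
  coefficients of \<^emph>\<open>f\<close>.
\<close>

definition henselian_ring :: "('a, 'm) ring_scheme \<Rightarrow> bool" where
  "henselian_ring R \<longleftrightarrow> local_ring R \<and>
    (\<forall>f \<in> carrier (UP R). \<forall>\<alpha> \<in> carrier (residue_field R).
       coeff (UP R) f (deg R f) = \<one>\<^bsub>R\<^esub> \<and>
       eval R (residue_field R) (residue_map R) \<alpha> f = \<zero>\<^bsub>residue_field R\<^esub> \<and>
       eval R (residue_field R) (residue_map R) \<alpha> (poly_deriv R f) \<noteq> \<zero>\<^bsub>residue_field R\<^esub> \<longrightarrow>
       (\<exists>a \<in> carrier R. eval R R id a f = \<zero>\<^bsub>R\<^esub> \<and> residue_map R a = \<alpha>))"

text \<open>
  The Henselization \<^emph>\<open>\<phi> : R \<rightarrow> H\<close>, by its universal property: \<^emph>\<open>H\<close> is a Henselian local ring, \<^emph>\<open>\<phi>\<close> is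
  local, and every local homomorphism from \<^emph>\<open>R\<close> to a Henselian local ring factors through \<^emph>\<open>\<phi>\<close>
  by a unique local homomorphism. The test rings \<^emph>\<open>A\<close> have their carriers in \<^typ>\<open>nat \<Rightarrow> 'a + 'b\<close>.
  This type has room for a copy of \<^emph>\<open>H\<close>, and for a copy of the Henselization of \<^emph>\<open>R\<close> given by the
  usual construction, the cardinality of which is at most the maximum of \<^emph>\<open>|R|\<close> and \<^emph>\<open>aleph_0\<close>. Testing
  against these two determines \<^emph>\<open>H\<close> up to unique isomorphism over \<^emph>\<open>R\<close>, so nothing is lost compared
  to test rings in arbitrary types.
\<close>

definition is_henselization ::
  "('a, 'm) ring_scheme \<Rightarrow> ('b, 'n) ring_scheme \<Rightarrow> ('a \<Rightarrow> 'b) \<Rightarrow> bool" where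
  "is_henselization R H \<phi> \<longleftrightarrow>
    local_ring R \<and> henselian_ring H \<and> local_hom R H \<phi> \<and>
    (\<forall>(A :: (nat \<Rightarrow> 'a + 'b) ring) \<psi>. henselian_ring A \<and> local_hom R A \<psi> \<longrightarrow>
       (\<exists>\<chi>. local_hom H A \<chi> \<and> (\<forall>x\<in>carrier R. \<chi> (\<phi> x) = \<psi> x) \<and>
         (\<forall>\<chi>'. local_hom H A \<chi>' \<and> (\<forall>x\<in>carrier R. \<chi>' (\<phi> x) = \<psi> x) \<longrightarrow>
           (\<forall>y\<in>carrier H. \<chi>' y = \<chi> y))))"

end

theory Submission
  imports Defs "HOL-Algebra.Weak_Morphisms" "HOL-Algebra.Subrings"
begin

text \<open>Write \<open>H\<close> for the Henselization. By the universal property \<open>H\<close> is the smallest subring of itself that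
  contains \<open>R\<close>, inverts units of \<open>H\<close> and is closed under adjoining simple roots of monic polynomials. Three
  facts follow by this kind of induction: \<open>H = R + q H\<close> for all ideals \<open>q\<close> primary to the maximal ideal,
  and \<open>q H\<close> contracts to \<open>q\<close>; \<open>H\<close> is a union of Noetherian subrings with the same property; and for every finite
  subset \<open>Z\<close> of \<open>H\<close> there is \<open>e = \<Sum> u \<otimes> v\<close> in \<open>H \<otimes>\<^sub>R H\<close> with \<open>\<Sum> u v = 1\<close> and \<open>(z \<otimes> 1 - 1 \<otimes> z) e = 0\<close> for \<open>z \<in> Z\<close>. The first
  two, with Krull's intersection theorem, make \<open>H\<close> Noetherian and flat over \<open>R\<close>. The third makes every finitely
  generated \<open>H\<close>-module \<open>M\<close> a retract of \<open>H \<otimes>\<^sub>R N\<close> for some finitely generated \<open>R\<close>-module \<open>N\<close>.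

  Let \<open>a\<close> annihilate \<open>Ext\<^sup>n\<close> over \<open>R\<close> with \<open>n > 0\<close>, and let \<open>F\<close> be a resolution of \<open>N\<close> by finitely generated
  free modules. Then multiplication by \<open>a\<close> on \<open>F\<^sub>n\<close> has the form \<open>K d + d K'\<close>. This identity survives the base
  change to \<open>H\<close>, which resolves \<open>H \<otimes>\<^sub>R N\<close>, so \<open>a\<close> annihilates \<open>Ext\<^sup>n\<close> of \<open>H \<otimes>\<^sub>R N\<close> and hence of its
  retract \<open>M\<close>. For \<open>n = 0\<close> already \<open>a = 0\<close>.\<close>

section \<open>Local rings\<close>

text \<open>\<open>H\<close> is given only by its universal property, so there is no direct limit of
  etale neighbourhoods to compute in. Facts about \<open>H\<close> have two sources: homomorphisms
  from \<open>H\<close> to Henselian rings that are at hand, namely quotients of \<open>R\<close> by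
  primary ideals, and subrings of \<open>H\<close> closed under the generating steps. Krull's
  theorem turns statements modulo all primary ideals into statements about \<open>H\<close>, but it
  presupposes a Noetherian ring; the Noetherian subrings break this circle.

  A finitely generated \<open>H\<close>-module need not be extended from \<open>R\<close>, and the
  second argument of Ext over \<open>H\<close> is an arbitrary one. The first obstacle is met by a
  section of \<open>H \<otimes>\<^sub>R M \<rightarrow> M\<close>; as \<open>H\<close> is only a
  union of etale pieces, the separability element behind it depends on the finitely many scalars it
  must commute with. The second is met by trading annihilation of Ext for a homotopy, which consists
  of matrices over \<open>R\<close>. Tensor products with \<open>H\<close> are mostly written as
  cokernels of base changed presentations.\<close>

lemma (in cring) nonunit_in_maximalideal:
  assumes x: "x \<in> carrier R" "x \<notin> Units R"
  shows "\<exists>m. maximalideal m R \<and> x \<in> m"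
proof -
  define F where "F = {I. ideal I R \<and> x \<in> I \<and> \<one> \<notin> I}"
  have prI: "PIdl x \<in> F"
  proof -
    have "\<one> \<notin> PIdl x"
    proof
      assume "\<one> \<in> PIdl x"
      then obtain y where "y \<in> carrier R" "\<one> = y \<otimes> x" by (auto simp: cgenideal_def)
      with x show False by (auto simp: Units_def m_comm)
    qed
    with x show ?thesis by (simp add: F_def cgenideal_ideal cgenideal_self)
  qed
  have "\<exists>M\<in>F. \<forall>X\<in>F. M \<subseteq> X \<longrightarrow> X = M"
  proof (rule subset_Zorn_nonempty)
    show "F \<noteq> {}" using prI by blast
    fix C assume C: "C \<noteq> {}" "subset.chain F C"
    have "subset.chain {I. ideal I R} C"
      using C(2) by (auto simp: F_def subset_chain_def)
    from chain_Union_is_ideal[OF this] C(1) have "ideal (\<Union>C) R" by simp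
    then show "\<Union>C \<in> F" using C by (auto simp: F_def subset_chain_def)
  qed
  then obtain M where M: "M \<in> F" "\<forall>X\<in>F. M \<subseteq> X \<longrightarrow> X = M" by blast
  have "maximalideal M R"
  proof (rule maximalidealI)
    show "ideal M R" using M by (simp add: F_def)
    show "carrier R \<noteq> M" using M by (auto simp: F_def)
    fix J assume J: "ideal J R" "M \<subseteq> J" "J \<subseteq> carrier R"
    show "J = M \<or> J = carrier R"
    proof (cases "\<one> \<in> J")
      case True then show ?thesis using ideal.one_imp_carrier[OF J(1)] by blast
    next
      case False then show ?thesis using M J by (auto simp: F_def)
    qed
  qed
  then show ?thesis using M by (auto simp: F_def)
qed

lemma (in cring) UnitsI:
  "x \<in> carrier R \<Longrightarrow> y \<in> carrier R \<Longrightarrow> x \<otimes> y = \<one> \<Longrightarrow> x \<in> Units R"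
  unfolding Units_def using m_comm[of x y] by force

lemma ring_hom_cring_intro:
  "cring A \<Longrightarrow> cring B \<Longrightarrow> h \<in> ring_hom A B \<Longrightarrow> ring_hom_cring A B h"
  by (intro ring_hom_cring.intro) (auto simp: ring_hom_cring_axioms_def)

lemma ring_hom_Units:
  assumes "cring A" "cring B" "h \<in> ring_hom A B" "x \<in> Units A"
  shows "h x \<in> Units B"
proof -
  interpret h: ring_hom_cring A B h using assms by (intro ring_hom_cring_intro)
  have "h x \<otimes>\<^bsub>B\<^esub> h (inv\<^bsub>A\<^esub> x) = h (x \<otimes>\<^bsub>A\<^esub> inv\<^bsub>A\<^esub> x)" using assms(4) by (subst h.hom_mult) auto
  then show ?thesis using assms(4) by (intro h.S.UnitsI[of _ "h (inv\<^bsub>A\<^esub> x)"]) auto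
qed

lemma local_ring_maximalideal:
  assumes "local_ring A" shows "maximalideal (max_ideal A) A"
  using assms unfolding local_ring_def max_ideal_def by (metis theI')

text \<open>A nonunit lies in some maximal ideal by Zorn's lemma, and there is only one. Locality is
  mostly used in this form later on.\<close>

lemma local_ring_Units_iff:
  fixes A (structure)
  assumes A: "local_ring A" and x: "x \<in> carrier A"
  shows "x \<in> Units A \<longleftrightarrow> x \<notin> max_ideal A"
proof -
  interpret cring A using A by (simp add: local_ring_def)
  interpret m: maximalideal "max_ideal A" A by (rule local_ring_maximalideal[OF A])
  have "x \<notin> max_ideal A" if "x \<in> Units A"
  proof
    assume "x \<in> max_ideal A"
    then have "inv x \<otimes> x \<in> max_ideal A" using that by (intro m.I_l_closed) auto
    then have "\<one> \<in> max_ideal A" using that by simp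
    then show False using m.one_imp_carrier m.I_notcarr by blast
  qed
  moreover have "x \<in> max_ideal A" if u: "x \<notin> Units A"
  proof -
    obtain m where m: "maximalideal m A" "x \<in> m" using nonunit_in_maximalideal[OF x u] by blast
    moreover have "m = max_ideal A"
      using A m(1) local_ring_maximalideal[OF A] unfolding local_ring_def by metis
    ultimately show ?thesis by simp
  qed
  ultimately show ?thesis by blast
qed

text \<open>A proper ideal whose complement consists of units contains every other proper ideal. The
  rule also computes \<open>max_ideal\<close>, which is defined by description; it is applied to
  subrings, quotients and isomorphic copies.\<close>

lemma local_ringI:
  fixes A (structure)
  assumes "cring A" and m: "ideal m A" and one: "\<one>\<^bsub>A\<^esub> \<notin> m"
    and U: "\<And>x. x \<in> carrier A \<Longrightarrow> x \<notin> m \<Longrightarrow> x \<in> Units A"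
  shows "local_ring A" and "max_ideal A = m"
proof -
  interpret cring A by fact
  have max: "maximalideal m A"
  proof (rule maximalidealI[OF m])
    show "carrier A \<noteq> m" using one by blast
    fix J assume J: "ideal J A" "m \<subseteq> J" "J \<subseteq> carrier A"
    interpret J: ideal J A by fact
    show "J = m \<or> J = carrier A"
    proof (cases "J \<subseteq> m")
      case False
      then obtain x where x: "x \<in> J" "x \<notin> m" by blast
      then have "x \<in> Units A" using U J by blast
      then have "inv x \<otimes> x \<in> J" using x by (intro J.I_l_closed) auto
      then show ?thesis using J.one_imp_carrier \<open>x \<in> Units A\<close> by simp
    qed (use J in blast)
  qed
  have uniq: "m' = m" if m': "maximalideal m' A" for m'
  proof -
    interpret m': maximalideal m' A by fact
    have "m' \<subseteq> m"
    proof
      fix x assume x: "x \<in> m'"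
      show "x \<in> m"
      proof (rule ccontr)
        assume "x \<notin> m"
        then have u: "x \<in> Units A" using U x m'.Icarr by blast
        then have "inv x \<otimes> x \<in> m'" using x by (intro m'.I_l_closed) auto
        then show False using u m'.one_imp_carrier m'.I_notcarr by auto
      qed
    qed
    moreover have "m \<subseteq> carrier A" using ideal.Icarr[OF m] by blast
    ultimately show ?thesis using m'.I_maximal[OF m] one by auto
  qed
  show "local_ring A" unfolding local_ring_def using max uniq \<open>cring A\<close> by blast
  show "max_ideal A = m" unfolding max_ideal_def by (intro the_equality max uniq)
qed

lemma local_ring_one_notin: "local_ring A \<Longrightarrow> \<one>\<^bsub>A\<^esub> \<notin> max_ideal A"
  using local_ring_Units_iff[of A "\<one>\<^bsub>A\<^esub>"]
  by (simp add: cring.cring_simprules local_ring_def cring_def ring.is_monoid monoid.Units_one_closed)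

text \<open>\<open>local_hom\<close> demands one inclusion only; the converse holds because units
  map to units.\<close>

lemma local_hom_mem_iff:
  assumes "local_ring A" "local_ring B" "local_hom A B f" "x \<in> carrier A"
  shows "f x \<in> max_ideal B \<longleftrightarrow> x \<in> max_ideal A"
proof
  assume fx: "f x \<in> max_ideal B"
  show "x \<in> max_ideal A"
  proof (rule ccontr)
    interpret A: cring A using assms by (simp add: local_ring_def)
    interpret B: cring B using assms by (simp add: local_ring_def)
    interpret f: ring_hom_cring A B f
      using assms by (intro ring_hom_cring_intro) (auto simp: local_hom_def A.cring_axioms B.cring_axioms)
    assume "x \<notin> max_ideal A"
    then have u: "x \<in> Units A" using local_ring_Units_iff[OF assms(1,4)] by blast
    then have "f x \<in> Units B" using assms(3)
      by (intro ring_hom_Units[OF A.cring_axioms B.cring_axioms]) (auto simp: local_hom_def)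
    then show False using fx local_ring_Units_iff[OF assms(2) f.hom_closed[OF assms(4)]] by simp
  qed
qed (use assms in \<open>auto simp: local_hom_def\<close>)

section \<open>Polynomials as coefficient lists\<close>

text \<open>Coefficients with the constant term first, evaluated by Horner's rule; a monic
  polynomial is written \<open>f @ [\<one>]\<close>. Unlike elements of \<open>UP\<close>, lists
  make sense over every subring and pass along homomorphisms by \<open>map\<close>.\<close>

primrec pev :: "('a, 'm) ring_scheme \<Rightarrow> 'a list \<Rightarrow> 'a \<Rightarrow> 'a" where
  "pev A [] x = \<zero>\<^bsub>A\<^esub>"
| "pev A (c # cs) x = c \<oplus>\<^bsub>A\<^esub> x \<otimes>\<^bsub>A\<^esub> pev A cs x"

text \<open>The divided difference \<open>(f(x) - f(y)) / (x - y)\<close>; on the diagonal it is the derivative.\<close>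

primrec pdd :: "('a, 'm) ring_scheme \<Rightarrow> 'a list \<Rightarrow> 'a \<Rightarrow> 'a \<Rightarrow> 'a" where
  "pdd A [] x y = \<zero>\<^bsub>A\<^esub>"
| "pdd A (c # cs) x y = pev A cs x \<oplus>\<^bsub>A\<^esub> y \<otimes>\<^bsub>A\<^esub> pdd A cs x y"

lemma (in cring) pev_closed [simp]:
  "set f \<subseteq> carrier R \<Longrightarrow> x \<in> carrier R \<Longrightarrow> pev R f x \<in> carrier R"
  by (induct f) auto

lemma (in cring) pdd_closed [simp]:
  "set f \<subseteq> carrier R \<Longrightarrow> x \<in> carrier R \<Longrightarrow> y \<in> carrier R \<Longrightarrow> pdd R f x y \<in> carrier R"
  by (induct f) auto

lemma (in cring) pev_diff:
  assumes "set f \<subseteq> carrier R" "x \<in> carrier R" "y \<in> carrier R"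
  shows "pev R f x \<ominus> pev R f y = (x \<ominus> y) \<otimes> pdd R f x y"
  using assms(1)
proof (induct f)
  case Nil
  then show ?case using assms by (simp add: minus_eq)
next
  case (Cons c cs)
  define a b d where "a = pev R cs x" "b = pev R cs y" "d = pdd R cs x y"
  have cl [simp]: "a \<in> carrier R" "b \<in> carrier R" "d \<in> carrier R" "c \<in> carrier R"
    using Cons.prems assms(2,3) by (auto simp: a_b_d_def)
  have IH: "a \<ominus> b = (x \<ominus> y) \<otimes> d" using Cons by (simp add: a_b_d_def)
  \<comment> \<open>The product rule for differences,
    \<open>x a - y b = (x - y) a + y (a - b)\<close>. It is also the origin of the recursion for
    \<open>pdd\<close>.\<close>
  have "(c \<oplus> x \<otimes> a) \<ominus> (c \<oplus> y \<otimes> b) = (x \<ominus> y) \<otimes> a \<oplus> y \<otimes> (a \<ominus> b)"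
    using cl assms(2,3) by algebra
  also have "\<dots> = (x \<ominus> y) \<otimes> (a \<oplus> y \<otimes> d)" unfolding IH using cl assms(2,3) by algebra
  finally show ?case by (simp add: a_b_d_def)
qed

lemma pev_subring [simp]: "pev (A\<lparr>carrier := S\<rparr>) f x = pev A f x"
  by (induct f) auto

lemma pdd_subring [simp]: "pdd (A\<lparr>carrier := S\<rparr>) f x y = pdd A f x y"
  by (induct f) auto

lemma (in cring) pev_in_subring:
  assumes "subring S R" "set f \<subseteq> S" "x \<in> S" shows "pev R f x \<in> S"
  using assms(2) by (induct f) (auto simp: subringE[OF assms(1)] assms(3))

lemma (in cring) pdd_in_subring:
  assumes "subring S R" "set f \<subseteq> S" "x \<in> S" "y \<in> S" shows "pdd R f x y \<in> S"
  using assms(2) by (induct f) (auto simp: subringE[OF assms(1)] assms(3,4) pev_in_subring[OF assms(1)])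

lemma pev_hom:
  assumes "cring A" "cring B" "h \<in> ring_hom A B" "set f \<subseteq> carrier A" "x \<in> carrier A"
  shows "h (pev A f x) = pev B (map h f) (h x)"
proof -
  interpret h: ring_hom_cring A B h
    using assms by (intro ring_hom_cring_intro)
  show ?thesis using assms(4) by (induct f) (auto simp: assms(5) h.R.pev_closed)
qed

lemma pdd_hom:
  assumes "cring A" "cring B" "h \<in> ring_hom A B" "set f \<subseteq> carrier A" "x \<in> carrier A" "y \<in> carrier A"
  shows "h (pdd A f x y) = pdd B (map h f) (h x) (h y)"
proof -
  interpret h: ring_hom_cring A B h
    using assms by (intro ring_hom_cring_intro)
  show ?thesis using assms(4)
    by (induct f) (auto simp: assms(5,6) h.R.pev_closed h.R.pdd_closed pev_hom[OF assms(1-3)])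
qed

lemma (in cring) rcos_eq_iff:
  assumes "ideal I R" "x \<in> carrier R" "y \<in> carrier R"
  shows "I +> x = I +> y \<longleftrightarrow> x \<ominus> y \<in> I"
  using assms quotient_eq_iff_same_a_r_cos by blast

text \<open>In the quotient by \<open>I\<close> the arguments become equal, and divided differences
  commute with the projection.\<close>

lemma (in cring) pdd_cong:
  assumes I: "ideal I R" and f: "set f \<subseteq> carrier R"
    and x: "x \<in> carrier R" "x' \<in> carrier R" "x \<ominus> x' \<in> I" and y: "y \<in> carrier R" "y' \<in> carrier R" "y \<ominus> y' \<in> I"
  shows "pdd R f x y \<ominus> pdd R f x' y' \<in> I"
proof -
  interpret I: ideal I R by fact
  have c: "cring (R Quot I)" by (rule I.quotient_is_cring[OF cring_axioms])
  have e: "I +> x = I +> x'" "I +> y = I +> y'" using x y I by (auto simp: rcos_eq_iff)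
  have "I +> pdd R f x y = I +> pdd R f x' y'"
    using pdd_hom[OF cring_axioms c I.rcos_ring_hom f x(1) y(1)]
      pdd_hom[OF cring_axioms c I.rcos_ring_hom f x(2) y(2)] e by metis
  then show ?thesis using x y f I by (simp add: rcos_eq_iff)
qed

lemma (in cring) pev_cong:
  assumes I: "ideal I R" and f: "set f \<subseteq> carrier R"
    and x: "x \<in> carrier R" "x' \<in> carrier R" "x \<ominus> x' \<in> I"
  shows "pev R f x \<ominus> pev R f x' \<in> I"
  using pev_diff[OF f x(1,2)] ideal.I_r_closed[OF I x(3)] f x by simp

lemma (in cring) pev_snoc:
  assumes "set f \<subseteq> carrier R" "a \<in> carrier R" "x \<in> carrier R"
  shows "pev R (f @ [a]) x = pev R f x \<oplus> x [^] length f \<otimes> a"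
  using assms(1)
proof (induct f)
  case (Cons c f)
  define p q where "p = pev R f x" "q = x [^] length f"
  have cl: "p \<in> carrier R" "q \<in> carrier R" "c \<in> carrier R" using Cons.prems assms by (auto simp: p_q_def)
  have "pev R ((c # f) @ [a]) x = c \<oplus> x \<otimes> (p \<oplus> q \<otimes> a)" using Cons by (simp add: p_q_def)
  also have "\<dots> = (c \<oplus> x \<otimes> p) \<oplus> (q \<otimes> x) \<otimes> a" using cl assms(2,3) by algebra
  finally show ?case using cl by (simp add: p_q_def)
qed (use assms in simp)

text \<open>This is the derivative of the appended monomial. For empty \<open>f\<close> the exponent
  \<open>length f - 1\<close> truncates to 0, which is harmless because the factor
  \<open>[0] \<cdot> a\<close> vanishes.\<close>

lemma (in cring) pdd_diag_snoc:
  assumes "set f \<subseteq> carrier R" "a \<in> carrier R" "x \<in> carrier R"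
  shows "pdd R (f @ [a]) x x = pdd R f x x \<oplus> x [^] (length f - 1) \<otimes> ([length f] \<cdot> a)"
  using assms(1)
proof (induct f)
  case (Cons c f)
  define p d q r k where "p = pev R f x" "d = pdd R f x x" "q = x [^] (length f - 1)" "r = x [^] length f"
    "k = [length f] \<cdot> a"
  have cl: "p \<in> carrier R" "q \<in> carrier R" "d \<in> carrier R" "c \<in> carrier R" "r \<in> carrier R" "k \<in> carrier R"
    using Cons.prems assms by (auto simp: p_d_q_r_k_def)
  have qr: "x \<otimes> q \<otimes> k = r \<otimes> k"
    using assms by (cases f) (auto simp: p_d_q_r_k_def m_comm)
  have "pdd R ((c # f) @ [a]) x x = (p \<oplus> r \<otimes> a) \<oplus> x \<otimes> (d \<oplus> q \<otimes> k)"
    using Cons assms by (simp add: p_d_q_r_k_def pev_snoc)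
  also have "\<dots> = (p \<oplus> x \<otimes> d) \<oplus> (r \<otimes> a \<oplus> x \<otimes> q \<otimes> k)" using cl assms(2,3) by algebra
  also have "\<dots> = (p \<oplus> x \<otimes> d) \<oplus> r \<otimes> (k \<oplus> a)" unfolding qr using cl assms(2,3) by algebra
  finally show ?case using cl assms by (simp add: p_d_q_r_k_def)
qed (use assms in simp)

lemma (in cring) finsum_eq_pev:
  fixes n :: nat
  assumes "\<And>i. c i \<in> carrier R" "x \<in> carrier R"
  shows "(\<Oplus>i\<in>{..n}. c i \<otimes> x [^] i) = pev R (map c [0..<Suc n]) x"
proof (induct n)
  case 0 then show ?case using assms by simp
next
  case (Suc n)
  have "pev R (map c [0..<Suc (Suc n)]) x = pev R (map c [0..<Suc n]) x \<oplus> x [^] Suc n \<otimes> c (Suc n)"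
    using assms pev_snoc[of "map c [0..<Suc n]" "c (Suc n)" x] by (auto simp del: upt_Suc simp: upt_Suc_append)
  moreover have "(\<Oplus>i\<in>{..Suc n}. c i \<otimes> x [^] i) = c (Suc n) \<otimes> x [^] Suc n \<oplus> (\<Oplus>i\<in>{..n}. c i \<otimes> x [^] i)"
    using assms by (intro finsum_Suc) auto
  moreover have "pev R (map c [0..<Suc n]) x \<in> carrier R" using assms by (intro pev_closed) auto
  ultimately show ?case using assms Suc by (auto simp: m_comm a_comm simp del: upt_Suc)
qed

lemma (in cring) pdd_diag_eq_pev:
  assumes "\<And>i. c i \<in> carrier R" "x \<in> carrier R"
  shows "pdd R (map c [0..<Suc n]) x x = pev R (map (\<lambda>i. [Suc i] \<cdot> c (Suc i)) [0..<n]) x"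
proof (induct n)
  case 0 then show ?case using assms by simp
next
  case (Suc n)
  have "pdd R (map c [0..<Suc (Suc n)]) x x
      = pdd R (map c [0..<Suc n]) x x \<oplus> x [^] n \<otimes> ([Suc n] \<cdot> c (Suc n))"
    using assms pdd_diag_snoc[of "map c [0..<Suc n]" "c (Suc n)" x]
    by (auto simp del: upt_Suc simp: upt_Suc_append)
  moreover have "pev R (map (\<lambda>i. [Suc i] \<cdot> c (Suc i)) [0..<Suc n]) x
      = pev R (map (\<lambda>i. [Suc i] \<cdot> c (Suc i)) [0..<n]) x \<oplus> x [^] n \<otimes> ([Suc n] \<cdot> c (Suc n))"
    using assms pev_snoc[of "map (\<lambda>i. [Suc i] \<cdot> c (Suc i)) [0..<n]" "[Suc n] \<cdot> c (Suc n)" x]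
    by (auto simp: add.nat_pow_closed simp del: add.nat_pow_Suc)
  ultimately show ?case using Suc by (simp del: upt_Suc)
qed

lemma coeff_UP: "f \<in> carrier (UP A) \<Longrightarrow> coeff (UP A) f = f"
  by (simp add: UP_def)

text \<open>The bound \<open>n\<close> is kept free so that the derivative of a polynomial, whose
  degree may drop, can still be evaluated on a list of the length that belongs to the polynomial
  itself.\<close>

lemma eval_eq_pev:
  assumes A: "cring A" and B: "cring B" and h: "h \<in> ring_hom A B" and s: "s \<in> carrier B"
    and f: "f \<in> carrier (UP A)" and n: "deg A f \<le> n"
  shows "eval A B h s f = pev B (map (\<lambda>i. h (coeff (UP A) f i)) [0..<Suc n]) s"
proof -
  interpret A: UP_cring A "UP A" using A by (simp add: UP_cring_def)
  interpret h: ring_hom_cring A B h using A B h by (intro ring_hom_cring_intro)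
  let ?c = "\<lambda>i. h (coeff (UP A) f i)"
  have c: "?c i \<in> carrier B" for i using f by simp
  have "pev B (map ?c [0..<Suc n]) s = (\<Oplus>\<^bsub>B\<^esub>i\<in>{..n}. ?c i \<otimes>\<^bsub>B\<^esub> s [^]\<^bsub>B\<^esub> i)"
    using c s by (subst h.S.finsum_eq_pev) auto
  also have "\<dots> = (\<Oplus>\<^bsub>B\<^esub>i\<in>{..deg A f}. ?c i \<otimes>\<^bsub>B\<^esub> s [^]\<^bsub>B\<^esub> i)"
    using n c s f by (intro h.S.add.finprod_mono_neutral_cong_right) (auto simp: A.deg_aboveD)
  finally show ?thesis using f by (simp add: eval_def)
qed

lemma poly_deriv_closed:
  assumes A: "cring A" and f: "f \<in> carrier (UP A)"
  shows "poly_deriv A f \<in> carrier (UP A)" "deg A (poly_deriv A f) \<le> deg A f"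
proof -
  interpret A: UP_cring A "UP A" using A by (simp add: UP_cring_def)
  have z: "poly_deriv A f i = \<zero>\<^bsub>A\<^esub>" if "deg A f \<le> i" for i
    using that f by (simp add: poly_deriv_def A.deg_aboveD)
  show *: "poly_deriv A f \<in> carrier (UP A)"
  proof -
    have "bound \<zero>\<^bsub>A\<^esub> (deg A f) (poly_deriv A f)" using z by (intro bound.intro) simp
    moreover have "poly_deriv A f i \<in> carrier A" for i using f unfolding poly_deriv_def by (intro A.R.add.nat_pow_closed) simp
    ultimately show ?thesis by (auto simp: UP_def up_def)
  qed
  show "deg A (poly_deriv A f) \<le> deg A f"
    using z * by (intro A.deg_aboveI) (auto simp: coeff_UP)
qed

lemma eval_poly_deriv_eq_pdd:
  assumes A: "cring A" and B: "cring B" and h: "h \<in> ring_hom A B" and s: "s \<in> carrier A"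
    and f: "f \<in> carrier (UP A)"
  shows "eval A B h (h s) (poly_deriv A f) = h (pdd A (map (coeff (UP A) f) [0..<Suc (deg A f)]) s s)"
proof -
  interpret A: UP_cring A "UP A" using A by (simp add: UP_cring_def)
  interpret h: ring_hom_cring A B h using A B h by (intro ring_hom_cring_intro)
  let ?c = "coeff (UP A) f" and ?d = "\<lambda>i. [Suc i] \<cdot>\<^bsub>A\<^esub> coeff (UP A) f (Suc i)"
  have c: "?c i \<in> carrier A" for i using f by simp
  then have d: "?d i \<in> carrier A" for i by (intro A.R.add.nat_pow_closed)
  have pd: "coeff (UP A) (poly_deriv A f) = ?d"
    using poly_deriv_closed(1)[OF A f] by (simp add: coeff_UP) (simp add: poly_deriv_def coeff_UP[OF f])
  have "eval A B h (h s) (poly_deriv A f) = pev B (map (\<lambda>i. h (?d i)) [0..<Suc (deg A f)]) (h s)"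
    using eval_eq_pev[OF A B h h.hom_closed[OF s] poly_deriv_closed[OF A f]] pd by simp
  also have "\<dots> = h (pev A (map ?d [0..<Suc (deg A f)]) s)"
  proof -
    have "set (map ?d [0..<Suc (deg A f)]) \<subseteq> carrier A" using d by auto
    from pev_hom[OF A B h this s] show ?thesis by (simp only: map_map o_def)
  qed
  \<comment> \<open>The last entry of the longer list is a multiple of the coefficient of
    \<open>f\<close> just above its degree, hence zero.\<close>
  also have "pev A (map ?d [0..<Suc (deg A f)]) s = pev A (map ?d [0..<deg A f]) s"
  proof -
    have "set (map ?d [0..<deg A f]) \<subseteq> carrier A" using d by auto
    from A.R.pev_snoc[OF this d[of "deg A f"] s] show ?thesis
      using s f A.R.pev_closed[OF \<open>set (map ?d [0..<deg A f]) \<subseteq> carrier A\<close> s]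
      by (simp add: A.deg_aboveD)
  qed
  also have "\<dots> = pdd A (map ?c [0..<Suc (deg A f)]) s s"
    using c s by (subst A.R.pdd_diag_eq_pev) auto
  finally show ?thesis .
qed

section \<open>Henselian rings\<close>

text \<open>A residue class \<open>\<alpha>\<close> is replaced by a representative
  \<open>t\<close>, and the derivative by the divided difference on the diagonal. This form mentions
  neither the residue field nor the polynomial ring, so it can be read inside a subring.\<close>

lemma henselian_ring_iff:
  fixes A (structure)
  shows "henselian_ring A \<longleftrightarrow> local_ring A \<and>
    (\<forall>f t. set f \<subseteq> carrier A \<and> t \<in> carrier A \<and> pev A (f @ [\<one>]) t \<in> max_ideal A \<and>
       pdd A (f @ [\<one>]) t t \<notin> max_ideal A \<longrightarrow>
       (\<exists>a\<in>carrier A. pev A (f @ [\<one>]) a = \<zero> \<and> a \<ominus> t \<in> max_ideal A))" (is "_ \<longleftrightarrow> _ \<and> ?R")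
proof (cases "local_ring A")
  case True
  interpret A: UP_cring A "UP A" using True by (simp add: UP_cring_def local_ring_def)
  interpret m: maximalideal "max_ideal A" A by (rule local_ring_maximalideal[OF True])
  let ?m = "max_ideal A" and ?K = "residue_field A"
  have K: "cring ?K" unfolding residue_field_def by (rule m.quotient_is_cring[OF A.R.cring_axioms])
  have h: "residue_map A \<in> ring_hom A ?K"
    using m.rcos_ring_hom unfolding residue_field_def residue_map_def by (simp add: ring_hom_def)
  have z: "residue_map A x = \<zero>\<^bsub>?K\<^esub> \<longleftrightarrow> x \<in> ?m" if "x \<in> carrier A" for x
    using that m.rcos_const_imp_mem A.R.a_rcos_zero[OF m.is_ideal]
    by (auto simp: residue_map_def residue_field_def FactRing_def)
  have eq: "residue_map A x = residue_map A y \<longleftrightarrow> x \<ominus> y \<in> ?m" if "x \<in> carrier A" "y \<in> carrier A" for x y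
    using that A.R.rcos_eq_iff[OF m.is_ideal] by (simp add: residue_map_def)
  have id: "id \<in> ring_hom A A" by (simp add: ring_hom_def)
  have e1: "eval A ?K (residue_map A) (residue_map A t) f =
      residue_map A (pev A (map (coeff (UP A) f) [0..<Suc (deg A f)]) t)"
    if "f \<in> carrier (UP A)" "t \<in> carrier A" for f t
  proof -
    have "set (map (coeff (UP A) f) [0..<Suc (deg A f)]) \<subseteq> carrier A" using that by auto
    from pev_hom[OF A.R.cring_axioms K h this that(2)] show ?thesis
      unfolding eval_eq_pev[OF A.R.cring_axioms K h ring_hom_closed[OF h that(2)] that(1) order_refl]
      by (simp only: map_map o_def)
  qed
  have e2: "eval A A id t f = pev A (map (coeff (UP A) f) [0..<Suc (deg A f)]) t"
    if "f \<in> carrier (UP A)" "t \<in> carrier A" for f t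
    using eval_eq_pev[OF A.R.cring_axioms A.R.cring_axioms id that(2,1) order_refl] by (simp del: upt_Suc)
  note e3 = eval_poly_deriv_eq_pdd[OF A.R.cring_axioms K h]
  have "?R \<longleftrightarrow> (\<forall>f\<in>carrier (UP A). \<forall>\<alpha>\<in>carrier ?K.
       coeff (UP A) f (deg A f) = \<one> \<and>
       eval A ?K (residue_map A) \<alpha> f = \<zero>\<^bsub>?K\<^esub> \<and>
       eval A ?K (residue_map A) \<alpha> (poly_deriv A f) \<noteq> \<zero>\<^bsub>?K\<^esub> \<longrightarrow>
       (\<exists>a\<in>carrier A. eval A A id a f = \<zero> \<and> residue_map A a = \<alpha>))" (is "?R = ?L")
  proof
    assume R: ?R
    show ?L
    proof (intro ballI impI, elim conjE)
      fix f \<alpha> assume f: "f \<in> carrier (UP A)" and \<alpha>: "\<alpha> \<in> carrier ?K"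
        and 1: "coeff (UP A) f (deg A f) = \<one>"
        and 2: "eval A ?K (residue_map A) \<alpha> f = \<zero>\<^bsub>?K\<^esub>"
        and 3: "eval A ?K (residue_map A) \<alpha> (poly_deriv A f) \<noteq> \<zero>\<^bsub>?K\<^esub>"
      obtain t where t: "t \<in> carrier A" "\<alpha> = residue_map A t"
        using \<alpha> by (auto simp: residue_field_def FactRing_simps residue_map_def)
      define c where "c = map (coeff (UP A) f) [0..<deg A f]"
      have c: "map (coeff (UP A) f) [0..<Suc (deg A f)] = c @ [\<one>]" by (simp add: c_def 1)
      have sc: "set c \<subseteq> carrier A" using f by (auto simp: c_def)
      have "pev A (c @ [\<one>]) t \<in> ?m" "pdd A (c @ [\<one>]) t t \<notin> ?m"
        using 2 3 t f sc by (simp_all add: e1 e3 c z del: upt_Suc)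
      then obtain a where "a \<in> carrier A" "pev A (c @ [\<one>]) a = \<zero>" "a \<ominus> t \<in> ?m"
        using R sc t by blast
      then show "\<exists>a\<in>carrier A. eval A A id a f = \<zero> \<and> residue_map A a = \<alpha>"
        using t f by (intro bexI[of _ a]) (simp_all add: e2 c eq del: upt_Suc)
    qed
  next
    assume L: ?L
    show ?R
    proof (intro allI impI, elim conjE)
      fix c t assume sc: "set c \<subseteq> carrier A" and t: "t \<in> carrier A"
        and pv: "pev A (c @ [\<one>]) t \<in> ?m" and dv: "pdd A (c @ [\<one>]) t t \<notin> ?m"
      define f where "f i = (if i < length c then c ! i else if i = length c then \<one> else \<zero>)" for i
      have "bound \<zero> (length c) f" by (intro bound.intro) (simp add: f_def)
      then have f: "f \<in> carrier (UP A)" using subsetD[OF sc nth_mem] by (auto simp: UP_def up_def f_def)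
      \<comment> \<open>Needed for \<open>deg A f = length c\<close>: in the zero ring the leading
        coefficient would not be visible.\<close>
      have ne: "\<one> \<noteq> \<zero>" using m.I_notcarr m.zero_closed m.one_imp_carrier by auto
      have d: "deg A f = length c"
        using f ne by (intro le_antisym A.deg_aboveI A.deg_belowI) (auto simp: coeff_UP f_def)
      have "map f [0..<length c] = c" by (rule nth_equalityI) (auto simp: f_def)
      then have c: "map (coeff (UP A) f) [0..<Suc (deg A f)] = c @ [\<one>]"
        by (simp add: coeff_UP[OF f] d) (simp add: f_def)
      have "\<exists>a\<in>carrier A. eval A A id a f = \<zero> \<and> residue_map A a = residue_map A t"
      proof (rule L[THEN bspec, OF f, THEN bspec, THEN mp], goal_cases)
        case 1 show ?case using ring_hom_closed[OF h t] .
      next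
        case 2
        have "coeff (UP A) f (deg A f) = \<one>" by (simp add: coeff_UP[OF f] d) (simp add: f_def)
        moreover have "eval A ?K (residue_map A) (residue_map A t) f = \<zero>\<^bsub>?K\<^esub>"
          using pv t f sc by (simp add: e1 c z del: upt_Suc)
        moreover have "eval A ?K (residue_map A) (residue_map A t) (poly_deriv A f) \<noteq> \<zero>\<^bsub>?K\<^esub>"
          using dv t f sc by (simp add: e3 c z del: upt_Suc)
        ultimately show ?case by blast
      qed
      then show "\<exists>a\<in>carrier A. pev A (c @ [\<one>]) a = \<zero> \<and> a \<ominus> t \<in> ?m"
        using t f by (auto simp: e2 c eq simp del: upt_Suc)
    qed
  qed
  then show ?thesis using True unfolding henselian_ring_def by blast
qed (simp add: henselian_ring_def)

lemma henselian_ringI: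
  fixes A (structure)
  assumes "local_ring A"
    and "\<And>f t. set f \<subseteq> carrier A \<Longrightarrow> t \<in> carrier A \<Longrightarrow> pev A (f @ [\<one>]) t \<in> max_ideal A \<Longrightarrow>
      pdd A (f @ [\<one>]) t t \<notin> max_ideal A \<Longrightarrow>
      \<exists>a\<in>carrier A. pev A (f @ [\<one>]) a = \<zero> \<and> a \<ominus> t \<in> max_ideal A"
  shows "henselian_ring A"
  using assms unfolding henselian_ring_iff by blast

lemma henselian_ringD:
  fixes A (structure)
  assumes "henselian_ring A" "set f \<subseteq> carrier A" "t \<in> carrier A"
    "pev A (f @ [\<one>]) t \<in> max_ideal A" "pdd A (f @ [\<one>]) t t \<notin> max_ideal A"
  obtains a where "a \<in> carrier A" "pev A (f @ [\<one>]) a = \<zero>" "a \<ominus> t \<in> max_ideal A"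
  using assms unfolding henselian_ring_iff by blast

text \<open>Moves a Henselian ring to another carrier type; \<open>universal\<close> uses it to
  reach the type of the test rings.\<close>

lemma henselian_ring_iso:
  assumes A: "henselian_ring A" and B: "cring B"
    and h: "h \<in> ring_hom A B" and g: "g \<in> ring_hom B A"
    and hg: "\<And>y. y \<in> carrier B \<Longrightarrow> h (g y) = y" and gh: "\<And>x. x \<in> carrier A \<Longrightarrow> g (h x) = x"
  shows "henselian_ring B" and "max_ideal B = {y \<in> carrier B. g y \<in> max_ideal A}"
proof -
  have lA: "local_ring A" using A by (simp add: henselian_ring_def)
  then have cA: "cring A" by (simp add: local_ring_def)
  interpret h: ring_hom_cring A B h using cA B h by (intro ring_hom_cring_intro)
  interpret g: ring_hom_cring B A g using cA B g by (intro ring_hom_cring_intro)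
  interpret mA: maximalideal "max_ideal A" A by (rule local_ring_maximalideal[OF lA])
  let ?m = "{y \<in> carrier B. g y \<in> max_ideal A}"
  have i: "ideal ?m B" by (rule g.ring.ideal_vimage[OF mA.is_ideal])
  have one: "\<one>\<^bsub>B\<^esub> \<notin> ?m" using local_ring_one_notin[OF lA] by simp
  have U: "y \<in> Units B" if "y \<in> carrier B" "y \<notin> ?m" for y
  proof -
    have "g y \<in> Units A" using that by (simp add: local_ring_Units_iff[OF lA])
    from ring_hom_Units[OF cA B h this] show ?thesis by (simp add: hg that)
  qed
  note lB = local_ringI[OF B i one U]
  show mB: "max_ideal B = ?m" by (rule lB(2))
  show "henselian_ring B"
  proof (rule henselian_ringI[OF lB(1)])
    fix f t assume f: "set f \<subseteq> carrier B" and t: "t \<in> carrier B"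
      and pv: "pev B (f @ [\<one>\<^bsub>B\<^esub>]) t \<in> max_ideal B" and dv: "pdd B (f @ [\<one>\<^bsub>B\<^esub>]) t t \<notin> max_ideal B"
    let ?f = "f @ [\<one>\<^bsub>B\<^esub>]"
    have f': "set ?f \<subseteq> carrier B" using f by simp
    have gf: "map g ?f = map g f @ [\<one>\<^bsub>A\<^esub>]" by simp
    have sg: "set (map g f) \<subseteq> carrier A" "set (map g ?f) \<subseteq> carrier A" using f by auto
    have "pev A (map g f @ [\<one>\<^bsub>A\<^esub>]) (g t) \<in> max_ideal A"
      using pv pev_hom[OF B cA g f' t] by (simp add: mB)
    moreover have "pdd A (map g f @ [\<one>\<^bsub>A\<^esub>]) (g t) (g t) \<notin> max_ideal A"
      using dv pdd_hom[OF B cA g f' t t] f t by (simp add: mB h.S.pdd_closed)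
    ultimately obtain a where a: "a \<in> carrier A" "pev A (map g ?f) a = \<zero>\<^bsub>A\<^esub>" "a \<ominus>\<^bsub>A\<^esub> g t \<in> max_ideal A"
      using A sg t unfolding henselian_ring_iff gf by (metis g.hom_closed)
    have "map h (map g ?f) = ?f" using f' by (intro nth_equalityI) (auto simp: hg nth_append subset_iff)
    then have "pev B ?f (h a) = \<zero>\<^bsub>B\<^esub>"
      using pev_hom[OF cA B h sg(2) a(1)] a(2) by simp
    moreover have "g (h a \<ominus>\<^bsub>B\<^esub> t) = a \<ominus>\<^bsub>A\<^esub> g t" using a t by (simp add: a_minus_def gh)
    ultimately show "\<exists>a\<in>carrier B. pev B ?f a = \<zero>\<^bsub>B\<^esub> \<and> a \<ominus>\<^bsub>B\<^esub> t \<in> max_ideal B"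
      using a t by (intro bexI[of _ "h a"]) (auto simp: mB)
  qed
qed

text \<open>Newton's iteration with the inverse of the derivative frozen at the starting point. Each
  step gains one more factor \<open>pev R f t\<close>, which suffices when this element is
  nilpotent, or nilpotent modulo an ideal. The second equation keeps the approximation congruent to
  \<open>t\<close>.\<close>

lemma (in cring) Newton:
  assumes f: "set f \<subseteq> carrier R" and t: "t \<in> carrier R" and w: "w \<in> carrier R" "pdd R f t t \<otimes> w = \<one>"
  shows "\<exists>a\<in>carrier R. \<exists>z\<in>carrier R. \<exists>z'\<in>carrier R.
    pev R f a = pev R f t [^] Suc k \<otimes> z \<and> a \<ominus> t = pev R f t \<otimes> z'"
proof (induct k)
  case 0
  have "t \<ominus> t = pev R f t \<otimes> \<zero>" using t f by (simp add: minus_eq r_neg)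
  then show ?case using t f by (intro bexI[of _ t] bexI[of _ \<one>] bexI[of _ \<zero>]) auto
next
  case (Suc k)
  define y where "y = pev R f t"
  have y: "y \<in> carrier R" using f t by (simp add: y_def)
  from Suc obtain a z z' where a: "a \<in> carrier R" "z \<in> carrier R" "z' \<in> carrier R"
    "pev R f a = y [^] Suc k \<otimes> z" "a \<ominus> t = y \<otimes> z'" unfolding y_def by blast
  define b p where "b = pev R f a" "p = y [^] Suc k"
  have bp: "b \<in> carrier R" "p \<in> carrier R" using a y f by (auto simp: b_p_def)
  have b1: "b = y \<otimes> (y [^] k \<otimes> z)" using a y by (simp add: b_p_def m_ac)
  define a' where "a' = a \<ominus> w \<otimes> b"
  have a': "a' \<in> carrier R" using a w bp by (simp add: a'_def)
  have att: "a = t \<oplus> y \<otimes> z'" using a(5) a(1,3) t y by (metis a_minus_def add.inv_solve_right m_closed minus_closed a_comm minus_equality r_neg add.inv_closed add.m_assoc r_zero)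
  define q where "q = pdd R f a' a"
  have q: "q \<in> carrier R" using f a a' by (simp add: q_def)
  let ?I = "PIdl y"
  have I: "ideal ?I R" using y by (rule cgenideal_ideal)
  have inI: "y \<otimes> u \<in> ?I" if "u \<in> carrier R" for u using that y by (auto simp: cgenideal_def m_comm)
  have "a' \<ominus> t = y \<otimes> (z' \<ominus> w \<otimes> (y [^] k \<otimes> z))"
  proof -
    define yk where "yk = y [^] k"
    have "yk \<in> carrier R" using y by (simp add: yk_def)
    then show ?thesis unfolding a'_def b1 att yk_def[symmetric] using a(2,3) t y w(1) by algebra
  qed
  moreover define u where "u = z' \<ominus> w \<otimes> (y [^] k \<otimes> z)"
  ultimately have att': "a' \<ominus> t = y \<otimes> u" and u: "u \<in> carrier R" using a w y by auto
  \<comment> \<open>The elements \<open>a'\<close>, \<open>a\<close> and \<open>t\<close> agree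
    modulo \<open>y\<close>, so \<open>q\<close> is the derivative at \<open>t\<close> plus a
    multiple of \<open>y\<close>. Below, the derivative cancels against \<open>w\<close> and the
    multiple supplies the new factor \<open>y\<close>.\<close>
  have "q \<ominus> pdd R f t t \<in> ?I"
    unfolding q_def using att' a(5) inI u a by (intro pdd_cong[OF I f a' t _ a(1) t]) auto
  then obtain v where v: "v \<in> carrier R" "q \<ominus> pdd R f t t = v \<otimes> y" by (auto simp: cgenideal_def)
  define d where "d = pdd R f t t"
  have d: "d \<in> carrier R" "d \<otimes> w = \<one>" using f t w by (auto simp: d_def)
  have "q = d \<oplus> (q \<ominus> d)" using q d(1) by algebra
  then have qd: "q = d \<oplus> v \<otimes> y" using v by (simp add: d_def)
  have "pev R f a' \<ominus> b = (a' \<ominus> a) \<otimes> q" using pev_diff[OF f a' a(1)] by (simp add: b_p_def q_def)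
  also have "a' \<ominus> a = \<ominus> (w \<otimes> b)" unfolding a'_def using a(1) w(1) bp by algebra
  finally have e: "pev R f a' \<ominus> b = \<ominus> (w \<otimes> b) \<otimes> q" .
  have "pev R f a' = b \<oplus> (pev R f a' \<ominus> b)" using bp pev_closed[OF f a'] by algebra
  also have "\<dots> = b \<ominus> b \<otimes> ((d \<otimes> w) \<oplus> w \<otimes> v \<otimes> y)"
    unfolding e qd using bp w(1) v(1) y d(1) by algebra
  also have "\<dots> = p \<otimes> z \<ominus> p \<otimes> z \<otimes> (\<one> \<oplus> w \<otimes> v \<otimes> y)" unfolding d(2) using a(4) by (simp add: b_p_def)
  also have "\<dots> = (p \<otimes> y) \<otimes> (\<ominus> (z \<otimes> w \<otimes> v))" using bp w(1) v(1) y a(2) by algebra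
  finally have "pev R f a' = y [^] Suc (Suc k) \<otimes> (\<ominus> (z \<otimes> w \<otimes> v))" by (simp add: b_p_def)
  then show ?case using att' u a' a w v unfolding y_def[symmetric]
    by (intro bexI[of _ a'] bexI[of _ "\<ominus> (z \<otimes> w \<otimes> v)"] bexI[of _ u]) auto
qed

text \<open>A power of the starting value \<open>f(t)\<close> vanishes, so finitely many Newton
  steps reach an exact root.\<close>

lemma henselian_ring_nil:
  assumes A: "local_ring A" and nil: "\<And>x. x \<in> max_ideal A \<Longrightarrow> \<exists>k::nat. x [^]\<^bsub>A\<^esub> k = \<zero>\<^bsub>A\<^esub>"
  shows "henselian_ring A"
proof (rule henselian_ringI[OF A])
  interpret cring A using A by (simp add: local_ring_def)
  interpret m: maximalideal "max_ideal A" A by (rule local_ring_maximalideal[OF A])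
  fix f t assume f: "set f \<subseteq> carrier A" and t: "t \<in> carrier A"
    and pv: "pev A (f @ [\<one>\<^bsub>A\<^esub>]) t \<in> max_ideal A" and dv: "pdd A (f @ [\<one>\<^bsub>A\<^esub>]) t t \<notin> max_ideal A"
  let ?f = "f @ [\<one>\<^bsub>A\<^esub>]"
  have f': "set ?f \<subseteq> carrier A" using f by simp
  have "pdd A ?f t t \<in> Units A" using dv f' t by (simp add: local_ring_Units_iff[OF A])
  then have w: "inv\<^bsub>A\<^esub> (pdd A ?f t t) \<in> carrier A" "pdd A ?f t t \<otimes>\<^bsub>A\<^esub> inv\<^bsub>A\<^esub> (pdd A ?f t t) = \<one>\<^bsub>A\<^esub>" by auto
  obtain k :: nat where k: "pev A ?f t [^]\<^bsub>A\<^esub> k = \<zero>\<^bsub>A\<^esub>" using nil[OF pv] by blast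
  obtain a z z' where a: "a \<in> carrier A" "z \<in> carrier A" "z' \<in> carrier A"
    "pev A ?f a = pev A ?f t [^]\<^bsub>A\<^esub> Suc k \<otimes>\<^bsub>A\<^esub> z" "a \<ominus>\<^bsub>A\<^esub> t = pev A ?f t \<otimes>\<^bsub>A\<^esub> z'"
    using Newton[OF f' t w, of k] by blast
  have "pev A ?f a = \<zero>\<^bsub>A\<^esub>" using a(2,4) k f' t by simp
  moreover have "a \<ominus>\<^bsub>A\<^esub> t \<in> max_ideal A" unfolding a(5) using pv a(3) by (rule m.I_r_closed)
  ultimately show "\<exists>a\<in>carrier A. pev A ?f a = \<zero>\<^bsub>A\<^esub> \<and> a \<ominus>\<^bsub>A\<^esub> t \<in> max_ideal A" using a(1) by blast
qed

text \<open>For a local ring these are the ideals primary to the maximal ideal, and the whole ring.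
  The condition is on single elements rather than on a power of the maximal ideal, so it passes to
  preimages under local homomorphisms without any finite generation.\<close>

definition primary_ideals :: "('a, 'm) ring_scheme \<Rightarrow> 'a set set" where
  "primary_ideals A = {q. ideal q A \<and> (\<forall>x\<in>max_ideal A. \<exists>k::nat. x [^]\<^bsub>A\<^esub> k \<in> q)}"

text \<open>The maximal ideal of the quotient is nil because \<open>q\<close> is primary. These
  quotients are the targets for the universal property that are available without constructing a
  Henselization.\<close>

lemma henselian_Quot:
  assumes A: "local_ring A" and q: "q \<in> primary_ideals A" "q \<noteq> carrier A"
  shows "henselian_ring (A Quot q)" "local_hom A (A Quot q) ((+>\<^bsub>A\<^esub>) q)"
proof -
  interpret cring A using A by (simp add: local_ring_def)
  interpret q: ideal q A using q by (simp add: primary_ideals_def)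
  interpret m: maximalideal "max_ideal A" A by (rule local_ring_maximalideal[OF A])
  have nilq: "\<forall>x\<in>max_ideal A. \<exists>k::nat. x [^]\<^bsub>A\<^esub> k \<in> q" using q(1) by (simp add: primary_ideals_def)
  let ?Q = "A Quot q" and ?\<pi> = "(+>\<^bsub>A\<^esub>) q"
  have cQ: "cring ?Q" by (rule q.quotient_is_cring[OF cring_axioms])
  interpret \<pi>: ring_hom_cring A ?Q ?\<pi> by (intro ring_hom_cring_intro cring_axioms cQ q.rcos_ring_hom)
  have qm: "q \<subseteq> max_ideal A"
  proof
    fix x assume x: "x \<in> q"
    have "x \<notin> Units A"
    proof
      assume "x \<in> Units A"
      then have "inv\<^bsub>A\<^esub> x \<otimes>\<^bsub>A\<^esub> x \<in> q" using x by (intro q.I_l_closed) auto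
      then show False using \<open>x \<in> Units A\<close> q(2) q.one_imp_carrier by simp
    qed
    then show "x \<in> max_ideal A" using local_ring_Units_iff[OF A q.Icarr[OF x]] by blast
  qed
  have i: "ideal (?\<pi> ` max_ideal A) ?Q" by (rule ring_ideal_imp_quot_ideal[OF q.is_ideal m.is_ideal])
  have mem: "x \<in> max_ideal A" if x: "?\<pi> x \<in> ?\<pi> ` max_ideal A" "x \<in> carrier A" for x
  proof -
    obtain y where y: "y \<in> max_ideal A" "?\<pi> x = ?\<pi> y" using x(1) by (metis imageE)
    then have "x \<ominus>\<^bsub>A\<^esub> y \<in> max_ideal A" using x qm rcos_eq_iff[OF q.is_ideal] m.Icarr by blast
    moreover have "x = (x \<ominus>\<^bsub>A\<^esub> y) \<oplus>\<^bsub>A\<^esub> y" using x(2) m.Icarr[OF y(1)] by algebra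
    ultimately show ?thesis using y(1) m.a_closed by metis
  qed
  have one: "\<one>\<^bsub>?Q\<^esub> \<notin> ?\<pi> ` max_ideal A" using mem[of "\<one>\<^bsub>A\<^esub>"] local_ring_one_notin[OF A] by auto
  have car: "\<exists>x\<in>carrier A. X = ?\<pi> x" if "X \<in> carrier ?Q" for X using that unfolding FactRing_def A_RCOSETS_def' partial_object.simps UN_iff singleton_iff .
  have U: "X \<in> Units ?Q" if X: "X \<in> carrier ?Q" "X \<notin> ?\<pi> ` max_ideal A" for X
  proof -
    obtain x where x: "x \<in> carrier A" "X = ?\<pi> x" using car[OF X(1)] by blast
    then have "x \<in> Units A" using X by (auto simp: local_ring_Units_iff[OF A])
    then show ?thesis using ring_hom_Units[OF cring_axioms cQ \<pi>.homh] x by simp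
  qed
  have l1: "local_ring ?Q" by (rule local_ringI(1)[OF cQ i one U])
  have l2: "max_ideal ?Q = ?\<pi> ` max_ideal A" by (rule local_ringI(2)[OF cQ i one U])
  show "local_hom A ?Q ?\<pi>" by (simp add: local_hom_def l2 q.rcos_ring_hom)
  show "henselian_ring ?Q"
  proof (rule henselian_ring_nil[OF l1])
    fix X assume "X \<in> max_ideal ?Q"
    then have "X \<in> ?\<pi> ` max_ideal A" by (simp only: l2)
    then obtain x where x: "x \<in> max_ideal A" "X = ?\<pi> x" by (rule imageE)
    obtain k :: nat where k: "x [^]\<^bsub>A\<^esub> k \<in> q" using nilq[THEN bspec, OF x(1)] by (elim exE)
    have "?\<pi> (x [^]\<^bsub>A\<^esub> k) = \<zero>\<^bsub>?Q\<^esub>"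
      unfolding a_rcos_zero[OF q.is_ideal k] FactRing_def by simp
    then have "X [^]\<^bsub>?Q\<^esub> k = \<zero>\<^bsub>?Q\<^esub>"
      unfolding x(2) \<pi>.ring.hom_nat_pow[OF m.Icarr[OF x(1)], symmetric] .
    then show "\<exists>k::nat. X [^]\<^bsub>?Q\<^esub> k = \<zero>\<^bsub>?Q\<^esub>" ..
  qed
qed

text \<open>\<open>\<ominus>\<close> is defined by description over the carrier, so restricting the
  carrier might change it, whereas the fields of the record stay the same. A subring contains the
  inverse, which is unique.\<close>

lemma (in ring) subring_a_inv:
  assumes "subring S R" "x \<in> S" shows "\<ominus>\<^bsub>R\<lparr>carrier := S\<rparr>\<^esub> x = \<ominus> x"
  using group.m_inv_consistent[OF add.is_group, of S x] assms
  by (simp add: a_inv_def subring_def)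

lemma (in ring) subring_minus:
  assumes "subring S R" "x \<in> S" "y \<in> S" shows "x \<ominus>\<^bsub>R\<lparr>carrier := S\<rparr>\<^esub> y = x \<ominus> y"
  using assms by (simp add: a_minus_def subring_a_inv)

lemma (in cring) subring_is_cring:
  assumes "subring S R" shows "cring (R\<lparr>carrier := S\<rparr>)"
  using subcringI'[OF assms] subcring_iff[of S] subringE(1)[OF assms] by simp

section \<open>The Henselization is generated by simple roots\<close>

locale henselization =
  fixes R :: "('a, 'm) ring_scheme" and H :: "('b, 'n) ring_scheme" and \<phi> :: "'a \<Rightarrow> 'b"
  assumes is_hens: "is_henselization R H \<phi>"
begin

abbreviation "mR \<equiv> max_ideal R"
abbreviation "mH \<equiv> max_ideal H"

lemma local_R: "local_ring R" and hens_H: "henselian_ring H" and local_\<phi>: "local_hom R H \<phi>"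
  using is_hens by (auto simp: is_henselization_def)

lemma local_H: "local_ring H" using hens_H by (simp add: henselian_ring_def)

sublocale R: cring R using local_R by (simp add: local_ring_def)
sublocale H: cring H using local_H by (simp add: local_ring_def)
sublocale \<phi>: ring_hom_cring R H \<phi>
  using local_\<phi> by (intro ring_hom_cring_intro R.cring_axioms H.cring_axioms) (simp add: local_hom_def)
sublocale mR: maximalideal mR R by (rule local_ring_maximalideal[OF local_R])
sublocale mH: maximalideal mH H by (rule local_ring_maximalideal[OF local_H])

lemma universal:
  fixes B :: "('c, 'k) ring_scheme" and \<iota> :: "'c \<Rightarrow> nat \<Rightarrow> 'a + 'b"
  assumes B: "henselian_ring B" and \<iota>: "inj_on \<iota> (carrier B)" and \<psi>: "local_hom R B \<psi>"
  obtains \<chi> where "local_hom H B \<chi>" "\<And>x. x \<in> carrier R \<Longrightarrow> \<chi> (\<phi> x) = \<psi> x"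
    "\<forall>\<chi>'. local_hom H B \<chi>' \<and> (\<forall>x\<in>carrier R. \<chi>' (\<phi> x) = \<psi> x) \<longrightarrow> (\<forall>y\<in>carrier H. \<chi>' y = \<chi> y)"
proof -
  let ?A = "image_ring \<iota> B" and ?g = "inv_into (carrier B) \<iota>"
  have lB: "local_ring B" using B by (simp add: henselian_ring_def)
  then interpret B: cring B by (simp add: local_ring_def)
  have iso: "\<iota> \<in> ring_iso B ?A" by (rule inj_imp_image_ring_iso[OF \<iota>])
  have A: "cring ?A"
    using B.ring_iso_imp_img_cring[OF iso] by (simp add: image_ring_def image_group_def monoid.defs)
  have g: "?g \<in> ring_hom ?A B" using ring_iso_set_sym[OF B.ring_axioms iso] by (simp add: ring_iso_def)
  have i: "\<iota> \<in> ring_hom B ?A" using iso by (simp add: ring_iso_def)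
  have gi: "?g (\<iota> x) = x" if "x \<in> carrier B" for x using that \<iota> by simp
  have ig: "\<iota> (?g y) = y" if "y \<in> carrier ?A" for y
    using that by (simp add: image_ring_carrier f_inv_into_f)
  have hA1: "henselian_ring ?A" by (rule henselian_ring_iso(1)[OF B A i g]) (simp_all add: ig gi)
  have hA2: "max_ideal ?A = {y \<in> carrier ?A. ?g y \<in> max_ideal B}"
    by (rule henselian_ring_iso(2)[OF B A i g]) (simp_all add: ig gi)
  have lg: "local_hom ?A B ?g" using g by (auto simp: local_hom_def hA2)
  have li: "local_hom B ?A \<iota>" using i gi ideal.Icarr[OF maximalideal.axioms(1)[OF local_ring_maximalideal[OF lB]]]
    by (auto simp: local_hom_def hA2 image_ring_carrier)
  have comp: "local_hom X Z (g \<circ> f)" if "local_hom X Y f" "local_hom Y Z g"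
    for X :: "('x, 'x1) ring_scheme" and Y :: "('y, 'y1) ring_scheme" and Z :: "('z, 'z1) ring_scheme" and f g
    using that ring_hom_trans[of f X Y g Z] by (auto simp: local_hom_def)
  have "\<forall>(A :: (nat \<Rightarrow> 'a + 'b) ring) \<psi>. henselian_ring A \<and> local_hom R A \<psi> \<longrightarrow>
       (\<exists>\<chi>. local_hom H A \<chi> \<and> (\<forall>x\<in>carrier R. \<chi> (\<phi> x) = \<psi> x) \<and>
         (\<forall>\<chi>'. local_hom H A \<chi>' \<and> (\<forall>x\<in>carrier R. \<chi>' (\<phi> x) = \<psi> x) \<longrightarrow>
           (\<forall>y\<in>carrier H. \<chi>' y = \<chi> y)))"
    using is_hens unfolding is_henselization_def by (elim conjE)
  from this[THEN spec, THEN spec, THEN mp, OF conjI[OF hA1 comp[OF \<psi> li]]]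
  obtain \<chi> where \<chi>: "local_hom H ?A \<chi>" "\<forall>x\<in>carrier R. \<chi> (\<phi> x) = (\<iota> \<circ> \<psi>) x"
    and un: "\<forall>\<chi>'. local_hom H ?A \<chi>' \<and> (\<forall>x\<in>carrier R. \<chi>' (\<phi> x) = (\<iota> \<circ> \<psi>) x) \<longrightarrow>
      (\<forall>y\<in>carrier H. \<chi>' y = \<chi> y)"
    by (elim exE conjE)
  have \<psi>c: "\<psi> x \<in> carrier B" if "x \<in> carrier R" for x
    using \<psi> that by (auto simp: local_hom_def ring_hom_def)
  show ?thesis
  proof (rule that[of "?g \<circ> \<chi>"])
    show "local_hom H B (?g \<circ> \<chi>)" by (rule comp[OF \<chi>(1) lg])
    show "(?g \<circ> \<chi>) (\<phi> x) = \<psi> x" if "x \<in> carrier R" for x using \<chi>(2) that \<psi>c gi by simp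
    show "\<forall>\<chi>'. local_hom H B \<chi>' \<and> (\<forall>x\<in>carrier R. \<chi>' (\<phi> x) = \<psi> x) \<longrightarrow> (\<forall>y\<in>carrier H. \<chi>' y = (?g \<circ> \<chi>) y)"
    proof (intro allI impI ballI, elim conjE)
    fix \<chi>' y assume \<chi>': "local_hom H B \<chi>'" "\<forall>x\<in>carrier R. \<chi>' (\<phi> x) = \<psi> x" and y: "y \<in> carrier H"
    have "(\<iota> \<circ> \<chi>') y = \<chi> y" using un[THEN spec, of "\<iota> \<circ> \<chi>'"] comp[OF \<chi>'(1) li] \<chi>'(2) y by simp
    moreover have "\<chi>' y \<in> carrier B" using \<chi>'(1) y by (auto simp: local_hom_def ring_hom_def)
    ultimately show "\<chi>' y = (?g \<circ> \<chi>) y" using gi by (metis comp_apply)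
    qed
  qed
qed

lemma contraction_primary:
  assumes q: "q \<in> primary_ideals R" and x: "x \<in> carrier R" "\<phi> x \<in> Idl\<^bsub>H\<^esub> (\<phi> ` q)"
  shows "x \<in> q"
\<comment> \<open>The zero ring is not local, hence not a target for the universal property.\<close>
proof (cases "q = carrier R")
  case False
  interpret q: ideal q R using q by (simp add: primary_ideals_def)
  let ?Q = "R Quot q"
  \<comment> \<open>A coset is coded by a chosen representative, as a constant function. This places
    the quotient ring, whose elements are sets, into the type of the test rings.\<close>
  define \<iota> where "\<iota> X = (\<lambda>_::nat. Inl (SOME x. x \<in> X) :: 'a + 'b)" for X :: "'a set"
  have inj: "inj_on \<iota> (carrier ?Q)"
  proof (rule inj_onI)
    have *: "X = q +>\<^bsub>R\<^esub> (SOME x. x \<in> X)" if X: "X \<in> carrier ?Q" for X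
    proof -
      obtain y where y: "y \<in> carrier R" "X = q +>\<^bsub>R\<^esub> y" using X by (auto simp: FactRing_def A_RCOSETS_def')
      then have "y \<in> X" using q.a_rcos_self by simp
      then have "(SOME x. x \<in> X) \<in> X" by (rule someI)
      then show ?thesis using y R.a_repr_independence[OF _ y(1) q.a_subgroup] by simp
    qed
    fix X Y assume X: "X \<in> carrier ?Q" and Y: "Y \<in> carrier ?Q" and e: "\<iota> X = \<iota> Y"
    have "(SOME x. x \<in> X) = (SOME x. x \<in> Y)" using fun_cong[OF e, of 0] by (simp add: \<iota>_def)
    then show "X = Y" using *[OF X] *[OF Y] by simp
  qed
  obtain \<chi> where \<chi>: "local_hom H ?Q \<chi>" "\<And>x. x \<in> carrier R \<Longrightarrow> \<chi> (\<phi> x) = q +>\<^bsub>R\<^esub> x"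
    by (rule universal[OF henselian_Quot(1)[OF local_R q False] inj henselian_Quot(2)[OF local_R q False]])
      (rule that)
  have "\<chi> \<in> ring_hom H ?Q" using \<chi>(1) unfolding local_hom_def by (rule conjunct1)
  then interpret \<chi>: ring_hom_cring H ?Q \<chi>
    by (intro ring_hom_cring_intro H.cring_axioms q.quotient_is_cring[OF R.cring_axioms])
  let ?K = "a_kernel H ?Q \<chi>"
  have z: "\<zero>\<^bsub>?Q\<^esub> = q" unfolding FactRing_def by simp
  have "\<phi> ` q \<subseteq> ?K"
  proof (rule image_subsetI)
    fix x assume x: "x \<in> q"
    have "\<chi> (\<phi> x) = \<zero>\<^bsub>?Q\<^esub>" unfolding z \<chi>(2)[OF q.Icarr[OF x]] by (rule R.a_rcos_zero[OF q.is_ideal x])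
    then show "\<phi> x \<in> ?K" using q.Icarr[OF x] unfolding a_kernel_def' by simp
  qed
  then have "Idl\<^bsub>H\<^esub> (\<phi> ` q) \<subseteq> ?K" by (intro H.genideal_minimal \<chi>.ring.kernel_is_ideal)
  then have "\<chi> (\<phi> x) = \<zero>\<^bsub>?Q\<^esub>" using x(2) unfolding a_kernel_def' by blast
  then have "q +>\<^bsub>R\<^esub> x = q" unfolding z \<chi>(2)[OF x(1)] .
  then show ?thesis by (rule q.rcos_const_imp_mem[OF x(1)])
qed (use x in simp)

text \<open>Elements of \<open>T\<close> outside \<open>mH\<close> are invertible in
  \<open>H\<close>, and the assumption puts the inverse into \<open>T\<close>.\<close>

lemma local_subring:
  assumes T: "subring T H" and inv: "\<And>x. x \<in> T \<Longrightarrow> x \<in> Units H \<Longrightarrow> inv\<^bsub>H\<^esub> x \<in> T"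
  shows "local_ring (H\<lparr>carrier := T\<rparr>)" "max_ideal (H\<lparr>carrier := T\<rparr>) = T \<inter> mH"
proof -
  let ?B = "H\<lparr>carrier := T\<rparr>"
  have sub: "T \<subseteq> carrier H" by (rule subringE(1)[OF T])
  have cB: "cring ?B" by (rule H.subring_is_cring[OF T])
  interpret B: cring ?B by fact
  have i: "ideal (T \<inter> mH) ?B"
  proof (rule idealI[OF B.ring_axioms])
    show "subgroup (T \<inter> mH) (add_monoid ?B)"
    proof
      fix x assume x: "x \<in> T \<inter> mH"
      have "inv\<^bsub>add_monoid ?B\<^esub> x = \<ominus>\<^bsub>H\<^esub> x" using H.subring_a_inv[OF T, of x] x by (simp add: a_inv_def)
      then show "inv\<^bsub>add_monoid ?B\<^esub> x \<in> T \<inter> mH" using x subringE(5)[OF T] by simp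
    qed (use subringE[OF T] mH.zero_closed in auto)
    show "x \<otimes>\<^bsub>?B\<^esub> a \<in> T \<inter> mH" "a \<otimes>\<^bsub>?B\<^esub> x \<in> T \<inter> mH" if "a \<in> T \<inter> mH" "x \<in> carrier ?B" for a x
      using that subringE(6)[OF T] sub mH.I_l_closed mH.I_r_closed by auto
  qed
  have one: "\<one>\<^bsub>?B\<^esub> \<notin> T \<inter> mH" using local_ring_one_notin[OF local_H] by simp
  have U: "x \<in> Units ?B" if "x \<in> carrier ?B" "x \<notin> T \<inter> mH" for x
  proof -
    have "x \<in> Units H" using that sub by (auto simp: local_ring_Units_iff[OF local_H])
    then show ?thesis using inv[of x] that by (intro B.UnitsI[of _ "inv\<^bsub>H\<^esub> x"]) auto
  qed
  show "local_ring ?B" by (rule local_ringI(1)[OF cB i one U])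
  show "max_ideal ?B = T \<inter> mH" by (rule local_ringI(2)[OF cB i one U])
qed

text \<open>\<open>T\<close> is Henselian, so the universal property gives a homomorphism \<open>H \<rightarrow> T\<close> over \<open>R\<close>, and by uniqueness
  its composition with the inclusion \<open>T \<rightarrow> H\<close> is the identity.\<close>

lemma generation:
  assumes T: "subring T H" "\<phi> ` carrier R \<subseteq> T"
    and inv: "\<And>x. x \<in> T \<Longrightarrow> x \<in> Units H \<Longrightarrow> inv\<^bsub>H\<^esub> x \<in> T"
    and root: "\<And>f a t. set f \<subseteq> T \<Longrightarrow> a \<in> carrier H \<Longrightarrow> t \<in> T \<Longrightarrow> a \<ominus>\<^bsub>H\<^esub> t \<in> mH \<Longrightarrow>
      pev H (f @ [\<one>\<^bsub>H\<^esub>]) a = \<zero>\<^bsub>H\<^esub> \<Longrightarrow> pdd H (f @ [\<one>\<^bsub>H\<^esub>]) a a \<notin> mH \<Longrightarrow> a \<in> T"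
  shows "T = carrier H"
proof -
  let ?B = "H\<lparr>carrier := T\<rparr>"
  have sub: "T \<subseteq> carrier H" by (rule subringE(1)[OF T(1)])
  have lB: "local_ring ?B" and mB: "max_ideal ?B = T \<inter> mH"
    by (rule local_subring[OF T(1) inv]; assumption)+
  have "henselian_ring ?B"
  proof (rule henselian_ringI[OF lB])
    fix f t assume f: "set f \<subseteq> carrier ?B" and t: "t \<in> carrier ?B"
      and pv: "pev ?B (f @ [\<one>\<^bsub>?B\<^esub>]) t \<in> max_ideal ?B" and dv: "pdd ?B (f @ [\<one>\<^bsub>?B\<^esub>]) t t \<notin> max_ideal ?B"
    let ?f = "f @ [\<one>\<^bsub>H\<^esub>]"
    have fH: "set f \<subseteq> carrier H" "t \<in> carrier H" "set f \<subseteq> T" "t \<in> T" using f t sub by auto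
    have dv': "pdd H ?f t t \<notin> mH"
      using dv H.pdd_in_subring[OF T(1), of ?f t t] fH subringE(3)[OF T(1)] by (simp add: mB)
    obtain a where a: "a \<in> carrier H" "pev H ?f a = \<zero>\<^bsub>H\<^esub>" "a \<ominus>\<^bsub>H\<^esub> t \<in> mH"
      using henselian_ringD[OF hens_H fH(1,2) _ dv'] pv by (auto simp: mB)
    \<comment> \<open>The Henselian condition has the derivative at \<open>t\<close>, while
      \<open>root\<close> asks for it at the root \<open>a\<close>; the two agree modulo
      \<open>mH\<close>.\<close>
    have "pdd H ?f a a \<ominus>\<^bsub>H\<^esub> pdd H ?f t t \<in> mH"
      using a fH by (intro H.pdd_cong[OF mH.is_ideal]) auto
    moreover have "pdd H ?f t t = pdd H ?f a a \<ominus>\<^bsub>H\<^esub> (pdd H ?f a a \<ominus>\<^bsub>H\<^esub> pdd H ?f t t)"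
    proof -
      have "pdd H ?f t t \<in> carrier H" "pdd H ?f a a \<in> carrier H" using a fH by auto
      then show ?thesis by algebra
    qed
    ultimately have "pdd H ?f a a \<notin> mH" using dv' unfolding a_minus_def
      by (metis mH.a_closed mH.a_inv_closed)
    then have aT: "a \<in> T" using root fH a by blast
    then show "\<exists>a\<in>carrier ?B. pev ?B (f @ [\<one>\<^bsub>?B\<^esub>]) a = \<zero>\<^bsub>?B\<^esub> \<and> a \<ominus>\<^bsub>?B\<^esub> t \<in> max_ideal ?B"
    proof (intro bexI[of _ a] conjI)
      have "a \<ominus>\<^bsub>H\<^esub> t \<in> T" using aT fH subringE(5,7)[OF T(1)] unfolding a_minus_def by blast
      then show "a \<ominus>\<^bsub>?B\<^esub> t \<in> max_ideal ?B"
        using a(3) unfolding mB H.subring_minus[OF T(1) aT fH(4)] by blast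
    qed (use aT a in auto)
  qed
  note hB = this
  have injB: "inj_on (\<lambda>y (_::nat). Inr y :: 'a + 'b) (carrier ?B)"
    by (rule inj_onI) (metis sum.inject(2))
  have locB: "local_hom R ?B \<phi>"
    using local_\<phi> T(2) mR.Icarr by (auto simp: local_hom_def ring_hom_def mB)
  obtain \<chi> where \<chi>: "local_hom H ?B \<chi>" "\<And>x. x \<in> carrier R \<Longrightarrow> \<chi> (\<phi> x) = \<phi> x"
    by (rule universal[OF hB injB locB]) (rule that)
  have \<chi>H: "local_hom H H \<chi>" using \<chi>(1) sub by (auto simp: local_hom_def ring_hom_def mB)
  have injH: "inj_on (\<lambda>y (_::nat). Inr y :: 'a + 'b) (carrier H)"
    by (rule inj_onI) (metis sum.inject(2))
  obtain \<chi>0 where "local_hom H H \<chi>0" "\<And>x. x \<in> carrier R \<Longrightarrow> \<chi>0 (\<phi> x) = \<phi> x"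
    and u: "\<forall>\<chi>'. local_hom H H \<chi>' \<and> (\<forall>x\<in>carrier R. \<chi>' (\<phi> x) = \<phi> x) \<longrightarrow> (\<forall>y\<in>carrier H. \<chi>' y = \<chi>0 y)"
    by (rule universal[OF hens_H injH local_\<phi>]) (rule that)
  have idH: "local_hom H H (\<lambda>x. x)" by (auto simp: local_hom_def ring_hom_def)
  have "y \<in> T" if "y \<in> carrier H" for y
  proof -
    have "\<chi> y = y" using u[THEN spec, of \<chi>] u[THEN spec, of "\<lambda>x. x"] \<chi>H \<chi>(2) idH that by simp
    moreover have "\<chi> y \<in> T" using \<chi>(1) that by (auto simp: local_hom_def ring_hom_def)
    ultimately show ?thesis by simp
  qed
  then show ?thesis using sub by blast
qed

end

section \<open>Noetherian modules\<close>

text \<open>An inductive span lets proofs proceed one summand at a time, without families of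
  coefficients.\<close>

inductive_set mspan :: "('a, 'm) ring_scheme \<Rightarrow> ('a, 'b, 'k) module_scheme \<Rightarrow> 'b set \<Rightarrow> 'b set"
  for R and M and X where
  mspan_zero: "\<zero>\<^bsub>M\<^esub> \<in> mspan R M X"
| mspan_step: "a \<in> carrier R \<Longrightarrow> x \<in> X \<Longrightarrow> v \<in> mspan R M X \<Longrightarrow> a \<odot>\<^bsub>M\<^esub> x \<oplus>\<^bsub>M\<^esub> v \<in> mspan R M X"

lemma mspan_mono: "X \<subseteq> Y \<Longrightarrow> mspan R M X \<subseteq> mspan R M Y"
proof
  fix v assume XY: "X \<subseteq> Y" and "v \<in> mspan R M X"
  from this(2) show "v \<in> mspan R M Y"
    by (induct rule: mspan.induct) (use XY in \<open>auto intro: mspan.intros\<close>)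
qed

lemma (in abelian_group) add_diff_cancel:
  assumes "a \<in> carrier G" "b \<in> carrier G" "c \<in> carrier G"
  shows "(a \<oplus> b) \<oplus> \<ominus> (a \<oplus> c) = b \<oplus> \<ominus> c"
proof -
  have "(a \<oplus> b) \<oplus> \<ominus> (a \<oplus> c) = (b \<oplus> a) \<oplus> (\<ominus> a \<oplus> \<ominus> c)"
    using assms by (simp add: minus_add a_comm[of a b])
  also have "\<dots> = b \<oplus> (a \<oplus> (\<ominus> a \<oplus> \<ominus> c))" using assms by (intro a_assoc) auto
  finally show ?thesis using assms by (simp add: r_neg2)
qed

lemma (in abelian_group) add_diff_restore:
  assumes "a \<in> carrier G" "b \<in> carrier G" "c \<in> carrier G"
  shows "(a \<oplus> c) \<oplus> (b \<oplus> \<ominus> c) = a \<oplus> b"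
proof -
  have "(a \<oplus> c) \<oplus> (b \<oplus> \<ominus> c) = a \<oplus> (c \<oplus> (\<ominus> c \<oplus> b))"
    using assms by (simp add: a_assoc a_comm[of b])
  then show ?thesis using assms by (simp add: r_neg2)
qed

context module begin

lemma submodule_zero: "submodule N R M \<Longrightarrow> \<zero>\<^bsub>M\<^esub> \<in> N"
  by (metis additive_subgroup.zero_closed additive_subgroup.intro submodule.axioms(1))

lemmas submoduleD = submoduleE(1) submoduleE(3) submoduleE(4) submoduleE(5) submodule_zero

lemma mspan_subset: "submodule N R M \<Longrightarrow> X \<subseteq> N \<Longrightarrow> mspan R M X \<subseteq> N"
proof
  fix v assume "submodule N R M" "X \<subseteq> N" and v: "v \<in> mspan R M X"
  from v show "v \<in> N"
    by (induct rule: mspan.induct) (use \<open>submodule N R M\<close> \<open>X \<subseteq> N\<close> in \<open>auto intro: submoduleD\<close>)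
qed

lemma mspan_carrier: "X \<subseteq> carrier M \<Longrightarrow> mspan R M X \<subseteq> carrier M"
  by (intro mspan_subset carrier_is_submodule)

lemma mspan_superset:
  assumes "X \<subseteq> carrier M" shows "X \<subseteq> mspan R M X"
proof
  fix x assume x: "x \<in> X"
  have "\<one> \<odot>\<^bsub>M\<^esub> x \<oplus>\<^bsub>M\<^esub> \<zero>\<^bsub>M\<^esub> \<in> mspan R M X" using x by (intro mspan.intros) auto
  then show "x \<in> mspan R M X" using x assms by auto
qed

lemma mspan_submodule:
  assumes X: "X \<subseteq> carrier M" shows "submodule (mspan R M X) R M"
proof -
  note c = mspan_carrier[OF X]
  have add: "u \<oplus>\<^bsub>M\<^esub> v \<in> mspan R M X" if "u \<in> mspan R M X" and v: "v \<in> mspan R M X" for u v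
    using that(1)
  proof induct
    case mspan_zero then show ?case using v c by auto
  next
    case (mspan_step a x u)
    then have "a \<odot>\<^bsub>M\<^esub> x \<oplus>\<^bsub>M\<^esub> u \<oplus>\<^bsub>M\<^esub> v = a \<odot>\<^bsub>M\<^esub> x \<oplus>\<^bsub>M\<^esub> (u \<oplus>\<^bsub>M\<^esub> v)"
      using X c v by (intro M.a_assoc) auto
    then show ?case using mspan_step by (auto intro: mspan.intros)
  qed
  have sm: "b \<odot>\<^bsub>M\<^esub> u \<in> mspan R M X" if b: "b \<in> carrier R" and "u \<in> mspan R M X" for b u
    using that(2)
  proof induct
    case mspan_zero then show ?case using b by (auto intro: mspan.intros)
  next
    case (mspan_step a x u)
    then have "b \<odot>\<^bsub>M\<^esub> (a \<odot>\<^bsub>M\<^esub> x \<oplus>\<^bsub>M\<^esub> u) = (b \<otimes> a) \<odot>\<^bsub>M\<^esub> x \<oplus>\<^bsub>M\<^esub> b \<odot>\<^bsub>M\<^esub> u"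
      using X c b by (subst smult_r_distr) (auto simp: smult_assoc1 subset_iff)
    then show ?case using mspan_step b by (auto intro: mspan.intros)
  qed
  have "\<ominus>\<^bsub>M\<^esub> u \<in> mspan R M X" if "u \<in> mspan R M X" for u
  proof -
    have "\<ominus>\<^bsub>M\<^esub> u = (\<ominus> \<one>) \<odot>\<^bsub>M\<^esub> u" using that c by (subst smult_l_minus) auto
    then show ?thesis using sm[of "\<ominus> \<one>" u] that by simp
  qed
  then show ?thesis using c add sm by (intro submoduleI) (auto intro: mspan.intros)
qed

lemma mspan_insertE:
  assumes "v \<in> mspan R M (insert y Y)" and Y: "Y \<subseteq> carrier M" "y \<in> carrier M"
  obtains s w where "s \<in> carrier R" "w \<in> mspan R M Y" "v = s \<odot>\<^bsub>M\<^esub> y \<oplus>\<^bsub>M\<^esub> w"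
proof -
  note c = mspan_carrier[OF Y(1)] and sub = mspan_submodule[OF Y(1)]
  have "\<exists>s\<in>carrier R. \<exists>w\<in>mspan R M Y. v = s \<odot>\<^bsub>M\<^esub> y \<oplus>\<^bsub>M\<^esub> w"
    using assms(1)
  proof induct
    case mspan_zero
    have "\<zero>\<^bsub>M\<^esub> = \<zero> \<odot>\<^bsub>M\<^esub> y \<oplus>\<^bsub>M\<^esub> \<zero>\<^bsub>M\<^esub>" using Y by simp
    then show ?case using mspan.mspan_zero[of M R Y] R.zero_closed by blast
  next
    case (mspan_step a x v)
    then obtain s w where sw: "s \<in> carrier R" "w \<in> mspan R M Y" "v = s \<odot>\<^bsub>M\<^esub> y \<oplus>\<^bsub>M\<^esub> w" by blast
    have wc: "w \<in> carrier M" using sw c by auto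
    show ?case
    proof (cases "x = y")
      case True
      then have "a \<odot>\<^bsub>M\<^esub> x \<oplus>\<^bsub>M\<^esub> v = (a \<oplus> s) \<odot>\<^bsub>M\<^esub> y \<oplus>\<^bsub>M\<^esub> w"
        using sw wc Y mspan_step(1) by (simp add: smult_l_distr M.a_assoc)
      then show ?thesis using sw mspan_step(1) by blast
    next
      case False
      then have x: "x \<in> Y" "x \<in> carrier M" using mspan_step Y by auto
      then have "a \<odot>\<^bsub>M\<^esub> x \<oplus>\<^bsub>M\<^esub> v = s \<odot>\<^bsub>M\<^esub> y \<oplus>\<^bsub>M\<^esub> (a \<odot>\<^bsub>M\<^esub> x \<oplus>\<^bsub>M\<^esub> w)"
        using sw wc Y mspan_step(1) by (simp add: M.a_lcomm)
      then show ?thesis using sw mspan_step(1) x by (blast intro: mspan.intros)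
    qed
  qed
  then show ?thesis using that by blast
qed

definition noeth_module :: bool where
  "noeth_module \<longleftrightarrow> (\<forall>N. submodule N R M \<longrightarrow> (\<exists>X. finite X \<and> X \<subseteq> N \<and> N = mspan R M X))"

lemma submodule_Int:
  "submodule N R M \<Longrightarrow> submodule K R M \<Longrightarrow> submodule (N \<inter> K) R M"
  by (intro submoduleI) (auto intro: submoduleD dest: submoduleD(1))

text \<open>Induction on the generators. The coefficients of \<open>y\<close> that occur in
  \<open>V\<close> modulo the span of \<open>Y\<close> form an ideal \<open>In V\<close>, which is
  finitely generated. Elements of \<open>V\<close> with these leading coefficients, together with
  generators of \<open>V \<inter> mspan R M Y\<close>, generate \<open>V\<close>.\<close>

lemma fg_submodule:
  assumes R: "noetherian_ring R" and "finite Y" and "Y \<subseteq> carrier M"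
    and "submodule V R M" "V \<subseteq> mspan R M Y"
  shows "\<exists>X. finite X \<and> X \<subseteq> V \<and> V = mspan R M X"
  using assms(2-5)
proof (induct Y arbitrary: V)
  case empty
  have "mspan R M {} = {\<zero>\<^bsub>M\<^esub>}" by (auto elim: mspan.cases intro: mspan.intros)
  then have "V = mspan R M {}" using empty submodule_zero by auto
  then show ?case by blast
next
  case (insert y Y)
  have Y: "Y \<subseteq> carrier M" and y: "y \<in> carrier M" using insert by auto
  note sY = mspan_submodule[OF Y] and cY = mspan_carrier[OF Y] and V = submoduleD[OF insert(5)]
  have VY: "submodule (V \<inter> mspan R M Y) R M" by (rule submodule_Int[OF insert(5) sY])
  obtain X where X: "finite X" "X \<subseteq> V \<inter> mspan R M Y" "V \<inter> mspan R M Y = mspan R M X"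
    using insert(3)[OF Y VY] by blast
  define In where "In W = {s \<in> carrier R. \<exists>w\<in>mspan R M Y. s \<odot>\<^bsub>M\<^esub> y \<oplus>\<^bsub>M\<^esub> w \<in> W}" for W
  have InI: "ideal (In W) R" if W: "submodule W R M" for W
  proof -
    note Wd = submoduleD[OF W]
    have add: "a \<oplus> b \<in> In W" if ab: "a \<in> In W" "b \<in> In W" for a b
    proof -
      obtain u v where uv: "u \<in> mspan R M Y" "v \<in> mspan R M Y" "a \<odot>\<^bsub>M\<^esub> y \<oplus>\<^bsub>M\<^esub> u \<in> W" "b \<odot>\<^bsub>M\<^esub> y \<oplus>\<^bsub>M\<^esub> v \<in> W"
        and abc: "a \<in> carrier R" "b \<in> carrier R" using ab by (auto simp: In_def)
      have c: "u \<in> carrier M" "v \<in> carrier M" using uv cY by auto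
      have "(a \<oplus> b) \<odot>\<^bsub>M\<^esub> y \<oplus>\<^bsub>M\<^esub> (u \<oplus>\<^bsub>M\<^esub> v) = (a \<odot>\<^bsub>M\<^esub> y \<oplus>\<^bsub>M\<^esub> u) \<oplus>\<^bsub>M\<^esub> (b \<odot>\<^bsub>M\<^esub> y \<oplus>\<^bsub>M\<^esub> v)"
        using abc c y by (simp add: smult_l_distr M.a_ac)
      then show ?thesis using uv abc Wd(4) submoduleD(4)[OF sY]
        by (auto simp: In_def intro!: bexI[of _ "u \<oplus>\<^bsub>M\<^esub> v"])
    qed
    have mult: "b \<otimes> a \<in> In W" if aI: "a \<in> In W" and b: "b \<in> carrier R" for a b
    proof -
      obtain u where u: "u \<in> mspan R M Y" "a \<odot>\<^bsub>M\<^esub> y \<oplus>\<^bsub>M\<^esub> u \<in> W" and a: "a \<in> carrier R"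
        using aI by (auto simp: In_def)
      have "(b \<otimes> a) \<odot>\<^bsub>M\<^esub> y \<oplus>\<^bsub>M\<^esub> b \<odot>\<^bsub>M\<^esub> u = b \<odot>\<^bsub>M\<^esub> (a \<odot>\<^bsub>M\<^esub> y \<oplus>\<^bsub>M\<^esub> u)"
        using a b u cY y by (auto simp: smult_r_distr smult_assoc1)
      then show ?thesis using u a b Wd(3) submoduleD(3)[OF sY]
        by (auto simp: In_def intro!: bexI[of _ "b \<odot>\<^bsub>M\<^esub> u"])
    qed
    have "\<zero> \<in> In W" using y Wd(5) by (auto simp: In_def intro!: bexI[of _ "\<zero>\<^bsub>M\<^esub>"] mspan.intros)
    show ?thesis
    proof (rule idealI[OF R.ring_axioms])
      show "subgroup (In W) (add_monoid R)"
      proof (rule R.add.subgroupI)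
        show "In W \<subseteq> carrier R" by (auto simp: In_def)
        show "In W \<noteq> {}" using \<open>\<zero> \<in> In W\<close> by blast
        show "\<ominus> a \<in> In W" if "a \<in> In W" for a
        proof -
          have "a \<in> carrier R" using that by (simp add: In_def)
          then have "\<ominus> a = (\<ominus> \<one>) \<otimes> a" by (simp add: R.l_minus)
          then show ?thesis using mult[OF that, of "\<ominus> \<one>"] by simp
        qed
      qed (use add in auto)
      show "x \<otimes> a \<in> In W" "a \<otimes> x \<in> In W" if "a \<in> In W" "x \<in> carrier R" for a x
        using mult[OF that] that by (auto simp: In_def R.m_comm)
    qed
  qed
  obtain A where A: "A \<subseteq> carrier R" "finite A" "In V = Idl A"
    using noetherian_ring.finetely_gen[OF R InI[OF insert(5)]] by blast
  have "\<forall>s\<in>A. \<exists>v\<in>V. \<exists>w\<in>mspan R M Y. v = s \<odot>\<^bsub>M\<^esub> y \<oplus>\<^bsub>M\<^esub> w"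
  proof
    fix s assume "s \<in> A"
    then have "s \<in> In V" using R.genideal_self[OF A(1)] A(3) by blast
    then show "\<exists>v\<in>V. \<exists>w\<in>mspan R M Y. v = s \<odot>\<^bsub>M\<^esub> y \<oplus>\<^bsub>M\<^esub> w" by (auto simp: In_def)
  qed
  then obtain g where g: "\<And>s. s \<in> A \<Longrightarrow> g s \<in> V \<and> (\<exists>w\<in>mspan R M Y. g s = s \<odot>\<^bsub>M\<^esub> y \<oplus>\<^bsub>M\<^esub> w)" by metis
  let ?X = "g ` A \<union> X"
  have XV: "?X \<subseteq> V" using g X by auto
  then have Xc: "?X \<subseteq> carrier M" using V(1) by auto
  note sX = mspan_submodule[OF Xc] and X' = mspan_superset[OF Xc]
  have "A \<subseteq> In (mspan R M ?X)"
  proof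
    fix s assume s: "s \<in> A"
    then have "g s \<in> mspan R M ?X" using X' by auto
    then show "s \<in> In (mspan R M ?X)" using g[OF s] s A(1) by (auto simp: In_def)
  qed
  \<comment> \<open>\<open>In\<close> is an ideal for the span of \<open>?X\<close> as well, so the
    comparison needs only the generators in \<open>A\<close> and no linear combination of
    them.\<close>
  then have "Idl A \<subseteq> In (mspan R M ?X)" by (intro R.genideal_minimal InI sX)
  then have InV: "In V \<subseteq> In (mspan R M ?X)" using A(3) by simp
  have "V \<subseteq> mspan R M ?X"
  proof
    fix v assume v: "v \<in> V"
    then obtain s w where sw: "s \<in> carrier R" "w \<in> mspan R M Y" "v = s \<odot>\<^bsub>M\<^esub> y \<oplus>\<^bsub>M\<^esub> w"
      using insert(6) mspan_insertE[OF _ Y y] by (metis subsetD)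
    then have "s \<in> In (mspan R M ?X)" using v InV by (auto simp: In_def)
    then obtain w' where w': "w' \<in> mspan R M Y" "s \<odot>\<^bsub>M\<^esub> y \<oplus>\<^bsub>M\<^esub> w' \<in> mspan R M ?X" by (auto simp: In_def)
    let ?v = "s \<odot>\<^bsub>M\<^esub> y \<oplus>\<^bsub>M\<^esub> w'"
    have c: "w \<in> carrier M" "w' \<in> carrier M" "s \<odot>\<^bsub>M\<^esub> y \<in> carrier M" using sw w' cY y by auto
    have "v \<oplus>\<^bsub>M\<^esub> \<ominus>\<^bsub>M\<^esub> ?v = w \<oplus>\<^bsub>M\<^esub> \<ominus>\<^bsub>M\<^esub> w'"
      unfolding sw(3) using c by (intro M.add_diff_cancel)
    moreover have "?v \<in> V" using w'(2) mspan_subset[OF insert(5) XV] by blast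
    ultimately have "w \<oplus>\<^bsub>M\<^esub> \<ominus>\<^bsub>M\<^esub> w' \<in> V \<inter> mspan R M Y"
      using v V sw w' submoduleD[OF sY] by (metis IntI)
    then have "w \<oplus>\<^bsub>M\<^esub> \<ominus>\<^bsub>M\<^esub> w' \<in> mspan R M ?X" using X(3) mspan_mono[of X ?X] by blast
    then have "?v \<oplus>\<^bsub>M\<^esub> (w \<oplus>\<^bsub>M\<^esub> \<ominus>\<^bsub>M\<^esub> w') \<in> mspan R M ?X" using submoduleD(4)[OF sX] w'(2) by blast
    moreover have "?v \<oplus>\<^bsub>M\<^esub> (w \<oplus>\<^bsub>M\<^esub> \<ominus>\<^bsub>M\<^esub> w') = v"
      unfolding sw(3) using c by (intro M.add_diff_restore)
    ultimately show "v \<in> mspan R M ?X" by simp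
  qed
  then have "V = mspan R M ?X" using mspan_subset[OF insert(5) XV] by blast
  then show ?case using XV A(2) X(1) by (intro exI[of _ ?X]) auto
qed

lemma noeth_moduleI:
  assumes "noetherian_ring R" "finite Y" "Y \<subseteq> carrier M" "carrier M \<subseteq> mspan R M Y"
  shows noeth_module
  unfolding noeth_module_def using fg_submodule[OF assms(1-3)] submoduleE(1) assms(4) by blast

text \<open>The union of a chain has finitely many generators, which all lie in one member; so the
  union is itself a member.\<close>

lemma noeth_maximal:
  assumes N: noeth_module and F: "F \<noteq> {}" "\<And>U. U \<in> F \<Longrightarrow> submodule U R M"
  shows "\<exists>U\<in>F. \<forall>V\<in>F. U \<subseteq> V \<longrightarrow> V = U"
proof (rule subset_Zorn_nonempty[OF F(1)])
  fix C assume C: "C \<noteq> {}" "subset.chain F C"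
  then have CF: "C \<subseteq> F" by (simp add: subset_chain_def)
  have two: "\<exists>U\<in>C. x \<in> U \<and> y \<in> U" if "x \<in> \<Union>C" "y \<in> \<Union>C" for x y
    using that C(2) unfolding subset_chain_def by blast
  have sC: "submodule (\<Union>C) R M"
  proof (rule submoduleI)
    show "\<Union>C \<subseteq> carrier M" using CF F(2) submoduleE(1) by blast
    show "\<zero>\<^bsub>M\<^esub> \<in> \<Union>C" using C(1) CF F(2) submodule_zero by blast
    show "\<ominus>\<^bsub>M\<^esub> a \<in> \<Union>C" if "a \<in> \<Union>C" for a using that CF F(2) submoduleE(3) by blast
    show "a \<odot>\<^bsub>M\<^esub> x \<in> \<Union>C" if "a \<in> carrier R" "x \<in> \<Union>C" for a x
      using that CF F(2) submoduleE(4) by blast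
    show "a \<oplus>\<^bsub>M\<^esub> b \<in> \<Union>C" if "a \<in> \<Union>C" "b \<in> \<Union>C" for a b
      using two[OF that] CF F(2) submoduleE(5) by blast
  qed
  obtain X where X: "finite X" "X \<subseteq> \<Union>C" "\<Union>C = mspan R M X"
    using N[unfolded noeth_module_def, THEN spec, THEN mp, OF sC] by (elim exE conjE)
  obtain U where U: "U \<in> C" "X \<subseteq> U"
    by (rule finite_subset_Union_chain[OF X(1,2) C])
  then have "\<Union>C \<subseteq> U" unfolding X(3) by (intro mspan_subset F(2) subsetD[OF CF])
  then have "\<Union>C = U" using U by blast
  then show "\<Union>C \<in> F" using U CF by blast
qed

lemma noeth_maximalE:
  assumes noeth_module "F \<noteq> {}" "\<And>U. U \<in> F \<Longrightarrow> submodule U R M"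
  obtains U where "U \<in> F" "\<forall>V\<in>F. U \<subseteq> V \<longrightarrow> V = U"
  using noeth_maximal[OF assms] by blast

text \<open>A submodule \<open>U\<close> that is maximal with \<open>U \<inter> W = W\<^sub>0\<close> makes \<open>W / W\<^sub>0\<close> an essential
  submodule of \<open>M / U\<close>. A ring element that is nilpotent on \<open>W / W\<^sub>0\<close> is then nilpotent on \<open>M / U\<close>, because
  the kernels of its powers on \<open>M / U\<close> stabilise.\<close>

theorem weak_Artin_Rees:
  assumes N: noeth_module and W: "submodule W R M" and W0: "submodule W0 R M" "W0 \<subseteq> W"
    and m: "m \<subseteq> carrier R" and nil: "\<And>x. x \<in> m \<Longrightarrow> \<exists>n::nat. \<forall>w\<in>W. x [^] n \<odot>\<^bsub>M\<^esub> w \<in> W0"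
  obtains U where "submodule U R M" "U \<inter> W = W0" "\<And>x. x \<in> m \<Longrightarrow> \<exists>k::nat. \<forall>y\<in>carrier M. x [^] k \<odot>\<^bsub>M\<^esub> y \<in> U"
proof -
  define F where "F = {U. submodule U R M \<and> U \<inter> W = W0}"
  have "W0 \<in> F" using W0 by (auto simp: F_def)
  then have ne: "F \<noteq> {}" by blast
  have subF: "submodule U R M" if "U \<in> F" for U using that by (simp add: F_def)
  obtain U where U: "U \<in> F" and max: "\<forall>V\<in>F. U \<subseteq> V \<longrightarrow> V = U"
    by (rule noeth_maximalE[OF N ne subF])
  have sU: "submodule U R M" and UW: "U \<inter> W = W0" using U by (auto simp: F_def)
  note Ud = submoduleD[OF sU] and Wd = submoduleD[OF W]
  have "\<exists>k::nat. \<forall>y\<in>carrier M. x [^] k \<odot>\<^bsub>M\<^esub> y \<in> U" if xm: "x \<in> m" for x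
  proof -
    have x: "x \<in> carrier R" using xm m by blast
    obtain n :: nat where n: "\<And>w. w \<in> W \<Longrightarrow> x [^] n \<odot>\<^bsub>M\<^esub> w \<in> W0" using nil[OF xm] by blast
    define V where "V k = {y \<in> carrier M. x [^] (k::nat) \<odot>\<^bsub>M\<^esub> y \<in> U}" for k
    have sV: "submodule (V k) R M" for k
    proof (rule submoduleI)
      show "\<ominus>\<^bsub>M\<^esub> a \<in> V k" if "a \<in> V k" for a
        using that x Ud by (auto simp: V_def smult_r_minus)
      show "a \<odot>\<^bsub>M\<^esub> y \<in> V k" if "a \<in> carrier R" "y \<in> V k" for a y
      proof -
        have "x [^] k \<odot>\<^bsub>M\<^esub> (a \<odot>\<^bsub>M\<^esub> y) = a \<odot>\<^bsub>M\<^esub> (x [^] k \<odot>\<^bsub>M\<^esub> y)"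
          using that x by (simp add: V_def smult_assoc1[symmetric] R.m_comm)
        then show ?thesis using that Ud by (auto simp: V_def)
      qed
    qed (use x Ud in \<open>auto simp: V_def smult_r_distr\<close>)
    have Vle: "V k \<subseteq> V (k + j)" for k j
    proof
      fix y assume y: "y \<in> V k"
      have "x [^] (k + j) \<odot>\<^bsub>M\<^esub> y = x [^] j \<odot>\<^bsub>M\<^esub> (x [^] k \<odot>\<^bsub>M\<^esub> y)"
        using y x by (simp add: V_def smult_assoc1[symmetric] R.nat_pow_mult add.commute)
      then show "y \<in> V (k + j)" using y x Ud by (auto simp: V_def)
    qed
    obtain k where k: "\<And>j. V (k + j) = V k"
    proof -
      have ne: "range V \<noteq> {}" by simp
      have sub: "submodule X R M" if "X \<in> range V" for X using that sV by auto
      obtain X where X: "X \<in> range V" "\<forall>Y\<in>range V. X \<subseteq> Y \<longrightarrow> Y = X"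
        by (rule noeth_maximalE[OF N ne sub])
      then obtain k where "X = V k" by blast
      then have "V (k + j) = V k" for j using X(2) Vle by blast
      then show ?thesis by (rule that)
    qed
    \<comment> \<open>This is \<open>U + x^k M\<close>. If \<open>w = u + x^k z\<close> lies in
      \<open>W\<close>, then \<open>x^n w \<in> U\<close> puts \<open>z\<close> into
      \<open>V (k + n) = V k\<close>, whence \<open>w \<in> U\<close>. So \<open>K\<close> still
      meets \<open>W\<close> in \<open>W0\<close>, and maximality of \<open>U\<close> gives
      \<open>x^k M \<subseteq> U\<close>.\<close>
    define K where "K = {u \<oplus>\<^bsub>M\<^esub> x [^] k \<odot>\<^bsub>M\<^esub> y | u y. u \<in> U \<and> y \<in> carrier M}"
    have sK: "submodule K R M"
    proof (rule submoduleI)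
      show "K \<subseteq> carrier M" using Ud(1) x by (auto simp: K_def)
      have "\<zero>\<^bsub>M\<^esub> = \<zero>\<^bsub>M\<^esub> \<oplus>\<^bsub>M\<^esub> x [^] k \<odot>\<^bsub>M\<^esub> \<zero>\<^bsub>M\<^esub>" using x by simp
      then show "\<zero>\<^bsub>M\<^esub> \<in> K" using Ud(5) unfolding K_def by blast
      fix a assume "a \<in> K"
      then obtain u y where a: "a = u \<oplus>\<^bsub>M\<^esub> x [^] k \<odot>\<^bsub>M\<^esub> y" "u \<in> U" "y \<in> carrier M" by (auto simp: K_def)
      then have uc: "u \<in> carrier M" using Ud(1) by auto
      have "\<ominus>\<^bsub>M\<^esub> a = \<ominus>\<^bsub>M\<^esub> u \<oplus>\<^bsub>M\<^esub> x [^] k \<odot>\<^bsub>M\<^esub> (\<ominus>\<^bsub>M\<^esub> y)"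
        using a uc x by (simp add: M.minus_add smult_r_minus)
      then show "\<ominus>\<^bsub>M\<^esub> a \<in> K" using a Ud(2) unfolding K_def by blast
      { fix b assume "b \<in> K"
        then obtain v z where b: "b = v \<oplus>\<^bsub>M\<^esub> x [^] k \<odot>\<^bsub>M\<^esub> z" "v \<in> U" "z \<in> carrier M" by (auto simp: K_def)
        then have "v \<in> carrier M" using Ud(1) by auto
        then have "a \<oplus>\<^bsub>M\<^esub> b = (u \<oplus>\<^bsub>M\<^esub> v) \<oplus>\<^bsub>M\<^esub> x [^] k \<odot>\<^bsub>M\<^esub> (y \<oplus>\<^bsub>M\<^esub> z)"
          using a b uc x by (simp add: smult_r_distr M.a_ac)
        then show "a \<oplus>\<^bsub>M\<^esub> b \<in> K" using a b Ud(4) unfolding K_def by blast }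
      { fix c assume c: "c \<in> carrier R"
        have "c \<odot>\<^bsub>M\<^esub> a = c \<odot>\<^bsub>M\<^esub> u \<oplus>\<^bsub>M\<^esub> x [^] k \<odot>\<^bsub>M\<^esub> (c \<odot>\<^bsub>M\<^esub> y)"
          using a c uc x by (simp add: smult_r_distr smult_assoc1[symmetric] R.m_comm)
        then show "c \<odot>\<^bsub>M\<^esub> a \<in> K" using a c Ud(3) unfolding K_def by blast }
    qed
    have UK: "U \<subseteq> K"
    proof
      fix u assume u: "u \<in> U"
      then have "u = u \<oplus>\<^bsub>M\<^esub> x [^] k \<odot>\<^bsub>M\<^esub> \<zero>\<^bsub>M\<^esub>" using Ud(1) x by auto
      then show "u \<in> K" using u unfolding K_def by blast
    qed
    have "K \<inter> W \<subseteq> U"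
    proof
      fix w assume w: "w \<in> K \<inter> W"
      then obtain u z where uz: "w = u \<oplus>\<^bsub>M\<^esub> x [^] k \<odot>\<^bsub>M\<^esub> z" "u \<in> U" "z \<in> carrier M" by (auto simp: K_def)
      have uc: "u \<in> carrier M" using uz Ud(1) by auto
      have e: "x [^] n \<odot>\<^bsub>M\<^esub> w = x [^] n \<odot>\<^bsub>M\<^esub> u \<oplus>\<^bsub>M\<^esub> x [^] (k + n) \<odot>\<^bsub>M\<^esub> z"
        using uz uc x by (simp add: smult_r_distr smult_assoc1[symmetric] R.nat_pow_mult add.commute)
      have "x [^] n \<odot>\<^bsub>M\<^esub> w \<in> U" using n w UW by blast
      moreover have "x [^] n \<odot>\<^bsub>M\<^esub> u \<in> U" using uz x Ud by simp
      ultimately have "\<ominus>\<^bsub>M\<^esub> (x [^] n \<odot>\<^bsub>M\<^esub> u) \<oplus>\<^bsub>M\<^esub> x [^] n \<odot>\<^bsub>M\<^esub> w \<in> U" using Ud by simp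
      moreover have "\<ominus>\<^bsub>M\<^esub> (x [^] n \<odot>\<^bsub>M\<^esub> u) \<oplus>\<^bsub>M\<^esub> x [^] n \<odot>\<^bsub>M\<^esub> w = x [^] (k + n) \<odot>\<^bsub>M\<^esub> z"
        unfolding e using uc uz x by (intro M.r_neg1) auto
      ultimately have "z \<in> V (k + n)" using uz by (simp add: V_def)
      then have "x [^] k \<odot>\<^bsub>M\<^esub> z \<in> U" unfolding k by (simp add: V_def)
      then show "w \<in> U" using uz Ud by simp
    qed
    then have "K \<inter> W = W0" using UW UK by blast
    then have "K = U" using max UK sK by (simp add: F_def)
    moreover have "x [^] k \<odot>\<^bsub>M\<^esub> y \<in> K" if "y \<in> carrier M" for y
    proof -
      have "x [^] k \<odot>\<^bsub>M\<^esub> y = \<zero>\<^bsub>M\<^esub> \<oplus>\<^bsub>M\<^esub> x [^] k \<odot>\<^bsub>M\<^esub> y" using x that by simp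
      then show ?thesis using Ud(5) that unfolding K_def by blast
    qed
    ultimately show ?thesis by blast
  qed
  then show ?thesis using that sU UW by blast
qed

text \<open>Serves Krull's theorem, with the whole ring or its maximal ideal for \<open>K\<close>,
  and over \<open>self_module\<close> the ideals \<open>J + R x\<close> of Cohen's argument.\<close>

lemma submodule_sum_ideal:
  assumes J: "submodule J R M" and K: "ideal K R" and y: "y \<in> carrier M"
  shows "submodule {s \<odot>\<^bsub>M\<^esub> y \<oplus>\<^bsub>M\<^esub> j | s j. s \<in> K \<and> j \<in> J} R M" (is "submodule ?W R M")
proof (rule submoduleI)
  interpret K: ideal K R by fact
  note Jd = submoduleD[OF J]
  show "?W \<subseteq> carrier M" using Jd(1) y by auto
  have "\<zero>\<^bsub>M\<^esub> = \<zero> \<odot>\<^bsub>M\<^esub> y \<oplus>\<^bsub>M\<^esub> \<zero>\<^bsub>M\<^esub>" using y by simp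
  then show "\<zero>\<^bsub>M\<^esub> \<in> ?W" using Jd(5) K.zero_closed by blast
  fix a assume "a \<in> ?W"
  then obtain s j where a: "a = s \<odot>\<^bsub>M\<^esub> y \<oplus>\<^bsub>M\<^esub> j" "s \<in> K" "j \<in> J" by blast
  have jc: "j \<in> carrier M" using a Jd(1) by auto
  have "\<ominus>\<^bsub>M\<^esub> a = (\<ominus> s) \<odot>\<^bsub>M\<^esub> y \<oplus>\<^bsub>M\<^esub> \<ominus>\<^bsub>M\<^esub> j"
    using a jc y by (simp add: M.minus_add smult_l_minus)
  then show "\<ominus>\<^bsub>M\<^esub> a \<in> ?W" using a Jd(2) K.a_inv_closed by blast
  { fix b assume "b \<in> ?W"
    then obtain t i where b: "b = t \<odot>\<^bsub>M\<^esub> y \<oplus>\<^bsub>M\<^esub> i" "t \<in> K" "i \<in> J" by blast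
    have "i \<in> carrier M" using b Jd(1) by auto
    then have "a \<oplus>\<^bsub>M\<^esub> b = (s \<oplus> t) \<odot>\<^bsub>M\<^esub> y \<oplus>\<^bsub>M\<^esub> (j \<oplus>\<^bsub>M\<^esub> i)"
      using a b jc y by (simp add: smult_l_distr M.a_ac)
    then show "a \<oplus>\<^bsub>M\<^esub> b \<in> ?W" using a b Jd(4) K.a_closed by blast }
  { fix c assume c: "c \<in> carrier R"
    have "c \<odot>\<^bsub>M\<^esub> a = (c \<otimes> s) \<odot>\<^bsub>M\<^esub> y \<oplus>\<^bsub>M\<^esub> (c \<odot>\<^bsub>M\<^esub> j)"
      using a c jc y by (simp add: smult_r_distr smult_assoc1)
    then show "c \<odot>\<^bsub>M\<^esub> a \<in> ?W" using a c Jd(3) K.I_l_closed by blast }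
qed

text \<open>Weak Artin-Rees for \<open>J + m y\<close> inside \<open>J + R y\<close>. These differ
  at \<open>y\<close>: if \<open>y = s y + j\<close> with \<open>s\<close> in the maximal ideal,
  then \<open>1 - s\<close> is a unit and \<open>y \<in> J\<close>. The intersection theorem takes
  the form of a submodule \<open>U\<close> that separates \<open>y\<close> from \<open>J\<close> and
  for which each element of the maximal ideal acts nilpotently on \<open>M / U\<close>; powers of
  ideals do not occur.\<close>

theorem Krull_intersection:
  assumes L: "local_ring R" and N: noeth_module and J: "submodule J R M" and y: "y \<in> carrier M" "y \<notin> J"
  obtains U where "submodule U R M" "J \<subseteq> U" "y \<notin> U"
    "\<And>x. x \<in> max_ideal R \<Longrightarrow> \<exists>k::nat. \<forall>z\<in>carrier M. x [^] k \<odot>\<^bsub>M\<^esub> z \<in> U"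
proof -
  let ?m = "max_ideal R"
  interpret m: maximalideal ?m R by (rule local_ring_maximalideal[OF L])
  note Jd = submoduleD[OF J]
  define W where "W K = {s \<odot>\<^bsub>M\<^esub> y \<oplus>\<^bsub>M\<^esub> j | s j. s \<in> K \<and> j \<in> J}" for K
  have sW: "submodule (W (carrier R)) R M" "submodule (W ?m) R M"
    unfolding W_def using submodule_sum_ideal[OF J _ y(1)] R.oneideal m.is_ideal by auto
  have sub: "W ?m \<subseteq> W (carrier R)" unfolding W_def using m.Icarr by blast
  have nil: "\<exists>n::nat. \<forall>w\<in>W (carrier R). x [^] n \<odot>\<^bsub>M\<^esub> w \<in> W ?m" if x: "x \<in> ?m" for x
  proof (intro exI[of _ 1] ballI)
    fix w assume "w \<in> W (carrier R)"
    then obtain s j where w: "w = s \<odot>\<^bsub>M\<^esub> y \<oplus>\<^bsub>M\<^esub> j" "s \<in> carrier R" "j \<in> J" by (auto simp: W_def)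
    have "j \<in> carrier M" using w Jd(1) by auto
    then have "x [^] (1::nat) \<odot>\<^bsub>M\<^esub> w = (x \<otimes> s) \<odot>\<^bsub>M\<^esub> y \<oplus>\<^bsub>M\<^esub> x \<odot>\<^bsub>M\<^esub> j"
      using w y x m.Icarr[OF x] by (simp add: smult_r_distr smult_assoc1)
    then show "x [^] (1::nat) \<odot>\<^bsub>M\<^esub> w \<in> W ?m"
      using w Jd(3) m.I_r_closed[OF x] m.Icarr[OF x] unfolding W_def by blast
  qed
  obtain U where U: "submodule U R M" "U \<inter> W (carrier R) = W ?m"
    "\<And>x. x \<in> ?m \<Longrightarrow> \<exists>k::nat. \<forall>z\<in>carrier M. x [^] k \<odot>\<^bsub>M\<^esub> z \<in> U"
    by (rule weak_Artin_Rees[OF N sW sub _ nil]) (auto dest: m.Icarr)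
  have JW: "J \<subseteq> W ?m"
  proof
    fix j assume j: "j \<in> J"
    then have "j = \<zero> \<odot>\<^bsub>M\<^esub> y \<oplus>\<^bsub>M\<^esub> j" using y Jd(1) by auto
    then show "j \<in> W ?m" unfolding W_def using j m.zero_closed by blast
  qed
  have yW: "y \<in> W (carrier R)"
  proof -
    have "y = \<one> \<odot>\<^bsub>M\<^esub> y \<oplus>\<^bsub>M\<^esub> \<zero>\<^bsub>M\<^esub>" using y by simp
    then show ?thesis unfolding W_def using Jd(5) by blast
  qed
  have "y \<notin> W ?m"
  proof
    assume "y \<in> W ?m"
    then obtain s j where sj: "y = s \<odot>\<^bsub>M\<^esub> y \<oplus>\<^bsub>M\<^esub> j" "s \<in> ?m" "j \<in> J" by (auto simp: W_def)
    have c: "s \<in> carrier R" "j \<in> carrier M" using sj m.Icarr Jd(1) by auto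
    have "\<one> \<ominus> s \<notin> ?m"
    proof
      assume "\<one> \<ominus> s \<in> ?m"
      then have "(\<one> \<ominus> s) \<oplus> s \<in> ?m" using sj by simp
      moreover have "(\<one> \<ominus> s) \<oplus> s = \<one>" using c by algebra
      ultimately show False using local_ring_one_notin[OF L] by simp
    qed
    then have u: "\<one> \<ominus> s \<in> Units R" using c local_ring_Units_iff[OF L] by simp
    have "(\<one> \<ominus> s) \<odot>\<^bsub>M\<^esub> y = y \<oplus>\<^bsub>M\<^esub> \<ominus>\<^bsub>M\<^esub> (s \<odot>\<^bsub>M\<^esub> y)"
      using c y by (simp add: R.minus_eq smult_l_distr smult_l_minus)
    also have "\<dots> = j" using sj(1) c y by (metis M.a_comm M.add.inv_solve_right smult_closed)
    finally have "inv (\<one> \<ominus> s) \<odot>\<^bsub>M\<^esub> ((\<one> \<ominus> s) \<odot>\<^bsub>M\<^esub> y) \<in> J" using sj Jd(3) u by simp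
    then have "y \<in> J" using u c y by (simp add: smult_assoc1[symmetric])
    then show False using y by simp
  qed
  then show ?thesis using that U JW yW by blast
qed

end

section \<open>A ring as a module over its subrings\<close>

lemma self_module_simps [simp]:
  "carrier (self_module A) = carrier A" "x \<oplus>\<^bsub>self_module A\<^esub> y = x \<oplus>\<^bsub>A\<^esub> y"
  "\<zero>\<^bsub>self_module A\<^esub> = \<zero>\<^bsub>A\<^esub>" "a \<odot>\<^bsub>self_module A\<^esub> x = a \<otimes>\<^bsub>A\<^esub> x"
  by (simp_all add: self_module_def)

lemma a_inv_self_module [simp]: "\<ominus>\<^bsub>self_module A\<^esub> x = \<ominus>\<^bsub>A\<^esub> x"
  by (simp add: self_module_def a_inv_def m_inv_def)

text \<open>Makes \<open>H\<close> a module over a subring \<open>S\<close>, so that adjoining a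
  root \<open>a\<close> to \<open>S\<close> can be described by the span of the powers of
  \<open>a\<close>.\<close>

lemma (in cring) self_module_over_subring:
  assumes S: "subring S R" shows "module (R\<lparr>carrier := S\<rparr>) (self_module R)"
proof (rule moduleI)
  show "cring (R\<lparr>carrier := S\<rparr>)" by (rule subring_is_cring[OF S])
  show "abelian_group (self_module R)"
    by (rule abelian_groupI) (auto simp: a_ac intro: l_neg)
  show "(a \<oplus>\<^bsub>R\<lparr>carrier := S\<rparr>\<^esub> b) \<odot>\<^bsub>self_module R\<^esub> x = a \<odot>\<^bsub>self_module R\<^esub> x \<oplus>\<^bsub>self_module R\<^esub> b \<odot>\<^bsub>self_module R\<^esub> x"
    if "a \<in> carrier (R\<lparr>carrier := S\<rparr>)" "b \<in> carrier (R\<lparr>carrier := S\<rparr>)" "x \<in> carrier (self_module R)" for a b x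
    using that subringE(1)[OF S] by (auto simp: l_distr subset_iff)
qed (use subringE(1)[OF S] in \<open>auto simp: r_distr m_assoc subset_iff\<close>)

lemma (in cring) self_module: "module R (self_module R)"
  using self_module_over_subring[OF carrier_is_subring] by simp

lemma (in cring) submodule_self_module_iff:
  "submodule I R (self_module R) \<longleftrightarrow> ideal I R"
proof
  interpret M: module R "self_module R" by (rule self_module)
  assume "submodule I R (self_module R)"
  note d = M.submoduleD[OF this]
  show "ideal I R"
  proof (rule idealI[OF ring_axioms])
    show "subgroup I (add_monoid R)"
      using d by (intro add.subgroupI) (auto simp flip: a_inv_def)
    show "x \<otimes> a \<in> I" "a \<otimes> x \<in> I" if "a \<in> I" "x \<in> carrier R" for a x
      using d(1) d(3)[of x a] that by (auto simp: m_comm)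
  qed
next
  interpret M: module R "self_module R" by (rule self_module)
  assume "ideal I R"
  then interpret I: ideal I R .
  show "submodule I R (self_module R)"
    by (rule M.submoduleI) (use I.a_subset I.zero_closed I.a_inv_closed I.I_l_closed in auto)
qed

lemma (in cring) noeth_self_module:
  assumes "noetherian_ring R" shows "module.noeth_module R (self_module R)"
proof -
  interpret M: module R "self_module R" by (rule self_module)
  show ?thesis
  proof (rule M.noeth_moduleI[OF assms, of "{\<one>}"])
    show "carrier (self_module R) \<subseteq> mspan R (self_module R) {\<one>}"
    proof
      fix x assume "x \<in> carrier (self_module R)"
      then show "x \<in> mspan R (self_module R) {\<one>}"
        using mspan_step[of x R \<one> "{\<one>}" "\<zero>" "self_module R"] mspan_zero[of "self_module R" R "{\<one>}"] by simp
    qed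
  qed auto
qed

text \<open>Restates the closure of an ideal in a restricted record through the operations of
  \<open>R\<close>, because \<open>\<ominus>\<close> of the record is a different term.\<close>

lemma (in cring) subring_ideal_props:
  assumes S: "subring S R" and I: "ideal I (R\<lparr>carrier := S\<rparr>)"
  shows "I \<subseteq> S" "\<zero> \<in> I" "\<And>x y. x \<in> I \<Longrightarrow> y \<in> I \<Longrightarrow> x \<oplus> y \<in> I" "\<And>x. x \<in> I \<Longrightarrow> \<ominus> x \<in> I"
    "\<And>x s. x \<in> I \<Longrightarrow> s \<in> S \<Longrightarrow> s \<otimes> x \<in> I" "\<And>x s. x \<in> I \<Longrightarrow> s \<in> S \<Longrightarrow> x \<otimes> s \<in> I"
    "\<And>x y. x \<in> I \<Longrightarrow> y \<in> I \<Longrightarrow> x \<ominus> y \<in> I"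
proof -
  interpret I: ideal I "R\<lparr>carrier := S\<rparr>" by fact
  show 1: "I \<subseteq> S" using I.a_subset by simp
  show "\<zero> \<in> I" using additive_subgroup.zero_closed[OF I.is_additive_subgroup] by simp
  show 2: "x \<oplus> y \<in> I" if "x \<in> I" "y \<in> I" for x y using additive_subgroup.a_closed[OF I.is_additive_subgroup that] by simp
  show 3: "\<ominus> x \<in> I" if "x \<in> I" for x
    using additive_subgroup.a_inv_closed[OF I.is_additive_subgroup that]
    unfolding subring_a_inv[OF S subsetD[OF 1 that]] .
  show "s \<otimes> x \<in> I" "x \<otimes> s \<in> I" if "x \<in> I" "s \<in> S" for x s
    using I.I_l_closed[OF that(1)] I.I_r_closed[OF that(1)] that by auto
  show "x \<ominus> y \<in> I" if "x \<in> I" "y \<in> I" for x y using 2 3 that by (simp add: a_minus_def)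
qed

text \<open>The larger ideal, contracted to \<open>S\<close>, is an ideal of the smaller ring that
  contains \<open>X\<close>.\<close>

lemma (in cring) subring_genideal_subset:
  assumes "subring S R" "subring S' R" "S \<subseteq> S'" "X \<subseteq> S"
  shows "Idl\<^bsub>R\<lparr>carrier := S\<rparr>\<^esub> X \<subseteq> Idl\<^bsub>R\<lparr>carrier := S'\<rparr>\<^esub> X"
proof -
  interpret S: cring "R\<lparr>carrier := S\<rparr>" by (rule subring_is_cring[OF assms(1)])
  interpret S': cring "R\<lparr>carrier := S'\<rparr>" by (rule subring_is_cring[OF assms(2)])
  let ?I = "Idl\<^bsub>R\<lparr>carrier := S'\<rparr>\<^esub> X"
  have I: "ideal ?I (R\<lparr>carrier := S'\<rparr>)" using assms by (intro S'.genideal_ideal) auto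
  note p = subring_ideal_props[OF assms(2) I]
  have "ideal (S \<inter> ?I) (R\<lparr>carrier := S\<rparr>)"
  proof (rule idealI[OF S.ring_axioms])
    show "subgroup (S \<inter> ?I) (add_monoid (R\<lparr>carrier := S\<rparr>))"
    proof (rule S.add.subgroupI)
      show "\<ominus>\<^bsub>R\<lparr>carrier := S\<rparr>\<^esub> x \<in> S \<inter> ?I" if "x \<in> S \<inter> ?I" for x
        using that p(4) subringE(5)[OF assms(1)] by (simp add: subring_a_inv[OF assms(1)])
    qed (use p(2,3) subringE[OF assms(1)] in auto)
    show "x \<otimes>\<^bsub>R\<lparr>carrier := S\<rparr>\<^esub> a \<in> S \<inter> ?I" "a \<otimes>\<^bsub>R\<lparr>carrier := S\<rparr>\<^esub> x \<in> S \<inter> ?I"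
      if "a \<in> S \<inter> ?I" "x \<in> carrier (R\<lparr>carrier := S\<rparr>)" for a x
      using that p(5,6) assms(3) subringE(6)[OF assms(1)] by auto
  qed
  moreover have "X \<subseteq> S \<inter> ?I" using S'.genideal_self[of X] assms by auto
  ultimately have "Idl\<^bsub>R\<lparr>carrier := S\<rparr>\<^esub> X \<subseteq> S \<inter> ?I" by (rule S.genideal_minimal)
  then show ?thesis by blast
qed

section \<open>Approximation of the Henselization by \<open>R\<close> modulo primary ideals\<close>

context henselization begin

lemma \<phi>_mem_iff: "r \<in> carrier R \<Longrightarrow> \<phi> r \<in> mH \<longleftrightarrow> r \<in> mR"
  by (rule local_hom_mem_iff[OF local_R local_H local_\<phi>])

lemma Units_H_iff: "x \<in> carrier H \<Longrightarrow> x \<in> Units H \<longleftrightarrow> x \<notin> mH"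
  by (rule local_ring_Units_iff[OF local_H])

lemmas mH_closed = additive_subgroup.a_closed[OF mH.is_additive_subgroup]
  additive_subgroup.a_inv_closed[OF mH.is_additive_subgroup]
  additive_subgroup.zero_closed[OF mH.is_additive_subgroup]

lemma Units_cong:
  assumes "x \<in> carrier H" "y \<in> carrier H" "x \<ominus>\<^bsub>H\<^esub> y \<in> mH"
  shows "x \<in> mH \<longleftrightarrow> y \<in> mH"
proof -
  have "y = x \<ominus>\<^bsub>H\<^esub> (x \<ominus>\<^bsub>H\<^esub> y)" "x = (x \<ominus>\<^bsub>H\<^esub> y) \<oplus>\<^bsub>H\<^esub> y" using assms by algebra+
  then show ?thesis using assms(3) mH_closed unfolding a_minus_def by metis
qed

lemma minus_mH_trans:
  assumes "x \<in> carrier H" "y \<in> carrier H" "z \<in> carrier H" "x \<ominus>\<^bsub>H\<^esub> y \<in> mH" "z \<ominus>\<^bsub>H\<^esub> y \<in> mH"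
  shows "x \<ominus>\<^bsub>H\<^esub> z \<in> mH"
proof -
  have "x \<ominus>\<^bsub>H\<^esub> z = (x \<ominus>\<^bsub>H\<^esub> y) \<oplus>\<^bsub>H\<^esub> \<ominus>\<^bsub>H\<^esub> (z \<ominus>\<^bsub>H\<^esub> y)" using assms(1-3) by algebra
  then show ?thesis using assms(4,5) mH_closed by simp
qed

text \<open>The subrings over which the inductions run: by \<open>local_subring\<close> they are
  local, and their inclusion into \<open>H\<close> is a local homomorphism.\<close>

definition inv_closed :: "'b set \<Rightarrow> bool" where
  "inv_closed S \<longleftrightarrow> subring S H \<and> \<phi> ` carrier R \<subseteq> S \<and> (\<forall>x\<in>S. x \<in> Units H \<longrightarrow> inv\<^bsub>H\<^esub> x \<in> S)"

lemma inv_closedD: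
  assumes "inv_closed S"
  shows "subring S H" "\<phi> ` carrier R \<subseteq> S" "\<And>x. x \<in> S \<Longrightarrow> x \<in> Units H \<Longrightarrow> inv\<^bsub>H\<^esub> x \<in> S"
    "S \<subseteq> carrier H" "\<And>r. r \<in> carrier R \<Longrightarrow> \<phi> r \<in> S"
  using assms subringE(1) by (auto simp: inv_closed_def)

definition ext :: "'b set \<Rightarrow> 'a set \<Rightarrow> 'b set" where
  "ext S q = Idl\<^bsub>H\<lparr>carrier := S\<rparr>\<^esub> (\<phi> ` q)"

text \<open>The sum \<open>\<phi> R + q S\<close>.\<close>

definition approx :: "'b set \<Rightarrow> 'a set \<Rightarrow> 'b set" where
  "approx S q = {\<phi> r \<oplus>\<^bsub>H\<^esub> y | r y. r \<in> carrier R \<and> y \<in> ext S q}"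

text \<open>The roots range over a parameter \<open>B\<close>, since \<open>approx B q\<close> can
  contain only roots that lie in \<open>B\<close>. With \<open>B\<close> the whole of
  \<open>H\<close> this is the hypothesis of \<open>generation\<close>.\<close>

definition root_closed :: "'b set \<Rightarrow> 'b set \<Rightarrow> bool" where
  "root_closed B T \<longleftrightarrow> (\<forall>f a t. set f \<subseteq> T \<and> a \<in> B \<and> t \<in> T \<and> a \<ominus>\<^bsub>H\<^esub> t \<in> mH \<and>
      pev H (f @ [\<one>\<^bsub>H\<^esub>]) a = \<zero>\<^bsub>H\<^esub> \<and> pdd H (f @ [\<one>\<^bsub>H\<^esub>]) a a \<notin> mH \<longrightarrow> a \<in> T)"

lemma root_closedD:
  "root_closed B T \<Longrightarrow> set f \<subseteq> T \<Longrightarrow> a \<in> B \<Longrightarrow> t \<in> T \<Longrightarrow> a \<ominus>\<^bsub>H\<^esub> t \<in> mH \<Longrightarrow>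
   pev H (f @ [\<one>\<^bsub>H\<^esub>]) a = \<zero>\<^bsub>H\<^esub> \<Longrightarrow> pdd H (f @ [\<one>\<^bsub>H\<^esub>]) a a \<notin> mH \<Longrightarrow> a \<in> T"
  unfolding root_closed_def by blast

lemma generation': "inv_closed T \<Longrightarrow> root_closed (carrier H) T \<Longrightarrow> T = carrier H"
  by (rule generation) (auto dest: inv_closedD root_closedD)

lemma ext_ideal:
  assumes "inv_closed S" "q \<subseteq> carrier R"
  shows "ideal (ext S q) (H\<lparr>carrier := S\<rparr>)" "\<phi> ` q \<subseteq> ext S q"
proof -
  interpret S: cring "H\<lparr>carrier := S\<rparr>" by (rule H.subring_is_cring[OF inv_closedD(1)[OF assms(1)]])
  have "\<phi> ` q \<subseteq> S" using inv_closedD(2)[OF assms(1)] assms(2) by blast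
  then show "ideal (ext S q) (H\<lparr>carrier := S\<rparr>)" "\<phi> ` q \<subseteq> ext S q"
    using S.genideal_ideal[of "\<phi> ` q"] S.genideal_self[of "\<phi> ` q"] unfolding ext_def by simp_all
qed

lemma ext_subset_mH:
  assumes S: "inv_closed S" and q: "q \<subseteq> mR"
  shows "ext S q \<subseteq> mH"
proof -
  have "q \<subseteq> carrier R" using q mR.Icarr by blast
  have "ext S q \<subseteq> Idl\<^bsub>H\<lparr>carrier := carrier H\<rparr>\<^esub> (\<phi> ` q)"
    unfolding ext_def using q mR.Icarr inv_closedD[OF S]
    by (intro H.subring_genideal_subset H.carrier_is_subring) auto
  also have "\<dots> \<subseteq> mH"
  proof -
    have "\<phi> ` q \<subseteq> mH" using q \<phi>_mem_iff mR.Icarr by blast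
    then show ?thesis using H.genideal_minimal[OF mH.is_ideal] by simp
  qed
  finally show ?thesis .
qed

lemma primary_subset:
  assumes q: "q \<in> primary_ideals R" "q \<noteq> carrier R" shows "q \<subseteq> mR"
proof
  interpret q: ideal q R using q by (simp add: primary_ideals_def)
  fix x assume x: "x \<in> q"
  have "x \<notin> Units R"
  proof
    assume "x \<in> Units R"
    then have "inv\<^bsub>R\<^esub> x \<otimes>\<^bsub>R\<^esub> x \<in> q" using x by (intro q.I_l_closed) auto
    then show False using \<open>x \<in> Units R\<close> q(2) q.one_imp_carrier by simp
  qed
  then show "x \<in> mR" using local_ring_Units_iff[OF local_R q.Icarr[OF x]] by blast
qed

lemma approx_inv_closed:
  assumes B: "inv_closed B" and q: "q \<in> primary_ideals R"
  shows "inv_closed (approx B q)" "approx B q \<subseteq> B"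
proof -
  have qR: "q \<subseteq> carrier R" using q by (auto simp: primary_ideals_def ideal.Icarr)
  note Bd = inv_closedD[OF B] and p = H.subring_ideal_props[OF inv_closedD(1)[OF B] ext_ideal(1)[OF B qR]]
  note sB = subringE[OF Bd(1)]
  let ?I = "ext B q" and ?T = "approx B q"
  have TI: "\<phi> r \<oplus>\<^bsub>H\<^esub> y \<in> ?T" if "r \<in> carrier R" "y \<in> ?I" for r y using that by (auto simp: approx_def)
  have Ic: "y \<in> carrier H" if "y \<in> ?I" for y using that p(1) Bd(4) by blast
  show TB: "?T \<subseteq> B" using p(1) Bd(5) sB(7) by (auto simp: approx_def)
  have \<phi>T: "\<phi> r \<in> ?T" if "r \<in> carrier R" for r
  proof -
    have "\<phi> r = \<phi> r \<oplus>\<^bsub>H\<^esub> \<zero>\<^bsub>H\<^esub>" using that by simp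
    then show ?thesis using TI[OF that p(2)] by simp
  qed
  have sub: "subring ?T H"
  proof (rule H.subringI)
    show "?T \<subseteq> carrier H" using TB Bd(4) by blast
    show "\<one>\<^bsub>H\<^esub> \<in> ?T" using \<phi>T[of "\<one>\<^bsub>R\<^esub>"] by simp
    fix x assume "x \<in> ?T"
    then obtain r y where x: "x = \<phi> r \<oplus>\<^bsub>H\<^esub> y" "r \<in> carrier R" "y \<in> ?I" by (auto simp: approx_def)
    have "\<ominus>\<^bsub>H\<^esub> x = \<phi> (\<ominus>\<^bsub>R\<^esub> r) \<oplus>\<^bsub>H\<^esub> \<ominus>\<^bsub>H\<^esub> y" using x Ic by (simp add: H.minus_add)
    then show "\<ominus>\<^bsub>H\<^esub> x \<in> ?T" using TI[of "\<ominus>\<^bsub>R\<^esub> r" "\<ominus>\<^bsub>H\<^esub> y"] x p(4) by simp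
    fix x' assume "x' \<in> ?T"
    then obtain r' y' where x': "x' = \<phi> r' \<oplus>\<^bsub>H\<^esub> y'" "r' \<in> carrier R" "y' \<in> ?I" by (auto simp: approx_def)
    have c: "\<phi> r \<in> carrier H" "\<phi> r' \<in> carrier H" "y \<in> carrier H" "y' \<in> carrier H" using x x' Ic by auto
    have "x \<otimes>\<^bsub>H\<^esub> x' = \<phi> (r \<otimes>\<^bsub>R\<^esub> r') \<oplus>\<^bsub>H\<^esub> (\<phi> r \<otimes>\<^bsub>H\<^esub> y' \<oplus>\<^bsub>H\<^esub> (y \<otimes>\<^bsub>H\<^esub> \<phi> r' \<oplus>\<^bsub>H\<^esub> y \<otimes>\<^bsub>H\<^esub> y'))"
      using x(2) x'(2) unfolding x(1) x'(1) \<phi>.hom_mult[OF x(2) x'(2)] using c by algebra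
    moreover have "\<phi> r \<otimes>\<^bsub>H\<^esub> y' \<oplus>\<^bsub>H\<^esub> (y \<otimes>\<^bsub>H\<^esub> \<phi> r' \<oplus>\<^bsub>H\<^esub> y \<otimes>\<^bsub>H\<^esub> y') \<in> ?I"
      using x x' p Bd(5) by (meson subsetD)
    ultimately show "x \<otimes>\<^bsub>H\<^esub> x' \<in> ?T" using TI[OF R.m_closed[OF x(2) x'(2)]] by metis
    have "x \<oplus>\<^bsub>H\<^esub> x' = \<phi> (r \<oplus>\<^bsub>R\<^esub> r') \<oplus>\<^bsub>H\<^esub> (y \<oplus>\<^bsub>H\<^esub> y')"
      unfolding x(1) x'(1) \<phi>.hom_add[OF x(2) x'(2)] using c by algebra
    then show "x \<oplus>\<^bsub>H\<^esub> x' \<in> ?T" using TI[OF R.a_closed[OF x(2) x'(2)] p(3)[OF x(3) x'(3)]] by metis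
  qed
  have inv: "inv\<^bsub>H\<^esub> x \<in> ?T" if xT: "x \<in> ?T" and u: "x \<in> Units H" for x
  \<comment> \<open>For improper \<open>q\<close> the ideal is all of \<open>B\<close>. In the other
    case the argument relies on \<open>y \<in> mH\<close>, which makes \<open>r\<close> a unit of
    \<open>R\<close>.\<close>
  proof (cases "q = carrier R")
    case True
    have "\<phi> \<one>\<^bsub>R\<^esub> \<in> ?I" using ext_ideal(2)[OF B qR] True by blast
    then have "B \<subseteq> ?I" using p(5)[of "\<one>\<^bsub>H\<^esub>"] Bd(4) by (metis H.r_one \<phi>.hom_one subset_iff)
    then have "inv\<^bsub>H\<^esub> x \<in> ?I" using Bd(3) xT TB u by blast
    then have "\<phi> \<zero>\<^bsub>R\<^esub> \<oplus>\<^bsub>H\<^esub> inv\<^bsub>H\<^esub> x \<in> ?T" by (intro TI) auto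
    then show ?thesis using u by simp
  next
    case False
    obtain r y where x: "x = \<phi> r \<oplus>\<^bsub>H\<^esub> y" "r \<in> carrier R" "y \<in> ?I" using xT by (auto simp: approx_def)
    have ym: "y \<in> mH" using ext_subset_mH[OF B primary_subset[OF q False]] x by blast
    have "\<phi> r \<notin> mH"
    proof
      assume "\<phi> r \<in> mH"
      then have "x \<in> mH" using x ym by simp
      then show False using u Units_H_iff by blast
    qed
    then have ur: "r \<in> Units R" using \<phi>_mem_iff x local_ring_Units_iff[OF local_R] by blast
    define s where "s = inv\<^bsub>R\<^esub> r"
    have s: "s \<in> carrier R" "\<phi> r \<otimes>\<^bsub>H\<^esub> \<phi> s = \<one>\<^bsub>H\<^esub>"
      using ur \<phi>.hom_mult[of r s] by (auto simp: s_def)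
    define i where "i = inv\<^bsub>H\<^esub> x"
    have i: "i \<in> carrier H" "x \<otimes>\<^bsub>H\<^esub> i = \<one>\<^bsub>H\<^esub>" "i \<in> B" using u Bd(3) xT TB by (auto simp: i_def)
    have c: "\<phi> r \<in> carrier H" "\<phi> s \<in> carrier H" "y \<in> carrier H" using x s Ic by auto
    \<comment> \<open>The inverse of \<open>\<phi> r + y\<close> is
      \<open>\<phi> s - i \<phi> s y\<close>, again an element of \<open>\<phi> R\<close> plus one
      of the ideal.\<close>
    have "i = \<phi> s \<oplus>\<^bsub>H\<^esub> ((\<phi> r \<otimes>\<^bsub>H\<^esub> \<phi> s) \<otimes>\<^bsub>H\<^esub> i \<ominus>\<^bsub>H\<^esub> \<phi> s \<otimes>\<^bsub>H\<^esub> (x \<otimes>\<^bsub>H\<^esub> i))"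
      unfolding s(2) i(2) using i(1) c by algebra
    also have "(\<phi> r \<otimes>\<^bsub>H\<^esub> \<phi> s) \<otimes>\<^bsub>H\<^esub> i \<ominus>\<^bsub>H\<^esub> \<phi> s \<otimes>\<^bsub>H\<^esub> (x \<otimes>\<^bsub>H\<^esub> i) = (\<ominus>\<^bsub>H\<^esub> (i \<otimes>\<^bsub>H\<^esub> \<phi> s)) \<otimes>\<^bsub>H\<^esub> y"
      unfolding x(1) using i(1) c by algebra
    finally have e: "i = \<phi> s \<oplus>\<^bsub>H\<^esub> (\<ominus>\<^bsub>H\<^esub> (i \<otimes>\<^bsub>H\<^esub> \<phi> s)) \<otimes>\<^bsub>H\<^esub> y" .
    have "(\<ominus>\<^bsub>H\<^esub> (i \<otimes>\<^bsub>H\<^esub> \<phi> s)) \<otimes>\<^bsub>H\<^esub> y \<in> ?I" using i(3) Bd(5)[OF s(1)] sB x(3) by (intro p(5)) auto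
    then have "\<phi> s \<oplus>\<^bsub>H\<^esub> (\<ominus>\<^bsub>H\<^esub> (i \<otimes>\<^bsub>H\<^esub> \<phi> s)) \<otimes>\<^bsub>H\<^esub> y \<in> ?T" by (rule TI[OF s(1)])
    then show ?thesis using e unfolding i_def by simp
  qed
  show "inv_closed ?T" unfolding inv_closed_def using sub \<phi>T inv by blast
qed

text \<open>The value \<open>f(t)\<close> is nilpotent modulo \<open>q B\<close>, so Newton's
  iteration finds an \<open>a'\<close> in \<open>approx B q\<close> with
  \<open>f(a') \<in> q B\<close>. Since \<open>f(a')\<close> is \<open>a' - a\<close> times a unit
  of \<open>B\<close>, the root \<open>a\<close> differs from \<open>a'\<close> by an element of
  \<open>q B\<close>.\<close>

lemma approx_root_closed:
  assumes B: "inv_closed B" and q: "q \<in> primary_ideals R"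
  shows "root_closed B (approx B q)"
  unfolding root_closed_def
proof (intro allI impI, elim conjE)
  fix f a t
  let ?I = "ext B q" and ?T = "approx B q" and ?f = "f @ [\<one>\<^bsub>H\<^esub>]"
  assume f: "set f \<subseteq> ?T" and a: "a \<in> B" and t: "t \<in> ?T" and at: "a \<ominus>\<^bsub>H\<^esub> t \<in> mH"
    and fa: "pev H ?f a = \<zero>\<^bsub>H\<^esub>" and da: "pdd H ?f a a \<notin> mH"
  note T = approx_inv_closed[OF B q]
  note Td = inv_closedD[OF T(1)] and Bd = inv_closedD[OF B]
  have qR: "q \<subseteq> carrier R" using q by (auto simp: primary_ideals_def ideal.Icarr)
  interpret qi: ideal q R using q by (simp add: primary_ideals_def)
  note p = H.subring_ideal_props[OF Bd(1) ext_ideal(1)[OF B qR]]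
  have ac: "a \<in> carrier H" and tc: "t \<in> carrier H" using a t Bd(4) Td(4) by auto
  have fT: "set ?f \<subseteq> ?T" using f subringE(3)[OF Td(1)] by simp
  then have fc: "set ?f \<subseteq> carrier H" and fB: "set ?f \<subseteq> B" using Td(4) T(2) by auto
  have "pdd H ?f a a \<ominus>\<^bsub>H\<^esub> pdd H ?f t t \<in> mH" using ac tc at fc by (intro H.pdd_cong mH.is_ideal) auto
  note dat = this
  have pc: "pdd H ?f a a \<in> carrier H" "pdd H ?f t t \<in> carrier H" "pev H ?f a \<in> carrier H" "pev H ?f t \<in> carrier H"
    by (rule H.pdd_closed[OF fc ac ac] H.pdd_closed[OF fc tc tc] H.pev_closed[OF fc ac] H.pev_closed[OF fc tc])+
  have dt: "pdd H ?f t t \<notin> mH" using da Units_cong[OF pc(1,2) dat] by simp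
  have dtT: "pdd H ?f t t \<in> ?T" using H.pdd_in_subring[OF Td(1) fT t t] .
  define w where "w = inv\<^bsub>H\<^esub> (pdd H ?f t t)"
  have du: "pdd H ?f t t \<in> Units H" using dt Units_H_iff[OF pc(2)] by simp
  then have w: "w \<in> ?T" "pdd H ?f t t \<otimes>\<^bsub>H\<^esub> w = \<one>\<^bsub>H\<^esub>" using Td(3)[OF dtT] by (auto simp: w_def)
  define y where "y = pev H ?f t"
  have yT: "y \<in> ?T" unfolding y_def by (rule H.pev_in_subring[OF Td(1) fT t])
  have "pev H ?f a \<ominus>\<^bsub>H\<^esub> pev H ?f t \<in> mH" using ac tc at fc by (intro H.pev_cong mH.is_ideal) auto
  then have ym: "y \<in> mH" using fa Units_cong[OF pc(3,4)] mH_closed(3) by (simp add: y_def)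
  obtain r z where rz: "y = \<phi> r \<oplus>\<^bsub>H\<^esub> z" "r \<in> carrier R" "z \<in> ?I" using yT by (auto simp: approx_def)
  \<comment> \<open>Modulo the ideal, \<open>y\<close> is \<open>\<phi> r\<close>. As
    \<open>y\<close> lies in \<open>mH\<close>, \<open>r\<close> lies in \<open>mR\<close>, and a
    power of \<open>r\<close> lies in \<open>q\<close>.\<close>
  have "\<exists>k::nat. y [^]\<^bsub>H\<^esub> k \<in> ?I"
  proof (cases "q = carrier R")
    case True
    then have "\<phi> \<one>\<^bsub>R\<^esub> \<in> ?I" using ext_ideal(2)[OF B qR] by blast
    then show ?thesis by (intro exI[of _ 0]) simp
  next
    case False
    have "z \<in> mH" using ext_subset_mH[OF B primary_subset[OF q False]] rz by blast
    then have "\<phi> r \<ominus>\<^bsub>H\<^esub> y \<in> mH"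
    proof -
      have "\<phi> r \<ominus>\<^bsub>H\<^esub> y = \<ominus>\<^bsub>H\<^esub> z" unfolding rz(1) using \<phi>.hom_closed[OF rz(2)] mH.Icarr[OF \<open>z \<in> mH\<close>] by algebra
      then show ?thesis using \<open>z \<in> mH\<close> by simp
    qed
    then have "r \<in> mR" using ym Units_cong[OF \<phi>.hom_closed[OF rz(2)] mH.Icarr[OF ym]] \<phi>_mem_iff[OF rz(2)] by blast
    then obtain k :: nat where k: "r [^]\<^bsub>R\<^esub> k \<in> q" using q unfolding primary_ideals_def by blast
    have "\<exists>u\<in>?I. y [^]\<^bsub>H\<^esub> j = \<phi> (r [^]\<^bsub>R\<^esub> j) \<oplus>\<^bsub>H\<^esub> u" for j :: nat
    proof (induct j)
      case 0 show ?case using p(2) by (intro bexI[of _ "\<zero>\<^bsub>H\<^esub>"]) auto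
    next
      case (Suc j)
      then obtain u where u: "u \<in> ?I" "y [^]\<^bsub>H\<^esub> j = \<phi> (r [^]\<^bsub>R\<^esub> j) \<oplus>\<^bsub>H\<^esub> u" by blast
      have c: "u \<in> carrier H" "z \<in> carrier H" "\<phi> r \<in> carrier H" "\<phi> (r [^]\<^bsub>R\<^esub> j) \<in> carrier H"
        using u rz p(1) Bd(4) by auto
      have "y [^]\<^bsub>H\<^esub> Suc j = (\<phi> (r [^]\<^bsub>R\<^esub> j) \<oplus>\<^bsub>H\<^esub> u) \<otimes>\<^bsub>H\<^esub> (\<phi> r \<oplus>\<^bsub>H\<^esub> z)" using u rz by simp
      also have "\<dots> = \<phi> (r [^]\<^bsub>R\<^esub> j) \<otimes>\<^bsub>H\<^esub> \<phi> r \<oplus>\<^bsub>H\<^esub> (\<phi> (r [^]\<^bsub>R\<^esub> j) \<otimes>\<^bsub>H\<^esub> z \<oplus>\<^bsub>H\<^esub> (u \<otimes>\<^bsub>H\<^esub> \<phi> r \<oplus>\<^bsub>H\<^esub> u \<otimes>\<^bsub>H\<^esub> z))"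
        using c by algebra
      also have "\<phi> (r [^]\<^bsub>R\<^esub> j) \<otimes>\<^bsub>H\<^esub> \<phi> r = \<phi> (r [^]\<^bsub>R\<^esub> Suc j)" using rz by simp
      finally have "y [^]\<^bsub>H\<^esub> Suc j = \<phi> (r [^]\<^bsub>R\<^esub> Suc j) \<oplus>\<^bsub>H\<^esub> (\<phi> (r [^]\<^bsub>R\<^esub> j) \<otimes>\<^bsub>H\<^esub> z \<oplus>\<^bsub>H\<^esub> (u \<otimes>\<^bsub>H\<^esub> \<phi> r \<oplus>\<^bsub>H\<^esub> u \<otimes>\<^bsub>H\<^esub> z))" .
      moreover have "\<phi> (r [^]\<^bsub>R\<^esub> j) \<otimes>\<^bsub>H\<^esub> z \<oplus>\<^bsub>H\<^esub> (u \<otimes>\<^bsub>H\<^esub> \<phi> r \<oplus>\<^bsub>H\<^esub> u \<otimes>\<^bsub>H\<^esub> z) \<in> ?I"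
        by (rule p(3)[OF p(5)[OF rz(3) Bd(5)[OF R.nat_pow_closed[OF rz(2)]]]
              p(3)[OF p(6)[OF u(1) Bd(5)[OF rz(2)]] p(6)[OF u(1) subsetD[OF p(1) rz(3)]]]])
      ultimately show ?case by blast
    qed
    then obtain u where "u \<in> ?I" "y [^]\<^bsub>H\<^esub> k = \<phi> (r [^]\<^bsub>R\<^esub> k) \<oplus>\<^bsub>H\<^esub> u" by blast
    then show ?thesis using p(3) ext_ideal(2)[OF B qR] k by (metis imageI subsetD)
  qed
  then obtain k :: nat where k: "y [^]\<^bsub>H\<^esub> k \<in> ?I" by blast
  \<comment> \<open>The iteration runs in the ring \<open>?T\<close> itself, so that the approximate
    root lies in \<open>?T\<close>; only its value is measured by the ideal of
    \<open>B\<close>.\<close>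
  let ?HT = "H\<lparr>carrier := ?T\<rparr>"
  have "cring ?HT" by (rule H.subring_is_cring[OF Td(1)])
  then obtain a' c c' where a': "a' \<in> ?T" "c \<in> ?T" "c' \<in> ?T"
    "pev H ?f a' = y [^]\<^bsub>H\<^esub> Suc k \<otimes>\<^bsub>H\<^esub> c" "a' \<ominus>\<^bsub>H\<^esub> t = y \<otimes>\<^bsub>H\<^esub> c'"
    using cring.Newton[of ?HT ?f t w k] fT t w by (auto simp: y_def H.subring_minus[OF Td(1)] nat_pow_def)
  have a'c: "a' \<in> carrier H" "c \<in> carrier H" "c' \<in> carrier H" "y \<in> carrier H" using a' Td(4) yT by auto
  have "pev H ?f a' = y [^]\<^bsub>H\<^esub> k \<otimes>\<^bsub>H\<^esub> (y \<otimes>\<^bsub>H\<^esub> c)" unfolding a'(4) using a'c by (simp add: H.m_assoc)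
  then have fa': "pev H ?f a' \<in> ?I" using k a' yT T(2) subringE(6)[OF Bd(1)] by (auto intro!: p(6))
  have "a' \<ominus>\<^bsub>H\<^esub> t \<in> mH" unfolding a'(5) using ym a'c by (intro mH.I_r_closed)
  then have "a' \<ominus>\<^bsub>H\<^esub> a \<in> mH" using at minus_mH_trans a'c ac tc by blast
  define d where "d = pdd H ?f a' a"
  have dc: "d \<in> carrier H" using fc a'c ac by (simp add: d_def)
  have "d \<ominus>\<^bsub>H\<^esub> pdd H ?f a a \<in> mH"
  proof -
    have "a \<ominus>\<^bsub>H\<^esub> a = \<zero>\<^bsub>H\<^esub>" using ac by algebra
    then have "a \<ominus>\<^bsub>H\<^esub> a \<in> mH" using mH_closed(3) by simp
    then show ?thesis unfolding d_def using \<open>a' \<ominus>\<^bsub>H\<^esub> a \<in> mH\<close> a'c ac fc by (intro H.pdd_cong mH.is_ideal) simp_all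
  qed
  then have "d \<notin> mH" using da Units_cong[OF dc pc(1)] by simp
  then have dU: "d \<in> Units H" using Units_H_iff[OF dc] by blast
  have dB: "d \<in> B" unfolding d_def using fB a' T(2) a by (intro H.pdd_in_subring[OF Bd(1)]) auto
  \<comment> \<open>As \<open>a\<close> is an exact root and \<open>d\<close> is invertible in
    \<open>B\<close>, the difference \<open>a' - a\<close> lies in the ideal along with
    \<open>f(a')\<close>.\<close>
  have "pev H ?f a' = (a' \<ominus>\<^bsub>H\<^esub> a) \<otimes>\<^bsub>H\<^esub> d"
    using H.pev_diff[OF fc a'c(1) ac] fa fc a'c by (simp add: d_def a_minus_def)
  then have "pev H ?f a' \<otimes>\<^bsub>H\<^esub> inv\<^bsub>H\<^esub> d = a' \<ominus>\<^bsub>H\<^esub> a"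
    using H.m_assoc[OF H.minus_closed[OF a'c(1) ac] dc H.Units_inv_closed[OF dU]] dU a'c ac by simp
  then have "a' \<ominus>\<^bsub>H\<^esub> a \<in> ?I" using p(6)[OF fa'] Bd(3)[OF dB dU] by metis
  moreover have "?I \<subseteq> ?T"
  proof
    fix u assume "u \<in> ?I"
    then have "\<phi> \<zero>\<^bsub>R\<^esub> \<oplus>\<^bsub>H\<^esub> u \<in> ?T" unfolding approx_def by blast
    then show "u \<in> ?T" using \<open>u \<in> ?I\<close> p(1) Bd(4) by auto
  qed
  ultimately have "a' \<ominus>\<^bsub>H\<^esub> a \<in> ?T" by blast
  then have "a' \<ominus>\<^bsub>H\<^esub> (a' \<ominus>\<^bsub>H\<^esub> a) \<in> ?T" using a' subringE(5,7)[OF Td(1)] unfolding a_minus_def by blast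
  moreover have "a' \<ominus>\<^bsub>H\<^esub> (a' \<ominus>\<^bsub>H\<^esub> a) = a" using a'c ac by algebra
  ultimately show "a \<in> ?T" by simp
qed

lemma inv_closed_carrier: "inv_closed (carrier H)"
  by (auto simp: inv_closed_def H.carrier_is_subring)

lemma approx_H: "q \<in> primary_ideals R \<Longrightarrow> approx (carrier H) q = carrier H"
  by (intro generation' approx_inv_closed(1) approx_root_closed inv_closed_carrier)

end

section \<open>Noetherian stages\<close>

context henselization begin

text \<open>Every finite subset of \<open>H\<close> lies in a stage: adjoining to a stage \<open>S\<close> a simple root \<open>a\<close> that is
  congruent to an element of \<open>S\<close>, and inverting the units of \<open>H\<close>, gives a stage.\<close>

definition stage :: "'b set \<Rightarrow> bool" where
  "stage S \<longleftrightarrow> inv_closed S \<and> noetherian_ring (H\<lparr>carrier := S\<rparr>) \<and> (\<forall>q\<in>primary_ideals R. approx S q = S)"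

lemma \<phi>_into_subring:
  assumes "inv_closed S" shows "ring_hom_cring R (H\<lparr>carrier := S\<rparr>) \<phi>"
  by (intro ring_hom_cring_intro R.cring_axioms H.subring_is_cring inv_closedD(1)[OF assms])
    (use inv_closedD(5)[OF assms] in \<open>auto simp: ring_hom_def\<close>)

lemma ext_mono:
  assumes "inv_closed S" "inv_closed S'" "S \<subseteq> S'" "q \<subseteq> carrier R"
  shows "ext S q \<subseteq> ext S' q"
  unfolding ext_def using assms inv_closedD(1,5) 
  by (intro H.subring_genideal_subset) auto

lemma approx_mono:
  assumes "inv_closed S" "inv_closed S'" "S \<subseteq> S'" "q \<subseteq> carrier R"
  shows "approx S q \<subseteq> approx S' q"
  unfolding approx_def using ext_mono[OF assms] by blast

lemma primary_carrier: "q \<in> primary_ideals R \<Longrightarrow> q \<subseteq> carrier R"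
  by (auto simp: primary_ideals_def ideal.Icarr)

text \<open>The bottom stage. An ideal of the image is generated by the images of generators of its
  preimage, and the approximation property holds because \<open>approx\<close> contains
  \<open>\<phi> R\<close> in any case.\<close>

lemma stage_image:
  assumes R: "noetherian_ring R" shows "stage (\<phi> ` carrier R)"
proof -
  let ?S = "\<phi> ` carrier R"
  have "inv\<^bsub>H\<^esub> x \<in> ?S" if x: "x \<in> ?S" "x \<in> Units H" for x
  proof -
    obtain r where r: "r \<in> carrier R" "x = \<phi> r" using x by blast
    then have u: "r \<in> Units R" using x(2) Units_H_iff \<phi>_mem_iff local_ring_Units_iff[OF local_R] by auto
    have "\<phi> r \<otimes>\<^bsub>H\<^esub> \<phi> (inv\<^bsub>R\<^esub> r) = \<one>\<^bsub>H\<^esub>" using u \<phi>.hom_mult[of r "inv\<^bsub>R\<^esub> r"] r by auto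
    then have "inv\<^bsub>H\<^esub> x = \<phi> (inv\<^bsub>R\<^esub> r)" using r u by (metis H.comm_inv_char R.Units_inv_closed \<phi>.hom_closed)
    then show ?thesis using u by blast
  qed
  moreover have "subring ?S H" by (rule \<phi>.ring.img_is_subring[OF R.carrier_is_subring])
  ultimately have S: "inv_closed ?S" by (auto simp: inv_closed_def)
  interpret \<phi>S: ring_hom_cring R "H\<lparr>carrier := ?S\<rparr>" \<phi> by (rule \<phi>_into_subring[OF S])
  have "noetherian_ring (H\<lparr>carrier := ?S\<rparr>)"
  proof (rule \<phi>S.S.noetherian_ringI)
    fix I assume I: "ideal I (H\<lparr>carrier := ?S\<rparr>)"
    let ?J = "{r \<in> carrier R. \<phi> r \<in> I}"
    have "ideal ?J R" by (rule \<phi>S.ring.ideal_vimage[OF I])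
    then obtain A where A: "A \<subseteq> carrier R" "finite A" "?J = Idl\<^bsub>R\<^esub> A"
      using noetherian_ring.finetely_gen[OF R] by blast
    let ?K = "Idl\<^bsub>H\<lparr>carrier := ?S\<rparr>\<^esub> (\<phi> ` A)"
    have AS: "\<phi> ` A \<subseteq> carrier (H\<lparr>carrier := ?S\<rparr>)" using A by auto
    have K: "ideal ?K (H\<lparr>carrier := ?S\<rparr>)" by (rule \<phi>S.S.genideal_ideal[OF AS])
    have "\<phi> ` A \<subseteq> I" using R.genideal_self[OF A(1)] A(3) by auto
    then have 1: "?K \<subseteq> I" by (rule \<phi>S.S.genideal_minimal[OF I])
    have "A \<subseteq> {r \<in> carrier R. \<phi> r \<in> ?K}" using \<phi>S.S.genideal_self[OF AS] A by auto
    then have "Idl\<^bsub>R\<^esub> A \<subseteq> {r \<in> carrier R. \<phi> r \<in> ?K}"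
      by (rule R.genideal_minimal[OF \<phi>S.ring.ideal_vimage[OF K]])
    then have "?J \<subseteq> {r \<in> carrier R. \<phi> r \<in> ?K}" using A(3) by simp
    moreover have "I \<subseteq> ?S" using ideal.Icarr[OF I] by auto
    ultimately have "I \<subseteq> ?K" by auto
    then show "\<exists>A\<subseteq>carrier (H\<lparr>carrier := ?S\<rparr>). finite A \<and> I = Idl\<^bsub>H\<lparr>carrier := ?S\<rparr>\<^esub> A"
      using 1 AS A(2) by (intro exI[of _ "\<phi> ` A"]) auto
  qed
  moreover have "approx ?S q = ?S" if q: "q \<in> primary_ideals R" for q
  proof
    show "approx ?S q \<subseteq> ?S" by (rule approx_inv_closed(2)[OF S q])
    show "?S \<subseteq> approx ?S q" by (rule inv_closedD(2)[OF approx_inv_closed(1)[OF S q]])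
  qed
  ultimately show ?thesis using S by (simp add: stage_def)
qed

text \<open>As \<open>f\<close> is monic, the ring \<open>W = S[a]\<close> is spanned over
  \<open>S\<close> by finitely many powers of \<open>a\<close>; \<open>S'\<close> is its
  localization at the units of \<open>H\<close>. The approximation property is inherited through
  \<open>approx_root_closed\<close>: \<open>approx S' q\<close> contains \<open>S\<close>, hence
  \<open>a\<close>, hence all of \<open>S'\<close>.\<close>

lemma stage_adjoin_root:
  assumes S: "stage S" and f: "set f \<subseteq> S" and a: "a \<in> carrier H" and t: "t \<in> S" "a \<ominus>\<^bsub>H\<^esub> t \<in> mH"
    and fa: "pev H (f @ [\<one>\<^bsub>H\<^esub>]) a = \<zero>\<^bsub>H\<^esub>" and da: "pdd H (f @ [\<one>\<^bsub>H\<^esub>]) a a \<notin> mH"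
  shows "\<exists>S'. stage S' \<and> S \<subseteq> S' \<and> a \<in> S'"
proof -
  let ?HS = "H\<lparr>carrier := S\<rparr>" and ?M = "self_module H"
  have iS: "inv_closed S" and nS: "noetherian_ring ?HS" and aS: "\<And>q. q \<in> primary_ideals R \<Longrightarrow> approx S q = S"
    using S by (auto simp: stage_def)
  note Sd = inv_closedD[OF iS] and sS = subringE[OF inv_closedD(1)[OF iS]]
  interpret M: module ?HS ?M by (rule H.self_module_over_subring[OF Sd(1)])
  define n where "n = length f"
  \<comment> \<open>Degree zero would give \<open>\<one> = \<zero>\<close>. Positive degree puts
    \<open>\<one>\<close>, the power with exponent 0, among the generators.\<close>
  have n0: "n > 0"
  proof (rule ccontr)
    assume "\<not> n > 0"
    then have "\<one>\<^bsub>H\<^esub> = \<zero>\<^bsub>H\<^esub>" using fa a by (simp add: n_def)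
    then show False using local_ring_one_notin[OF local_H] mH_closed(3) by simp
  qed
  define Y where "Y = (\<lambda>i. a [^]\<^bsub>H\<^esub> i) ` {..<n}"
  have Y: "Y \<subseteq> carrier ?M" "finite Y" using a by (auto simp: Y_def)
  define W where "W = mspan ?HS ?M Y"
  have subW: "submodule W ?HS ?M" unfolding W_def by (rule M.mspan_submodule[OF Y(1)])
  note Wd = M.submoduleD[OF subW, simplified]
  have Wc: "x \<in> carrier H" if "x \<in> W" for x using that Wd(1) by auto
  have powW: "a [^]\<^bsub>H\<^esub> i \<in> W" if "i < n" for i
    using M.mspan_superset[OF Y(1)] that by (auto simp: Y_def W_def)
  have W1: "\<one>\<^bsub>H\<^esub> \<in> W" using powW[OF n0] by simp
  have SW: "S \<subseteq> W" using Wd(3)[OF _ W1] Sd(4) by (auto simp: subset_iff)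
  have pevW: "pev H g a \<in> W" if "set g \<subseteq> S" "length g \<le> n" for g
    using that
  proof (induct g rule: rev_induct)
    case Nil then show ?case using Wd(5) by simp
  next
    case (snoc c g)
    have "set g \<subseteq> carrier H" "c \<in> carrier H" using snoc Sd(4) by auto
    then have "pev H (g @ [c]) a = pev H g a \<oplus>\<^bsub>H\<^esub> c \<otimes>\<^bsub>H\<^esub> a [^]\<^bsub>H\<^esub> length g"
      using a by (simp add: H.pev_snoc H.m_comm)
    then show ?case using snoc Wd(3,4) powW[of "length g"] by simp
  qed
  have fc: "set f \<subseteq> carrier H" using f Sd(4) by auto
  have anW: "a [^]\<^bsub>H\<^esub> n \<in> W"
  proof -
    have "pev H f a \<oplus>\<^bsub>H\<^esub> a [^]\<^bsub>H\<^esub> n = \<zero>\<^bsub>H\<^esub>" using fa fc a by (simp add: H.pev_snoc n_def)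
    then have "a [^]\<^bsub>H\<^esub> n = \<ominus>\<^bsub>H\<^esub> pev H f a"
      using fc a by (metis H.a_comm H.minus_equality H.nat_pow_closed H.pev_closed)
    then show ?thesis using Wd(2) pevW[of f] f by (simp add: n_def)
  qed
  have aW: "a \<otimes>\<^bsub>H\<^esub> x \<in> W" if "x \<in> W" for x
    using that unfolding W_def
  proof induct
    case mspan_zero then show ?case using Wd(5) a by (simp add: W_def)
  next
    case (mspan_step s y v)
    then obtain i where i: "i < n" "y = a [^]\<^bsub>H\<^esub> i" by (auto simp: Y_def)
    have c: "s \<in> carrier H" "v \<in> carrier H" "y \<in> carrier H" using mspan_step Sd(4) Wc i a by (auto simp: W_def)
    have "a [^]\<^bsub>H\<^esub> Suc i \<in> W" using powW[of "Suc i"] anW i by (cases "Suc i = n") auto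
    then have "s \<otimes>\<^bsub>H\<^esub> a [^]\<^bsub>H\<^esub> Suc i \<oplus>\<^bsub>H\<^esub> a \<otimes>\<^bsub>H\<^esub> v \<in> W" using mspan_step Wd(3,4) by (simp add: W_def)
    moreover have "s \<otimes>\<^bsub>H\<^esub> a [^]\<^bsub>H\<^esub> Suc i \<oplus>\<^bsub>H\<^esub> a \<otimes>\<^bsub>H\<^esub> v = a \<otimes>\<^bsub>H\<^esub> (s \<otimes>\<^bsub>H\<^esub> y \<oplus>\<^bsub>H\<^esub> v)"
      using c a unfolding i(2) by (simp add: H.r_distr H.m_ac)
    ultimately show ?case by (simp add: W_def)
  qed
  have multW: "x \<otimes>\<^bsub>H\<^esub> z \<in> W" if "x \<in> W" and z: "z \<in> W" for x z
    using that(1) unfolding W_def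
  proof induct
    case mspan_zero then show ?case using Wd(5) Wc[OF z] by (simp add: W_def)
  next
    case (mspan_step s y v)
    then obtain i where i: "y = a [^]\<^bsub>H\<^esub> (i::nat)" by (auto simp: Y_def)
    have c: "s \<in> carrier H" "v \<in> carrier H" "y \<in> carrier H" "z \<in> carrier H"
      using mspan_step Sd(4) Wc i a z by (auto simp: W_def)
    have "a [^]\<^bsub>H\<^esub> j \<otimes>\<^bsub>H\<^esub> z \<in> W" for j :: nat
    proof (induct j)
      case (Suc j)
      have "a [^]\<^bsub>H\<^esub> Suc j \<otimes>\<^bsub>H\<^esub> z = a \<otimes>\<^bsub>H\<^esub> (a [^]\<^bsub>H\<^esub> j \<otimes>\<^bsub>H\<^esub> z)" using a c by (simp add: H.m_ac)
      then show ?case using aW[OF Suc] by simp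
    qed (use z c in simp)
    then have "s \<otimes>\<^bsub>H\<^esub> (y \<otimes>\<^bsub>H\<^esub> z) \<oplus>\<^bsub>H\<^esub> v \<otimes>\<^bsub>H\<^esub> z \<in> W" using mspan_step Wd(3,4) i by (simp add: W_def)
    moreover have "s \<otimes>\<^bsub>H\<^esub> (y \<otimes>\<^bsub>H\<^esub> z) \<oplus>\<^bsub>H\<^esub> v \<otimes>\<^bsub>H\<^esub> z = (s \<otimes>\<^bsub>H\<^esub> y \<oplus>\<^bsub>H\<^esub> v) \<otimes>\<^bsub>H\<^esub> z"
      using c by algebra
    ultimately show ?case by (simp add: W_def)
  qed
  define S' where "S' = {u \<otimes>\<^bsub>H\<^esub> inv\<^bsub>H\<^esub> v | u v. u \<in> W \<and> v \<in> W \<and> v \<in> Units H}"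
  \<comment> \<open>Fractions are handled through the equation \<open>x v = u\<close>, which turns
    the ring laws into identities without inverses.\<close>
  have S'I: "x \<in> S'" if "u \<in> W" "v \<in> W" "v \<in> Units H" "x \<in> carrier H" "x \<otimes>\<^bsub>H\<^esub> v = u" for x u v
  proof -
    have "u \<otimes>\<^bsub>H\<^esub> inv\<^bsub>H\<^esub> v = x" unfolding that(5)[symmetric] using that(3,4) by (simp add: H.m_assoc H.Units_closed)
    then show ?thesis using that unfolding S'_def by blast
  qed
  have S'E: "\<exists>u v. u \<in> W \<and> v \<in> W \<and> v \<in> Units H \<and> x \<in> carrier H \<and> x \<otimes>\<^bsub>H\<^esub> v = u" if xS: "x \<in> S'" for x
  proof -
    obtain u v where uv: "u \<in> W" "v \<in> W" "v \<in> Units H" "x = u \<otimes>\<^bsub>H\<^esub> inv\<^bsub>H\<^esub> v" using xS by (auto simp: S'_def)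
    then have "x \<otimes>\<^bsub>H\<^esub> v = u" using Wc[OF uv(1)] by (simp add: H.m_assoc H.Units_closed)
    then show ?thesis using uv Wc by auto
  qed
  have WS': "W \<subseteq> S'" using S'I[OF _ W1] Wc by auto
  have sub': "subring S' H"
  proof (rule H.subringI)
    show "S' \<subseteq> carrier H" using S'E by blast
    show "\<one>\<^bsub>H\<^esub> \<in> S'" using WS' W1 by blast
    fix x assume "x \<in> S'"
    then obtain u v where x: "u \<in> W" "v \<in> W" "v \<in> Units H" "x \<in> carrier H" "x \<otimes>\<^bsub>H\<^esub> v = u" using S'E by blast
    show "\<ominus>\<^bsub>H\<^esub> x \<in> S'" using x Wd(2)[OF x(1)] by (intro S'I[of "\<ominus>\<^bsub>H\<^esub> u" v]) (auto simp: H.l_minus)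
    fix y assume "y \<in> S'"
    then obtain p q where y: "p \<in> W" "q \<in> W" "q \<in> Units H" "y \<in> carrier H" "y \<otimes>\<^bsub>H\<^esub> q = p" using S'E by blast
    have c: "v \<in> carrier H" "q \<in> carrier H" using x y by auto
    show "x \<otimes>\<^bsub>H\<^esub> y \<in> S'"
    proof (rule S'I[of "u \<otimes>\<^bsub>H\<^esub> p" "v \<otimes>\<^bsub>H\<^esub> q"])
      show "x \<otimes>\<^bsub>H\<^esub> y \<otimes>\<^bsub>H\<^esub> (v \<otimes>\<^bsub>H\<^esub> q) = u \<otimes>\<^bsub>H\<^esub> p"
        unfolding x(5)[symmetric] y(5)[symmetric] using c x(4) y(4) by algebra
    qed (use x y multW in auto)
    show "x \<oplus>\<^bsub>H\<^esub> y \<in> S'"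
    proof (rule S'I[of "u \<otimes>\<^bsub>H\<^esub> q \<oplus>\<^bsub>H\<^esub> p \<otimes>\<^bsub>H\<^esub> v" "v \<otimes>\<^bsub>H\<^esub> q"])
      show "(x \<oplus>\<^bsub>H\<^esub> y) \<otimes>\<^bsub>H\<^esub> (v \<otimes>\<^bsub>H\<^esub> q) = u \<otimes>\<^bsub>H\<^esub> q \<oplus>\<^bsub>H\<^esub> p \<otimes>\<^bsub>H\<^esub> v"
        unfolding x(5)[symmetric] y(5)[symmetric] using c x(4) y(4) by algebra
    qed (use x y multW Wd(4) in auto)
  qed
  have inv': "inv\<^bsub>H\<^esub> x \<in> S'" if xS: "x \<in> S'" and ux: "x \<in> Units H" for x
  proof -
    obtain u v where x: "u \<in> W" "v \<in> W" "v \<in> Units H" "x \<in> carrier H" "x \<otimes>\<^bsub>H\<^esub> v = u" using S'E[OF xS] by blast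
    have "u \<in> Units H" using x ux by auto
    moreover have "inv\<^bsub>H\<^esub> x \<otimes>\<^bsub>H\<^esub> u = v" unfolding x(5)[symmetric] using x(3,4) ux by (simp add: H.m_assoc[symmetric] H.Units_closed)
    ultimately show ?thesis using x ux by (intro S'I[of v u]) auto
  qed
  have iS': "inv_closed S'" unfolding inv_closed_def using sub' inv' Sd(2) SW WS' by blast
  interpret HS': cring "H\<lparr>carrier := S'\<rparr>" by (rule H.subring_is_cring[OF sub'])
  have noeth': "noetherian_ring (H\<lparr>carrier := S'\<rparr>)"
  proof (rule HS'.noetherian_ringI)
    fix I assume I: "ideal I (H\<lparr>carrier := S'\<rparr>)"
    note p = H.subring_ideal_props[OF sub' I]
    \<comment> \<open>This contraction is a finitely generated \<open>S\<close>-module. It generates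
      \<open>I\<close>, since every element of \<open>I\<close> becomes one of
      \<open>I \<inter> W\<close> after multiplication by a unit of \<open>S'\<close>.\<close>
    have "submodule (I \<inter> W) ?HS ?M"
    proof (rule M.submoduleI)
      show "a \<odot>\<^bsub>?M\<^esub> x \<in> I \<inter> W" if "a \<in> carrier ?HS" "x \<in> I \<inter> W" for a x
        using that Wd(3) p(5) SW WS' by auto
    qed (use p Wd in auto)
    then obtain X where X: "finite X" "X \<subseteq> I \<inter> W" "I \<inter> W = mspan ?HS ?M X"
      using M.fg_submodule[OF nS Y(2,1), of "I \<inter> W"] by (auto simp: W_def)
    let ?K = "Idl\<^bsub>H\<lparr>carrier := S'\<rparr>\<^esub> X"
    have XS: "X \<subseteq> carrier (H\<lparr>carrier := S'\<rparr>)" using X(2) WS' by auto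
    have K: "ideal ?K (H\<lparr>carrier := S'\<rparr>)" by (rule HS'.genideal_ideal[OF XS])
    note k = H.subring_ideal_props[OF sub' K]
    have "?K \<subseteq> I" using X(2) by (intro HS'.genideal_minimal[OF I]) auto
    moreover have "I \<subseteq> ?K"
    proof
      fix x assume x: "x \<in> I"
      then obtain u v where uv: "u \<in> W" "v \<in> W" "v \<in> Units H" "x \<in> carrier H" "x \<otimes>\<^bsub>H\<^esub> v = u" using S'E p(1) by blast
      have "u \<in> I" using uv p(6)[OF x, of v] WS' by auto
      then have "u \<in> mspan ?HS ?M X" using uv X(3) by blast
      moreover have "y \<in> ?K" if "y \<in> mspan ?HS ?M X" for y
        using that
      proof induct
        case (mspan_step s y v)
        have "y \<in> ?K" "s \<in> S'" using mspan_step(1,2) HS'.genideal_self[OF XS] SW WS' by auto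
        then have "s \<otimes>\<^bsub>H\<^esub> y \<oplus>\<^bsub>H\<^esub> v \<in> ?K" using mspan_step(4) by (intro k(3) k(5))
        then show ?case by simp
      qed (use k in simp)
      ultimately have "u \<in> ?K" by blast
      then have "u \<otimes>\<^bsub>H\<^esub> inv\<^bsub>H\<^esub> v \<in> ?K" using k(6) inv' uv(2,3) WS' by blast
      moreover have "u \<otimes>\<^bsub>H\<^esub> inv\<^bsub>H\<^esub> v = x"
        unfolding uv(5)[symmetric] using uv(3,4) by (simp add: H.m_assoc H.Units_closed)
      ultimately show "x \<in> ?K" by simp
    qed
    ultimately show "\<exists>A\<subseteq>carrier (H\<lparr>carrier := S'\<rparr>). finite A \<and> I = Idl\<^bsub>H\<lparr>carrier := S'\<rparr>\<^esub> A"
      using X(1) XS by blast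
  qed
  have a1: "a \<in> W" using aW[OF W1] a by simp
  have approx': "approx S' q = S'" if q: "q \<in> primary_ideals R" for q
  proof
    let ?T = "approx S' q"
    note Td = inv_closedD[OF approx_inv_closed(1)[OF iS' q]]
    note sT = subringE[OF Td(1)]
    show "?T \<subseteq> S'" by (rule approx_inv_closed(2)[OF iS' q])
    \<comment> \<open>The approximation property of the stage \<open>S\<close>, transferred to the
      larger ring.\<close>
    have "S \<subseteq> approx S q" using aS[OF q] by simp
    also have "\<dots> \<subseteq> ?T" using SW WS' by (intro approx_mono iS iS' primary_carrier q) auto
    finally have ST: "S \<subseteq> ?T" .
    have aT: "a \<in> ?T"
      by (rule root_closedD[OF approx_root_closed[OF iS' q], of f a t]) (use ST f t fa da a1 WS' in auto)
    have aiT: "a [^]\<^bsub>H\<^esub> i \<in> ?T" for i :: nat using aT sT(3,6) by (induct i) auto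
    have WT: "W \<subseteq> ?T"
    proof
      fix x assume "x \<in> W"
      then show "x \<in> ?T" unfolding W_def
        by induct (use sT ST aiT in \<open>auto simp: Y_def\<close>)
    qed
    show "S' \<subseteq> ?T"
    proof
      fix x assume "x \<in> S'"
      then obtain u v where uv: "u \<in> W" "v \<in> W" "v \<in> Units H" "x = u \<otimes>\<^bsub>H\<^esub> inv\<^bsub>H\<^esub> v"
        unfolding S'_def by blast
      show "x \<in> ?T"
        unfolding uv(4) by (rule sT(6)[OF subsetD[OF WT uv(1)] Td(3)[OF subsetD[OF WT uv(2)] uv(3)]])
    qed
  qed
  have "stage S'" unfolding stage_def using iS' noeth' approx' by blast
  then show ?thesis using SW WS' a1 by blast
qed

lemma stage_exists:
  assumes R: "noetherian_ring R" and X: "finite X" "X \<subseteq> carrier H"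
  shows "\<exists>S. stage S \<and> X \<subseteq> S"
proof -
  define T where "T = {x \<in> carrier H. \<forall>S. stage S \<longrightarrow> (\<exists>S'. stage S' \<and> S \<subseteq> S' \<and> x \<in> S')}"
  have fin: "\<exists>S'. stage S' \<and> S \<subseteq> S' \<and> X \<subseteq> S'" if "finite X" "X \<subseteq> T" "stage S" for X S
    using that
  proof (induct X)
    case (insert x X)
    then obtain S' where "stage S'" "S \<subseteq> S'" "X \<subseteq> S'" by auto
    moreover from this obtain S'' where "stage S''" "S' \<subseteq> S''" "x \<in> S''" using insert(4) by (auto simp: T_def)
    ultimately show ?case by blast
  qed auto
  have TI: "x \<in> T" if x: "x \<in> carrier H" "finite Z" "Z \<subseteq> T"
    and cl: "\<And>S. stage S \<Longrightarrow> Z \<subseteq> S \<Longrightarrow> \<exists>S'. stage S' \<and> S \<subseteq> S' \<and> x \<in> S'" for x Z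
    unfolding T_def
  proof (intro CollectI conjI x(1) allI impI)
    fix S assume "stage S"
    then obtain S' where S': "stage S'" "S \<subseteq> S'" "Z \<subseteq> S'" using fin[OF x(2,3)] by blast
    then obtain S'' where "stage S''" "S' \<subseteq> S''" "x \<in> S''" using cl by blast
    then show "\<exists>S'. stage S' \<and> S \<subseteq> S' \<and> x \<in> S'" using S' by blast
  qed
  have iS: "inv_closed S" if "stage S" for S using that by (simp add: stage_def)
  note sub = inv_closedD[OF iS] and E = subringE[OF inv_closedD(1)[OF iS]]
  have Tc: "T \<subseteq> carrier H" by (auto simp: T_def)
  have \<phi>T: "\<phi> ` carrier R \<subseteq> T" using sub(5) by (auto simp: T_def)
  have "subring T H"
  proof (rule H.subringI[OF Tc])
    show "\<one>\<^bsub>H\<^esub> \<in> T" by (rule TI[of _ "{}"]) (use E(3) in auto)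
    show "\<ominus>\<^bsub>H\<^esub> x \<in> T" if "x \<in> T" for x by (rule TI[of _ "{x}"]) (use that E(5) Tc in auto)
    show "x \<otimes>\<^bsub>H\<^esub> y \<in> T" "x \<oplus>\<^bsub>H\<^esub> y \<in> T" if "x \<in> T" "y \<in> T" for x y
      by (rule TI[of _ "{x, y}"]; use that E(6,7) Tc in auto)+
  qed
  moreover have "inv\<^bsub>H\<^esub> x \<in> T" if "x \<in> T" "x \<in> Units H" for x
    by (rule TI[of _ "{x}"]) (use that sub(3) in auto)
  ultimately have "inv_closed T" using \<phi>T by (auto simp: inv_closed_def)
  moreover have "root_closed (carrier H) T"
    unfolding root_closed_def
  proof (intro allI impI, elim conjE)
    fix f a t
    assume h: "set f \<subseteq> T" "a \<in> carrier H" "t \<in> T" "a \<ominus>\<^bsub>H\<^esub> t \<in> mH"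
      "pev H (f @ [\<one>\<^bsub>H\<^esub>]) a = \<zero>\<^bsub>H\<^esub>" "pdd H (f @ [\<one>\<^bsub>H\<^esub>]) a a \<notin> mH"
    show "a \<in> T"
    proof (rule TI[of a "insert t (set f)"])
      fix S assume "stage S" "insert t (set f) \<subseteq> S"
      then show "\<exists>S'. stage S' \<and> S \<subseteq> S' \<and> a \<in> S'" by (intro stage_adjoin_root[OF _ _ h(2) _ h(4-6)]) auto
    qed (use h in auto)
  qed
  ultimately have "T = carrier H" by (rule generation')
  then show ?thesis using fin[OF X(1) _ stage_image[OF R]] X(2) by blast
qed

text \<open>Approximation inside \<open>S\<close> reduces the claim to an element of
  \<open>R\<close>, where \<open>contraction_primary\<close> applies.\<close>

lemma stage_contraction:
  assumes S: "stage S" and q: "q \<in> primary_ideals R" and x: "x \<in> S" "x \<in> ext (carrier H) q"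
  shows "x \<in> ext S q"
proof -
  have iS: "inv_closed S" using S by (simp add: stage_def)
  note qc = primary_carrier[OF q]
  note p = H.subring_ideal_props[OF H.carrier_is_subring ext_ideal(1)[OF inv_closed_carrier qc]]
  have "x \<in> approx S q" using S q x(1) by (simp add: stage_def)
  then obtain r y where ry: "x = \<phi> r \<oplus>\<^bsub>H\<^esub> y" "r \<in> carrier R" "y \<in> ext S q" by (auto simp: approx_def)
  have y: "y \<in> ext (carrier H) q"
    using ext_mono[OF iS inv_closed_carrier inv_closedD(4)[OF iS] qc] ry(3) by blast
  then have "x \<ominus>\<^bsub>H\<^esub> y \<in> ext (carrier H) q" using p(7) x(2) by blast
  moreover have "x \<ominus>\<^bsub>H\<^esub> y = \<phi> r"
    unfolding ry(1) using \<phi>.hom_closed[OF ry(2)] subsetD[OF p(1) y] by algebra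
  ultimately have "\<phi> r \<in> Idl\<^bsub>H\<^esub> (\<phi> ` q)" by (simp add: ext_def)
  then have "r \<in> q" by (rule contraction_primary[OF q ry(2)])
  then have "\<phi> r \<in> ext S q" using ext_ideal(2)[OF iS qc] by blast
  then show ?thesis
    unfolding ry(1) using H.subring_ideal_props(3)[OF inv_closedD(1)[OF iS] ext_ideal(1)[OF iS qc]] ry(3) by blast
qed

end

section \<open>The Henselization is Noetherian\<close>

context henselization begin

lemma inv_closed_local:
  assumes "inv_closed S"
  shows "local_ring (H\<lparr>carrier := S\<rparr>)" "max_ideal (H\<lparr>carrier := S\<rparr>) = S \<inter> mH"
  by (rule local_subring[OF inv_closedD(1,3)[OF assms]]; assumption)+

abbreviation extH :: "'a set \<Rightarrow> 'b set" where "extH \<equiv> ext (carrier H)"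

lemma extH_eq: "extH q = Idl\<^bsub>H\<^esub> (\<phi> ` q)" by (simp add: ext_def)

lemma extH_ideal: "q \<subseteq> carrier R \<Longrightarrow> ideal (extH q) H" "q \<subseteq> carrier R \<Longrightarrow> \<phi> ` q \<subseteq> extH q"
  using ext_ideal[OF inv_closed_carrier] by simp_all

lemma H_approx:
  assumes "q \<in> primary_ideals R" "h \<in> carrier H"
  obtains r y where "r \<in> carrier R" "y \<in> extH q" "h = \<phi> r \<oplus>\<^bsub>H\<^esub> y"
  using approx_H[OF assms(1)] assms(2) unfolding approx_def by blast

lemma H_ideal_props:
  assumes "ideal I H"
  shows "I \<subseteq> carrier H" "\<zero>\<^bsub>H\<^esub> \<in> I" "\<And>x y. x \<in> I \<Longrightarrow> y \<in> I \<Longrightarrow> x \<oplus>\<^bsub>H\<^esub> y \<in> I" "\<And>x. x \<in> I \<Longrightarrow> \<ominus>\<^bsub>H\<^esub> x \<in> I"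
    "\<And>x s. x \<in> I \<Longrightarrow> s \<in> carrier H \<Longrightarrow> s \<otimes>\<^bsub>H\<^esub> x \<in> I" "\<And>x s. x \<in> I \<Longrightarrow> s \<in> carrier H \<Longrightarrow> x \<otimes>\<^bsub>H\<^esub> s \<in> I"
    "\<And>x y. x \<in> I \<Longrightarrow> y \<in> I \<Longrightarrow> x \<ominus>\<^bsub>H\<^esub> y \<in> I"
  using H.subring_ideal_props[OF H.carrier_is_subring, of I] assms by simp_all

lemma mR_primary: "mR \<in> primary_ideals R"
proof -
  have "x [^]\<^bsub>R\<^esub> (1::nat) \<in> mR" if "x \<in> mR" for x using that mR.Icarr by simp
  then show ?thesis unfolding primary_ideals_def using mR.is_ideal by blast
qed

text \<open>The hypothesis says that \<open>y\<close> lies in the closure of the ideal generated by \<open>X\<close>.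
  A stage containing \<open>X\<close> and \<open>y\<close> is Noetherian, so Krull's theorem applies there, and it has the
  same quotients by primary ideals as \<open>H\<close>.\<close>

lemma fg_ideal_closed:
  assumes R: "noetherian_ring R" and X: "finite X" "X \<subseteq> carrier H" and y: "y \<in> carrier H"
    and cl: "\<And>q. q \<in> primary_ideals R \<Longrightarrow> \<exists>j\<in>Idl\<^bsub>H\<^esub> X. \<exists>z\<in>extH q. y = j \<oplus>\<^bsub>H\<^esub> z"
  shows "y \<in> Idl\<^bsub>H\<^esub> X"
proof -
  obtain S where S: "stage S" "insert y X \<subseteq> S" using stage_exists[OF R, of "insert y X"] X y by auto
  let ?HS = "H\<lparr>carrier := S\<rparr>"
  have iS: "inv_closed S" and nS: "noetherian_ring ?HS" using S by (auto simp: stage_def)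
  note Sd = inv_closedD[OF iS]
  interpret HS: cring ?HS by (rule H.subring_is_cring[OF Sd(1)])
  interpret M: module ?HS "self_module ?HS" by (rule HS.self_module)
  interpret \<phi>S: ring_hom_cring R ?HS \<phi> by (rule \<phi>_into_subring[OF iS])
  let ?J = "Idl\<^bsub>?HS\<^esub> X"
  have XS: "X \<subseteq> carrier ?HS" using S by simp
  have J: "ideal ?J ?HS" by (rule HS.genideal_ideal[OF XS])
  have "y \<in> ?J"
  proof (rule ccontr)
    assume yJ: "y \<notin> ?J"
    have yM: "y \<in> carrier (self_module ?HS)" using S by simp
    have sJ: "submodule ?J ?HS (self_module ?HS)" using J by (simp only: HS.submodule_self_module_iff)
    obtain U where U: "submodule U ?HS (self_module ?HS)" "?J \<subseteq> U" "y \<notin> U"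
      and pow: "\<And>x. x \<in> max_ideal ?HS \<Longrightarrow> \<exists>k::nat. \<forall>z\<in>carrier (self_module ?HS). x [^]\<^bsub>?HS\<^esub> k \<odot>\<^bsub>self_module ?HS\<^esub> z \<in> U"
      by (rule M.Krull_intersection[OF inv_closed_local(1)[OF iS] HS.noeth_self_module[OF nS] sJ yM yJ]) (rule that)
    have iU: "ideal U ?HS" using U(1) by (simp only: HS.submodule_self_module_iff)
    note u = H.subring_ideal_props[OF Sd(1) iU]
    \<comment> \<open>The trace of \<open>U\<close> on \<open>R\<close>. It is primary by
      \<open>pow\<close>, so approximation and contraction are available for it.\<close>
    define q where "q = {r \<in> carrier R. \<phi> r \<in> U}"
    have qi: "ideal q R" unfolding q_def by (rule \<phi>S.ring.ideal_vimage[OF iU])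
    have "\<exists>k::nat. x [^]\<^bsub>R\<^esub> k \<in> q" if x: "x \<in> mR" for x
    proof -
      have xc: "x \<in> carrier R" using x mR.Icarr by blast
      have "\<phi> x \<in> max_ideal ?HS" using Sd(5)[OF xc] \<phi>_mem_iff[OF xc] x by (simp add: inv_closed_local(2)[OF iS])
      then obtain k :: nat where k: "\<forall>z\<in>carrier (self_module ?HS). \<phi> x [^]\<^bsub>?HS\<^esub> k \<odot>\<^bsub>self_module ?HS\<^esub> z \<in> U"
        using pow by blast
      then have "\<phi> x [^]\<^bsub>?HS\<^esub> k \<otimes>\<^bsub>H\<^esub> \<one>\<^bsub>H\<^esub> \<in> U" using subringE(3)[OF Sd(1)] by simp
      moreover have "\<phi> x [^]\<^bsub>?HS\<^esub> k = \<phi> (x [^]\<^bsub>R\<^esub> k)" using \<phi>S.ring.hom_nat_pow[OF xc] by simp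
      ultimately have "\<phi> (x [^]\<^bsub>R\<^esub> k) \<in> U" using xc by (metis H.r_one R.nat_pow_closed \<phi>.hom_closed)
      then show ?thesis using xc unfolding q_def by blast
    qed
    then have q: "q \<in> primary_ideals R" using qi unfolding primary_ideals_def by blast
    note qc = primary_carrier[OF q]
    note e = H_ideal_props[OF extH_ideal(1)[OF qc]]
    note j = H.subring_ideal_props[OF Sd(1) J]
    \<comment> \<open>\<open>?J\<close> is an ideal of \<open>S\<close> only, yet
      \<open>?J + q H\<close> is an ideal of \<open>H\<close>: a multiplier from \<open>H\<close> is
      \<open>\<phi> r\<close> plus an element of \<open>q H\<close>, and \<open>\<phi> r\<close>
      lies in \<open>S\<close>.\<close>
    define K where "K = {s \<oplus>\<^bsub>H\<^esub> z | s z. s \<in> ?J \<and> z \<in> extH q}"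
    have KI: "s \<oplus>\<^bsub>H\<^esub> z \<in> K" if "s \<in> ?J" "z \<in> extH q" for s z using that by (auto simp: K_def)
    have Jc: "s \<in> carrier H" if "s \<in> ?J" for s using that j(1) Sd(4) by blast
    have add: "x \<oplus>\<^bsub>H\<^esub> y \<in> K" if xy: "x \<in> K" "y \<in> K" for x y
    proof -
      obtain s z s' z' where sz: "x = s \<oplus>\<^bsub>H\<^esub> z" "y = s' \<oplus>\<^bsub>H\<^esub> z'" "s \<in> ?J" "z \<in> extH q" "s' \<in> ?J" "z' \<in> extH q"
        using xy unfolding K_def by blast
      have "x \<oplus>\<^bsub>H\<^esub> y = (s \<oplus>\<^bsub>H\<^esub> s') \<oplus>\<^bsub>H\<^esub> (z \<oplus>\<^bsub>H\<^esub> z')"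
        unfolding sz(1,2) using Jc[OF sz(3)] Jc[OF sz(5)] subsetD[OF e(1) sz(4)] subsetD[OF e(1) sz(6)] by algebra
      then show ?thesis using KI[OF j(3)[OF sz(3,5)] e(3)[OF sz(4,6)]] by simp
    qed
    have mult: "h \<otimes>\<^bsub>H\<^esub> x \<in> K" if h: "h \<in> carrier H" and x: "x \<in> K" for h x
    proof -
      obtain s z where sz: "x = s \<oplus>\<^bsub>H\<^esub> z" "s \<in> ?J" "z \<in> extH q" using x unfolding K_def by blast
      obtain r w where rw: "r \<in> carrier R" "w \<in> extH q" "h = \<phi> r \<oplus>\<^bsub>H\<^esub> w" by (rule H_approx[OF q h])
      have "h \<otimes>\<^bsub>H\<^esub> x = \<phi> r \<otimes>\<^bsub>H\<^esub> s \<oplus>\<^bsub>H\<^esub> (w \<otimes>\<^bsub>H\<^esub> s \<oplus>\<^bsub>H\<^esub> h \<otimes>\<^bsub>H\<^esub> z)"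
        unfolding sz(1) using Jc[OF sz(2)] subsetD[OF e(1) sz(3)] subsetD[OF e(1) rw(2)] \<phi>.hom_closed[OF rw(1)]
        unfolding rw(3) by algebra
      then show ?thesis
        using KI[OF j(5)[OF sz(2) Sd(5)[OF rw(1)]] e(3)[OF e(6)[OF rw(2) Jc[OF sz(2)]] e(5)[OF sz(3) h]]] by simp
    qed
    have Kc: "K \<subseteq> carrier H" unfolding K_def using Jc e(1) by auto
    have "ideal K H"
    proof (rule idealI[OF H.ring_axioms])
      show "subgroup K (add_monoid H)"
      proof (rule H.add.subgroupI[OF Kc])
        show "K \<noteq> {}" using KI[OF j(2) e(2)] by blast
        show "\<ominus>\<^bsub>H\<^esub> x \<in> K" if "x \<in> K" for x
        proof -
          have "\<ominus>\<^bsub>H\<^esub> x = (\<ominus>\<^bsub>H\<^esub> \<one>\<^bsub>H\<^esub>) \<otimes>\<^bsub>H\<^esub> x" using that Kc by (auto simp: H.l_minus)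
          then show ?thesis using mult[OF _ that, of "\<ominus>\<^bsub>H\<^esub> \<one>\<^bsub>H\<^esub>"] by simp
        qed
      qed (use add in auto)
      show "x \<otimes>\<^bsub>H\<^esub> a \<in> K" "a \<otimes>\<^bsub>H\<^esub> x \<in> K" if "a \<in> K" "x \<in> carrier H" for a x
        using mult[OF that(2,1)] that Kc by (auto simp: H.m_comm subset_iff)
    qed
    moreover have "X \<subseteq> K"
    proof
      fix x assume "x \<in> X"
      then have "x \<in> ?J" using HS.genideal_self[OF XS] by blast
      then show "x \<in> K" using KI[OF _ e(2)] Jc by fastforce
    qed
    ultimately have XK: "Idl\<^bsub>H\<^esub> X \<subseteq> K" by (rule H.genideal_minimal)
    obtain i z where iz: "i \<in> Idl\<^bsub>H\<^esub> X" "z \<in> extH q" "y = i \<oplus>\<^bsub>H\<^esub> z" using cl[OF q] by blast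
    then obtain s z' where sz': "i = s \<oplus>\<^bsub>H\<^esub> z'" "s \<in> ?J" "z' \<in> extH q" using XK unfolding K_def by blast
    have c: "s \<in> carrier H" "z \<in> carrier H" "z' \<in> carrier H" using Jc sz' iz e(1) by auto
    have "y \<ominus>\<^bsub>H\<^esub> s = z' \<oplus>\<^bsub>H\<^esub> z" unfolding iz(3) sz'(1) using c by algebra
    then have "y \<ominus>\<^bsub>H\<^esub> s \<in> extH q" using e(3)[OF sz'(3) iz(2)] by simp
    moreover have "y \<ominus>\<^bsub>H\<^esub> s \<in> S"
      using S(2) subsetD[OF j(1) sz'(2)] subringE(5,7)[OF Sd(1)] unfolding a_minus_def by blast
    \<comment> \<open>Contraction brings the relation back from \<open>H\<close> to the stage, where
      \<open>q S \<subseteq> U\<close> by the choice of \<open>q\<close>.\<close>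
    ultimately have "y \<ominus>\<^bsub>H\<^esub> s \<in> ext S q" by (intro stage_contraction[OF S(1) q])
    moreover have "ext S q \<subseteq> U" unfolding ext_def by (rule HS.genideal_minimal[OF iU]) (auto simp: q_def)
    ultimately have "(y \<ominus>\<^bsub>H\<^esub> s) \<oplus>\<^bsub>H\<^esub> s \<in> U" using u(3) U(2) sz'(2) by blast
    moreover have "(y \<ominus>\<^bsub>H\<^esub> s) \<oplus>\<^bsub>H\<^esub> s = y" using c y by algebra
    ultimately show False using U(3) by simp
  qed
  moreover have "?J \<subseteq> Idl\<^bsub>H\<^esub> X"
    using H.subring_genideal_subset[OF Sd(1) H.carrier_is_subring Sd(4), of X] XS by simp
  ultimately show ?thesis by blast
qed

text \<open>Follows from \<open>H = \<phi> R + mR H\<close> and the locality of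
  \<open>\<phi>\<close>.\<close>

lemma mH_eq: "mH = extH mR"
proof
  note e = H_ideal_props[OF extH_ideal(1)[OF primary_carrier[OF mR_primary]]]
  have em: "extH mR \<subseteq> mH" by (rule ext_subset_mH[OF inv_closed_carrier]) simp
  then show "extH mR \<subseteq> mH" .
  show "mH \<subseteq> extH mR"
  proof
    fix x assume x: "x \<in> mH"
    obtain r y where ry: "r \<in> carrier R" "y \<in> extH mR" "x = \<phi> r \<oplus>\<^bsub>H\<^esub> y"
      by (rule H_approx[OF mR_primary mH.Icarr[OF x]])
    have "\<phi> r = x \<ominus>\<^bsub>H\<^esub> y" unfolding ry(3) using \<phi>.hom_closed[OF ry(1)] subsetD[OF e(1) ry(2)] by algebra
    also have "\<dots> \<in> mH" using x ry(2) em mH_closed unfolding a_minus_def by blast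
    finally have "r \<in> mR" using \<phi>_mem_iff[OF ry(1)] by simp
    then have "\<phi> r \<in> extH mR" using extH_ideal(2)[OF primary_carrier[OF mR_primary]] by blast
    then show "x \<in> extH mR" unfolding ry(3) using e(3) ry(2) by blast
  qed
qed

text \<open>Modulo \<open>q H\<close> the element \<open>x\<close> is the image of some
  \<open>r\<close>, which lies in \<open>mR\<close> unless \<open>q\<close> is the whole
  ring.\<close>

lemma primary_power:
  assumes q: "q \<in> primary_ideals R" and x: "x \<in> mH"
  shows "\<exists>k::nat. x [^]\<^bsub>H\<^esub> k \<in> extH q"
proof -
  note qc = primary_carrier[OF q]
  interpret E: ideal "extH q" H by (rule extH_ideal(1)[OF qc])
  obtain r y where ry: "r \<in> carrier R" "y \<in> extH q" "x = \<phi> r \<oplus>\<^bsub>H\<^esub> y" by (rule H_approx[OF q mH.Icarr[OF x]])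
  show ?thesis
  proof (cases "q = carrier R")
    case True
    then have "\<phi> \<one>\<^bsub>R\<^esub> \<in> extH q" using extH_ideal(2)[OF qc] by blast
    then show ?thesis by (intro exI[of _ 0]) simp
  next
    case False
    have ym: "y \<in> mH" using ext_subset_mH[OF inv_closed_carrier primary_subset[OF q False]] ry(2) by blast
    have "\<phi> r = x \<ominus>\<^bsub>H\<^esub> y" unfolding ry(3) using \<phi>.hom_closed[OF ry(1)] mH.Icarr[OF ym] by algebra
    also have "\<dots> \<in> mH" using x ym mH_closed unfolding a_minus_def by blast
    finally have "r \<in> mR" using \<phi>_mem_iff[OF ry(1)] by simp
    then obtain k :: nat where k: "r [^]\<^bsub>R\<^esub> k \<in> q" using q unfolding primary_ideals_def by blast
    have "extH q +>\<^bsub>H\<^esub> x = extH q +>\<^bsub>H\<^esub> \<phi> r"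
    proof -
      have "x \<ominus>\<^bsub>H\<^esub> \<phi> r = y" unfolding ry(3) using \<phi>.hom_closed[OF ry(1)] mH.Icarr[OF ym] by algebra
      then show ?thesis using H.rcos_eq_iff[OF E.is_ideal mH.Icarr[OF x] \<phi>.hom_closed[OF ry(1)]] ry(2) by simp
    qed
    note e = this and hp = ring_hom_ring.hom_nat_pow[OF E.rcos_ring_hom_ring]
    have "extH q +>\<^bsub>H\<^esub> (x [^]\<^bsub>H\<^esub> k) = extH q +>\<^bsub>H\<^esub> (\<phi> r [^]\<^bsub>H\<^esub> k)"
      unfolding hp[OF mH.Icarr[OF x]] hp[OF \<phi>.hom_closed[OF ry(1)]] e ..
    then have d: "x [^]\<^bsub>H\<^esub> k \<ominus>\<^bsub>H\<^esub> \<phi> r [^]\<^bsub>H\<^esub> k \<in> extH q"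
      by (simp only: H.rcos_eq_iff[OF E.is_ideal H.nat_pow_closed[OF mH.Icarr[OF x]]
            H.nat_pow_closed[OF \<phi>.hom_closed[OF ry(1)]]])
    have "\<phi> (r [^]\<^bsub>R\<^esub> k) \<in> extH q" using k extH_ideal(2)[OF qc] by blast
    moreover have "\<phi> (r [^]\<^bsub>R\<^esub> k) = \<phi> r [^]\<^bsub>H\<^esub> k" using \<phi>.ring.hom_nat_pow[OF ry(1)] .
    ultimately have "(x [^]\<^bsub>H\<^esub> k \<ominus>\<^bsub>H\<^esub> \<phi> r [^]\<^bsub>H\<^esub> k) \<oplus>\<^bsub>H\<^esub> \<phi> r [^]\<^bsub>H\<^esub> k \<in> extH q"
      using d H_ideal_props(3)[OF E.is_ideal] by simp
    moreover have "(x [^]\<^bsub>H\<^esub> k \<ominus>\<^bsub>H\<^esub> \<phi> r [^]\<^bsub>H\<^esub> k) \<oplus>\<^bsub>H\<^esub> \<phi> r [^]\<^bsub>H\<^esub> k = x [^]\<^bsub>H\<^esub> k"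
    proof -
      have "x [^]\<^bsub>H\<^esub> k \<in> carrier H" "\<phi> r [^]\<^bsub>H\<^esub> k \<in> carrier H" using mH.Icarr[OF x] \<phi>.hom_closed[OF ry(1)] by auto
      then show ?thesis by algebra
    qed
    ultimately show ?thesis by metis
  qed
qed

end

text \<open>Cohen's argument. Let \<open>P\<close> be maximal among the ideals that are not finitely generated and
  let \<open>x \<in> m - P\<close>. Then \<open>P + (x)\<close> is finitely generated, which gives \<open>P = J + x (P : x)\<close> with \<open>J\<close> finitely
  generated. As \<open>P\<close> is not finitely generated, \<open>(P : x) = P\<close>, hence \<open>P = J + x^k P\<close> for all \<open>k\<close>.\<close>

lemma (in cring) noetherian_of_closed_ideals:
  assumes m: "finite M" "M \<subseteq> carrier R" and max: "\<And>P. ideal P R \<Longrightarrow> P \<noteq> carrier R \<Longrightarrow> P \<subseteq> Idl M"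
    and closed: "\<And>X y x. finite X \<Longrightarrow> X \<subseteq> carrier R \<Longrightarrow> y \<in> carrier R \<Longrightarrow> x \<in> Idl M \<Longrightarrow>
      (\<And>k::nat. \<exists>j\<in>Idl X. \<exists>h\<in>carrier R. y = j \<oplus> h \<otimes> x [^] k) \<Longrightarrow> y \<in> Idl X"
  shows "noetherian_ring R"
proof (rule noetherian_ringI, rule ccontr)
  define fg where "fg I \<longleftrightarrow> (\<exists>A\<subseteq>carrier R. finite A \<and> I = Idl A)" for I
  fix I0 assume I0: "ideal I0 R" "\<not> (\<exists>A\<subseteq>carrier R. finite A \<and> I0 = Idl A)"
  define F where "F = {I. ideal I R \<and> \<not> fg I}"
  have "\<exists>P\<in>F. \<forall>X\<in>F. P \<subseteq> X \<longrightarrow> X = P"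
  proof (rule subset_Zorn_nonempty)
    show "F \<noteq> {}" using I0 by (auto simp: F_def fg_def)
    fix C assume C: "C \<noteq> {}" "subset.chain F C"
    have "subset.chain {I. ideal I R} C"
      using C(2) by (auto simp: F_def subset_chain_def)
    from chain_Union_is_ideal[OF this] C(1) have U: "ideal (\<Union>C) R" by simp
    have "\<not> fg (\<Union>C)"
    proof
      assume "fg (\<Union>C)"
      then obtain A where A: "A \<subseteq> carrier R" "finite A" "\<Union>C = Idl A" unfolding fg_def by blast
      have "A \<subseteq> \<Union>C" using genideal_self[OF A(1)] A(3) by simp
      then obtain I where I: "I \<in> C" "A \<subseteq> I" using finite_subset_Union_chain[OF A(2) _ C] by metis
      have IF: "I \<in> F" using I C by (auto simp: subset_chain_def)
      then have "Idl A \<subseteq> I" using I(2) by (intro genideal_minimal) (auto simp: F_def)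
      then have "I = Idl A" using A(3) I(1) by blast
      then show False using IF A unfolding F_def fg_def by blast
    qed
    then show "\<Union>C \<in> F" using U by (simp add: F_def)
  qed
  then obtain P where PF: "P \<in> F" and Pmax: "\<forall>X\<in>F. P \<subseteq> X \<longrightarrow> X = P" by blast
  have P: "ideal P R" and nfg: "\<not> fg P" using PF by (auto simp: F_def)
  interpret P: ideal P R by fact
  have fgI: "fg K" if "ideal K R" "P \<subseteq> K" "K \<noteq> P" for K using that Pmax by (auto simp: F_def)
  have "fg (carrier R)" unfolding fg_def using genideal_one by (intro exI[of _ "{\<one>}"]) auto
  then have "P \<subseteq> Idl M" using nfg by (intro max P) blast
  \<comment> \<open>\<open>Idl M\<close> is finitely generated and \<open>P\<close> is not, so some
    \<open>x\<close> of \<open>Idl M\<close> lies outside \<open>P\<close>.\<close>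
  moreover have "P \<noteq> Idl M" using nfg m unfolding fg_def by blast
  ultimately obtain x where x: "x \<in> Idl M" "x \<notin> P" by blast
  have idM: "ideal (Idl M) R" by (rule genideal_ideal[OF m(2)])
  have xc: "x \<in> carrier R" using ideal.Icarr[OF idM x(1)] .
  have pl: "ideal {j \<oplus> h \<otimes> x | j h. j \<in> J \<and> h \<in> carrier R} R" if "ideal J R" for J
  proof -
    interpret M: module R "self_module R" by (rule self_module)
    have "submodule J R (self_module R)" using that by (simp only: submodule_self_module_iff)
    from M.submodule_sum_ideal[OF this oneideal, of x] have
      "submodule {s \<otimes> x \<oplus> j |s j. s \<in> carrier R \<and> j \<in> J} R (self_module R)" using xc by simp
    moreover have "{s \<otimes> x \<oplus> j |s j. s \<in> carrier R \<and> j \<in> J} = {j \<oplus> h \<otimes> x | j h. j \<in> J \<and> h \<in> carrier R}"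
    proof -
      have "s \<otimes> x \<oplus> j = j \<oplus> s \<otimes> x" if "s \<in> carrier R" "j \<in> J" for s j
        using that xc ideal.Icarr[OF \<open>ideal J R\<close>] by (intro a_comm) auto
      then show ?thesis by (auto; metis)
    qed
    ultimately show ?thesis by (simp only: submodule_self_module_iff)
  qed
  define Q where "Q = {j \<oplus> h \<otimes> x | j h. j \<in> P \<and> h \<in> carrier R}"
  have QI: "ideal Q R" unfolding Q_def by (rule pl[OF P])
  have PQ: "P \<subseteq> Q"
  proof
    fix p assume p: "p \<in> P"
    then have "p = p \<oplus> \<zero> \<otimes> x" using xc P.Icarr by simp
    then show "p \<in> Q" unfolding Q_def using p by blast
  qed
  have "\<zero> \<in> P" using additive_subgroup.zero_closed[OF P.is_additive_subgroup] .
  moreover have "x = \<zero> \<oplus> \<one> \<otimes> x" using xc by simp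
  ultimately have xQ: "x \<in> Q" unfolding Q_def by blast
  then have "fg Q" using fgI[OF QI PQ] x(2) by blast
  then obtain A where A: "A \<subseteq> carrier R" "finite A" "Q = Idl A" unfolding fg_def by blast
  have "\<forall>a\<in>A. \<exists>j h. j \<in> P \<and> h \<in> carrier R \<and> a = j \<oplus> h \<otimes> x"
  proof
    fix a assume "a \<in> A"
    then have "a \<in> Q" using genideal_self[OF A(1)] A(3) by blast
    then show "\<exists>j h. j \<in> P \<and> h \<in> carrier R \<and> a = j \<oplus> h \<otimes> x" unfolding Q_def by blast
  qed
  then obtain g g' where g: "\<And>a. a \<in> A \<Longrightarrow> g a \<in> P \<and> g' a \<in> carrier R \<and> a = g a \<oplus> g' a \<otimes> x" by metis
  define X where "X = g ` A"
  have X: "finite X" "X \<subseteq> P" "X \<subseteq> carrier R" using A(2) g P.Icarr by (auto simp: X_def)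
  define J where "J = Idl X"
  have J: "ideal J R" unfolding J_def by (rule genideal_ideal[OF X(3)])
  have JP: "J \<subseteq> P" unfolding J_def by (rule genideal_minimal[OF P X(2)])
  have "A \<subseteq> {j \<oplus> h \<otimes> x | j h. j \<in> J \<and> h \<in> carrier R}"
  proof
    fix a assume a: "a \<in> A"
    then have "g a \<in> J" using genideal_self[OF X(3)] by (auto simp: J_def X_def)
    then show "a \<in> {j \<oplus> h \<otimes> x | j h. j \<in> J \<and> h \<in> carrier R}" using g[OF a] by blast
  qed
  then have QJ: "Q \<subseteq> {j \<oplus> h \<otimes> x | j h. j \<in> J \<and> h \<in> carrier R}"
    unfolding A(3) by (rule genideal_minimal[OF pl[OF J]])
  define C where "C I = {h \<in> carrier R. h \<otimes> x \<in> I}" for I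
  have CI: "ideal (C I) R" if I: "ideal I R" for I
  proof -
    interpret I: ideal I R by fact
    show ?thesis
    proof (rule idealI[OF ring_axioms])
      show "subgroup (C I) (add_monoid R)"
      proof (rule add.subgroupI)
        show "C I \<noteq> {}" using xc additive_subgroup.zero_closed[OF I.is_additive_subgroup]
          by (auto simp: C_def intro!: exI[of _ \<zero>])
        show "\<ominus> a \<in> C I" if "a \<in> C I" for a
          using that xc additive_subgroup.a_inv_closed[OF I.is_additive_subgroup] by (auto simp: C_def l_minus)
        show "a \<oplus> b \<in> C I" if "a \<in> C I" "b \<in> C I" for a b
          using that xc additive_subgroup.a_closed[OF I.is_additive_subgroup] by (auto simp: C_def l_distr)
      qed (auto simp: C_def)
      show "y \<otimes> a \<in> C I" "a \<otimes> y \<in> C I" if "a \<in> C I" "y \<in> carrier R" for a y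
      proof -
        show *: "y \<otimes> a \<in> C I" using that xc I.I_l_closed by (auto simp: C_def m_assoc)
        then show "a \<otimes> y \<in> C I" using that by (auto simp: C_def m_comm)
      qed
    qed
  qed
  have dec: "\<exists>j\<in>J. \<exists>h\<in>C P. p = j \<oplus> h \<otimes> x" if p: "p \<in> P" for p
  proof -
    obtain j h where jh: "p = j \<oplus> h \<otimes> x" "j \<in> J" "h \<in> carrier R" using p PQ QJ by blast
    have jc: "j \<in> carrier R" using jh JP P.Icarr by blast
    have "h \<otimes> x = p \<ominus> j" unfolding jh(1) using jc jh(3) xc by algebra
    also have "\<dots> \<in> P" using p jh(2) JP additive_subgroup.a_closed[OF P.is_additive_subgroup]
        additive_subgroup.a_inv_closed[OF P.is_additive_subgroup] unfolding a_minus_def by blast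
    finally have "h \<in> C P" using jh(3) by (simp add: C_def)
    then show ?thesis using jh by blast
  qed
  have "C P = P"
  proof (rule ccontr)
    assume ne: "C P \<noteq> P"
    have "P \<subseteq> C P"
    proof
      fix p assume "p \<in> P"
      then show "p \<in> C P" using P.I_r_closed[of p x] xc P.Icarr[of p] by (simp add: C_def)
    qed
    then have "fg (C P)" using fgI[OF CI[OF P]] ne by blast
    then obtain B where B: "B \<subseteq> carrier R" "finite B" "C P = Idl B" unfolding fg_def by blast
    \<comment> \<open>If the colon ideal were larger than \<open>P\<close>, it would have a finite
      generating set \<open>B\<close>, and \<open>X\<close> together with the multiples of
      \<open>B\<close> by \<open>x\<close> would generate \<open>P\<close>.\<close>
    define Z where "Z = X \<union> (\<lambda>b. b \<otimes> x) ` B"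
    have "b \<otimes> x \<in> P" if "b \<in> B" for b
    proof -
      have "b \<in> C P" using genideal_self[OF B(1)] B(3) that by blast
      then show ?thesis by (simp add: C_def)
    qed
    then have ZP: "Z \<subseteq> P" using X(2) by (auto simp: Z_def)
    then have Zc: "Z \<subseteq> carrier R" using P.Icarr by blast
    have ZI: "ideal (Idl Z) R" by (rule genideal_ideal[OF Zc])
    have "B \<subseteq> C (Idl Z)" using genideal_self[OF Zc] B(1) by (auto simp: C_def Z_def)
    then have CZ: "C P \<subseteq> C (Idl Z)" unfolding B(3) by (rule genideal_minimal[OF CI[OF ZI]])
    have JZ: "J \<subseteq> Idl Z" unfolding J_def using genideal_self[OF Zc]
      by (intro genideal_minimal[OF ZI]) (auto simp: Z_def)
    have "P \<subseteq> Idl Z"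
    proof
      fix p assume "p \<in> P"
      then obtain j h where "j \<in> J" "h \<in> C P" "p = j \<oplus> h \<otimes> x" using dec by blast
      then show "p \<in> Idl Z"
        using JZ CZ additive_subgroup.a_closed[OF ideal.axioms(1)[OF ZI], of j "h \<otimes> x"] by (auto simp: C_def)
    qed
    then have "P = Idl Z" using genideal_minimal[OF P ZP] by blast
    moreover have "finite Z" using X(1) B(2) by (simp add: Z_def)
    ultimately show False using nfg Zc unfolding fg_def by blast
  qed
  then have dec': "\<exists>j\<in>J. \<exists>h\<in>P. p = j \<oplus> h \<otimes> x" if "p \<in> P" for p using dec[OF that] by simp
  have "\<exists>j\<in>J. \<exists>h\<in>P. p = j \<oplus> h \<otimes> x [^] k" if p: "p \<in> P" for p and k :: nat
  proof (induct k)
    case 0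
    have "p = \<zero> \<oplus> p \<otimes> x [^] (0::nat)" using P.Icarr[OF p] by simp
    moreover have "\<zero> \<in> J" using additive_subgroup.zero_closed[OF ideal.axioms(1)[OF J]] .
    ultimately show ?case using p by blast
  next
    case (Suc k)
    then obtain j h where jh: "j \<in> J" "h \<in> P" "p = j \<oplus> h \<otimes> x [^] k" by blast
    obtain j' h' where jh': "j' \<in> J" "h' \<in> P" "h = j' \<oplus> h' \<otimes> x" using dec'[OF jh(2)] by blast
    define y where "y = x [^] k"
    have c: "j \<in> carrier R" "j' \<in> carrier R" "h' \<in> carrier R" "y \<in> carrier R"
      using jh jh' JP P.Icarr xc by (auto simp: y_def)
    have "p = (j \<oplus> j' \<otimes> y) \<oplus> h' \<otimes> (y \<otimes> x)" unfolding jh(3) jh'(3) y_def[symmetric] using c xc by algebra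
    moreover have "j \<oplus> j' \<otimes> y \<in> J"
      using jh jh' ideal.I_r_closed[OF J] additive_subgroup.a_closed[OF ideal.axioms(1)[OF J]] c by blast
    ultimately show ?case using jh'(2) by (auto simp: y_def)
  qed
  note dk = this
  \<comment> \<open>The decompositions for all \<open>k\<close> say that \<open>p\<close> is
    arbitrarily close to \<open>J\<close>; the hypothesis \<open>closed\<close> concludes.\<close>
  have "p \<in> J" if p: "p \<in> P" for p
    unfolding J_def
  proof (rule closed[OF X(1,3) P.Icarr[OF p] x(1)])
    fix k :: nat
    obtain j h where "j \<in> J" "h \<in> P" "p = j \<oplus> h \<otimes> x [^] k" using dk[OF p, of k] by blast
    then show "\<exists>j\<in>Idl X. \<exists>h\<in>carrier R. p = j \<oplus> h \<otimes> x [^] k" using P.Icarr unfolding J_def by blast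
  qed
  then have "P = Idl X" using JP by (auto simp: J_def)
  then show False using nfg X unfolding fg_def by blast
qed

context henselization begin

text \<open>The closedness required by Cohen's argument is \<open>fg_ideal_closed\<close>: for
  \<open>x\<close> in \<open>mH\<close> some power of \<open>x\<close> lies in \<open>q H\<close>,
  whatever the primary ideal \<open>q\<close>.\<close>

theorem noetherian_H:
  assumes R: "noetherian_ring R" shows "noetherian_ring H"
proof -
  obtain A where A: "A \<subseteq> carrier R" "finite A" "mR = Idl\<^bsub>R\<^esub> A"
    using noetherian_ring.finetely_gen[OF R mR.is_ideal] by blast
  have Ac: "\<phi> ` A \<subseteq> carrier H" using A(1) by auto
  have I: "ideal (Idl\<^bsub>H\<^esub> (\<phi> ` A)) H" by (rule H.genideal_ideal[OF Ac])
  have "A \<subseteq> {r \<in> carrier R. \<phi> r \<in> Idl\<^bsub>H\<^esub> (\<phi> ` A)}" using H.genideal_self[OF Ac] A(1) by blast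
  then have "Idl\<^bsub>R\<^esub> A \<subseteq> {r \<in> carrier R. \<phi> r \<in> Idl\<^bsub>H\<^esub> (\<phi> ` A)}"
    by (rule R.genideal_minimal[OF \<phi>.ring.ideal_vimage[OF I]])
  then have "\<phi> ` mR \<subseteq> Idl\<^bsub>H\<^esub> (\<phi> ` A)" unfolding A(3) by blast
  then have "mH \<subseteq> Idl\<^bsub>H\<^esub> (\<phi> ` A)" unfolding mH_eq extH_eq by (rule H.genideal_minimal[OF I])
  moreover have "\<phi> ` A \<subseteq> mH" using R.genideal_self[OF A(1)] A(1,3) \<phi>_mem_iff by blast
  then have "Idl\<^bsub>H\<^esub> (\<phi> ` A) \<subseteq> mH" by (rule H.genideal_minimal[OF mH.is_ideal])
  ultimately have mH: "Idl\<^bsub>H\<^esub> (\<phi> ` A) = mH" by blast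
  show ?thesis
  proof (rule H.noetherian_of_closed_ideals[of "\<phi> ` A"], unfold mH)
    show "finite (\<phi> ` A)" "\<phi> ` A \<subseteq> carrier H" using A(2) Ac by auto
    show "P \<subseteq> mH" if P: "ideal P H" "P \<noteq> carrier H" for P
    proof
      interpret P: ideal P H by fact
      fix x assume x: "x \<in> P"
      have "x \<notin> Units H"
      proof
        assume "x \<in> Units H"
        then have "inv\<^bsub>H\<^esub> x \<otimes>\<^bsub>H\<^esub> x \<in> P" using x by (intro P.I_l_closed) auto
        then show False using \<open>x \<in> Units H\<close> P(2) P.one_imp_carrier by simp
      qed
      then show "x \<in> mH" using Units_H_iff[OF P.Icarr[OF x]] by blast
    qed
    fix X y x
    assume X: "finite X" "X \<subseteq> carrier H" and y: "y \<in> carrier H" and x: "x \<in> mH"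
      and a: "\<And>k::nat. \<exists>j\<in>Idl\<^bsub>H\<^esub> X. \<exists>h\<in>carrier H. y = j \<oplus>\<^bsub>H\<^esub> h \<otimes>\<^bsub>H\<^esub> x [^]\<^bsub>H\<^esub> k"
    show "y \<in> Idl\<^bsub>H\<^esub> X"
    proof (rule fg_ideal_closed[OF R X y])
      fix q assume q: "q \<in> primary_ideals R"
      obtain k :: nat where k: "x [^]\<^bsub>H\<^esub> k \<in> extH q" using primary_power[OF q x] by blast
      obtain j h where "j \<in> Idl\<^bsub>H\<^esub> X" "h \<in> carrier H" "y = j \<oplus>\<^bsub>H\<^esub> h \<otimes>\<^bsub>H\<^esub> x [^]\<^bsub>H\<^esub> k" using a by blast
      then show "\<exists>j\<in>Idl\<^bsub>H\<^esub> X. \<exists>z\<in>extH q. y = j \<oplus>\<^bsub>H\<^esub> z"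
        using ideal.I_l_closed[OF extH_ideal(1)[OF primary_carrier[OF q]] k] by blast
    qed
  qed
qed

end

section \<open>Free modules and flatness of the Henselization\<close>

text \<open>Vectors are functions that vanish from \<open>p\<close> on. Equality of vectors is then
  equality of functions, and all ranks share one type.\<close>

definition fm :: "('a, 'm) ring_scheme \<Rightarrow> nat \<Rightarrow> ('a, nat \<Rightarrow> 'a) module" where
  "fm A p = \<lparr>carrier = {v. (\<forall>i<p. v i \<in> carrier A) \<and> (\<forall>i\<ge>p. v i = \<zero>\<^bsub>A\<^esub>)}, mult = undefined, one = undefined,
     zero = (\<lambda>_. \<zero>\<^bsub>A\<^esub>), add = (\<lambda>v w i. v i \<oplus>\<^bsub>A\<^esub> w i), smult = (\<lambda>a v i. a \<otimes>\<^bsub>A\<^esub> v i)\<rparr>"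

lemma fm_simps [simp]:
  "\<zero>\<^bsub>fm A p\<^esub> = (\<lambda>_. \<zero>\<^bsub>A\<^esub>)" "v \<oplus>\<^bsub>fm A p\<^esub> w = (\<lambda>i. v i \<oplus>\<^bsub>A\<^esub> w i)" "a \<odot>\<^bsub>fm A p\<^esub> v = (\<lambda>i. a \<otimes>\<^bsub>A\<^esub> v i)"
  by (simp_all add: fm_def)

lemma mem_fm_iff: "v \<in> carrier (fm A p) \<longleftrightarrow> (\<forall>i<p. v i \<in> carrier A) \<and> (\<forall>i\<ge>p. v i = \<zero>\<^bsub>A\<^esub>)"
  by (simp add: fm_def)

lemma (in cring) mem_fm_closed [simp]: "v \<in> carrier (fm R p) \<Longrightarrow> v i \<in> carrier R"
  by (cases "i < p") (auto simp: mem_fm_iff)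

lemma (in cring) fm_module: "module R (fm R p)"
proof (rule moduleI[OF cring_axioms])
  show "abelian_group (fm R p)"
  proof (rule abelian_groupI)
    show "\<exists>w\<in>carrier (fm R p). w \<oplus>\<^bsub>fm R p\<^esub> v = \<zero>\<^bsub>fm R p\<^esub>" if "v \<in> carrier (fm R p)" for v
      using that by (intro bexI[of _ "\<lambda>i. \<ominus> v i"]) (auto simp: mem_fm_iff l_neg fun_eq_iff not_le[symmetric])
  qed (auto simp: mem_fm_iff fun_eq_iff a_ac)
qed (auto simp: mem_fm_iff fun_eq_iff l_distr r_distr m_assoc)

definition unit_vec :: "('a, 'm) ring_scheme \<Rightarrow> nat \<Rightarrow> nat \<Rightarrow> 'a" where
  "unit_vec A j = (\<lambda>i. if i = j then \<one>\<^bsub>A\<^esub> else \<zero>\<^bsub>A\<^esub>)"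

lemma (in cring) unit_vec_closed [simp]: "j < p \<Longrightarrow> unit_vec R j \<in> carrier (fm R p)"
  by (auto simp: unit_vec_def mem_fm_iff)

text \<open>For a free module \<open>M\<close> this is the matrix with columns \<open>x i\<close>,
  applied to the vector \<open>v\<close>.\<close>

primrec lc :: "('a, 'b, 'k) module_scheme \<Rightarrow> (nat \<Rightarrow> 'b) \<Rightarrow> nat \<Rightarrow> (nat \<Rightarrow> 'a) \<Rightarrow> 'b" where
  "lc M x 0 v = \<zero>\<^bsub>M\<^esub>"
| "lc M x (Suc p) v = lc M x p v \<oplus>\<^bsub>M\<^esub> v p \<odot>\<^bsub>M\<^esub> x p"

lemma lc_cong:
  "(\<And>i. i < p \<Longrightarrow> x i = y i) \<Longrightarrow> (\<And>i. i < p \<Longrightarrow> v i = w i) \<Longrightarrow> lc M x p v = lc M y p w"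
  by (induct p) auto

context module begin

lemma lc_closed [simp]:
  "(\<And>i. i < p \<Longrightarrow> x i \<in> carrier M) \<Longrightarrow> (\<And>i. i < p \<Longrightarrow> v i \<in> carrier R) \<Longrightarrow> lc M x p v \<in> carrier M"
  by (induct p) auto

lemma lc_in_submodule:
  "submodule N R M \<Longrightarrow> (\<And>i. i < p \<Longrightarrow> v i \<odot>\<^bsub>M\<^esub> x i \<in> N) \<Longrightarrow> lc M x p v \<in> N"
  by (induct p) (auto simp: submoduleD)

lemma lc_add:
  assumes "\<And>i. i < p \<Longrightarrow> x i \<in> carrier M" "\<And>i. i < p \<Longrightarrow> v i \<in> carrier R" "\<And>i. i < p \<Longrightarrow> w i \<in> carrier R"
  shows "lc M x p (\<lambda>i. v i \<oplus> w i) = lc M x p v \<oplus>\<^bsub>M\<^esub> lc M x p w"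
  using assms
proof (induct p)
  case (Suc p)
  have c: "lc M x p v \<in> carrier M" "lc M x p w \<in> carrier M" "v p \<odot>\<^bsub>M\<^esub> x p \<in> carrier M" "w p \<odot>\<^bsub>M\<^esub> x p \<in> carrier M"
    using Suc.prems by simp_all
  have "lc M x p (\<lambda>i. v i \<oplus> w i) = lc M x p v \<oplus>\<^bsub>M\<^esub> lc M x p w" using Suc by simp
  then show ?case using c Suc.prems by (simp add: smult_l_distr M.a_ac)
qed simp

lemma lc_smult:
  assumes "\<And>i. i < p \<Longrightarrow> x i \<in> carrier M" "\<And>i. i < p \<Longrightarrow> v i \<in> carrier R" "a \<in> carrier R"
  shows "lc M x p (\<lambda>i. a \<otimes> v i) = a \<odot>\<^bsub>M\<^esub> lc M x p v"
  using assms by (induct p) (simp_all add: smult_r_distr smult_assoc1)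

lemma lc_zero:
  assumes "\<And>i. i < p \<Longrightarrow> x i \<in> carrier M" "\<And>i. i < p \<Longrightarrow> v i = \<zero>"
  shows "lc M x p v = \<zero>\<^bsub>M\<^esub>"
  using assms by (induct p) simp_all

lemma lc_unit_vec:
  assumes "\<And>i. i < p \<Longrightarrow> x i \<in> carrier M" "j < p"
  shows "lc M x p (unit_vec R j) = x j"
  using assms
proof (induct p)
  case (Suc p)
  show ?case
  proof (cases "j = p")
    case True
    have "lc M x p (unit_vec R j) = \<zero>\<^bsub>M\<^esub>" using Suc.prems True by (intro lc_zero) (auto simp: unit_vec_def)
    then show ?thesis using Suc.prems True by (simp add: unit_vec_def)
  next
    case False
    then have "lc M x p (unit_vec R j) = x j" using Suc by simp
    then show ?thesis using Suc.prems False by (simp add: unit_vec_def)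
  qed
qed simp

end

lemma lc_module_hom:
  assumes "module R M" "\<And>i. i < p \<Longrightarrow> x i \<in> carrier M"
  shows "lc M x p \<in> module_hom R (fm R p) M"
proof -
  interpret module R M by fact
  show ?thesis unfolding module_hom_def using assms by (auto simp: mem_fm_iff lc_add lc_smult)
qed

lemma module_homD:
  assumes "f \<in> module_hom R M N"
  shows "\<And>x. x \<in> carrier M \<Longrightarrow> f x \<in> carrier N"
    "\<And>x y. x \<in> carrier M \<Longrightarrow> y \<in> carrier M \<Longrightarrow> f (x \<oplus>\<^bsub>M\<^esub> y) = f x \<oplus>\<^bsub>N\<^esub> f y"
    "\<And>a x. a \<in> carrier R \<Longrightarrow> x \<in> carrier M \<Longrightarrow> f (a \<odot>\<^bsub>M\<^esub> x) = a \<odot>\<^bsub>N\<^esub> f x"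
  using assms by (auto simp: module_hom_def)

lemma module_hom_zero:
  assumes "module R M" "module R N" "f \<in> module_hom R M N" shows "f \<zero>\<^bsub>M\<^esub> = \<zero>\<^bsub>N\<^esub>"
proof -
  interpret M: module R M by fact
  interpret N: module R N by fact
  have "f (\<zero>\<^bsub>R\<^esub> \<odot>\<^bsub>M\<^esub> \<zero>\<^bsub>M\<^esub>) = \<zero>\<^bsub>R\<^esub> \<odot>\<^bsub>N\<^esub> f \<zero>\<^bsub>M\<^esub>" by (rule module_homD(3)[OF assms(3)]) auto
  then show ?thesis using module_homD(1)[OF assms(3), of "\<zero>\<^bsub>M\<^esub>"] by simp
qed

lemma module_hom_minus:
  assumes "module R M" "module R N" "f \<in> module_hom R M N" "x \<in> carrier M"
  shows "f (\<ominus>\<^bsub>M\<^esub> x) = \<ominus>\<^bsub>N\<^esub> f x"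
proof -
  interpret M: module R M by fact
  interpret N: module R N by fact
  have "f ((\<ominus>\<^bsub>R\<^esub> \<one>\<^bsub>R\<^esub>) \<odot>\<^bsub>M\<^esub> x) = (\<ominus>\<^bsub>R\<^esub> \<one>\<^bsub>R\<^esub>) \<odot>\<^bsub>N\<^esub> f x"
    using assms(4) by (intro module_homD(3)[OF assms(3)]) auto
  then show ?thesis using module_homD(1)[OF assms(3)] assms(4) by (simp add: M.smult_l_minus N.smult_l_minus)
qed

lemma module_hom_comp:
  "f \<in> module_hom R M N \<Longrightarrow> g \<in> module_hom R N K \<Longrightarrow> (\<lambda>x. g (f x)) \<in> module_hom R M K"
  by (simp add: module_hom_def Pi_iff)

lemma module_hom_lc:
  assumes "module R M" "module R N" "f \<in> module_hom R M N"
    and "\<And>i. i < p \<Longrightarrow> x i \<in> carrier M" "\<And>i. i < p \<Longrightarrow> v i \<in> carrier R"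
  shows "f (lc M x p v) = lc N (\<lambda>i. f (x i)) p v"
proof -
  interpret M: module R M by fact
  interpret N: module R N by fact
  show ?thesis using assms(4,5)
    by (induct p) (simp_all add: module_hom_zero[OF assms(1-3)] module_homD[OF assms(3)])
qed

lemma (in cring) fm_lc_apply:
  assumes "\<And>i. i < q \<Longrightarrow> v i \<in> carrier R"
  shows "lc (fm R p) x q v i = lc (self_module R) (\<lambda>k. x k i) q v"
  using assms by (induct q) simp_all

lemma (in cring) lc_unit_vecs:
  assumes v: "v \<in> carrier (fm R p)"
  shows "lc (fm R p) (unit_vec R) p v = v"
proof
  interpret M: module R "self_module R" by (rule self_module)
  fix i
  have "lc (self_module R) (\<lambda>k. unit_vec R k i) q v = (if i < q then v i else \<zero>)" if "q \<le> p" for q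
    using that v by (induct q) (auto simp: unit_vec_def less_Suc_eq)
  then show "lc (fm R p) (unit_vec R) p v i = v i"
    using v by (subst fm_lc_apply) (auto simp: mem_fm_iff not_less)
qed

text \<open>Provides the matrix of a homomorphism, which is what base change acts on.\<close>

lemma fm_hom_eq_lc:
  assumes "module R M" "f \<in> module_hom R (fm R p) M" "v \<in> carrier (fm R p)"
  shows "f v = lc M (\<lambda>i. f (unit_vec R i)) p v"
proof -
  interpret M: module R M by fact
  have "f (lc (fm R p) (unit_vec R) p v) = lc M (\<lambda>i. f (unit_vec R i)) p v"
    using assms(3) by (intro module_hom_lc[OF M.R.fm_module assms(1,2)]) auto
  then show ?thesis using M.R.lc_unit_vecs[OF assms(3)] by simp
qed

lemma image_submodule:
  assumes M: "module R M" and N: "module R N" and f: "f \<in> module_hom R N M" and K: "submodule K R N"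
  shows "submodule (f ` K) R M"
proof -
  interpret module R M by fact
  interpret N: module R N by fact
  note k = N.submoduleD[OF K] and h = module_homD[OF f]
  have kc: "x \<in> carrier N" if "x \<in> K" for x using that k(1) by blast
  show ?thesis
  proof (rule submoduleI)
    show "f ` K \<subseteq> carrier M" using kc h(1) by blast
    show "\<zero>\<^bsub>M\<^esub> \<in> f ` K" unfolding module_hom_zero[OF N M f, symmetric] by (rule imageI[OF k(5)])
    fix a assume "a \<in> f ` K"
    then obtain x where x: "a = f x" "x \<in> K" by (rule imageE)
    show "\<ominus>\<^bsub>M\<^esub> a \<in> f ` K"
      unfolding x(1) module_hom_minus[OF N M f kc[OF x(2)], symmetric] by (rule imageI[OF k(2)[OF x(2)]])
    { fix b assume "b \<in> f ` K"
      then obtain y where y: "b = f y" "y \<in> K" by (rule imageE)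
      show "a \<oplus>\<^bsub>M\<^esub> b \<in> f ` K"
        unfolding x(1) y(1) h(2)[OF kc[OF x(2)] kc[OF y(2)], symmetric] by (rule imageI[OF k(4)[OF x(2) y(2)]]) }
    { fix c assume c: "c \<in> carrier R"
      show "c \<odot>\<^bsub>M\<^esub> a \<in> f ` K"
        unfolding x(1) h(3)[OF c kc[OF x(2)], symmetric] by (rule imageI[OF k(3)[OF c x(2)]]) }
  qed
qed

lemma vimage_submodule:
  assumes M: "module R M" and N: "module R N" and f: "f \<in> module_hom R M N" and K: "submodule K R N"
  shows "submodule {x \<in> carrier M. f x \<in> K} R M"
proof -
  interpret module R M by fact
  interpret N: module R N by fact
  note k = N.submoduleD[OF K] and h = module_homD[OF f]
  show ?thesis
    by (rule submoduleI) (auto simp: h k module_hom_zero[OF M N f] module_hom_minus[OF M N f])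
qed

lemma (in module) zero_submodule: "submodule {\<zero>\<^bsub>M\<^esub>} R M"
  by (rule submoduleI) auto

lemma mspan_eq_image_lc:
  fixes M :: "('a, 'b) module"
  assumes M: "module R M" and x: "\<And>i. i < p \<Longrightarrow> x i \<in> carrier M"
  shows "mspan R M (x ` {..<p}) = lc M x p ` carrier (fm R p)"
proof
  interpret module R M by fact
  interpret F: module R "fm R p" by (rule R.fm_module)
  have h: "lc M x p \<in> module_hom R (fm R p) M" by (rule lc_module_hom[OF M x])
  have s: "submodule (lc M x p ` carrier (fm R p)) R M"
    by (rule image_submodule[OF M F.module_axioms h F.carrier_is_submodule])
  have "x ` {..<p} \<subseteq> lc M x p ` carrier (fm R p)"
  proof (rule image_subsetI)
    fix j assume "j \<in> {..<p}"
    then have j: "j < p" by simp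
    have "x j = lc M x p (unit_vec R j)" using lc_unit_vec[of p x j] x j by simp
    then show "x j \<in> lc M x p ` carrier (fm R p)" using R.unit_vec_closed[OF j] by blast
  qed
  then show "mspan R M (x ` {..<p}) \<subseteq> lc M x p ` carrier (fm R p)" by (rule mspan_subset[OF s])
  have xc: "x ` {..<p} \<subseteq> carrier M" using x by auto
  note sp = mspan_submodule[OF xc]
  show "lc M x p ` carrier (fm R p) \<subseteq> mspan R M (x ` {..<p})"
  proof (rule image_subsetI)
    fix v assume "v \<in> carrier (fm R p)"
    then show "lc M x p v \<in> mspan R M (x ` {..<p})"
      using mspan_superset[OF xc] by (intro lc_in_submodule[OF sp] submoduleD(3)[OF sp]) auto
  qed
qed

lemma noeth_submodule_image_lc:
  fixes M :: "('a, 'b) module"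
  assumes M: "module R M" and N: "module.noeth_module R M" "submodule N R M"
  obtains p x where "\<And>i. i < p \<Longrightarrow> x i \<in> N" "N = lc M x p ` carrier (fm R p)"
proof -
  interpret module R M by fact
  obtain X where X: "finite X" "X \<subseteq> N" "N = mspan R M X" using N unfolding noeth_module_def by blast
  obtain p :: nat and x where x: "X = x ` {i. i < p}"
    using finite_imp_nat_seg_image_inj_on[OF X(1)] by metis
  have xX: "x i \<in> X" if "i < p" for i using that x by blast
  have "x i \<in> carrier M" if "i < p" for i using xX[OF that] X(2) submoduleE(1)[OF N(2)] by blast
  then have "mspan R M (x ` {..<p}) = lc M x p ` carrier (fm R p)" by (rule mspan_eq_image_lc[OF M])
  moreover have "x ` {..<p} = X" by (simp add: x lessThan_def)
  ultimately show ?thesis using that[of p x] xX X by blast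
qed

context module begin

text \<open>The annihilator of the quotient \<open>M / U\<close>.\<close>

definition colon :: "'c set \<Rightarrow> 'a set" where
  "colon U = {r \<in> carrier R. \<forall>z\<in>carrier M. r \<odot>\<^bsub>M\<^esub> z \<in> U}"

lemma colon_ideal:
  assumes U: "submodule U R M" shows "ideal (colon U) R"
proof (rule idealI[OF R.ring_axioms])
  note u = submoduleD[OF U]
  show "subgroup (colon U) (add_monoid R)"
  proof (rule R.add.subgroupI)
    show "colon U \<noteq> {}" using u(5) by (auto simp: colon_def intro!: exI[of _ \<zero>])
  qed (auto simp: colon_def smult_l_distr smult_l_minus u)
  show "x \<otimes> a \<in> colon U" "a \<otimes> x \<in> colon U" if "a \<in> colon U" "x \<in> carrier R" for a x
    using that u(3) by (auto simp: colon_def smult_assoc1)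
qed

end

lemma (in cring) fm_mem_colon:
  assumes U: "submodule U R (fm R p)" and v: "v \<in> carrier (fm R p)"
    and c: "\<And>i. i < p \<Longrightarrow> v i \<in> module.colon R (fm R p) U"
  shows "v \<in> U"
proof -
  interpret F: module R "fm R p" by (rule fm_module)
  have "lc (fm R p) (unit_vec R) p v \<in> U"
  proof (rule F.lc_in_submodule[OF U])
    fix i assume "i < p"
    then show "v i \<odot>\<^bsub>fm R p\<^esub> unit_vec R i \<in> U" using c[of i] unit_vec_closed[of i p] unfolding F.colon_def by blast
  qed
  then show ?thesis by (simp only: lc_unit_vecs[OF v])
qed

lemma (in cring) fm_noeth:
  assumes "noetherian_ring R" shows "module.noeth_module R (fm R p)"
proof -
  interpret F: module R "fm R p" by (rule fm_module)
  have e: "mspan R (fm R p) (unit_vec R ` {..<p}) = lc (fm R p) (unit_vec R) p ` carrier (fm R p)"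
    by (rule mspan_eq_image_lc[OF F.module_axioms]) simp
  show ?thesis
  proof (rule F.noeth_moduleI[OF assms, of "unit_vec R ` {..<p}"])
    show "carrier (fm R p) \<subseteq> mspan R (fm R p) (unit_vec R ` {..<p})"
      unfolding e using lc_unit_vecs by (metis imageI subsetI)
  qed auto
qed

section \<open>Linear equations over the Henselization\<close>

context henselization begin

lemma \<phi>_fm [simp]: "v \<in> carrier (fm R p) \<Longrightarrow> (\<lambda>i. \<phi> (v i)) \<in> carrier (fm H p)"
  by (auto simp: mem_fm_iff)

lemma \<phi>_lc:
  assumes "\<And>k. k < q \<Longrightarrow> D k \<in> carrier (fm R p)" "\<And>k. k < q \<Longrightarrow> v k \<in> carrier R"
  shows "(\<lambda>i. \<phi> (lc (fm R p) D q v i)) = lc (fm H p) (\<lambda>k i. \<phi> (D k i)) q (\<lambda>k. \<phi> (v k))"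
  using assms
proof (induct q)
  case (Suc q)
  interpret F: module R "fm R p" by (rule R.fm_module)
  have c: "lc (fm R p) D q v \<in> carrier (fm R p)" "D q \<in> carrier (fm R p)" "v q \<in> carrier R"
    using Suc.prems by simp_all
  have "(\<lambda>i. \<phi> (lc (fm R p) D q v i)) = lc (fm H p) (\<lambda>k i. \<phi> (D k i)) q (\<lambda>k. \<phi> (v k))" using Suc by simp
  then show ?case using c by (simp add: fun_eq_iff)
qed simp

lemma primary_Int:
  assumes "p \<in> primary_ideals R" "q \<in> primary_ideals R" shows "p \<inter> q \<in> primary_ideals R"
proof -
  have "ideal (p \<inter> q) R" using assms R.i_intersect by (simp add: primary_ideals_def)
  moreover have "\<exists>k::nat. x [^]\<^bsub>R\<^esub> k \<in> p \<inter> q" if x: "x \<in> mR" for x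
  proof -
    have xc: "x \<in> carrier R" using x mR.Icarr by blast
    obtain k l :: nat where "x [^]\<^bsub>R\<^esub> k \<in> p" "x [^]\<^bsub>R\<^esub> l \<in> q" using assms x unfolding primary_ideals_def by blast
    then have "x [^]\<^bsub>R\<^esub> k \<otimes>\<^bsub>R\<^esub> x [^]\<^bsub>R\<^esub> l \<in> p \<inter> q"
      using assms ideal.I_l_closed ideal.I_r_closed xc unfolding primary_ideals_def by fastforce
    then show ?thesis using xc by (auto simp: R.nat_pow_mult)
  qed
  ultimately show ?thesis unfolding primary_ideals_def by blast
qed

text \<open>Modulo \<open>U\<close>, which contains a primary multiple of the free module, the solution \<open>y\<close> is congruent to
  a vector \<open>a\<close> over \<open>R\<close>. The congruence can be chosen so fine that \<open>D a\<close> lies in \<open>V\<close>, and then \<open>a\<close> differs from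
  a solution over \<open>R\<close> by a vector in \<open>U\<close>.\<close>

theorem flatness:
  assumes R: "noetherian_ring R" and D: "\<And>k. k < q \<Longrightarrow> D k \<in> carrier (fm R p)"
    and y: "y \<in> carrier (fm H q)" and y0: "lc (fm H p) (\<lambda>k i. \<phi> (D k i)) q y = \<zero>\<^bsub>fm H p\<^esub>"
  shows "y \<in> mspan H (fm H q) ((\<lambda>v i. \<phi> (v i)) ` {v \<in> carrier (fm R q). lc (fm R p) D q v = \<zero>\<^bsub>fm R p\<^esub>})"
    (is "y \<in> mspan H _ (?\<phi> ` ?Kr)")
proof (rule ccontr)
  interpret FRq: module R "fm R q" by (rule R.fm_module)
  interpret FRp: module R "fm R p" by (rule R.fm_module)
  interpret FHq: module H "fm H q" by (rule H.fm_module)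
  interpret FHp: module H "fm H p" by (rule H.fm_module)
  let ?J = "mspan H (fm H q) (?\<phi> ` ?Kr)" and ?D = "lc (fm R p) D q" and ?\<phi>D = "lc (fm H p) (\<lambda>k i. \<phi> (D k i)) q"
  have hD: "?D \<in> module_hom R (fm R q) (fm R p)" using D by (rule lc_module_hom[OF FRp.module_axioms])
  have h\<phi>D: "?\<phi>D \<in> module_hom H (fm H q) (fm H p)" using D by (intro lc_module_hom[OF FHp.module_axioms]) simp
  note D' = module_homD[OF hD] and \<phi>D' = module_homD[OF h\<phi>D]
  have Jc: "?\<phi> ` ?Kr \<subseteq> carrier (fm H q)" by auto
  have sJ: "submodule ?J H (fm H q)" by (rule FHq.mspan_submodule[OF Jc])
  assume "y \<notin> ?J"
  then obtain U where U: "submodule U H (fm H q)" "?J \<subseteq> U" "y \<notin> U"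
    and pow: "\<And>x. x \<in> mH \<Longrightarrow> \<exists>k::nat. \<forall>z\<in>carrier (fm H q). x [^]\<^bsub>H\<^esub> k \<odot>\<^bsub>fm H q\<^esub> z \<in> U"
    by (rule FHq.Krull_intersection[OF local_H H.fm_noeth[OF noetherian_H[OF R]] sJ y]) (rule that)
  define C where "C = FHq.colon U"
  have C: "ideal C H" unfolding C_def by (rule FHq.colon_ideal[OF U(1)])
  \<comment> \<open>Vectors over \<open>H\<close> with entries in \<open>q0 H\<close> lie in
    \<open>U\<close>; the error terms below are kept inside \<open>q0 H\<close>.\<close>
  define q0 where "q0 = {r \<in> carrier R. \<phi> r \<in> C}"
  have "ideal q0 R" unfolding q0_def by (rule \<phi>.ring.ideal_vimage[OF C])
  moreover have "\<exists>k::nat. x [^]\<^bsub>R\<^esub> k \<in> q0" if x: "x \<in> mR" for x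
  proof -
    have xc: "x \<in> carrier R" using x mR.Icarr by blast
    have "\<phi> x \<in> mH" using \<phi>_mem_iff[OF xc] x by blast
    then obtain k :: nat where "\<forall>z\<in>carrier (fm H q). \<phi> x [^]\<^bsub>H\<^esub> k \<odot>\<^bsub>fm H q\<^esub> z \<in> U" using pow by blast
    then have "\<phi> x [^]\<^bsub>H\<^esub> k \<in> C" unfolding C_def FHq.colon_def using \<phi>.hom_closed[OF xc] by blast
    then have "\<phi> (x [^]\<^bsub>R\<^esub> k) \<in> C" using \<phi>.ring.hom_nat_pow[OF xc] by metis
    then show ?thesis using xc unfolding q0_def by blast
  qed
  ultimately have q0: "q0 \<in> primary_ideals R" unfolding primary_ideals_def by blast
  interpret q0: ideal q0 R using q0 by (simp add: primary_ideals_def)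
  have extC: "extH q0 \<subseteq> C" 
  proof -
    have "\<phi> ` q0 \<subseteq> C" unfolding q0_def by blast
    then show ?thesis unfolding extH_eq by (rule H.genideal_minimal[OF C])
  qed
  define Q where "Q = {v \<in> carrier (fm R q). \<forall>i. v i \<in> q0}"
  have z0: "\<zero>\<^bsub>R\<^esub> \<in> q0" using additive_subgroup.zero_closed[OF q0.is_additive_subgroup] .
  have sQ: "submodule Q R (fm R q)"
  proof (rule FRq.submoduleI)
    show Qc: "Q \<subseteq> carrier (fm R q)" by (auto simp: Q_def)
    show "\<zero>\<^bsub>fm R q\<^esub> \<in> Q" using z0 by (auto simp: Q_def mem_fm_iff)
    show add: "a \<oplus>\<^bsub>fm R q\<^esub> b \<in> Q" if "a \<in> Q" "b \<in> Q" for a b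
      using that FRq.M.a_closed[of a b] additive_subgroup.a_closed[OF q0.is_additive_subgroup] by (auto simp: Q_def)
    show sm: "a \<odot>\<^bsub>fm R q\<^esub> x \<in> Q" if "a \<in> carrier R" "x \<in> Q" for a x
      using that FRq.smult_closed[of a x] q0.I_l_closed by (auto simp: Q_def)
    show "\<ominus>\<^bsub>fm R q\<^esub> a \<in> Q" if "a \<in> Q" for a
    proof -
      have "\<ominus>\<^bsub>fm R q\<^esub> a = (\<ominus>\<^bsub>R\<^esub> \<one>\<^bsub>R\<^esub>) \<odot>\<^bsub>fm R q\<^esub> a" using that Qc by (subst FRq.smult_l_minus) auto
      then show ?thesis using sm[of "\<ominus>\<^bsub>R\<^esub> \<one>\<^bsub>R\<^esub>" a] that by simp
    qed
  qed
  \<comment> \<open>Weak Artin-Rees is applied in the target: a vector in the image of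
    \<open>?D\<close> that lies deep enough is the image of a vector with entries in
    \<open>q0\<close>.\<close>
  define W W0 where "W = ?D ` carrier (fm R q)" and "W0 = ?D ` Q"
  have sW: "submodule W R (fm R p)" unfolding W_def
    by (rule image_submodule[OF FRp.module_axioms FRq.module_axioms hD FRq.carrier_is_submodule])
  have sW0: "submodule W0 R (fm R p)" unfolding W0_def
    by (rule image_submodule[OF FRp.module_axioms FRq.module_axioms hD sQ])
  have WW: "W0 \<subseteq> W" unfolding W_def W0_def Q_def by blast
  have nil: "\<exists>n::nat. \<forall>w\<in>W. x [^]\<^bsub>R\<^esub> n \<odot>\<^bsub>fm R p\<^esub> w \<in> W0" if x: "x \<in> mR" for x
  proof -
    have xc: "x \<in> carrier R" using x mR.Icarr by blast
    obtain n :: nat where n: "x [^]\<^bsub>R\<^esub> n \<in> q0" using q0 x unfolding primary_ideals_def by blast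
    have "x [^]\<^bsub>R\<^esub> n \<odot>\<^bsub>fm R p\<^esub> ?D v \<in> W0" if v: "v \<in> carrier (fm R q)" for v
    proof -
      have "x [^]\<^bsub>R\<^esub> n \<odot>\<^bsub>fm R q\<^esub> v \<in> Q"
        using v FRq.smult_closed[of "x [^]\<^bsub>R\<^esub> n" v] xc q0.I_r_closed[OF n] unfolding Q_def by simp
      moreover have "x [^]\<^bsub>R\<^esub> n \<odot>\<^bsub>fm R p\<^esub> ?D v = ?D (x [^]\<^bsub>R\<^esub> n \<odot>\<^bsub>fm R q\<^esub> v)"
        using D'(3)[OF _ v, of "x [^]\<^bsub>R\<^esub> n"] xc by simp
      ultimately show ?thesis unfolding W0_def by (metis imageI)
    qed
    then show ?thesis unfolding W_def by blast
  qed
  have mRc: "mR \<subseteq> carrier R" using mR.Icarr by blast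
  obtain V where V: "submodule V R (fm R p)" "V \<inter> W = W0"
    and Vpow: "\<And>x. x \<in> mR \<Longrightarrow> \<exists>k::nat. \<forall>z\<in>carrier (fm R p). x [^]\<^bsub>R\<^esub> k \<odot>\<^bsub>fm R p\<^esub> z \<in> V"
    by (rule FRp.weak_Artin_Rees[OF R.fm_noeth[OF R] sW sW0 WW mRc nil]) (auto intro: that)
  have "FRp.colon V \<in> primary_ideals R"
    using FRp.colon_ideal[OF V(1)] Vpow mRc unfolding primary_ideals_def FRp.colon_def by fastforce
  then have q1: "FRp.colon V \<inter> q0 \<in> primary_ideals R" by (rule primary_Int[OF _ q0])
  \<comment> \<open>The first factor forces \<open>?D a\<close> into \<open>V\<close>, the second
    keeps the error \<open>b\<close> inside \<open>U\<close>.\<close>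
  define q1 where "q1 = FRp.colon V \<inter> q0"
  note q1 = q1[folded q1_def]
  have E: "ideal (extH q1) H" by (rule extH_ideal(1)[OF primary_carrier[OF q1]])
  have "\<forall>i. \<exists>r z. r \<in> carrier R \<and> z \<in> extH q1 \<and> y i = \<phi> r \<oplus>\<^bsub>H\<^esub> z \<and> (i \<ge> q \<longrightarrow> r = \<zero>\<^bsub>R\<^esub> \<and> z = \<zero>\<^bsub>H\<^esub>)"
  proof
    fix i
    show "\<exists>r z. r \<in> carrier R \<and> z \<in> extH q1 \<and> y i = \<phi> r \<oplus>\<^bsub>H\<^esub> z \<and> (i \<ge> q \<longrightarrow> r = \<zero>\<^bsub>R\<^esub> \<and> z = \<zero>\<^bsub>H\<^esub>)"
    proof (cases "i < q")
      case True
      obtain r z where "r \<in> carrier R" "z \<in> extH q1" "y i = \<phi> r \<oplus>\<^bsub>H\<^esub> z"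
        by (rule H_approx[OF q1 H.mem_fm_closed[OF y]])
      then show ?thesis using True by auto
    next
      case False
      then show ?thesis using y H_ideal_props(2)[OF E]
        by (intro exI[of _ "\<zero>\<^bsub>R\<^esub>"] exI[of _ "\<zero>\<^bsub>H\<^esub>"]) (auto simp: mem_fm_iff)
    qed
  qed
  then obtain a b where ab: "\<And>i. a i \<in> carrier R" "\<And>i. b i \<in> extH q1" "\<And>i. y i = \<phi> (a i) \<oplus>\<^bsub>H\<^esub> b i"
    "\<And>i. i \<ge> q \<Longrightarrow> a i = \<zero>\<^bsub>R\<^esub>" "\<And>i. i \<ge> q \<Longrightarrow> b i = \<zero>\<^bsub>H\<^esub>" by metis
  have bc: "b i \<in> carrier H" for i using ab(2) H_ideal_props(1)[OF E] by blast
  have a: "a \<in> carrier (fm R q)" and b: "b \<in> carrier (fm H q)" using ab bc by (auto simp: mem_fm_iff)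
  have yab: "y = ?\<phi> a \<oplus>\<^bsub>fm H q\<^esub> b" using ab(3) by (simp add: fun_eq_iff)
  have \<phi>a: "?\<phi>D (?\<phi> a) = ?\<phi> (?D a)" using \<phi>_lc[of q D p a] D a by simp
  have sum0: "?\<phi> (?D a) \<oplus>\<^bsub>fm H p\<^esub> ?\<phi>D b = \<zero>\<^bsub>fm H p\<^esub>"
    using y0 \<phi>D'(2)[OF \<phi>_fm[OF a] b] unfolding yab \<phi>a by simp
  have Db: "?\<phi>D b i \<in> extH q1" for i
  proof -
    have "lc (self_module H) (\<lambda>k. \<phi> (D k i)) r b \<in> extH q1" if "r \<le> q" for r
      using that
    proof (induct r)
      case (Suc r)
      have "b r \<otimes>\<^bsub>H\<^esub> \<phi> (D r i) \<in> extH q1" using H_ideal_props(6)[OF E ab(2)] D[of r] Suc by simp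
      then show ?case using Suc H_ideal_props(3)[OF E] by simp
    qed (use H_ideal_props(2)[OF E] in simp)
    then show ?thesis using b by (subst H.fm_lc_apply) auto
  qed
  have Da: "?D a \<in> carrier (fm R p)" by (rule D'(1)[OF a])
  \<comment> \<open>\<open>y\<close> is a solution, so \<open>?D a\<close> becomes the negative of
    the image of \<open>b\<close> and has entries in \<open>q1 H\<close>;
    \<open>contraction_primary\<close> brings them back to \<open>q1\<close>.\<close>
  have Daq: "?D a i \<in> q1" for i
  proof -
    have c: "\<phi> (?D a i) \<in> carrier H" "?\<phi>D b i \<in> carrier H" using Da Db H_ideal_props(1)[OF E] by auto
    have "\<phi> (?D a i) \<oplus>\<^bsub>H\<^esub> ?\<phi>D b i = \<zero>\<^bsub>H\<^esub>" using fun_cong[OF sum0, of i] by simp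
    then have "\<phi> (?D a i) = \<ominus>\<^bsub>H\<^esub> ?\<phi>D b i" using c by (metis H.minus_equality)
    then have "\<phi> (?D a i) \<in> extH q1" using H_ideal_props(4)[OF E Db] by simp
    then show ?thesis using contraction_primary[OF q1, of "?D a i"] Da by (simp add: extH_eq)
  qed
  have "?D a \<in> V" by (rule R.fm_mem_colon[OF V(1) Da]) (use Daq in \<open>auto simp: q1_def\<close>)
  then have "?D a \<in> W0" using V(2) a unfolding W_def by blast
  then obtain z where z: "z \<in> Q" "?D a = ?D z" unfolding W0_def by blast
  have zc: "z \<in> carrier (fm R q)" using z by (simp add: Q_def)
  \<comment> \<open>An exact solution over \<open>R\<close>. It differs from \<open>y\<close> by
    \<open>z\<close> and \<open>b\<close>, which both give vectors in \<open>U\<close>.\<close>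
  define w where "w = a \<oplus>\<^bsub>fm R q\<^esub> \<ominus>\<^bsub>fm R q\<^esub> z"
  have wc: "w \<in> carrier (fm R q)" using a zc unfolding w_def by blast
  have "?D w = ?D a \<oplus>\<^bsub>fm R p\<^esub> \<ominus>\<^bsub>fm R p\<^esub> ?D z"
    unfolding w_def using D'(2)[OF a FRq.M.a_inv_closed[OF zc]]
      module_hom_minus[OF FRq.module_axioms FRp.module_axioms hD zc] by metis
  also have "\<dots> = \<zero>\<^bsub>fm R p\<^esub>" unfolding z(2) by (rule FRp.M.r_neg[OF D'(1)[OF zc]])
  finally have "w \<in> ?Kr" using wc by blast
  then have wU: "?\<phi> w \<in> U" using FHq.mspan_superset[OF Jc] U(2) by blast
  have zC: "\<phi> (z i) \<in> C" for i using z(1) unfolding Q_def q0_def by blast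
  have zU: "?\<phi> z \<in> U" by (rule H.fm_mem_colon[OF U(1) \<phi>_fm[OF zc] zC[unfolded C_def]])
  have "\<phi> ` q1 \<subseteq> \<phi> ` q0" unfolding q1_def by blast
  also have "\<dots> \<subseteq> extH q0" by (rule extH_ideal(2)[OF primary_carrier[OF q0]])
  finally have "extH q1 \<subseteq> extH q0"
    unfolding extH_eq[of q1] by (rule H.genideal_minimal[OF extH_ideal(1)[OF primary_carrier[OF q0]]])
  then have bC: "b i \<in> C" for i using ab(2) extC by blast
  have bU: "b \<in> U" by (rule H.fm_mem_colon[OF U(1) b bC[unfolded C_def]])
  have "a = w \<oplus>\<^bsub>fm R q\<^esub> z" unfolding w_def
    using FRq.M.a_assoc[OF a FRq.M.a_inv_closed[OF zc] zc] FRq.M.l_neg[OF zc] FRq.M.r_zero[OF a] by metis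
  then have "?\<phi> a = ?\<phi> w \<oplus>\<^bsub>fm H q\<^esub> ?\<phi> z" using wc zc by (simp add: fun_eq_iff)
  then have "y = (?\<phi> w \<oplus>\<^bsub>fm H q\<^esub> ?\<phi> z) \<oplus>\<^bsub>fm H q\<^esub> b" using yab by metis
  then have "y \<in> U" using FHq.submoduleD(4)[OF U(1) FHq.submoduleD(4)[OF U(1) wU zU] bU] by metis
  then show False using U(3) by blast
qed

end

section \<open>Separability\<close>

text \<open>Sums over lists instead of finite sets, because a tensor may contain the same pair of
  factors several times.\<close>

definition lsum :: "('c, 'k) ring_scheme \<Rightarrow> ('i \<Rightarrow> 'c) \<Rightarrow> 'i list \<Rightarrow> 'c" where
  "lsum X g xs = foldr (\<lambda>x s. g x \<oplus>\<^bsub>X\<^esub> s) xs \<zero>\<^bsub>X\<^esub>"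

lemma lsum_simps [simp]: "lsum X g [] = \<zero>\<^bsub>X\<^esub>" "lsum X g (x # xs) = g x \<oplus>\<^bsub>X\<^esub> lsum X g xs"
  by (simp_all add: lsum_def)

lemma lsum_cong: "(\<And>x. x \<in> set xs \<Longrightarrow> g x = h x) \<Longrightarrow> lsum X g xs = lsum X h xs"
  by (induct xs) auto

lemma lsum_map: "lsum X g (map f xs) = lsum X (\<lambda>x. g (f x)) xs"
  by (induct xs) auto

context abelian_group begin

lemma lsum_closed [simp]: "(\<And>x. x \<in> set xs \<Longrightarrow> g x \<in> carrier G) \<Longrightarrow> lsum G g xs \<in> carrier G"
  by (induct xs) auto

lemma lsum_append:
  assumes "\<And>x. x \<in> set xs \<union> set ys \<Longrightarrow> g x \<in> carrier G"
  shows "lsum G g (xs @ ys) = lsum G g xs \<oplus> lsum G g ys"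
  using assms by (induct xs) (auto simp: a_assoc)

lemma lsum_concat:
  assumes "\<And>xs x. xs \<in> set xss \<Longrightarrow> x \<in> set xs \<Longrightarrow> g x \<in> carrier G"
  shows "lsum G g (concat xss) = lsum G (lsum G g) xss"
  using assms
proof (induct xss)
  case (Cons xs xss)
  have "lsum G g (xs @ concat xss) = lsum G g xs \<oplus> lsum G g (concat xss)"
    using Cons(2) by (intro lsum_append) auto
  moreover have "lsum G g (concat xss) = lsum G (lsum G g) xss" using Cons(2) by (intro Cons(1)) auto
  ultimately show ?case by simp
qed simp

lemma lsum_add:
  assumes "\<And>x. x \<in> set xs \<Longrightarrow> g x \<in> carrier G" "\<And>x. x \<in> set xs \<Longrightarrow> h x \<in> carrier G"
  shows "lsum G (\<lambda>x. g x \<oplus> h x) xs = lsum G g xs \<oplus> lsum G h xs"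
  using assms by (induct xs) (auto simp: a_ac)

lemma lsum_zero: "(\<And>x. x \<in> set xs \<Longrightarrow> g x = \<zero>) \<Longrightarrow> lsum G g xs = \<zero>"
  by (induct xs) auto

lemma lsum_swap:
  assumes "\<And>x y. x \<in> set xs \<Longrightarrow> y \<in> set ys \<Longrightarrow> g x y \<in> carrier G"
  shows "lsum G (\<lambda>x. lsum G (g x) ys) xs = lsum G (\<lambda>y. lsum G (\<lambda>x. g x y) xs) ys"
  using assms
proof (induct xs)
  case Nil then show ?case by (simp add: lsum_zero)
next
  case (Cons x xs)
  then show ?case by (simp add: lsum_add[of ys "g x" "\<lambda>y. lsum G (\<lambda>x. g x y) xs"])
qed

end

context henselization begin

text \<open>A list of pairs represents an element of \<open>H \<otimes>\<^sub>R H\<close>, and an additive map out of this tensor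
  product is a balanced map. So \<open>sep e t\<close> says \<open>(t \<otimes> 1 - 1 \<otimes> t) e = 0\<close>, tested on
  the groups of one type.\<close>

definition balanced :: "('c, 'k) ring_scheme \<Rightarrow> ('b \<Rightarrow> 'b \<Rightarrow> 'c) \<Rightarrow> bool" where
  "balanced X \<beta> \<longleftrightarrow> abelian_group X \<and> (\<forall>h\<in>carrier H. \<forall>x\<in>carrier H. \<beta> h x \<in> carrier X) \<and>
    (\<forall>h\<in>carrier H. \<forall>h'\<in>carrier H. \<forall>x\<in>carrier H. \<beta> (h \<oplus>\<^bsub>H\<^esub> h') x = \<beta> h x \<oplus>\<^bsub>X\<^esub> \<beta> h' x) \<and>
    (\<forall>h\<in>carrier H. \<forall>x\<in>carrier H. \<forall>x'\<in>carrier H. \<beta> h (x \<oplus>\<^bsub>H\<^esub> x') = \<beta> h x \<oplus>\<^bsub>X\<^esub> \<beta> h x') \<and>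
    (\<forall>r\<in>carrier R. \<forall>h\<in>carrier H. \<forall>x\<in>carrier H. \<beta> (\<phi> r \<otimes>\<^bsub>H\<^esub> h) x = \<beta> h (\<phi> r \<otimes>\<^bsub>H\<^esub> x))"

definition sep :: "('b \<times> 'b) list \<Rightarrow> 'b \<Rightarrow> bool" where
  "sep e t \<longleftrightarrow> (\<forall>(X :: ('b, ('b univ \<Rightarrow> 'b) set) module) \<beta>. balanced X \<beta> \<longrightarrow>
    lsum X (\<lambda>(u, v). \<beta> (t \<otimes>\<^bsub>H\<^esub> u) v) e = lsum X (\<lambda>(u, v). \<beta> u (t \<otimes>\<^bsub>H\<^esub> v)) e)"

definition separator :: "('b \<times> 'b) list \<Rightarrow> bool" where
  "separator e \<longleftrightarrow> set e \<subseteq> carrier H \<times> carrier H \<and> lsum H (\<lambda>(u, v). u \<otimes>\<^bsub>H\<^esub> v) e = \<one>\<^bsub>H\<^esub>"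

text \<open>The product of the ring \<open>H \<otimes>\<^sub>R H\<close>.\<close>

definition tmult :: "('b \<times> 'b) list \<Rightarrow> ('b \<times> 'b) list \<Rightarrow> ('b \<times> 'b) list" where
  "tmult e e' = concat (map (\<lambda>(u, v). map (\<lambda>(u', v'). (u \<otimes>\<^bsub>H\<^esub> u', v \<otimes>\<^bsub>H\<^esub> v')) e') e)"

text \<open>Precomposition of \<open>\<beta>\<close> with multiplication by
  \<open>a \<otimes> b\<close>. Identities in the ring \<open>H \<otimes>\<^sub>R H\<close> are
  proved by applying hypotheses to shifted maps.\<close>

definition shift :: "'b \<Rightarrow> 'b \<Rightarrow> ('b \<Rightarrow> 'b \<Rightarrow> 'c) \<Rightarrow> 'b \<Rightarrow> 'b \<Rightarrow> 'c" where
  "shift a b \<beta> = (\<lambda>h x. \<beta> (a \<otimes>\<^bsub>H\<^esub> h) (b \<otimes>\<^bsub>H\<^esub> x))"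

lemma balancedD:
  assumes "balanced X \<beta>"
  shows "abelian_group X" "\<And>h x. h \<in> carrier H \<Longrightarrow> x \<in> carrier H \<Longrightarrow> \<beta> h x \<in> carrier X"
    "\<And>h h' x. h \<in> carrier H \<Longrightarrow> h' \<in> carrier H \<Longrightarrow> x \<in> carrier H \<Longrightarrow> \<beta> (h \<oplus>\<^bsub>H\<^esub> h') x = \<beta> h x \<oplus>\<^bsub>X\<^esub> \<beta> h' x"
    "\<And>h x x'. h \<in> carrier H \<Longrightarrow> x \<in> carrier H \<Longrightarrow> x' \<in> carrier H \<Longrightarrow> \<beta> h (x \<oplus>\<^bsub>H\<^esub> x') = \<beta> h x \<oplus>\<^bsub>X\<^esub> \<beta> h x'"
    "\<And>r h x. r \<in> carrier R \<Longrightarrow> h \<in> carrier H \<Longrightarrow> x \<in> carrier H \<Longrightarrow> \<beta> (\<phi> r \<otimes>\<^bsub>H\<^esub> h) x = \<beta> h (\<phi> r \<otimes>\<^bsub>H\<^esub> x)"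
  using assms unfolding balanced_def by blast+

lemma balanced_shift:
  assumes "balanced X \<beta>" "a \<in> carrier H" "b \<in> carrier H"
  shows "balanced X (shift a b \<beta>)"
proof -
  note B = balancedD[OF assms(1)]
  have "\<beta> (a \<otimes>\<^bsub>H\<^esub> (\<phi> r \<otimes>\<^bsub>H\<^esub> h)) (b \<otimes>\<^bsub>H\<^esub> x) = \<beta> (a \<otimes>\<^bsub>H\<^esub> h) (b \<otimes>\<^bsub>H\<^esub> (\<phi> r \<otimes>\<^bsub>H\<^esub> x))"
    if "r \<in> carrier R" "h \<in> carrier H" "x \<in> carrier H" for r h x
  proof -
    have "a \<otimes>\<^bsub>H\<^esub> (\<phi> r \<otimes>\<^bsub>H\<^esub> h) = \<phi> r \<otimes>\<^bsub>H\<^esub> (a \<otimes>\<^bsub>H\<^esub> h)" "b \<otimes>\<^bsub>H\<^esub> (\<phi> r \<otimes>\<^bsub>H\<^esub> x) = \<phi> r \<otimes>\<^bsub>H\<^esub> (b \<otimes>\<^bsub>H\<^esub> x)"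
      using that assms by (simp_all add: H.m_lcomm)
    then show ?thesis using B(5)[of r "a \<otimes>\<^bsub>H\<^esub> h" "b \<otimes>\<^bsub>H\<^esub> x"] that assms by simp
  qed
  then show ?thesis
    unfolding balanced_def shift_def using B assms(2,3) by (auto simp: H.r_distr)
qed

lemma balanced_zero:
  assumes "balanced X \<beta>" "x \<in> carrier H" shows "\<beta> \<zero>\<^bsub>H\<^esub> x = \<zero>\<^bsub>X\<^esub>" "\<beta> x \<zero>\<^bsub>H\<^esub> = \<zero>\<^bsub>X\<^esub>"
proof -
  interpret X: abelian_group X by (rule balancedD(1)[OF assms(1)])
  note B = balancedD[OF assms(1)]
  have "\<beta> \<zero>\<^bsub>H\<^esub> x \<oplus>\<^bsub>X\<^esub> \<beta> \<zero>\<^bsub>H\<^esub> x = \<beta> \<zero>\<^bsub>H\<^esub> x" using B(3)[of "\<zero>\<^bsub>H\<^esub>" "\<zero>\<^bsub>H\<^esub>" x] assms(2) by simp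
  then show "\<beta> \<zero>\<^bsub>H\<^esub> x = \<zero>\<^bsub>X\<^esub>" using B(2)[of "\<zero>\<^bsub>H\<^esub>" x] assms(2) by (metis H.zero_closed X.add.l_cancel_one)
  have "\<beta> x \<zero>\<^bsub>H\<^esub> \<oplus>\<^bsub>X\<^esub> \<beta> x \<zero>\<^bsub>H\<^esub> = \<beta> x \<zero>\<^bsub>H\<^esub>" using B(4)[of x "\<zero>\<^bsub>H\<^esub>" "\<zero>\<^bsub>H\<^esub>"] assms(2) by simp
  then show "\<beta> x \<zero>\<^bsub>H\<^esub> = \<zero>\<^bsub>X\<^esub>" using B(2)[of x "\<zero>\<^bsub>H\<^esub>"] assms(2) by (metis H.zero_closed X.add.l_cancel_one)
qed

lemma sepD:
  fixes X :: "('b, ('b univ \<Rightarrow> 'b) set) module"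
  assumes "sep e t" "balanced X \<beta>"
  shows "lsum X (\<lambda>(u, v). \<beta> (t \<otimes>\<^bsub>H\<^esub> u) v) e = lsum X (\<lambda>(u, v). \<beta> u (t \<otimes>\<^bsub>H\<^esub> v)) e"
  using assms unfolding sep_def by blast

lemma set_tmult:
  "set e \<subseteq> carrier H \<times> carrier H \<Longrightarrow> set e' \<subseteq> carrier H \<times> carrier H \<Longrightarrow> set (tmult e e') \<subseteq> carrier H \<times> carrier H"
  unfolding tmult_def by fastforce

lemma lsum_tmult:
  assumes X: "abelian_group X" and g: "\<And>u v. u \<in> carrier H \<Longrightarrow> v \<in> carrier H \<Longrightarrow> g u v \<in> carrier X"
    and e: "set e \<subseteq> carrier H \<times> carrier H" "set e' \<subseteq> carrier H \<times> carrier H"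
  shows "lsum X (\<lambda>(u, v). g u v) (tmult e e') =
    lsum X (\<lambda>(u, v). lsum X (\<lambda>(u', v'). g (u \<otimes>\<^bsub>H\<^esub> u') (v \<otimes>\<^bsub>H\<^esub> v')) e') e"
proof -
  interpret X: abelian_group X by fact
  have "lsum X (\<lambda>(u, v). g u v) (tmult e e') =
      lsum X (\<lambda>(u, v). lsum X (\<lambda>(u, v). g u v) (map (\<lambda>(u', v'). (u \<otimes>\<^bsub>H\<^esub> u', v \<otimes>\<^bsub>H\<^esub> v')) e')) e"
    unfolding tmult_def using e
    by (subst X.lsum_concat) (auto simp: lsum_map split_def subset_iff intro!: g)
  then show ?thesis by (simp add: lsum_map split_def)
qed

text \<open>The form with the second factor outermost, which \<open>sep_tmult_left\<close> needs in
  order to apply its hypothesis to the inner sum.\<close>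

lemma lsum_tmult':
  assumes X: "abelian_group X" and g: "\<And>u v. u \<in> carrier H \<Longrightarrow> v \<in> carrier H \<Longrightarrow> g u v \<in> carrier X"
    and e: "set e \<subseteq> carrier H \<times> carrier H" "set e' \<subseteq> carrier H \<times> carrier H"
  shows "lsum X (\<lambda>(u, v). g u v) (tmult e e') =
    lsum X (\<lambda>(u', v'). lsum X (\<lambda>(u, v). g (u \<otimes>\<^bsub>H\<^esub> u') (v \<otimes>\<^bsub>H\<^esub> v')) e) e'"
proof -
  interpret X: abelian_group X by fact
  have "lsum X (\<lambda>(u, v). g u v) (tmult e e') =
    lsum X (\<lambda>(u, v). lsum X (\<lambda>(u', v'). g (u \<otimes>\<^bsub>H\<^esub> u') (v \<otimes>\<^bsub>H\<^esub> v')) e') e"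
    by (rule lsum_tmult[OF X g e])
  also have "\<dots> = lsum X (\<lambda>(u', v'). lsum X (\<lambda>(u, v). g (u \<otimes>\<^bsub>H\<^esub> u') (v \<otimes>\<^bsub>H\<^esub> v')) e) e'"
    unfolding split_def by (rule X.lsum_swap) (use e in \<open>auto intro!: g simp: subset_iff\<close>)
  finally show ?thesis .
qed

lemma lsum_tmult_single:
  assumes "set l \<subseteq> carrier H \<times> carrier H"
  shows "lsum X (\<lambda>(u, v). g u v) (tmult [(w, \<one>\<^bsub>H\<^esub>)] l) = lsum X (\<lambda>(h, x). g (w \<otimes>\<^bsub>H\<^esub> h) x) l"
proof -
  have "lsum X (\<lambda>(u, v). g u v) (tmult [(w, \<one>\<^bsub>H\<^esub>)] l) = lsum X (\<lambda>(h, x). g (w \<otimes>\<^bsub>H\<^esub> h) (\<one>\<^bsub>H\<^esub> \<otimes>\<^bsub>H\<^esub> x)) l"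
    by (simp add: tmult_def lsum_map split_def)
  also have "\<dots> = lsum X (\<lambda>(h, x). g (w \<otimes>\<^bsub>H\<^esub> h) x) l"
  proof (rule lsum_cong)
    fix q assume "q \<in> set l"
    then obtain h x where "q = (h, x)" "x \<in> carrier H" using assms by auto
    then show "(case q of (h, x) \<Rightarrow> g (w \<otimes>\<^bsub>H\<^esub> h) (\<one>\<^bsub>H\<^esub> \<otimes>\<^bsub>H\<^esub> x)) = (case q of (h, x) \<Rightarrow> g (w \<otimes>\<^bsub>H\<^esub> h) x)" by simp
  qed
  finally show ?thesis .
qed

lemma separator_tmult:
  assumes "separator e" "separator e'" shows "separator (tmult e e')"
proof -
  have e: "set e \<subseteq> carrier H \<times> carrier H" "set e' \<subseteq> carrier H \<times> carrier H"
    and e1: "lsum H (\<lambda>(u, v). u \<otimes>\<^bsub>H\<^esub> v) e = \<one>\<^bsub>H\<^esub>" "lsum H (\<lambda>(u, v). u \<otimes>\<^bsub>H\<^esub> v) e' = \<one>\<^bsub>H\<^esub>"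
    using assms by (auto simp: separator_def)
  have "lsum H (\<lambda>(u', v'). (u \<otimes>\<^bsub>H\<^esub> u') \<otimes>\<^bsub>H\<^esub> (v \<otimes>\<^bsub>H\<^esub> v')) d = (u \<otimes>\<^bsub>H\<^esub> v) \<otimes>\<^bsub>H\<^esub> lsum H (\<lambda>(u, v). u \<otimes>\<^bsub>H\<^esub> v) d"
    if "u \<in> carrier H" "v \<in> carrier H" "set d \<subseteq> carrier H \<times> carrier H" for u v d
    using that(3)
  proof (induct d)
    case (Cons p d)
    obtain a b where p: "p = (a, b)" by force
    have c: "a \<in> carrier H" "b \<in> carrier H" "lsum H (\<lambda>(u, v). u \<otimes>\<^bsub>H\<^esub> v) d \<in> carrier H"
      using Cons.prems p by (auto intro!: H.lsum_closed)
    define s where "s = lsum H (\<lambda>(u, v). u \<otimes>\<^bsub>H\<^esub> v) d"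
    have "(u \<otimes>\<^bsub>H\<^esub> a) \<otimes>\<^bsub>H\<^esub> (v \<otimes>\<^bsub>H\<^esub> b) \<oplus>\<^bsub>H\<^esub> (u \<otimes>\<^bsub>H\<^esub> v) \<otimes>\<^bsub>H\<^esub> s = (u \<otimes>\<^bsub>H\<^esub> v) \<otimes>\<^bsub>H\<^esub> (a \<otimes>\<^bsub>H\<^esub> b \<oplus>\<^bsub>H\<^esub> s)"
      using that(1,2) c unfolding s_def[symmetric] by algebra
    then show ?case using Cons p by (simp add: s_def)
  qed (use that in simp)
  note fac = this
  have "lsum H (\<lambda>(u, v). u \<otimes>\<^bsub>H\<^esub> v) (tmult e e') =
      lsum H (\<lambda>(u, v). lsum H (\<lambda>(u', v'). (u \<otimes>\<^bsub>H\<^esub> u') \<otimes>\<^bsub>H\<^esub> (v \<otimes>\<^bsub>H\<^esub> v')) e') e"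
    by (rule lsum_tmult[OF H.abelian_group_axioms _ e]) simp
  also have "\<dots> = lsum H (\<lambda>(u, v). u \<otimes>\<^bsub>H\<^esub> v) e"
  proof (rule lsum_cong)
    fix q assume "q \<in> set e"
    then obtain u v where q: "q = (u, v)" "u \<in> carrier H" "v \<in> carrier H" using e by auto
    show "(case q of (u, v) \<Rightarrow> lsum H (\<lambda>(u', v'). (u \<otimes>\<^bsub>H\<^esub> u') \<otimes>\<^bsub>H\<^esub> (v \<otimes>\<^bsub>H\<^esub> v')) e') = (case q of (u, v) \<Rightarrow> u \<otimes>\<^bsub>H\<^esub> v)"
      using fac[OF q(2,3) e(2)] e1(2) q by simp
  qed
  finally have "lsum H (\<lambda>(u, v). u \<otimes>\<^bsub>H\<^esub> v) (tmult e e') = lsum H (\<lambda>(u, v). u \<otimes>\<^bsub>H\<^esub> v) e" .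
  then show ?thesis using set_tmult[OF e] e1 by (simp add: separator_def)
qed

text \<open>The annihilator of \<open>t \<otimes> 1 - 1 \<otimes> t\<close> is an ideal of
  \<open>H \<otimes>\<^sub>R H\<close>, so it absorbs the factor \<open>e'\<close>.\<close>

lemma sep_tmult_left:
  assumes s: "sep e t" and e: "set e \<subseteq> carrier H \<times> carrier H" "set e' \<subseteq> carrier H \<times> carrier H" and t: "t \<in> carrier H"
  shows "sep (tmult e e') t"
  unfolding sep_def
proof (intro allI impI)
  fix X :: "('b, ('b univ \<Rightarrow> 'b) set) module" and \<beta>
  assume b: "balanced X \<beta>"
  note B = balancedD[OF b]
  have "lsum X (\<lambda>(u, v). \<beta> (t \<otimes>\<^bsub>H\<^esub> u) v) (tmult e e') =
      lsum X (\<lambda>(u', v'). lsum X (\<lambda>(u, v). shift u' v' \<beta> (t \<otimes>\<^bsub>H\<^esub> u) v) e) e'"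
    using e t by (subst lsum_tmult'[OF B(1)]) (auto intro!: lsum_cong B simp: shift_def H.m_ac subset_iff)
  also have "\<dots> = lsum X (\<lambda>(u', v'). lsum X (\<lambda>(u, v). shift u' v' \<beta> u (t \<otimes>\<^bsub>H\<^esub> v)) e) e'"
    using e by (intro lsum_cong) (auto intro!: sepD[OF s] balanced_shift[OF b] simp: subset_iff)
  also have "\<dots> = lsum X (\<lambda>(u, v). \<beta> u (t \<otimes>\<^bsub>H\<^esub> v)) (tmult e e')"
    using e t by (subst lsum_tmult'[OF B(1)]) (auto intro!: lsum_cong B simp: shift_def H.m_ac subset_iff)
  finally show "lsum X (\<lambda>(u, v). \<beta> (t \<otimes>\<^bsub>H\<^esub> u) v) (tmult e e') = lsum X (\<lambda>(u, v). \<beta> u (t \<otimes>\<^bsub>H\<^esub> v)) (tmult e e')" .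
qed

lemma sep_tmult_right:
  assumes s: "sep e' t" and e: "set e \<subseteq> carrier H \<times> carrier H" "set e' \<subseteq> carrier H \<times> carrier H" and t: "t \<in> carrier H"
  shows "sep (tmult e e') t"
  unfolding sep_def
proof (intro allI impI)
  fix X :: "('b, ('b univ \<Rightarrow> 'b) set) module" and \<beta>
  assume b: "balanced X \<beta>"
  note B = balancedD[OF b]
  have "lsum X (\<lambda>(u, v). \<beta> (t \<otimes>\<^bsub>H\<^esub> u) v) (tmult e e') =
      lsum X (\<lambda>(u, v). lsum X (\<lambda>(u', v'). shift u v \<beta> (t \<otimes>\<^bsub>H\<^esub> u') v') e') e"
    using e t by (subst lsum_tmult[OF B(1)]) (auto intro!: lsum_cong B simp: shift_def H.m_ac subset_iff)
  also have "\<dots> = lsum X (\<lambda>(u, v). lsum X (\<lambda>(u', v'). shift u v \<beta> u' (t \<otimes>\<^bsub>H\<^esub> v')) e') e"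
    using e by (intro lsum_cong) (auto intro!: sepD[OF s] balanced_shift[OF b] simp: subset_iff)
  also have "\<dots> = lsum X (\<lambda>(u, v). \<beta> u (t \<otimes>\<^bsub>H\<^esub> v)) (tmult e e')"
    using e t by (subst lsum_tmult[OF B(1)]) (auto intro!: lsum_cong B simp: shift_def H.m_ac subset_iff)
  finally show "lsum X (\<lambda>(u, v). \<beta> (t \<otimes>\<^bsub>H\<^esub> u) v) (tmult e e') = lsum X (\<lambda>(u, v). \<beta> u (t \<otimes>\<^bsub>H\<^esub> v)) (tmult e e')" .
qed

definition septs :: "'b set" where
  "septs = {t \<in> carrier H. \<exists>e. separator e \<and> sep e t}"

text \<open>A product of separators separates whatever one of its factors separates, and
  multiplication \<open>H \<otimes>\<^sub>R H \<rightarrow> H\<close> sends it to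
  \<open>1\<close>.\<close>

lemma common_separator:
  assumes "finite Z" "Z \<subseteq> septs" shows "\<exists>e. separator e \<and> (\<forall>z\<in>Z. sep e z)"
  using assms
proof (induct Z)
  case empty
  have "separator [(\<one>\<^bsub>H\<^esub>, \<one>\<^bsub>H\<^esub>)]" by (simp add: separator_def)
  then show ?case by blast
next
  case (insert z Z)
  then obtain e e' where e: "separator e" "\<forall>z\<in>Z. sep e z" "separator e'" "sep e' z" "z \<in> carrier H"
    unfolding septs_def by auto
  have c: "set e \<subseteq> carrier H \<times> carrier H" "set e' \<subseteq> carrier H \<times> carrier H" using e by (auto simp: separator_def)
  have "sep (tmult e e') y" if "y \<in> Z" for y
    using that e(2) insert(4) by (intro sep_tmult_left c) (auto simp: septs_def)
  then show ?case using separator_tmult[OF e(1,3)] sep_tmult_right[OF e(4) c e(5)] by blast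
qed

text \<open>\<open>t t' \<otimes> 1 - 1 \<otimes> t t'\<close> equals \<open>(t \<otimes> 1) (t'
  \<otimes> 1 - 1 \<otimes> t') + (1 \<otimes> t') (t \<otimes> 1 - 1 \<otimes> t)\<close>.\<close>

lemma sep_mult:
  assumes s: "sep e t" "sep e t'" and e: "set e \<subseteq> carrier H \<times> carrier H" and t: "t \<in> carrier H" "t' \<in> carrier H"
  shows "sep e (t \<otimes>\<^bsub>H\<^esub> t')"
  unfolding sep_def
proof (intro allI impI)
  fix X :: "('b, ('b univ \<Rightarrow> 'b) set) module" and \<beta>
  assume b: "balanced X \<beta>"
  note B = balancedD[OF b]
  have "lsum X (\<lambda>(u, v). \<beta> (t \<otimes>\<^bsub>H\<^esub> t' \<otimes>\<^bsub>H\<^esub> u) v) e = lsum X (\<lambda>(u, v). shift t \<one>\<^bsub>H\<^esub> \<beta> (t' \<otimes>\<^bsub>H\<^esub> u) v) e"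
    using e t by (intro lsum_cong) (auto simp: shift_def H.m_assoc subset_iff)
  also have "\<dots> = lsum X (\<lambda>(u, v). shift t \<one>\<^bsub>H\<^esub> \<beta> u (t' \<otimes>\<^bsub>H\<^esub> v)) e"
    by (rule sepD[OF s(2) balanced_shift[OF b t(1) H.one_closed]])
  also have "\<dots> = lsum X (\<lambda>(u, v). shift \<one>\<^bsub>H\<^esub> t' \<beta> (t \<otimes>\<^bsub>H\<^esub> u) v) e"
    using e t by (intro lsum_cong) (auto simp: shift_def subset_iff)
  also have "\<dots> = lsum X (\<lambda>(u, v). shift \<one>\<^bsub>H\<^esub> t' \<beta> u (t \<otimes>\<^bsub>H\<^esub> v)) e"
    by (rule sepD[OF s(1) balanced_shift[OF b H.one_closed t(2)]])
  also have "\<dots> = lsum X (\<lambda>(u, v). \<beta> u (t \<otimes>\<^bsub>H\<^esub> t' \<otimes>\<^bsub>H\<^esub> v)) e"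
    using e t by (intro lsum_cong) (auto simp: shift_def H.m_ac subset_iff)
  finally show "lsum X (\<lambda>(u, v). \<beta> (t \<otimes>\<^bsub>H\<^esub> t' \<otimes>\<^bsub>H\<^esub> u) v) e = lsum X (\<lambda>(u, v). \<beta> u (t \<otimes>\<^bsub>H\<^esub> t' \<otimes>\<^bsub>H\<^esub> v)) e" .
qed

lemma sep_add:
  assumes s: "sep e t" "sep e t'" and e: "set e \<subseteq> carrier H \<times> carrier H" and t: "t \<in> carrier H" "t' \<in> carrier H"
  shows "sep e (t \<oplus>\<^bsub>H\<^esub> t')"
  unfolding sep_def
proof (intro allI impI)
  fix X :: "('b, ('b univ \<Rightarrow> 'b) set) module" and \<beta>
  assume b: "balanced X \<beta>"
  note B = balancedD[OF b]
  interpret X: abelian_group X by (rule B(1))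
  have "lsum X (\<lambda>(u, v). \<beta> ((t \<oplus>\<^bsub>H\<^esub> t') \<otimes>\<^bsub>H\<^esub> u) v) e =
      lsum X (\<lambda>p. (case p of (u, v) \<Rightarrow> \<beta> (t \<otimes>\<^bsub>H\<^esub> u) v) \<oplus>\<^bsub>X\<^esub> (case p of (u, v) \<Rightarrow> \<beta> (t' \<otimes>\<^bsub>H\<^esub> u) v)) e"
    using e t by (intro lsum_cong) (auto simp: H.l_distr B(3) subset_iff)
  also have "\<dots> = lsum X (\<lambda>(u, v). \<beta> (t \<otimes>\<^bsub>H\<^esub> u) v) e \<oplus>\<^bsub>X\<^esub> lsum X (\<lambda>(u, v). \<beta> (t' \<otimes>\<^bsub>H\<^esub> u) v) e"
    using e t by (intro X.lsum_add) (auto intro!: B(2) simp: subset_iff)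
  also have "\<dots> = lsum X (\<lambda>(u, v). \<beta> u (t \<otimes>\<^bsub>H\<^esub> v)) e \<oplus>\<^bsub>X\<^esub> lsum X (\<lambda>(u, v). \<beta> u (t' \<otimes>\<^bsub>H\<^esub> v)) e"
    using sepD[OF s(1) b] sepD[OF s(2) b] by simp
  also have "\<dots> = lsum X (\<lambda>p. (case p of (u, v) \<Rightarrow> \<beta> u (t \<otimes>\<^bsub>H\<^esub> v)) \<oplus>\<^bsub>X\<^esub> (case p of (u, v) \<Rightarrow> \<beta> u (t' \<otimes>\<^bsub>H\<^esub> v))) e"
    using e t by (intro X.lsum_add[symmetric]) (auto intro!: B(2) simp: subset_iff)
  also have "\<dots> = lsum X (\<lambda>(u, v). \<beta> u ((t \<oplus>\<^bsub>H\<^esub> t') \<otimes>\<^bsub>H\<^esub> v)) e"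
    using e t by (intro lsum_cong) (auto simp: H.l_distr B(4) subset_iff)
  finally show "lsum X (\<lambda>(u, v). \<beta> ((t \<oplus>\<^bsub>H\<^esub> t') \<otimes>\<^bsub>H\<^esub> u) v) e = lsum X (\<lambda>(u, v). \<beta> u ((t \<oplus>\<^bsub>H\<^esub> t') \<otimes>\<^bsub>H\<^esub> v)) e" .
qed

text \<open>With \<open>i\<close> inverse to \<open>t\<close>,
  \<open>i \<otimes> 1 - 1 \<otimes> i\<close> is the negative of
  \<open>(i \<otimes> i) (t \<otimes> 1 - 1 \<otimes> t)\<close>.\<close>

lemma sep_inv:
  assumes s: "sep e t" and e: "set e \<subseteq> carrier H \<times> carrier H" and t: "t \<in> Units H"
  shows "sep e (inv\<^bsub>H\<^esub> t)"
  unfolding sep_def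
proof (intro allI impI)
  fix X :: "('b, ('b univ \<Rightarrow> 'b) set) module" and \<beta>
  assume b: "balanced X \<beta>"
  define i where "i = inv\<^bsub>H\<^esub> t"
  have i: "i \<in> carrier H" "t \<in> carrier H" "i \<otimes>\<^bsub>H\<^esub> t = \<one>\<^bsub>H\<^esub>" using t by (auto simp: i_def)
  have it: "i \<otimes>\<^bsub>H\<^esub> (t \<otimes>\<^bsub>H\<^esub> x) = x" if "x \<in> carrier H" for x
    using i that by (simp add: H.m_assoc[symmetric])
  have "lsum X (\<lambda>(u, v). \<beta> (i \<otimes>\<^bsub>H\<^esub> u) v) e = lsum X (\<lambda>(u, v). shift i i \<beta> u (t \<otimes>\<^bsub>H\<^esub> v)) e"
    using e by (intro lsum_cong) (auto simp: shift_def it subset_iff)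
  also have "\<dots> = lsum X (\<lambda>(u, v). shift i i \<beta> (t \<otimes>\<^bsub>H\<^esub> u) v) e"
    by (rule sepD[OF s balanced_shift[OF b i(1,1)], symmetric])
  also have "\<dots> = lsum X (\<lambda>(u, v). \<beta> u (i \<otimes>\<^bsub>H\<^esub> v)) e"
    using e by (intro lsum_cong) (auto simp: shift_def it subset_iff)
  finally show "lsum X (\<lambda>(u, v). \<beta> (inv\<^bsub>H\<^esub> t \<otimes>\<^bsub>H\<^esub> u) v) e = lsum X (\<lambda>(u, v). \<beta> u (inv\<^bsub>H\<^esub> t \<otimes>\<^bsub>H\<^esub> v)) e"
    by (simp add: i_def)
qed

lemma sep_\<phi>:
  assumes "r \<in> carrier R" and e: "set e \<subseteq> carrier H \<times> carrier H" shows "sep e (\<phi> r)"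
  unfolding sep_def
proof (intro allI impI)
  fix X :: "('b, ('b univ \<Rightarrow> 'b) set) module" and \<beta>
  assume b: "balanced X \<beta>"
  show "lsum X (\<lambda>(u, v). \<beta> (\<phi> r \<otimes>\<^bsub>H\<^esub> u) v) e = lsum X (\<lambda>(u, v). \<beta> u (\<phi> r \<otimes>\<^bsub>H\<^esub> v)) e"
  proof (rule lsum_cong)
    fix q assume "q \<in> set e"
    then obtain u v where q: "q = (u, v)" "u \<in> carrier H" "v \<in> carrier H" using e by auto
    show "(case q of (u, v) \<Rightarrow> \<beta> (\<phi> r \<otimes>\<^bsub>H\<^esub> u) v) = (case q of (u, v) \<Rightarrow> \<beta> u (\<phi> r \<otimes>\<^bsub>H\<^esub> v))"
      using balancedD(5)[OF b assms(1) q(2,3)] q(1) by simp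
  qed
qed

lemma inv_closed_septs: "inv_closed septs"
proof -
  \<comment> \<open>One separator for the finitely many arguments reduces each closure property to
    the \<open>sep\<close> rule for a fixed \<open>e\<close>.\<close>
  have closed: "x \<in> septs" if "x \<in> carrier H" "finite Z" "Z \<subseteq> septs"
    and "\<And>e. set e \<subseteq> carrier H \<times> carrier H \<Longrightarrow> (\<And>z. z \<in> Z \<Longrightarrow> sep e z) \<Longrightarrow> sep e x" for x Z
    using common_separator[OF that(2,3)] that(1,4) unfolding septs_def separator_def by blast
  have c: "x \<in> carrier H" if "x \<in> septs" for x using that by (simp add: septs_def)
  have \<phi>: "\<phi> r \<in> septs" if "r \<in> carrier R" for r by (rule closed[of _ "{}"]) (use that sep_\<phi> in auto)
  have mult: "x \<otimes>\<^bsub>H\<^esub> y \<in> septs" if "x \<in> septs" "y \<in> septs" for x y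
    by (rule closed[of _ "{x, y}"]) (use that c sep_mult in auto)
  have "subring septs H"
  proof (rule H.subringI)
    show "\<ominus>\<^bsub>H\<^esub> x \<in> septs" if "x \<in> septs" for x
    proof -
      have "\<ominus>\<^bsub>H\<^esub> x = \<phi> (\<ominus>\<^bsub>R\<^esub> \<one>\<^bsub>R\<^esub>) \<otimes>\<^bsub>H\<^esub> x" using c[OF that] by (simp add: H.l_minus)
      then show ?thesis using mult[OF \<phi> that, of "\<ominus>\<^bsub>R\<^esub> \<one>\<^bsub>R\<^esub>"] by simp
    qed
    show "x \<oplus>\<^bsub>H\<^esub> y \<in> septs" if "x \<in> septs" "y \<in> septs" for x y
      by (rule closed[of _ "{x, y}"]) (use that c sep_add in auto)
    show "\<one>\<^bsub>H\<^esub> \<in> septs" using \<phi>[of "\<one>\<^bsub>R\<^esub>"] by simp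
  qed (use c mult in auto)
  moreover have "inv\<^bsub>H\<^esub> x \<in> septs" if "x \<in> septs" "x \<in> Units H" for x
    by (rule closed[of _ "{x}"]) (use that sep_inv in auto)
  ultimately show ?thesis using \<phi> by (auto simp: inv_closed_def)
qed

text \<open>For \<open>f\<close> with root \<open>a\<close>, \<open>tdd a f\<close> represents \<open>(f(a \<otimes> 1) - f(1 \<otimes> a)) / (a \<otimes> 1 - 1 \<otimes> a)\<close> with
  coefficients in the left factor, and \<open>teval a \<beta> f\<close> is \<open>\<beta>\<close> applied to \<open>f(1 \<otimes> a)\<close>.\<close>

primrec tdd :: "'b \<Rightarrow> 'b list \<Rightarrow> ('b \<times> 'b) list" where
  "tdd a [] = []"
| "tdd a (c # cs) = (pev H cs a, \<one>\<^bsub>H\<^esub>) # map (\<lambda>(h, x). (h, a \<otimes>\<^bsub>H\<^esub> x)) (tdd a cs)"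

fun teval :: "('c, 'k) ring_scheme \<Rightarrow> 'b \<Rightarrow> ('b \<Rightarrow> 'b \<Rightarrow> 'c) \<Rightarrow> 'b list \<Rightarrow> 'c" where
  "teval X a \<beta> [] = \<zero>\<^bsub>X\<^esub>"
| "teval X a \<beta> (c # cs) = \<beta> c \<one>\<^bsub>H\<^esub> \<oplus>\<^bsub>X\<^esub> teval X a (shift \<one>\<^bsub>H\<^esub> a \<beta>) cs"

lemma set_tdd:
  "a \<in> carrier H \<Longrightarrow> set f \<subseteq> carrier H \<Longrightarrow> set (tdd a f) \<subseteq> carrier H \<times> carrier H"
  by (induct f) auto

lemma teval_closed:
  "balanced X \<beta> \<Longrightarrow> a \<in> carrier H \<Longrightarrow> set f \<subseteq> carrier H \<Longrightarrow> teval X a \<beta> f \<in> carrier X"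
proof (induct f arbitrary: \<beta>)
  case Nil
  interpret X: abelian_group X by (rule balancedD(1)[OF Nil(1)])
  show ?case by simp
next
  case (Cons c f)
  interpret X: abelian_group X by (rule balancedD(1)[OF Cons(2)])
  show ?case using Cons balanced_shift[OF Cons(2)] balancedD(2)[OF Cons(2)] by simp
qed

lemma teval_cong:
  assumes "a \<in> carrier H" "set f \<subseteq> carrier H"
    and "\<And>h x. h \<in> carrier H \<Longrightarrow> x \<in> carrier H \<Longrightarrow> \<beta> h x = \<gamma> h x"
  shows "teval X a \<beta> f = teval X a \<gamma> f"
  using assms(2,3)
proof (induct f arbitrary: \<beta> \<gamma>)
  case (Cons c f)
  have "teval X a (shift \<one>\<^bsub>H\<^esub> a \<beta>) f = teval X a (shift \<one>\<^bsub>H\<^esub> a \<gamma>) f"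
  proof (rule Cons(1))
    show "shift \<one>\<^bsub>H\<^esub> a \<beta> h x = shift \<one>\<^bsub>H\<^esub> a \<gamma> h x" if "h \<in> carrier H" "x \<in> carrier H" for h x
      unfolding shift_def using that assms(1) by (intro Cons(3)) auto
  qed (use Cons(2) in simp)
  moreover have "\<beta> c \<one>\<^bsub>H\<^esub> = \<gamma> c \<one>\<^bsub>H\<^esub>" using Cons(2) by (intro Cons(3)) auto
  ultimately show ?case by simp
qed simp

text \<open>On the diagonal the divided difference is the derivative. At a simple root this is a
  unit, by which the tensor can be normalised.\<close>

lemma lsum_tdd_mult:
  assumes "a \<in> carrier H" "set f \<subseteq> carrier H"
  shows "lsum H (\<lambda>(h, x). h \<otimes>\<^bsub>H\<^esub> x) (tdd a f) = pdd H f a a"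
  using assms(2)
proof (induct f)
  case (Cons c f)
  have "lsum H (\<lambda>(h, x). h \<otimes>\<^bsub>H\<^esub> (a \<otimes>\<^bsub>H\<^esub> x)) d = a \<otimes>\<^bsub>H\<^esub> lsum H (\<lambda>(h, x). h \<otimes>\<^bsub>H\<^esub> x) d"
    if "set d \<subseteq> carrier H \<times> carrier H" for d
    using that
  proof (induct d)
    case (Cons p d)
    obtain h x where p: "p = (h, x)" by force
    have "lsum H (\<lambda>(h, x). h \<otimes>\<^bsub>H\<^esub> x) d \<in> carrier H" using Cons.prems by (intro H.lsum_closed) auto
    then show ?case using Cons p assms(1) by (simp add: H.r_distr H.m_lcomm)
  qed (use assms in simp)
  then have "lsum H (\<lambda>(h, x). h \<otimes>\<^bsub>H\<^esub> (a \<otimes>\<^bsub>H\<^esub> x)) (tdd a f) = a \<otimes>\<^bsub>H\<^esub> pdd H f a a"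
    using Cons set_tdd[of a f] assms(1) by simp
  then show ?case using Cons assms(1) by (simp add: lsum_map split_def)
qed simp

text \<open>The identity \<open>(a \<otimes> 1 - 1 \<otimes> a) tdd = f(a) \<otimes> 1 - f(1
  \<otimes> a)\<close>, written without subtraction.\<close>

lemma tdd_telescope:
  assumes "balanced X \<beta>" and a: "a \<in> carrier H" and f: "set f \<subseteq> carrier H"
  shows "lsum X (\<lambda>(h, x). \<beta> (a \<otimes>\<^bsub>H\<^esub> h) x) (tdd a f) \<oplus>\<^bsub>X\<^esub> teval X a \<beta> f =
    lsum X (\<lambda>(h, x). \<beta> h (a \<otimes>\<^bsub>H\<^esub> x)) (tdd a f) \<oplus>\<^bsub>X\<^esub> \<beta> (pev H f a) \<one>\<^bsub>H\<^esub>"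
  using assms(1) f
proof (induct f arbitrary: \<beta>)
  case Nil
  interpret X: abelian_group X by (rule balancedD(1)[OF Nil(1)])
  show ?case using balanced_zero[OF Nil(1)] by simp
next
  case (Cons c f)
  interpret X: abelian_group X by (rule balancedD(1)[OF Cons(2)])
  note B = balancedD[OF Cons(2)]
  have bs: "balanced X (shift \<one>\<^bsub>H\<^esub> a \<beta>)" by (rule balanced_shift[OF Cons(2) H.one_closed a])
  have f: "set f \<subseteq> carrier H" and c: "c \<in> carrier H" using Cons(3) by auto
  note st = set_tdd[OF a f]
  define p where "p = pev H f a"
  have p: "p \<in> carrier H" using a f by (simp add: p_def)
  define S1 where "S1 = lsum X (\<lambda>(h, x). \<beta> (a \<otimes>\<^bsub>H\<^esub> h) (a \<otimes>\<^bsub>H\<^esub> x)) (tdd a f)"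
  define S2 where "S2 = lsum X (\<lambda>(h, x). \<beta> h (a \<otimes>\<^bsub>H\<^esub> (a \<otimes>\<^bsub>H\<^esub> x))) (tdd a f)"
  define T where "T = teval X a (shift \<one>\<^bsub>H\<^esub> a \<beta>) f"
  have cl: "S1 \<in> carrier X" "S2 \<in> carrier X" "T \<in> carrier X"
    using st a teval_closed[OF bs a f] unfolding S1_def S2_def T_def
    by (auto intro!: X.lsum_closed B(2) simp: subset_iff)
  have e1: "lsum X (\<lambda>(h, x). shift \<one>\<^bsub>H\<^esub> a \<beta> (a \<otimes>\<^bsub>H\<^esub> h) x) (tdd a f) = S1"
    unfolding S1_def using st a by (intro lsum_cong) (auto simp: shift_def subset_iff)
  have e2: "lsum X (\<lambda>(h, x). shift \<one>\<^bsub>H\<^esub> a \<beta> h (a \<otimes>\<^bsub>H\<^esub> x)) (tdd a f) = S2"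
    unfolding S2_def using st a by (intro lsum_cong) (auto simp: shift_def subset_iff)
  have IH: "S1 \<oplus>\<^bsub>X\<^esub> T = S2 \<oplus>\<^bsub>X\<^esub> \<beta> p a"
    using Cons(1)[OF bs f] unfolding e1 e2 T_def[symmetric] using a p by (simp add: shift_def p_def)
  have bc: "\<beta> (a \<otimes>\<^bsub>H\<^esub> p) \<one>\<^bsub>H\<^esub> \<in> carrier X" "\<beta> c \<one>\<^bsub>H\<^esub> \<in> carrier X" "\<beta> p a \<in> carrier X"
    using a p c by (auto intro!: B(2))
  have "lsum X (\<lambda>(h, x). \<beta> (a \<otimes>\<^bsub>H\<^esub> h) x) (tdd a (c # f)) \<oplus>\<^bsub>X\<^esub> teval X a \<beta> (c # f) =
      (\<beta> (a \<otimes>\<^bsub>H\<^esub> p) \<one>\<^bsub>H\<^esub> \<oplus>\<^bsub>X\<^esub> S1) \<oplus>\<^bsub>X\<^esub> (\<beta> c \<one>\<^bsub>H\<^esub> \<oplus>\<^bsub>X\<^esub> T)"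
    by (simp add: lsum_map split_def p_def S1_def T_def)
  also have "\<dots> = (\<beta> (a \<otimes>\<^bsub>H\<^esub> p) \<one>\<^bsub>H\<^esub> \<oplus>\<^bsub>X\<^esub> \<beta> c \<one>\<^bsub>H\<^esub>) \<oplus>\<^bsub>X\<^esub> (S1 \<oplus>\<^bsub>X\<^esub> T)"
    using bc cl by (simp add: X.a_ac)
  also have "\<dots> = (\<beta> p a \<oplus>\<^bsub>X\<^esub> S2) \<oplus>\<^bsub>X\<^esub> (\<beta> c \<one>\<^bsub>H\<^esub> \<oplus>\<^bsub>X\<^esub> \<beta> (a \<otimes>\<^bsub>H\<^esub> p) \<one>\<^bsub>H\<^esub>)"
    unfolding IH using bc cl by (simp add: X.a_ac)
  also have "\<beta> c \<one>\<^bsub>H\<^esub> \<oplus>\<^bsub>X\<^esub> \<beta> (a \<otimes>\<^bsub>H\<^esub> p) \<one>\<^bsub>H\<^esub> = \<beta> (pev H (c # f) a) \<one>\<^bsub>H\<^esub>"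
    using a p c by (simp add: B(3) p_def)
  also have "\<beta> p a \<oplus>\<^bsub>X\<^esub> S2 = lsum X (\<lambda>(h, x). \<beta> h (a \<otimes>\<^bsub>H\<^esub> x)) (tdd a (c # f))"
    using a by (simp add: lsum_map split_def p_def S2_def)
  finally show ?case .
qed

text \<open>In \<open>e f(1 \<otimes> a)\<close> the coefficients sit in the left factor. As
  \<open>e\<close> separates them, they can be moved to the right, which yields
  \<open>e (1 \<otimes> f(a))\<close>; this vanishes when \<open>a\<close> is a root.\<close>

lemma lsum_teval:
  fixes X :: "('b, ('b univ \<Rightarrow> 'b) set) module"
  assumes "balanced X \<beta>" and a: "a \<in> carrier H" and f: "set f \<subseteq> carrier H"
    and e: "set e \<subseteq> carrier H \<times> carrier H" and s: "\<And>c. c \<in> set f \<Longrightarrow> sep e c"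
  shows "lsum X (\<lambda>(u, v). teval X a (shift u v \<beta>) f) e = lsum X (\<lambda>(u, v). \<beta> u (v \<otimes>\<^bsub>H\<^esub> pev H f a)) e"
  using assms(1) f s
proof (induct f arbitrary: \<beta>)
  case Nil
  interpret X: abelian_group X by (rule balancedD(1)[OF Nil(1)])
  show ?case using balanced_zero[OF Nil(1)] e by (auto intro!: lsum_cong simp: subset_iff)
next
  case (Cons c f)
  interpret X: abelian_group X by (rule balancedD(1)[OF Cons(2)])
  note B = balancedD[OF Cons(2)]
  have bs: "balanced X (shift \<one>\<^bsub>H\<^esub> a \<beta>)" by (rule balanced_shift[OF Cons(2) H.one_closed a])
  have f: "set f \<subseteq> carrier H" and c: "c \<in> carrier H" using Cons(3) by auto
  define p where "p = pev H f a"
  have p: "p \<in> carrier H" using a f by (simp add: p_def)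
  have tc: "teval X a (shift \<one>\<^bsub>H\<^esub> a (shift u v \<beta>)) f \<in> carrier X" if "u \<in> carrier H" "v \<in> carrier H" for u v
    by (intro teval_closed balanced_shift Cons(2) that a f H.one_closed)
  have teq: "teval X a (shift \<one>\<^bsub>H\<^esub> a (shift u v \<beta>)) g = teval X a (shift u v (shift \<one>\<^bsub>H\<^esub> a \<beta>)) g"
    if "u \<in> carrier H" "v \<in> carrier H" "set g \<subseteq> carrier H" for u v g
  proof -
    show ?thesis using that a by (intro teval_cong) (simp_all add: shift_def H.m_lcomm)
  qed
  have "lsum X (\<lambda>(u, v). teval X a (shift u v \<beta>) (c # f)) e =
      lsum X (\<lambda>q. (case q of (u, v) \<Rightarrow> \<beta> (c \<otimes>\<^bsub>H\<^esub> u) v) \<oplus>\<^bsub>X\<^esub>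
        (case q of (u, v) \<Rightarrow> teval X a (shift u v (shift \<one>\<^bsub>H\<^esub> a \<beta>)) f)) e"
  proof (rule lsum_cong)
    fix q assume "q \<in> set e"
    then obtain u v where q: "q = (u, v)" "u \<in> carrier H" "v \<in> carrier H" using e by auto
    have "shift u v \<beta> c \<one>\<^bsub>H\<^esub> = \<beta> (c \<otimes>\<^bsub>H\<^esub> u) v" using q c by (simp add: shift_def H.m_comm)
    then show "(case q of (u, v) \<Rightarrow> teval X a (shift u v \<beta>) (c # f)) = (case q of (u, v) \<Rightarrow> \<beta> (c \<otimes>\<^bsub>H\<^esub> u) v) \<oplus>\<^bsub>X\<^esub>
        (case q of (u, v) \<Rightarrow> teval X a (shift u v (shift \<one>\<^bsub>H\<^esub> a \<beta>)) f)"
      using teq[OF q(2,3) f] q(1) by simp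
  qed
  also have "\<dots> = lsum X (\<lambda>(u, v). \<beta> (c \<otimes>\<^bsub>H\<^esub> u) v) e \<oplus>\<^bsub>X\<^esub>
      lsum X (\<lambda>(u, v). teval X a (shift u v (shift \<one>\<^bsub>H\<^esub> a \<beta>)) f) e"
    using e c f tc by (intro X.lsum_add) (auto intro!: B(2) simp: teq[symmetric] subset_iff)
  also have "lsum X (\<lambda>(u, v). \<beta> (c \<otimes>\<^bsub>H\<^esub> u) v) e = lsum X (\<lambda>(u, v). \<beta> u (c \<otimes>\<^bsub>H\<^esub> v)) e"
    using Cons(4) by (intro sepD[OF _ Cons(2)]) simp
  also have "lsum X (\<lambda>(u, v). teval X a (shift u v (shift \<one>\<^bsub>H\<^esub> a \<beta>)) f) e =
      lsum X (\<lambda>(u, v). shift \<one>\<^bsub>H\<^esub> a \<beta> u (v \<otimes>\<^bsub>H\<^esub> p)) e"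
    unfolding p_def using Cons(4) by (intro Cons(1)[OF bs f]) simp
  also have "lsum X (\<lambda>(u, v). \<beta> u (c \<otimes>\<^bsub>H\<^esub> v)) e \<oplus>\<^bsub>X\<^esub> lsum X (\<lambda>(u, v). shift \<one>\<^bsub>H\<^esub> a \<beta> u (v \<otimes>\<^bsub>H\<^esub> p)) e =
      lsum X (\<lambda>q. (case q of (u, v) \<Rightarrow> \<beta> u (c \<otimes>\<^bsub>H\<^esub> v)) \<oplus>\<^bsub>X\<^esub> (case q of (u, v) \<Rightarrow> shift \<one>\<^bsub>H\<^esub> a \<beta> u (v \<otimes>\<^bsub>H\<^esub> p))) e"
    using e c a p by (intro X.lsum_add[symmetric]) (auto intro!: B(2) simp: shift_def subset_iff)
  also have "\<dots> = lsum X (\<lambda>(u, v). \<beta> u (v \<otimes>\<^bsub>H\<^esub> pev H (c # f) a)) e"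
  proof (rule lsum_cong)
    fix q assume "q \<in> set e"
    then obtain u v where q: "q = (u, v)" "u \<in> carrier H" "v \<in> carrier H" using e by auto
    have "v \<otimes>\<^bsub>H\<^esub> (c \<oplus>\<^bsub>H\<^esub> a \<otimes>\<^bsub>H\<^esub> p) = c \<otimes>\<^bsub>H\<^esub> v \<oplus>\<^bsub>H\<^esub> a \<otimes>\<^bsub>H\<^esub> (v \<otimes>\<^bsub>H\<^esub> p)" using q a c p by algebra
    then show "(case q of (u, v) \<Rightarrow> \<beta> u (c \<otimes>\<^bsub>H\<^esub> v)) \<oplus>\<^bsub>X\<^esub> (case q of (u, v) \<Rightarrow> shift \<one>\<^bsub>H\<^esub> a \<beta> u (v \<otimes>\<^bsub>H\<^esub> p)) =
        (case q of (u, v) \<Rightarrow> \<beta> u (v \<otimes>\<^bsub>H\<^esub> pev H (c # f) a))"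
      using q a c p by (simp add: shift_def B(4) p_def)
  qed
  finally show ?case .
qed

text \<open>The separability element of a standard etale extension is the divided difference of
  \<open>f\<close> over its derivative. It is annihilated by
  \<open>a \<otimes> 1 - 1 \<otimes> a\<close> once the coefficients of \<open>f\<close> may be
  moved between the factors, so it is multiplied by a separator \<open>e\<close> of the
  coefficients.\<close>

lemma root_closed_septs: "root_closed (carrier H) septs"
  unfolding root_closed_def
proof (intro allI impI, elim conjE)
  fix f a t
  assume f: "set f \<subseteq> septs" and a: "a \<in> carrier H"
    and fa: "pev H (f @ [\<one>\<^bsub>H\<^esub>]) a = \<zero>\<^bsub>H\<^esub>" and da: "pdd H (f @ [\<one>\<^bsub>H\<^esub>]) a a \<notin> mH"
  let ?f = "f @ [\<one>\<^bsub>H\<^esub>]"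
  have fs: "set ?f \<subseteq> septs" using f subringE(3)[OF inv_closedD(1)[OF inv_closed_septs]] by simp
  have fc: "set ?f \<subseteq> carrier H" using fs by (auto simp: septs_def)
  obtain e where e: "separator e" "\<forall>c\<in>set ?f. sep e c" using common_separator[OF _ fs] by blast
  have ec: "set e \<subseteq> carrier H \<times> carrier H" using e by (simp add: separator_def)
  define w where "w = inv\<^bsub>H\<^esub> (pdd H ?f a a)"
  have "pdd H ?f a a \<in> Units H" using da Units_H_iff[OF H.pdd_closed[OF fc a a]] by blast
  then have w: "w \<in> carrier H" "w \<otimes>\<^bsub>H\<^esub> pdd H ?f a a = \<one>\<^bsub>H\<^esub>" by (auto simp: w_def)
  \<comment> \<open>The factor \<open>w\<close> inverts the derivative, so that multiplication sends
    \<open>d\<close> to \<open>1\<close>.\<close>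
  define d where "d = tmult [(w, \<one>\<^bsub>H\<^esub>)] (tdd a ?f)"
  note st = set_tdd[OF a fc]
  have w1: "set [(w, \<one>\<^bsub>H\<^esub>)] \<subseteq> carrier H \<times> carrier H" using w by simp
  have dc: "set d \<subseteq> carrier H \<times> carrier H" unfolding d_def by (rule set_tmult[OF w1 st])
  have "separator d"
  proof -
    have "lsum H (\<lambda>(u', v'). w \<otimes>\<^bsub>H\<^esub> u' \<otimes>\<^bsub>H\<^esub> v') l = w \<otimes>\<^bsub>H\<^esub> lsum H (\<lambda>(h, x). h \<otimes>\<^bsub>H\<^esub> x) l"
      if "set l \<subseteq> carrier H \<times> carrier H" for l
      using that
    proof (induct l)
      case (Cons p l)
      obtain h x where p: "p = (h, x)" by force
      have "lsum H (\<lambda>(h, x). h \<otimes>\<^bsub>H\<^esub> x) l \<in> carrier H" using Cons.prems by (intro H.lsum_closed) auto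
      then show ?case using Cons p w by (simp add: H.r_distr H.m_assoc)
    qed (use w in simp)
    from this[OF st] have "lsum H (\<lambda>(u', v'). w \<otimes>\<^bsub>H\<^esub> u' \<otimes>\<^bsub>H\<^esub> v') (tdd a ?f) = \<one>\<^bsub>H\<^esub>"
      unfolding lsum_tdd_mult[OF a fc] w(2) .
    moreover have "lsum H (\<lambda>(u, v). u \<otimes>\<^bsub>H\<^esub> v) d = lsum H (\<lambda>(u', v'). w \<otimes>\<^bsub>H\<^esub> u' \<otimes>\<^bsub>H\<^esub> v') (tdd a ?f)"
      unfolding d_def by (rule lsum_tmult_single[OF st])
    ultimately show ?thesis using dc by (simp add: separator_def)
  qed
  then have sepr: "separator (tmult e d)" using e separator_tmult by blast
  have "sep (tmult e d) a"
    unfolding sep_def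
  proof (intro allI impI)
    fix X :: "('b, ('b univ \<Rightarrow> 'b) set) module" and \<beta>
    assume b: "balanced X \<beta>"
    interpret X: abelian_group X by (rule balancedD(1)[OF b])
    \<comment> \<open>Absorbs the factor \<open>w \<otimes> 1\<close> of \<open>d\<close>; what
      remains is the plain divided difference, to which \<open>tdd_telescope\<close>
      applies.\<close>
    define \<gamma> where "\<gamma> = shift w \<one>\<^bsub>H\<^esub> \<beta>"
    have g: "balanced X \<gamma>" unfolding \<gamma>_def by (rule balanced_shift[OF b w(1) H.one_closed])
    note G = balancedD[OF g] and B = balancedD[OF b]
    have gs: "balanced X (shift u v \<gamma>)" if "u \<in> carrier H" "v \<in> carrier H" for u v by (rule balanced_shift[OF g that])
    define L where "L u v = lsum X (\<lambda>(h, x). shift u v \<gamma> (a \<otimes>\<^bsub>H\<^esub> h) x) (tdd a ?f)" for u v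
    define L' where "L' u v = lsum X (\<lambda>(h, x). shift u v \<gamma> h (a \<otimes>\<^bsub>H\<^esub> x)) (tdd a ?f)" for u v
    define T where "T u v = teval X a (shift u v \<gamma>) ?f" for u v
    have cl: "L u v \<in> carrier X" "L' u v \<in> carrier X" "T u v \<in> carrier X" if uv: "u \<in> carrier H" "v \<in> carrier H" for u v
      unfolding L_def L'_def T_def using st a balancedD(2)[OF gs[OF uv]] teval_closed[OF gs[OF uv] a fc]
      by (auto intro!: X.lsum_closed simp: subset_iff)
    have LT: "L u v \<oplus>\<^bsub>X\<^esub> T u v = L' u v" if uv: "u \<in> carrier H" "v \<in> carrier H" for u v
      using tdd_telescope[OF gs[OF uv] a fc] cl[OF uv] balanced_zero(1)[OF gs[OF uv], of "\<one>\<^bsub>H\<^esub>"]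
      unfolding fa by (simp add: L_def L'_def T_def)
    have T0: "lsum X (\<lambda>(u, v). T u v) e = \<zero>\<^bsub>X\<^esub>"
    proof -
      have "lsum X (\<lambda>(u, v). T u v) e = lsum X (\<lambda>(u, v). \<gamma> u (v \<otimes>\<^bsub>H\<^esub> pev H ?f a)) e"
        unfolding T_def using e(2) by (intro lsum_teval[OF g a fc ec]) blast
      also have "\<dots> = \<zero>\<^bsub>X\<^esub>" unfolding fa using ec balanced_zero(2)[OF g] by (intro X.lsum_zero) auto
      finally show ?thesis .
    qed
    have exp: "lsum X (\<lambda>(u, v). \<delta> u v) (tmult e d) =
        lsum X (\<lambda>(u, v). lsum X (\<lambda>(h, x). \<delta> (u \<otimes>\<^bsub>H\<^esub> (w \<otimes>\<^bsub>H\<^esub> h)) (v \<otimes>\<^bsub>H\<^esub> x)) (tdd a ?f)) e"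
      if \<delta>: "\<And>u v. u \<in> carrier H \<Longrightarrow> v \<in> carrier H \<Longrightarrow> \<delta> u v \<in> carrier X" for \<delta>
    proof -
      have "lsum X (\<lambda>(u, v). \<delta> u v) (tmult e d) = lsum X (\<lambda>(u, v). lsum X (\<lambda>(u', v'). \<delta> (u \<otimes>\<^bsub>H\<^esub> u') (v \<otimes>\<^bsub>H\<^esub> v')) d) e"
        by (rule lsum_tmult[OF B(1) \<delta> ec dc])
      also have "\<dots> = lsum X (\<lambda>(u, v). lsum X (\<lambda>(h, x). \<delta> (u \<otimes>\<^bsub>H\<^esub> (w \<otimes>\<^bsub>H\<^esub> h)) (v \<otimes>\<^bsub>H\<^esub> x)) (tdd a ?f)) e"
      proof (rule lsum_cong)
        fix q assume "q \<in> set e"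
        then obtain u v where q: "q = (u, v)" "u \<in> carrier H" "v \<in> carrier H" using ec by auto
        have "lsum X (\<lambda>(u', v'). \<delta> (u \<otimes>\<^bsub>H\<^esub> u') (v \<otimes>\<^bsub>H\<^esub> v')) d =
            lsum X (\<lambda>(h, x). \<delta> (u \<otimes>\<^bsub>H\<^esub> (w \<otimes>\<^bsub>H\<^esub> h)) (v \<otimes>\<^bsub>H\<^esub> x)) (tdd a ?f)"
          unfolding d_def by (rule lsum_tmult_single[OF st])
        then show "(case q of (u, v) \<Rightarrow> lsum X (\<lambda>(u', v'). \<delta> (u \<otimes>\<^bsub>H\<^esub> u') (v \<otimes>\<^bsub>H\<^esub> v')) d) =
            (case q of (u, v) \<Rightarrow> lsum X (\<lambda>(h, x). \<delta> (u \<otimes>\<^bsub>H\<^esub> (w \<otimes>\<^bsub>H\<^esub> h)) (v \<otimes>\<^bsub>H\<^esub> x)) (tdd a ?f))"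
          using q by simp
      qed
      finally show ?thesis .
    qed
    have "lsum X (\<lambda>(u, v). \<beta> (a \<otimes>\<^bsub>H\<^esub> u) v) (tmult e d) = lsum X (\<lambda>(u, v). L u v) e"
    proof -
      have "lsum X (\<lambda>(u, v). \<beta> (a \<otimes>\<^bsub>H\<^esub> u) v) (tmult e d) =
          lsum X (\<lambda>(u, v). lsum X (\<lambda>(h, x). \<beta> (a \<otimes>\<^bsub>H\<^esub> (u \<otimes>\<^bsub>H\<^esub> (w \<otimes>\<^bsub>H\<^esub> h))) (v \<otimes>\<^bsub>H\<^esub> x)) (tdd a ?f)) e"
        using a by (intro exp B(2)) auto
      also have "\<dots> = lsum X (\<lambda>(u, v). L u v) e"
        unfolding L_def using ec st a w
        by (intro lsum_cong) (auto intro!: lsum_cong simp: \<gamma>_def shift_def H.m_ac subset_iff)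
      finally show ?thesis .
    qed
    also have "\<dots> = lsum X (\<lambda>(u, v). L u v) e \<oplus>\<^bsub>X\<^esub> lsum X (\<lambda>(u, v). T u v) e"
      unfolding T0 using ec cl by (intro X.r_zero[symmetric] X.lsum_closed) (auto simp: subset_iff)
    also have "\<dots> = lsum X (\<lambda>q. (case q of (u, v) \<Rightarrow> L u v) \<oplus>\<^bsub>X\<^esub> (case q of (u, v) \<Rightarrow> T u v)) e"
      using ec cl by (intro X.lsum_add[symmetric]) (auto simp: subset_iff)
    also have "\<dots> = lsum X (\<lambda>(u, v). L' u v) e"
      using ec LT by (intro lsum_cong) (auto simp: subset_iff)
    also have "\<dots> = lsum X (\<lambda>(u, v). \<beta> u (a \<otimes>\<^bsub>H\<^esub> v)) (tmult e d)"
    proof -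
      have "lsum X (\<lambda>(u, v). \<beta> u (a \<otimes>\<^bsub>H\<^esub> v)) (tmult e d) =
          lsum X (\<lambda>(u, v). lsum X (\<lambda>(h, x). \<beta> (u \<otimes>\<^bsub>H\<^esub> (w \<otimes>\<^bsub>H\<^esub> h)) (a \<otimes>\<^bsub>H\<^esub> (v \<otimes>\<^bsub>H\<^esub> x))) (tdd a ?f)) e"
        using a by (intro exp B(2)) auto
      also have "\<dots> = lsum X (\<lambda>(u, v). L' u v) e"
        unfolding L'_def using ec st a w
        by (intro lsum_cong) (auto intro!: lsum_cong simp: \<gamma>_def shift_def H.m_ac subset_iff)
      finally show ?thesis by simp
    qed
    finally show "lsum X (\<lambda>(u, v). \<beta> (a \<otimes>\<^bsub>H\<^esub> u) v) (tmult e d) = lsum X (\<lambda>(u, v). \<beta> u (a \<otimes>\<^bsub>H\<^esub> v)) (tmult e d)" .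
  qed
  then show "a \<in> septs" using a sepr unfolding septs_def by blast
qed

theorem separator_exists:
  assumes "finite Z" "Z \<subseteq> carrier H" obtains e where "separator e" "\<And>z. z \<in> Z \<Longrightarrow> sep e z"
proof -
  have "septs = carrier H" by (rule generation'[OF inv_closed_septs root_closed_septs])
  then show ?thesis using common_separator[OF assms(1)] assms(2) that by blast
qed

end

section \<open>Quotient modules\<close>

context
  fixes R :: "('a, 'm) ring_scheme" and M :: "('a, 'b) module" and K
  assumes M: "module R M" and K: "submodule K R M"
begin

interpretation M: module R M by (rule M)

lemma quot_abelian_subgroup: "abelian_subgroup K M"
  by (rule abelian_subgroupI3)
    (use K M.abelian_group_axioms in \<open>auto intro!: additive_subgroup.intro simp: submodule_def\<close>)

interpretation K: abelian_subgroup K M by (rule quot_abelian_subgroup)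

lemma carrier_quot_module: "carrier (quot_module M K) = (\<lambda>x. K +>\<^bsub>M\<^esub> x) ` carrier M"
  by (auto simp: quot_module_def A_RCOSETS_def')

lemma coset_eq_iff:
  assumes "x \<in> carrier M" "y \<in> carrier M"
  shows "K +>\<^bsub>M\<^esub> x = K +>\<^bsub>M\<^esub> y \<longleftrightarrow> x \<oplus>\<^bsub>M\<^esub> \<ominus>\<^bsub>M\<^esub> y \<in> K"
proof
  assume "K +>\<^bsub>M\<^esub> x = K +>\<^bsub>M\<^esub> y"
  then have "x \<in> K +>\<^bsub>M\<^esub> y" using K.a_rcos_self[OF assms(1)] by simp
  then show "x \<oplus>\<^bsub>M\<^esub> \<ominus>\<^bsub>M\<^esub> y \<in> K" using K.a_rcos_module_imp[OF assms(2)] by simp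
next
  assume "x \<oplus>\<^bsub>M\<^esub> \<ominus>\<^bsub>M\<^esub> y \<in> K"
  then have "x \<in> K +>\<^bsub>M\<^esub> y" using K.a_rcos_module_rev[OF assms(2,1)] by simp
  then show "K +>\<^bsub>M\<^esub> x = K +>\<^bsub>M\<^esub> y" using M.a_repr_independence[OF _ assms(2) K.a_subgroup] by simp
qed

lemma zero_quot_module: "\<zero>\<^bsub>quot_module M K\<^esub> = K" by (simp add: quot_module_def)

lemma coset_eq_zero_iff:
  assumes "x \<in> carrier M" shows "K +>\<^bsub>M\<^esub> x = \<zero>\<^bsub>quot_module M K\<^esub> \<longleftrightarrow> x \<in> K"
proof -
  have K0: "K +>\<^bsub>M\<^esub> \<zero>\<^bsub>M\<^esub> = K" using M.submoduleD(1)[OF K] by (rule M.a_coset_add_zero)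
  have "\<zero>\<^bsub>M\<^esub> \<oplus>\<^bsub>M\<^esub> \<ominus>\<^bsub>M\<^esub> \<zero>\<^bsub>M\<^esub> = \<zero>\<^bsub>M\<^esub>" by (rule M.M.r_neg) (rule M.M.zero_closed)
  then have m0: "\<ominus>\<^bsub>M\<^esub> \<zero>\<^bsub>M\<^esub> = \<zero>\<^bsub>M\<^esub>" by (simp only: M.M.l_zero M.M.a_inv_closed M.M.zero_closed)
  show ?thesis
    unfolding zero_quot_module
    using coset_eq_iff[OF assms M.M.zero_closed] unfolding K0 m0 M.M.r_zero[OF assms] .
qed

lemma coset_module_hom: "(\<lambda>x. K +>\<^bsub>M\<^esub> x) \<in> module_hom R M (quot_module M K)"
proof -
  have "(\<Union>z\<in>K +>\<^bsub>M\<^esub> y. K +>\<^bsub>M\<^esub> (a \<odot>\<^bsub>M\<^esub> z)) = K +>\<^bsub>M\<^esub> (a \<odot>\<^bsub>M\<^esub> y)" if a: "a \<in> carrier R" and y: "y \<in> carrier M" for a y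
  proof -
    have "K +>\<^bsub>M\<^esub> (a \<odot>\<^bsub>M\<^esub> z) = K +>\<^bsub>M\<^esub> (a \<odot>\<^bsub>M\<^esub> y)" if z: "z \<in> K +>\<^bsub>M\<^esub> y" for z
    proof -
      have zc: "z \<in> carrier M" using z K.a_elemrcos_carrier[OF y] by blast
      have "z \<oplus>\<^bsub>M\<^esub> \<ominus>\<^bsub>M\<^esub> y \<in> K" using K.a_rcos_module_imp[OF y z] .
      then have "a \<odot>\<^bsub>M\<^esub> (z \<oplus>\<^bsub>M\<^esub> \<ominus>\<^bsub>M\<^esub> y) \<in> K" using a M.submoduleD(3)[OF K] by blast
      then show ?thesis using a y zc by (subst coset_eq_iff) (auto simp: M.smult_r_distr M.smult_r_minus)
    qed
    moreover have "y \<in> K +>\<^bsub>M\<^esub> y" using K.a_rcos_self[OF y] .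
    ultimately show ?thesis by blast
  qed
  then show ?thesis
    unfolding module_hom_def by (auto simp: quot_module_def A_RCOSETS_def' K.a_rcos_sum)
qed

end

text \<open>Stated for an arbitrary surjection instead of a quotient projection, so that it also
  serves presentations by generators and copies of a module in another type.\<close>

lemma factor_hom:
  assumes F: "module R F" and M: "module R M" and N: "module R N"
    and q: "q \<in> module_hom R F M" "q ` carrier F = carrier M" and f: "f \<in> module_hom R F N"
    and ker: "\<And>x. x \<in> carrier F \<Longrightarrow> q x = \<zero>\<^bsub>M\<^esub> \<Longrightarrow> f x = \<zero>\<^bsub>N\<^esub>"
  obtains g where "g \<in> module_hom R M N" "\<And>x. x \<in> carrier F \<Longrightarrow> g (q x) = f x"
proof -
  interpret F: module R F by fact
  interpret M: module R M by fact
  interpret N: module R N by fact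
  note q' = module_homD[OF q(1)] and f' = module_homD[OF f]
  define i where "i y = (SOME x. x \<in> carrier F \<and> q x = y)" for y
  have i: "i y \<in> carrier F" "q (i y) = y" if "y \<in> carrier M" for y
  proof -
    have "\<exists>x. x \<in> carrier F \<and> q x = y" using that q(2) by (metis imageE)
    then have "i y \<in> carrier F \<and> q (i y) = y" unfolding i_def by (rule someI_ex)
    then show "i y \<in> carrier F" "q (i y) = y" by auto
  qed
  have eq: "f x = f y" if "x \<in> carrier F" "y \<in> carrier F" "q x = q y" for x y
  proof -
    have "q (x \<oplus>\<^bsub>F\<^esub> \<ominus>\<^bsub>F\<^esub> y) = \<zero>\<^bsub>M\<^esub>"
      using that q'(1)[of y] by (simp add: q'(2) module_hom_minus[OF F M q(1)] M.M.r_neg)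
    then have "f (x \<oplus>\<^bsub>F\<^esub> \<ominus>\<^bsub>F\<^esub> y) = \<zero>\<^bsub>N\<^esub>" using ker that by simp
    then have "f x \<oplus>\<^bsub>N\<^esub> \<ominus>\<^bsub>N\<^esub> f y = \<zero>\<^bsub>N\<^esub>" using that by (simp add: f'(2) module_hom_minus[OF F N f])
    then show ?thesis using f'(1)[OF that(1)] f'(1)[OF that(2)]
      by (metis N.M.add.inv_solve_right N.M.l_zero N.M.zero_closed)
  qed
  have g: "(\<lambda>y. f (i y)) \<in> module_hom R M N"
    unfolding module_hom_def
  proof (intro CollectI conjI ballI)
    show "(\<lambda>y. f (i y)) \<in> carrier M \<rightarrow> carrier N" using i f'(1) by auto
    show "f (i (x \<oplus>\<^bsub>M\<^esub> y)) = f (i x) \<oplus>\<^bsub>N\<^esub> f (i y)" if "x \<in> carrier M" "y \<in> carrier M" for x y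
    proof -
      have "f (i (x \<oplus>\<^bsub>M\<^esub> y)) = f (i x \<oplus>\<^bsub>F\<^esub> i y)" using that i by (intro eq) (simp_all add: q'(2))
      then show ?thesis using i that by (simp add: f'(2))
    qed
    show "f (i (a \<odot>\<^bsub>M\<^esub> x)) = a \<odot>\<^bsub>N\<^esub> f (i x)" if "a \<in> carrier R" "x \<in> carrier M" for a x
    proof -
      have "f (i (a \<odot>\<^bsub>M\<^esub> x)) = f (a \<odot>\<^bsub>F\<^esub> i x)" using that i by (intro eq) (simp_all add: q'(3))
      then show ?thesis using i that by (simp add: f'(3))
    qed
  qed
  have "f (i (q x)) = f x" if "x \<in> carrier F" for x using that i q'(1)[OF that] by (intro eq) auto
  then show ?thesis using that[OF g] by blast
qed

lemma fg_module_generators: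
  assumes "fg_module R M"
  obtains p g where "\<And>i. i < p \<Longrightarrow> g i \<in> carrier M" "lc M g p ` carrier (fm R p) = carrier M"
proof -
  have M: "module R M" using assms by (simp add: fg_module_def)
  interpret M: module R M by (rule M)
  obtain S where S: "finite S" "S \<subseteq> carrier M" "\<And>H. submodule H R M \<and> S \<subseteq> H \<Longrightarrow> H = carrier M"
    using assms unfolding fg_module_def by metis
  obtain p :: nat and g where g: "S = g ` {i. i < p}"
    using finite_imp_nat_seg_image_inj_on[OF S(1)] by metis
  have gS: "g ` {..<p} = S" by (simp add: g lessThan_def)
  have gc: "g i \<in> carrier M" if "i < p" for i using that S(2) gS by auto
  have "mspan R M S = carrier M" using S(3) M.mspan_submodule[OF S(2)] M.mspan_superset[OF S(2)] by blast
  then have "lc M g p ` carrier (fm R p) = carrier M" using mspan_eq_image_lc[OF M, of p g] gc gS by simp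
  then show ?thesis using that gc by blast
qed

section \<open>Every finitely generated module is a retract of an extended module\<close>

context henselization begin

text \<open>The \<open>R\<close>-linear relations among the elements \<open>m i\<close>. Modulo
  these, \<open>fm R L\<close> is the \<open>R\<close>-submodule of \<open>M\<close> that they
  generate, called \<open>N\<close> below.\<close>

definition ker_vec :: "('b, 'c) module \<Rightarrow> (nat \<Rightarrow> 'c) \<Rightarrow> nat \<Rightarrow> (nat \<Rightarrow> 'a) set" where
  "ker_vec M m L = {v \<in> carrier (fm R L). lc M m L (\<lambda>i. \<phi> (v i)) = \<zero>\<^bsub>M\<^esub>}"

text \<open>The image of \<open>H \<otimes>\<^sub>R K\<close> in \<open>fm H L\<close>. By right
  exactness \<open>quot_module (fm H L) (ext_vec L K)\<close> is the base change of
  \<open>fm R L\<close> modulo \<open>K\<close>.\<close>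

definition ext_vec :: "nat \<Rightarrow> (nat \<Rightarrow> 'a) set \<Rightarrow> (nat \<Rightarrow> 'b) set" where
  "ext_vec L K = mspan H (fm H L) ((\<lambda>v i. \<phi> (v i)) ` K)"

lemma ker_vec_submodule:
  assumes M: "module H M" and m: "\<And>i. i < L \<Longrightarrow> m i \<in> carrier M"
  shows "submodule (ker_vec M m L) R (fm R L)"
proof -
  interpret M: module H M by fact
  interpret F: module R "fm R L" by (rule R.fm_module)
  have add: "lc M m L (\<lambda>i. \<phi> (v i) \<oplus>\<^bsub>H\<^esub> \<phi> (w i)) = lc M m L (\<lambda>i. \<phi> (v i)) \<oplus>\<^bsub>M\<^esub> lc M m L (\<lambda>i. \<phi> (w i))"
    if "v \<in> carrier (fm R L)" "w \<in> carrier (fm R L)" for v w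
    using that m by (intro M.lc_add) auto
  have sm: "lc M m L (\<lambda>i. \<phi> r \<otimes>\<^bsub>H\<^esub> \<phi> (v i)) = \<phi> r \<odot>\<^bsub>M\<^esub> lc M m L (\<lambda>i. \<phi> (v i))"
    if "v \<in> carrier (fm R L)" "r \<in> carrier R" for v r
    using that m by (intro M.lc_smult) auto
  have smult: "r \<odot>\<^bsub>fm R L\<^esub> v \<in> ker_vec M m L" if "r \<in> carrier R" "v \<in> ker_vec M m L" for r v
  proof -
    have v: "v \<in> carrier (fm R L)" "lc M m L (\<lambda>i. \<phi> (v i)) = \<zero>\<^bsub>M\<^esub>" using that by (auto simp: ker_vec_def)
    have "(\<lambda>i. \<phi> ((r \<odot>\<^bsub>fm R L\<^esub> v) i)) = (\<lambda>i. \<phi> r \<otimes>\<^bsub>H\<^esub> \<phi> (v i))" using that(1) R.mem_fm_closed[OF v(1)] by simp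
    then show ?thesis using that(1) v F.smult_closed[OF that(1) v(1)] sm[OF v(1) that(1)] unfolding ker_vec_def by simp
  qed
  show ?thesis
  proof (rule F.submoduleI)
    show kc: "ker_vec M m L \<subseteq> carrier (fm R L)" by (auto simp: ker_vec_def)
    show "\<zero>\<^bsub>fm R L\<^esub> \<in> ker_vec M m L" using F.M.zero_closed m by (simp add: ker_vec_def M.lc_zero)
    show "\<ominus>\<^bsub>fm R L\<^esub> v \<in> ker_vec M m L" if "v \<in> ker_vec M m L" for v
    proof -
      have "\<ominus>\<^bsub>fm R L\<^esub> v = (\<ominus>\<^bsub>R\<^esub> \<one>\<^bsub>R\<^esub>) \<odot>\<^bsub>fm R L\<^esub> v" using that kc by (subst F.smult_l_minus) auto
      then show ?thesis using smult[of "\<ominus>\<^bsub>R\<^esub> \<one>\<^bsub>R\<^esub>" v] that by simp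
    qed
    show "v \<oplus>\<^bsub>fm R L\<^esub> w \<in> ker_vec M m L" if "v \<in> ker_vec M m L" "w \<in> ker_vec M m L" for v w
    proof -
      have v: "v \<in> carrier (fm R L)" "lc M m L (\<lambda>i. \<phi> (v i)) = \<zero>\<^bsub>M\<^esub>"
        and w: "w \<in> carrier (fm R L)" "lc M m L (\<lambda>i. \<phi> (w i)) = \<zero>\<^bsub>M\<^esub>" using that by (auto simp: ker_vec_def)
      have "(\<lambda>i. \<phi> ((v \<oplus>\<^bsub>fm R L\<^esub> w) i)) = (\<lambda>i. \<phi> (v i) \<oplus>\<^bsub>H\<^esub> \<phi> (w i))"
        using R.mem_fm_closed[OF v(1)] R.mem_fm_closed[OF w(1)] by simp
      then show ?thesis using v w F.M.a_closed[OF v(1) w(1)] add[OF v(1) w(1)] unfolding ker_vec_def by simp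
    qed
  qed (use smult in auto)
qed

lemma ext_vec_submodule:
  assumes "K \<subseteq> carrier (fm R L)" shows "submodule (ext_vec L K) H (fm H L)"
proof -
  interpret F: module H "fm H L" by (rule H.fm_module)
  show ?thesis unfolding ext_vec_def using assms by (intro F.mspan_submodule) auto
qed

text \<open>Relations over \<open>R\<close> remain relations over \<open>H\<close>. This makes the
  map from \<open>H \<otimes>\<^sub>R N\<close> to \<open>M\<close> well defined.\<close>

lemma ext_vec_ker:
  assumes M: "module H M" and m: "\<And>i. i < L \<Longrightarrow> m i \<in> carrier M" and v: "v \<in> ext_vec L (ker_vec M m L)"
  shows "lc M m L v = \<zero>\<^bsub>M\<^esub>"
proof -
  interpret M: module H M by fact
  interpret F: module H "fm H L" by (rule H.fm_module)
  have h: "lc M m L \<in> module_hom H (fm H L) M" by (rule lc_module_hom[OF M m])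
  have "ext_vec L (ker_vec M m L) \<subseteq> {v \<in> carrier (fm H L). lc M m L v \<in> {\<zero>\<^bsub>M\<^esub>}}"
    unfolding ext_vec_def
    by (rule F.mspan_subset[OF vimage_submodule[OF F.module_axioms M h M.zero_submodule]]) (auto simp: ker_vec_def)
  then show ?thesis using v by blast
qed

text \<open>The ambient module for a presentation of \<open>H \<otimes>\<^sub>R M\<close> with one
  generator for each element of \<open>M\<close>. Finite support is not imposed here;
  \<open>trel\<close> looks at restrictions to finite sets.\<close>

definition funs :: "('b, 'c \<Rightarrow> 'b) module" where
  "funs = \<lparr>carrier = {f. \<forall>m. f m \<in> carrier H}, mult = undefined, one = undefined,
     zero = (\<lambda>_. \<zero>\<^bsub>H\<^esub>), add = (\<lambda>f g m. f m \<oplus>\<^bsub>H\<^esub> g m), smult = (\<lambda>a f m. a \<otimes>\<^bsub>H\<^esub> f m)\<rparr>"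

lemma funs_simps [simp]:
  "\<zero>\<^bsub>funs\<^esub> = (\<lambda>_. \<zero>\<^bsub>H\<^esub>)" "f \<oplus>\<^bsub>funs\<^esub> g = (\<lambda>m. f m \<oplus>\<^bsub>H\<^esub> g m)" "a \<odot>\<^bsub>funs\<^esub> f = (\<lambda>m. a \<otimes>\<^bsub>H\<^esub> f m)"
  by (simp_all add: funs_def)

lemma mem_funs: "f \<in> carrier funs \<longleftrightarrow> (\<forall>m. f m \<in> carrier H)"
  by (simp add: funs_def)

lemma funs_module: "module H funs"
proof (rule moduleI[OF H.cring_axioms])
  show "abelian_group funs"
  proof (rule abelian_groupI)
    show "\<exists>g\<in>carrier funs. g \<oplus>\<^bsub>funs\<^esub> f = \<zero>\<^bsub>funs\<^esub>" if "f \<in> carrier funs" for f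
      using that by (intro bexI[of _ "\<lambda>m. \<ominus>\<^bsub>H\<^esub> f m"]) (auto simp: mem_funs H.l_neg)
  qed (auto simp: mem_funs H.a_ac)
qed (auto simp: mem_funs H.l_distr H.r_distr H.m_assoc)

definition restr :: "(nat \<Rightarrow> 'c) \<Rightarrow> nat \<Rightarrow> ('c \<Rightarrow> 'b) \<Rightarrow> nat \<Rightarrow> 'b" where
  "restr m L f = (\<lambda>i. if i < L then f (m i) else \<zero>\<^bsub>H\<^esub>)"

text \<open>Finite subsets of \<open>M\<close> enter as enumerations because free modules are
  indexed by numbers; injectivity makes \<open>restr\<close> count each value once.\<close>

definition enum_ge :: "('b, 'c) module \<Rightarrow> 'c set \<Rightarrow> (nat \<Rightarrow> 'c) \<Rightarrow> nat \<Rightarrow> bool" where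
  "enum_ge M A m L \<longleftrightarrow> A \<subseteq> m ` {..<L} \<and> inj_on m {..<L} \<and> m ` {..<L} \<subseteq> carrier M"

text \<open>The functions of finite support on \<open>M\<close> that represent \<open>0\<close> in \<open>H \<otimes>\<^sub>R M\<close>: restricted to every
  sufficiently large finite subset of \<open>M\<close> they are \<open>H\<close>-combinations of \<open>R\<close>-linear relations.\<close>

definition trel :: "('b, 'c) module \<Rightarrow> ('c \<Rightarrow> 'b) set" where
  "trel M = {f \<in> carrier funs. \<exists>A. finite A \<and> A \<subseteq> carrier M \<and>
     (\<forall>m L. enum_ge M A m L \<longrightarrow> restr m L f \<in> ext_vec L (ker_vec M m L))}"

lemma enum_geD: "enum_ge M A m L \<Longrightarrow> i < L \<Longrightarrow> m i \<in> carrier M"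
  by (auto simp: enum_ge_def)

text \<open>Closure under sums rests on the demand for all enumerations beyond a finite set, not
  just for one: the union of two such sets serves for the sum.\<close>

lemma trel_submodule:
  assumes M: "module H M" shows "submodule (trel M) H funs"
proof -
  interpret Fu: module H funs by (rule funs_module)
  have sub: "submodule (ext_vec L (ker_vec M m L)) H (fm H L)" for m L
    by (rule ext_vec_submodule) (auto simp: ker_vec_def)
  note D = module.submoduleD[OF H.fm_module sub]
  have sm: "a \<odot>\<^bsub>funs\<^esub> f \<in> trel M" if a: "a \<in> carrier H" and f: "f \<in> trel M" for a f
  proof -
    obtain A where A: "finite A" "A \<subseteq> carrier M"
      "\<And>m L. enum_ge M A m L \<Longrightarrow> restr m L f \<in> ext_vec L (ker_vec M m L)" and fc: "f \<in> carrier funs"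
      using f unfolding trel_def by blast
    have "restr m L (a \<odot>\<^bsub>funs\<^esub> f) \<in> ext_vec L (ker_vec M m L)" if "enum_ge M A m L" for m L
    proof -
      have "restr m L (a \<odot>\<^bsub>funs\<^esub> f) = a \<odot>\<^bsub>fm H L\<^esub> restr m L f" using a by (auto simp: restr_def)
      then show ?thesis using D(3)[OF a A(3)[OF that]] by metis
    qed
    then show ?thesis using A(1,2) fc a Fu.smult_closed[OF a fc] unfolding trel_def by blast
  qed
  show ?thesis
  proof (rule Fu.submoduleI)
    show c: "trel M \<subseteq> carrier funs" by (auto simp: trel_def)
    have "restr m L \<zero>\<^bsub>funs\<^esub> \<in> ext_vec L (ker_vec M m L)" for m L
    proof -
      have "restr m L \<zero>\<^bsub>funs\<^esub> = \<zero>\<^bsub>fm H L\<^esub>" by (auto simp: restr_def)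
      then show ?thesis using D(5) by metis
    qed
    then show "\<zero>\<^bsub>funs\<^esub> \<in> trel M" using Fu.M.zero_closed unfolding trel_def by blast
    show "\<ominus>\<^bsub>funs\<^esub> f \<in> trel M" if "f \<in> trel M" for f
    proof -
      have fc: "f \<in> carrier funs" using that c by blast
      have "\<ominus>\<^bsub>funs\<^esub> f = (\<ominus>\<^bsub>H\<^esub> \<one>\<^bsub>H\<^esub>) \<odot>\<^bsub>funs\<^esub> f"
        by (simp only: Fu.smult_l_minus[OF H.one_closed fc] Fu.smult_one[OF fc])
      then show ?thesis using sm[of "\<ominus>\<^bsub>H\<^esub> \<one>\<^bsub>H\<^esub>" f] that by simp
    qed
    show "f \<oplus>\<^bsub>funs\<^esub> g \<in> trel M" if f: "f \<in> trel M" and g: "g \<in> trel M" for f g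
    proof -
      obtain A where A: "finite A" "A \<subseteq> carrier M"
        "\<And>m L. enum_ge M A m L \<Longrightarrow> restr m L f \<in> ext_vec L (ker_vec M m L)" and fc: "f \<in> carrier funs"
        using f unfolding trel_def by blast
      obtain B where B: "finite B" "B \<subseteq> carrier M"
        "\<And>m L. enum_ge M B m L \<Longrightarrow> restr m L g \<in> ext_vec L (ker_vec M m L)" and gc: "g \<in> carrier funs"
        using g unfolding trel_def by blast
      have "restr m L (f \<oplus>\<^bsub>funs\<^esub> g) \<in> ext_vec L (ker_vec M m L)" if e: "enum_ge M (A \<union> B) m L" for m L
      proof -
        have "restr m L (f \<oplus>\<^bsub>funs\<^esub> g) = restr m L f \<oplus>\<^bsub>fm H L\<^esub> restr m L g" by (auto simp: restr_def)
        moreover have "enum_ge M A m L" "enum_ge M B m L" using e by (auto simp: enum_ge_def)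
        ultimately show ?thesis using D(4)[OF A(3) B(3)] by metis
      qed
      then show ?thesis using A(1,2) B(1,2) Fu.M.a_closed[OF fc gc] unfolding trel_def by blast
    qed
  qed (use sm in auto)
qed

definition single :: "'c \<Rightarrow> 'b \<Rightarrow> 'c \<Rightarrow> 'b" where
  "single m h = (\<lambda>m'. if m' = m then h else \<zero>\<^bsub>H\<^esub>)"

lemma single_closed [simp]: "h \<in> carrier H \<Longrightarrow> single m h \<in> carrier funs"
  by (simp add: mem_funs single_def)

text \<open>The relation is a vector over \<open>R\<close> in \<open>ker_vec\<close>, and its
  multiple by \<open>h\<close> lies in the \<open>H\<close>-span. The three elements may coincide,
  which is why sums of \<open>single\<close> are taken.\<close>

lemma single_relation:
  assumes M: "module H M" and x: "x \<in> carrier M" "y \<in> carrier M" "z \<in> carrier M"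
    and r: "r \<in> carrier R" "s \<in> carrier R" "t \<in> carrier R" and h: "h \<in> carrier H"
    and rel: "\<phi> r \<odot>\<^bsub>M\<^esub> x \<oplus>\<^bsub>M\<^esub> (\<phi> s \<odot>\<^bsub>M\<^esub> y \<oplus>\<^bsub>M\<^esub> \<phi> t \<odot>\<^bsub>M\<^esub> z) = \<zero>\<^bsub>M\<^esub>"
  shows "single x (h \<otimes>\<^bsub>H\<^esub> \<phi> r) \<oplus>\<^bsub>funs\<^esub> (single y (h \<otimes>\<^bsub>H\<^esub> \<phi> s) \<oplus>\<^bsub>funs\<^esub> single z (h \<otimes>\<^bsub>H\<^esub> \<phi> t)) \<in> trel M" (is "?f \<in> _")
proof -
  interpret M: module H M by fact
  interpret Fu: module H funs by (rule funs_module)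
  have "restr m L ?f \<in> ext_vec L (ker_vec M m L)" if e: "enum_ge M {x, y, z} m L" for m L
  proof -
    interpret F: module R "fm R L" by (rule R.fm_module)
    interpret FH: module H "fm H L" by (rule H.fm_module)
    have im: "x \<in> m ` {..<L}" "y \<in> m ` {..<L}" "z \<in> m ` {..<L}" using e unfolding enum_ge_def by simp_all
    obtain i where i: "i < L" "x = m i" using im(1) by auto
    obtain j where j: "j < L" "y = m j" using im(2) by auto
    obtain k where k: "k < L" "z = m k" using im(3) by auto
    note ijk = i(1) j(1) k(1) i(2) j(2) k(2)
    define v where "v = r \<odot>\<^bsub>fm R L\<^esub> unit_vec R i \<oplus>\<^bsub>fm R L\<^esub> (s \<odot>\<^bsub>fm R L\<^esub> unit_vec R j \<oplus>\<^bsub>fm R L\<^esub> t \<odot>\<^bsub>fm R L\<^esub> unit_vec R k)"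
    have vc: "v \<in> carrier (fm R L)" unfolding v_def using r ijk R.unit_vec_closed by blast
    define u where "u = \<phi> r \<odot>\<^bsub>fm H L\<^esub> unit_vec H i \<oplus>\<^bsub>fm H L\<^esub> (\<phi> s \<odot>\<^bsub>fm H L\<^esub> unit_vec H j \<oplus>\<^bsub>fm H L\<^esub> \<phi> t \<odot>\<^bsub>fm H L\<^esub> unit_vec H k)"
    have \<phi>v: "(\<lambda>n. \<phi> (v n)) = u" using r by (auto simp: v_def u_def unit_vec_def)
    have mc: "m n \<in> carrier M" if "n < L" for n using enum_geD[OF e that] .
    have hom: "lc M m L \<in> module_hom H (fm H L) M" by (rule lc_module_hom[OF M mc])
    note hd = module_homD[OF hom]
    have ucl: "unit_vec H i \<in> carrier (fm H L)" "unit_vec H j \<in> carrier (fm H L)" "unit_vec H k \<in> carrier (fm H L)"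
      using ijk by auto
    have \<phi>c: "\<phi> r \<in> carrier H" "\<phi> s \<in> carrier H" "\<phi> t \<in> carrier H" using r by auto
    have lu: "lc M m L (unit_vec H n) = m n" if "n < L" for n by (rule M.lc_unit_vec[OF mc that])
    have "lc M m L u = \<phi> r \<odot>\<^bsub>M\<^esub> x \<oplus>\<^bsub>M\<^esub> (\<phi> s \<odot>\<^bsub>M\<^esub> y \<oplus>\<^bsub>M\<^esub> \<phi> t \<odot>\<^bsub>M\<^esub> z)"
      unfolding u_def hd(2)[OF FH.smult_closed[OF \<phi>c(1) ucl(1)] FH.M.a_closed[OF FH.smult_closed[OF \<phi>c(2) ucl(2)] FH.smult_closed[OF \<phi>c(3) ucl(3)]]]
        hd(2)[OF FH.smult_closed[OF \<phi>c(2) ucl(2)] FH.smult_closed[OF \<phi>c(3) ucl(3)]]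
        hd(3)[OF \<phi>c(1) ucl(1)] hd(3)[OF \<phi>c(2) ucl(2)] hd(3)[OF \<phi>c(3) ucl(3)] ijk(4-6)
        lu[OF ijk(1)] lu[OF ijk(2)] lu[OF ijk(3)] ..
    then have "v \<in> ker_vec M m L" using vc rel \<phi>v unfolding ker_vec_def by simp
    then have "u \<in> (\<lambda>v n. \<phi> (v n)) ` ker_vec M m L" unfolding \<phi>v[symmetric] by (rule imageI)
    moreover have kc: "ker_vec M m L \<subseteq> carrier (fm R L)" by (auto simp: ker_vec_def)
    then have "(\<lambda>v n. \<phi> (v n)) ` ker_vec M m L \<subseteq> carrier (fm H L)" using \<phi>_fm by blast
    ultimately have "u \<in> ext_vec L (ker_vec M m L)"
      unfolding ext_vec_def using FH.mspan_superset by blast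
    then have "h \<odot>\<^bsub>fm H L\<^esub> u \<in> ext_vec L (ker_vec M m L)"
      by (rule FH.submoduleD(3)[OF ext_vec_submodule[OF kc] h])
    moreover have "restr m L ?f = h \<odot>\<^bsub>fm H L\<^esub> u"
    proof
      fix n
      have inj: "m n = m i' \<longleftrightarrow> n = i'" if "n < L" "i' < L" for i' using e that unfolding enum_ge_def inj_on_def by auto
      show "restr m L ?f n = (h \<odot>\<^bsub>fm H L\<^esub> u) n"
        using ijk(1-3) \<phi>c h inj unfolding ijk(4-6)
        by (cases "n < L") (auto simp: restr_def single_def u_def unit_vec_def H.r_distr)
    qed
    ultimately show ?thesis by metis
  qed
  moreover have "?f \<in> carrier funs"
    using h r by (intro Fu.M.a_closed single_closed) auto
  ultimately show ?thesis using x unfolding trel_def by (intro CollectI conjI exI[of _ "{x, y, z}"]) auto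
qed

text \<open>The elementary tensor \<open>h \<otimes> m\<close> in
  \<open>H \<otimes>\<^sub>R M\<close>.\<close>

definition tens :: "('b, 'c) module \<Rightarrow> 'c \<Rightarrow> 'b \<Rightarrow> ('c \<Rightarrow> 'b) set" where
  "tens M m h = trel M +>\<^bsub>funs\<^esub> single m h"

context
  fixes M :: "('b, 'c) module"
  assumes M: "module H M"
begin

interpretation M: module H M by (rule M)
interpretation Fu: module H "funs :: ('b, 'c \<Rightarrow> 'b) module" by (rule funs_module)

abbreviation "T \<equiv> quot_module funs (trel M)"

lemma T_module: "module H T" by (rule quot_module_module[OF funs_module trel_submodule[OF M]])

interpretation T: module H T by (rule T_module)

lemma tens_closed: "h \<in> carrier H \<Longrightarrow> tens M m h \<in> carrier T"
  unfolding tens_def carrier_quot_module[OF funs_module trel_submodule[OF M]] by (intro imageI single_closed)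

lemma coset_add:
  assumes "f \<in> carrier funs" "g \<in> carrier funs"
  shows "(trel M +>\<^bsub>funs\<^esub> f) \<oplus>\<^bsub>T\<^esub> (trel M +>\<^bsub>funs\<^esub> g) = trel M +>\<^bsub>funs\<^esub> (f \<oplus>\<^bsub>funs\<^esub> g)"
  using module_homD(2)[OF coset_module_hom[OF funs_module trel_submodule[OF M]] assms] by (rule sym)

lemma tens_add_right:
  assumes "h \<in> carrier H" "h' \<in> carrier H"
  shows "tens M m (h \<oplus>\<^bsub>H\<^esub> h') = tens M m h \<oplus>\<^bsub>T\<^esub> tens M m h'"
proof -
  have "single m (h \<oplus>\<^bsub>H\<^esub> h') = single m h \<oplus>\<^bsub>funs\<^esub> single m h'" using assms by (auto simp: single_def)
  then show ?thesis unfolding tens_def coset_add[OF single_closed[OF assms(1)] single_closed[OF assms(2)]] by simp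
qed

text \<open>Additivity in the module argument, vanishing at zero and the passage of scalars from
  \<open>R\<close> across the tensor sign are instances of this one relation.\<close>

lemma tens_relation:
  assumes x: "x \<in> carrier M" "y \<in> carrier M" "z \<in> carrier M"
    and r: "s \<in> carrier R" "t \<in> carrier R" and h: "h \<in> carrier H"
    and rel: "x = \<phi> s \<odot>\<^bsub>M\<^esub> y \<oplus>\<^bsub>M\<^esub> \<phi> t \<odot>\<^bsub>M\<^esub> z"
  shows "tens M x h = tens M y (h \<otimes>\<^bsub>H\<^esub> \<phi> s) \<oplus>\<^bsub>T\<^esub> tens M z (h \<otimes>\<^bsub>H\<^esub> \<phi> t)"
proof -
  have c: "h \<otimes>\<^bsub>H\<^esub> \<phi> s \<in> carrier H" "h \<otimes>\<^bsub>H\<^esub> \<phi> t \<in> carrier H" using h r by auto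
  let ?g = "single y (h \<otimes>\<^bsub>H\<^esub> \<phi> s) \<oplus>\<^bsub>funs\<^esub> single z (h \<otimes>\<^bsub>H\<^esub> \<phi> t)"
  have gc: "?g \<in> carrier funs" using c by (intro Fu.M.a_closed single_closed)
  have "\<phi> \<one>\<^bsub>R\<^esub> \<odot>\<^bsub>M\<^esub> x \<oplus>\<^bsub>M\<^esub> (\<phi> (\<ominus>\<^bsub>R\<^esub> s) \<odot>\<^bsub>M\<^esub> y \<oplus>\<^bsub>M\<^esub> \<phi> (\<ominus>\<^bsub>R\<^esub> t) \<odot>\<^bsub>M\<^esub> z) = \<zero>\<^bsub>M\<^esub>"
  proof -
    have cc: "\<phi> s \<odot>\<^bsub>M\<^esub> y \<in> carrier M" "\<phi> t \<odot>\<^bsub>M\<^esub> z \<in> carrier M" using r x by auto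
    have "\<phi> (\<ominus>\<^bsub>R\<^esub> s) \<odot>\<^bsub>M\<^esub> y \<oplus>\<^bsub>M\<^esub> \<phi> (\<ominus>\<^bsub>R\<^esub> t) \<odot>\<^bsub>M\<^esub> z = \<ominus>\<^bsub>M\<^esub> (\<phi> s \<odot>\<^bsub>M\<^esub> y \<oplus>\<^bsub>M\<^esub> \<phi> t \<odot>\<^bsub>M\<^esub> z)"
      using r x cc by (simp add: M.smult_l_minus M.M.minus_add)
    then show ?thesis using x r by (simp add: rel M.M.r_neg)
  qed
  then have "single x (h \<otimes>\<^bsub>H\<^esub> \<phi> \<one>\<^bsub>R\<^esub>) \<oplus>\<^bsub>funs\<^esub> (single y (h \<otimes>\<^bsub>H\<^esub> \<phi> (\<ominus>\<^bsub>R\<^esub> s)) \<oplus>\<^bsub>funs\<^esub> single z (h \<otimes>\<^bsub>H\<^esub> \<phi> (\<ominus>\<^bsub>R\<^esub> t))) \<in> trel M"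
    using r by (intro single_relation[OF M x _ _ _ h]) auto
  moreover have "single x (h \<otimes>\<^bsub>H\<^esub> \<phi> \<one>\<^bsub>R\<^esub>) \<oplus>\<^bsub>funs\<^esub> (single y (h \<otimes>\<^bsub>H\<^esub> \<phi> (\<ominus>\<^bsub>R\<^esub> s)) \<oplus>\<^bsub>funs\<^esub> single z (h \<otimes>\<^bsub>H\<^esub> \<phi> (\<ominus>\<^bsub>R\<^esub> t))) =
      single x h \<oplus>\<^bsub>funs\<^esub> \<ominus>\<^bsub>funs\<^esub> ?g"
  proof -
    have "\<ominus>\<^bsub>funs\<^esub> ?g = (\<ominus>\<^bsub>H\<^esub> \<one>\<^bsub>H\<^esub>) \<odot>\<^bsub>funs\<^esub> ?g"
      by (simp only: Fu.smult_l_minus[OF H.one_closed gc] Fu.smult_one[OF gc])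
    also have "\<dots> = single y (h \<otimes>\<^bsub>H\<^esub> \<phi> (\<ominus>\<^bsub>R\<^esub> s)) \<oplus>\<^bsub>funs\<^esub> single z (h \<otimes>\<^bsub>H\<^esub> \<phi> (\<ominus>\<^bsub>R\<^esub> t))"
      using h r by (auto simp: single_def H.l_minus H.r_minus H.minus_add)
    finally show ?thesis using h by simp
  qed
  ultimately have "single x h \<oplus>\<^bsub>funs\<^esub> \<ominus>\<^bsub>funs\<^esub> ?g \<in> trel M" by metis
  then have "trel M +>\<^bsub>funs\<^esub> single x h = trel M +>\<^bsub>funs\<^esub> ?g"
    using coset_eq_iff[OF funs_module trel_submodule[OF M] single_closed[OF h] gc] by blast
  then show ?thesis unfolding tens_def coset_add[OF single_closed[OF c(1)] single_closed[OF c(2)]] .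
qed

lemma tens_zero_right: "tens M m \<zero>\<^bsub>H\<^esub> = \<zero>\<^bsub>T\<^esub>"
proof -
  have "single m \<zero>\<^bsub>H\<^esub> = \<zero>\<^bsub>funs\<^esub>" by (auto simp: single_def)
  then show ?thesis
    unfolding tens_def coset_eq_zero_iff[OF funs_module trel_submodule[OF M] single_closed[OF H.zero_closed]]
    using Fu.submoduleD(5)[OF trel_submodule[OF M]] by metis
qed

lemma tens_add_left:
  assumes "x \<in> carrier M" "y \<in> carrier M" "h \<in> carrier H"
  shows "tens M (x \<oplus>\<^bsub>M\<^esub> y) h = tens M x h \<oplus>\<^bsub>T\<^esub> tens M y h"
proof -
  have e: "x \<oplus>\<^bsub>M\<^esub> y = \<phi> \<one>\<^bsub>R\<^esub> \<odot>\<^bsub>M\<^esub> x \<oplus>\<^bsub>M\<^esub> \<phi> \<one>\<^bsub>R\<^esub> \<odot>\<^bsub>M\<^esub> y" using assms by simp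
  have h: "h \<otimes>\<^bsub>H\<^esub> \<phi> \<one>\<^bsub>R\<^esub> = h" using assms by simp
  show ?thesis
    using tens_relation[OF M.M.a_closed[OF assms(1,2)] assms(1,2) R.one_closed R.one_closed assms(3) e] unfolding h .
qed

lemma tens_zero_left:
  assumes "h \<in> carrier H" shows "tens M \<zero>\<^bsub>M\<^esub> h = \<zero>\<^bsub>T\<^esub>"
proof -
  note z = M.M.zero_closed
  have e: "\<zero>\<^bsub>M\<^esub> = \<phi> \<zero>\<^bsub>R\<^esub> \<odot>\<^bsub>M\<^esub> \<zero>\<^bsub>M\<^esub> \<oplus>\<^bsub>M\<^esub> \<phi> \<zero>\<^bsub>R\<^esub> \<odot>\<^bsub>M\<^esub> \<zero>\<^bsub>M\<^esub>" by simp
  have h: "h \<otimes>\<^bsub>H\<^esub> \<phi> \<zero>\<^bsub>R\<^esub> = \<zero>\<^bsub>H\<^esub>" using assms by simp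
  show ?thesis
    using tens_relation[OF z z z R.zero_closed R.zero_closed assms e]
    unfolding h tens_zero_right T.M.r_zero[OF T.M.zero_closed] .
qed

lemma tens_balanced_smult:
  assumes "x \<in> carrier M" "r \<in> carrier R" "h \<in> carrier H"
  shows "tens M (\<phi> r \<odot>\<^bsub>M\<^esub> x) h = tens M x (\<phi> r \<otimes>\<^bsub>H\<^esub> h)"
proof -
  have e: "\<phi> r \<odot>\<^bsub>M\<^esub> x = \<phi> r \<odot>\<^bsub>M\<^esub> x \<oplus>\<^bsub>M\<^esub> \<phi> \<zero>\<^bsub>R\<^esub> \<odot>\<^bsub>M\<^esub> x" using assms by simp
  have h: "h \<otimes>\<^bsub>H\<^esub> \<phi> \<zero>\<^bsub>R\<^esub> = \<zero>\<^bsub>H\<^esub>" "h \<otimes>\<^bsub>H\<^esub> \<phi> r = \<phi> r \<otimes>\<^bsub>H\<^esub> h" "\<phi> r \<otimes>\<^bsub>H\<^esub> h \<in> carrier H"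
    using assms by (auto simp: H.m_comm)
  have "\<phi> r \<odot>\<^bsub>M\<^esub> x \<in> carrier M" using assms by simp
  from tens_relation[OF this assms(1,1,2) R.zero_closed assms(3) e] show ?thesis
    unfolding h(1,2) tens_zero_right T.M.r_zero[OF tens_closed[OF h(3)]] .
qed

text \<open>The map to which the separator is applied: the second ring argument acts on a fixed
  element of \<open>M\<close>.\<close>

lemma tens_balanced:
  assumes "g \<in> carrier M" shows "balanced T (\<lambda>h x. tens M (x \<odot>\<^bsub>M\<^esub> g) h)"
  unfolding balanced_def
  using assms T.M.abelian_group_axioms
  by (auto simp: tens_closed tens_add_right tens_add_left M.smult_l_distr M.smult_assoc1 tens_balanced_smult)

lemma additive_lc:
  assumes X: "abelian_group X" and \<psi>: "\<And>x. x \<in> carrier M \<Longrightarrow> \<psi> x \<in> carrier X"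
    "\<And>x y. x \<in> carrier M \<Longrightarrow> y \<in> carrier M \<Longrightarrow> \<psi> (x \<oplus>\<^bsub>M\<^esub> y) = \<psi> x \<oplus>\<^bsub>X\<^esub> \<psi> y" "\<psi> \<zero>\<^bsub>M\<^esub> = \<zero>\<^bsub>X\<^esub>"
    and g: "\<And>i. i < p \<Longrightarrow> g i \<in> carrier M" "\<And>i. i < p \<Longrightarrow> v i \<in> carrier H"
  shows "\<psi> (lc M g p v) = lsum X (\<lambda>j. \<psi> (v j \<odot>\<^bsub>M\<^esub> g j)) [0..<p]"
proof -
  interpret X: abelian_group X by fact
  show ?thesis using g
  proof (induct p)
    case (Suc p)
    have "lsum X (\<lambda>j. \<psi> (v j \<odot>\<^bsub>M\<^esub> g j)) ([0..<p] @ [p]) = lsum X (\<lambda>j. \<psi> (v j \<odot>\<^bsub>M\<^esub> g j)) [0..<p] \<oplus>\<^bsub>X\<^esub> \<psi> (v p \<odot>\<^bsub>M\<^esub> g p)"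
      using Suc \<psi> by (subst X.lsum_append) auto
    then show ?case using Suc \<psi> by simp
  qed (simp add: \<psi>)
qed

end

end

lemma lsum_additive:
  assumes "f \<zero>\<^bsub>X\<^esub> = \<zero>\<^bsub>Y\<^esub>" "\<And>x y. x \<in> carrier X \<Longrightarrow> y \<in> carrier X \<Longrightarrow> f (x \<oplus>\<^bsub>X\<^esub> y) = f x \<oplus>\<^bsub>Y\<^esub> f y"
    and X: "abelian_group X" and "\<And>i. i \<in> set xs \<Longrightarrow> g i \<in> carrier X"
  shows "f (lsum X g xs) = lsum Y (\<lambda>i. f (g i)) xs"
proof -
  interpret X: abelian_group X by fact
  show ?thesis using assms(4) by (induct xs) (simp_all add: assms(1,2))
qed

lemma module_hom_lsum:
  assumes "module R M" "module R N" "f \<in> module_hom R M N" "\<And>i. i \<in> set xs \<Longrightarrow> g i \<in> carrier M"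
  shows "f (lsum M g xs) = lsum N (\<lambda>i. f (g i)) xs"
  using assms(4)
  by (intro lsum_additive module_hom_zero[OF assms(1-3)] module_homD(2)[OF assms(3)])
    (auto simp: module.axioms(2)[OF assms(1)])

context module begin

lemma lsum_smult:
  assumes "a \<in> carrier R" "\<And>i. i \<in> set xs \<Longrightarrow> g i \<in> carrier M"
  shows "a \<odot>\<^bsub>M\<^esub> lsum M g xs = lsum M (\<lambda>i. a \<odot>\<^bsub>M\<^esub> g i) xs"
  using assms by (intro lsum_additive) (auto simp: smult_r_distr M.abelian_group_axioms)

lemma lsum_smult_left:
  assumes "x \<in> carrier M" "\<And>i. i \<in> set xs \<Longrightarrow> g i \<in> carrier R"
  shows "lsum R g xs \<odot>\<^bsub>M\<^esub> x = lsum M (\<lambda>i. g i \<odot>\<^bsub>M\<^esub> x) xs"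
  using assms by (intro lsum_additive) (auto simp: smult_l_distr R.abelian_group_axioms)

end

context henselization begin

lemma restr_module_hom: "restr m L \<in> module_hom H funs (fm H L)"
  by (auto simp: module_hom_def restr_def mem_funs mem_fm_iff fun_eq_iff)

lemma lc_restr_single:
  assumes M: "module H M" and e: "enum_ge M A m L" and x: "x \<in> A" and h: "h \<in> carrier H"
  shows "lc M m L (restr m L (single x h)) = h \<odot>\<^bsub>M\<^esub> x"
proof -
  interpret M: module H M by fact
  have mc: "m n \<in> carrier M" if "n < L" for n using enum_geD[OF e that] .
  have "x \<in> m ` {..<L}" using e x unfolding enum_ge_def by blast
  then obtain i where i: "i < L" "x = m i" by auto
  have inj: "m n = m i \<longleftrightarrow> n = i" if "n < L" for n using e that i(1) unfolding enum_ge_def inj_on_def by auto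
  have "restr m L (single x h) = h \<odot>\<^bsub>fm H L\<^esub> unit_vec H i"
    using h i inj by (auto simp: restr_def single_def unit_vec_def)
  moreover have "lc M m L (h \<odot>\<^bsub>fm H L\<^esub> unit_vec H i) = h \<odot>\<^bsub>M\<^esub> lc M m L (unit_vec H i)"
    by (rule module_homD(3)[OF lc_module_hom[OF M mc] h H.unit_vec_closed[OF i(1)]])
  moreover have "lc M m L (unit_vec H i) = m i" by (rule M.lc_unit_vec[OF mc i(1)])
  ultimately show ?thesis using i by simp
qed

text \<open>With a separator \<open>\<Sum> u \<otimes> v\<close> for the coefficients of the relations between the generators
  \<open>g j\<close>, the map \<open>g j \<mapsto> \<Sum> u \<otimes> v g j\<close> is a section of the multiplication map \<open>H \<otimes>\<^sub>R M \<rightarrow> M\<close>; it factors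
  through \<open>H \<otimes>\<^sub>R N\<close> for a finitely generated \<open>R\<close>-module \<open>N\<close>.\<close>

theorem retract_of_extended:
  fixes M :: "('b, 'b univ) module"
  assumes R: "noetherian_ring R" and fg: "fg_module H M"
  obtains m L s p where "\<And>i. i < L \<Longrightarrow> m i \<in> carrier M"
    "s \<in> module_hom H M (quot_module (fm H L) (ext_vec L (ker_vec M m L)))"
    "p \<in> module_hom H (quot_module (fm H L) (ext_vec L (ker_vec M m L))) M"
    "\<And>x. x \<in> carrier M \<Longrightarrow> p (s x) = x"
proof -
  have M: "module H M" using fg by (simp add: fg_module_def)
  interpret M: module H M by (rule M)
  interpret Fu: module H "funs :: ('b, 'b univ \<Rightarrow> 'b) module" by (rule funs_module)
  let ?T = "quot_module funs (trel M)" and ?\<pi> = "\<lambda>f. trel M +>\<^bsub>funs\<^esub> f"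
  have T: "module H ?T" by (rule T_module[OF M])
  interpret T: module H ?T by (rule T)
  note tr = trel_submodule[OF M]
  have \<pi>: "?\<pi> \<in> module_hom H funs ?T" by (rule coset_module_hom[OF funs_module tr])
  note \<pi>' = module_homD[OF \<pi>]
  obtain p0 g where g: "\<And>i. i < p0 \<Longrightarrow> g i \<in> carrier M" and gen: "lc M g p0 ` carrier (fm H p0) = carrier M"
    by (rule fg_module_generators[OF fg]) (rule that)
  interpret F0: module H "fm H p0" by (rule H.fm_module)
  have hg: "lc M g p0 \<in> module_hom H (fm H p0) M" by (rule lc_module_hom[OF M g])
  define J where "J = {v \<in> carrier (fm H p0). lc M g p0 v \<in> {\<zero>\<^bsub>M\<^esub>}}"
  have J: "submodule J H (fm H p0)"
    unfolding J_def by (rule vimage_submodule[OF F0.module_axioms M hg M.zero_submodule])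
  obtain nb B where B: "\<And>k. k < nb \<Longrightarrow> B k \<in> J" "J = lc (fm H p0) B nb ` carrier (fm H nb)"
    by (rule noeth_submodule_image_lc[OF F0.module_axioms H.fm_noeth[OF noetherian_H[OF R]] J]) (rule that)
  have Bc: "B k \<in> carrier (fm H p0)" "lc M g p0 (B k) = \<zero>\<^bsub>M\<^esub>" if "k < nb" for k using B(1)[OF that] by (auto simp: J_def)
  \<comment> \<open>\<open>H\<close> is Noetherian, so finitely many relations \<open>B k\<close>
    generate all relations among the generators; \<open>Z\<close> collects their
    coefficients.\<close>
  define Z where "Z = (\<lambda>(k, j). B k j) ` ({..<nb} \<times> {..<p0})"
  have "finite Z" by (simp add: Z_def)
  moreover have "Z \<subseteq> carrier H" using H.mem_fm_closed[OF Bc(1)] by (auto simp: Z_def)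
  ultimately obtain e where e: "separator e" "\<And>z. z \<in> Z \<Longrightarrow> sep e z" by (rule separator_exists) (rule that)
  have ec: "set e \<subseteq> carrier H \<times> carrier H" and e1: "lsum H (\<lambda>(u, v). u \<otimes>\<^bsub>H\<^esub> v) e = \<one>\<^bsub>H\<^esub>"
    using e(1) by (auto simp: separator_def)
  have uc: "fst q \<in> carrier H" "snd q \<in> carrier H" if "q \<in> set e" for q using ec that by auto
  define S where "S j = lsum funs (\<lambda>(u, v). single (v \<odot>\<^bsub>M\<^esub> g j) u) e" for j
  have Sc: "S j \<in> carrier funs" for j
    unfolding S_def using uc by (intro Fu.M.lsum_closed) (auto simp: split_def)
  \<comment> \<open>Well-definedness of the section. The coefficients of a relation are moved across
    the separator to the side of the generators, where the relation itself makes the sum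
    vanish.\<close>
  have AT: "lc funs S p0 (B k) \<in> trel M" if k: "k < nb" for k
  proof -
    have Bkj: "B k j \<in> carrier H" for j using Bc(1)[OF k] by (rule H.mem_fm_closed)
    have "?\<pi> (lc funs S p0 (B k)) = lsum ?T (\<lambda>j. ?\<pi> (B k j \<odot>\<^bsub>funs\<^esub> S j)) [0..<p0]"
      using Sc Bkj by (intro additive_lc[OF funs_module T.M.abelian_group_axioms] \<pi>' module_hom_zero[OF funs_module T \<pi>])
    also have "\<dots> = lsum ?T (\<lambda>j. lsum ?T (\<lambda>(u, v). tens M (v \<odot>\<^bsub>M\<^esub> g j) (B k j \<otimes>\<^bsub>H\<^esub> u)) e) [0..<p0]"
    proof (rule lsum_cong)
      fix j assume "j \<in> set [0..<p0]"
      have "B k j \<odot>\<^bsub>funs\<^esub> S j = lsum funs (\<lambda>q. B k j \<odot>\<^bsub>funs\<^esub> (case q of (u, v) \<Rightarrow> single (v \<odot>\<^bsub>M\<^esub> g j) u)) e"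
        unfolding S_def using uc Bkj by (intro Fu.lsum_smult) (auto simp: split_def)
      also have "\<dots> = lsum funs (\<lambda>q. single (snd q \<odot>\<^bsub>M\<^esub> g j) (B k j \<otimes>\<^bsub>H\<^esub> fst q)) e"
        using Bkj by (intro lsum_cong) (auto simp: single_def split_def)
      finally have "?\<pi> (B k j \<odot>\<^bsub>funs\<^esub> S j) = ?\<pi> (lsum funs (\<lambda>q. single (snd q \<odot>\<^bsub>M\<^esub> g j) (B k j \<otimes>\<^bsub>H\<^esub> fst q)) e)" by simp
      also have "\<dots> = lsum ?T (\<lambda>q. tens M (snd q \<odot>\<^bsub>M\<^esub> g j) (B k j \<otimes>\<^bsub>H\<^esub> fst q)) e"
        unfolding tens_def using uc Bkj by (intro module_hom_lsum[OF funs_module T \<pi>]) auto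
      finally show "?\<pi> (B k j \<odot>\<^bsub>funs\<^esub> S j) = lsum ?T (\<lambda>(u, v). tens M (v \<odot>\<^bsub>M\<^esub> g j) (B k j \<otimes>\<^bsub>H\<^esub> u)) e"
        by (simp only: split_def)
    qed
    also have "\<dots> = lsum ?T (\<lambda>j. lsum ?T (\<lambda>(u, v). tens M ((B k j \<otimes>\<^bsub>H\<^esub> v) \<odot>\<^bsub>M\<^esub> g j) u) e) [0..<p0]"
    proof (rule lsum_cong)
      fix j assume "j \<in> set [0..<p0]"
      then have j: "j < p0" by simp
      have "sep e (B k j)" using k j by (intro e(2)) (auto simp: Z_def)
      \<comment> \<open>For \<open>M\<close> in type \<open>'b univ\<close> the carrier of
        \<open>?T\<close> lies in exactly the type of groups on which \<open>sep\<close> is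
        tested.\<close>
      from sepD[OF this tens_balanced[OF M g[OF j]]]
      show "lsum ?T (\<lambda>(u, v). tens M (v \<odot>\<^bsub>M\<^esub> g j) (B k j \<otimes>\<^bsub>H\<^esub> u)) e = lsum ?T (\<lambda>(u, v). tens M ((B k j \<otimes>\<^bsub>H\<^esub> v) \<odot>\<^bsub>M\<^esub> g j) u) e" .
    qed
    also have "\<dots> = lsum ?T (\<lambda>q. lsum ?T (\<lambda>j. tens M ((B k j \<otimes>\<^bsub>H\<^esub> snd q) \<odot>\<^bsub>M\<^esub> g j) (fst q)) [0..<p0]) e"
      unfolding split_def using uc Bkj by (intro T.M.lsum_swap tens_closed[OF M]) auto
    also have "\<dots> = \<zero>\<^bsub>?T\<^esub>"
    proof (rule T.M.lsum_zero)
      fix q assume q: "q \<in> set e"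
      have "lsum ?T (\<lambda>j. tens M ((B k j \<otimes>\<^bsub>H\<^esub> snd q) \<odot>\<^bsub>M\<^esub> g j) (fst q)) [0..<p0] =
          tens M (lc M g p0 (\<lambda>j. B k j \<otimes>\<^bsub>H\<^esub> snd q)) (fst q)"
        using g uc[OF q] Bkj
        by (intro additive_lc[OF M T.M.abelian_group_axioms, symmetric] tens_closed[OF M] tens_add_left[OF M] tens_zero_left[OF M]) auto
      also have "lc M g p0 (\<lambda>j. B k j \<otimes>\<^bsub>H\<^esub> snd q) = lc M g p0 (\<lambda>j. snd q \<otimes>\<^bsub>H\<^esub> B k j)"
        using uc[OF q] Bkj by (intro lc_cong) (auto simp: H.m_comm)
      also have "\<dots> = snd q \<odot>\<^bsub>M\<^esub> lc M g p0 (B k)" using g uc[OF q] Bkj by (intro M.lc_smult)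
      also have "\<dots> = \<zero>\<^bsub>M\<^esub>" using Bc(2)[OF k] uc[OF q] by simp
      finally show "lsum ?T (\<lambda>j. tens M ((B k j \<otimes>\<^bsub>H\<^esub> snd q) \<odot>\<^bsub>M\<^esub> g j) (fst q)) [0..<p0] = \<zero>\<^bsub>?T\<^esub>"
        using tens_zero_left[OF M uc(1)[OF q]] by simp
    qed
    finally have "?\<pi> (lc funs S p0 (B k)) = \<zero>\<^bsub>?T\<^esub>" .
    moreover have "lc funs S p0 (B k) \<in> carrier funs" using Sc Bkj by (intro Fu.lc_closed)
    ultimately show ?thesis using coset_eq_zero_iff[OF funs_module tr] by blast
  qed
  let ?Q = "\<lambda>k A. finite A \<and> A \<subseteq> carrier M \<and>
      (\<forall>m L. enum_ge M A m L \<longrightarrow> restr m L (lc funs S p0 (B k)) \<in> ext_vec L (ker_vec M m L))"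
  have "\<exists>A. ?Q k A" if "k < nb" for k
    using AT[OF that] unfolding trel_def mem_Collect_eq by (rule conjunct2)
  then have "\<forall>k\<in>{..<nb}. \<exists>A. ?Q k A" unfolding Ball_def lessThan_iff by (intro allI impI)
  from bchoice[OF this] obtain A where A': "\<forall>k\<in>{..<nb}. ?Q k (A k)" by (rule exE)
  have A: "finite (A k)" "A k \<subseteq> carrier M" if "k < nb" for k
    using bspec[OF A', of k] that unfolding lessThan_iff by (simp_all only: simp_thms)
  have A3: "restr m L (lc funs S p0 (B k)) \<in> ext_vec L (ker_vec M m L)" if "k < nb" "enum_ge M (A k) m L" for k m L
    using bspec[OF A', of k] that unfolding lessThan_iff by (simp only: simp_thms)
  \<comment> \<open>Finitely many elements of \<open>M\<close> generate the module \<open>N\<close>: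
    those that occur in the section, and those needed to see that the relations vanish. The latter
    is why \<open>N\<close>, and not just the span of the former, receives a well-defined
    map.\<close>
  define A0 where "A0 = (\<Union>k<nb. A k) \<union> (\<lambda>(q, j). snd q \<odot>\<^bsub>M\<^esub> g j) ` (set e \<times> {..<p0})"
  have A0: "finite A0" "A0 \<subseteq> carrier M" using A(1,2) uc g by (auto simp: A0_def)
  obtain L :: nat and m where mL: "A0 = m ` {i. i < L}" "inj_on m {i. i < L}"
    using finite_imp_nat_seg_image_inj_on[OF A0(1)] by metis
  have en: "enum_ge M A0 m L" using mL A0(2) by (simp add: enum_ge_def lessThan_def)
  have enk: "enum_ge M (A k) m L" if "k < nb" for k using en that by (auto simp: enum_ge_def A0_def)
  have mc: "m i \<in> carrier M" if "i < L" for i using enum_geD[OF en that] .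
  interpret FL: module H "fm H L" by (rule H.fm_module)
  let ?K = "ext_vec L (ker_vec M m L)"
  let ?E = "quot_module (fm H L) ?K" and ?\<rho> = "\<lambda>v. ?K +>\<^bsub>fm H L\<^esub> v"
  have K: "submodule ?K H (fm H L)" by (rule ext_vec_submodule) (auto simp: ker_vec_def)
  have E: "module H ?E" by (rule quot_module_module[OF FL.module_axioms K])
  interpret E: module H ?E by (rule E)
  have \<rho>: "?\<rho> \<in> module_hom H (fm H L) ?E" by (rule coset_module_hom[OF FL.module_axioms K])
  define sg where "sg j = restr m L (S j)" for j
  have sgc: "sg j \<in> carrier (fm H L)" for j unfolding sg_def by (rule module_homD(1)[OF restr_module_hom Sc])
  have hsg: "lc (fm H L) sg p0 \<in> module_hom H (fm H p0) (fm H L)" by (rule lc_module_hom[OF FL.module_axioms sgc])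
  have BK: "lc (fm H L) sg p0 (B k) \<in> ?K" if k: "k < nb" for k
  proof -
    have "restr m L (lc funs S p0 (B k)) = lc (fm H L) sg p0 (B k)"
      unfolding sg_def using Sc Bc(1)[OF k]
      by (intro module_hom_lc[OF funs_module FL.module_axioms restr_module_hom]) auto
    then show ?thesis using A3[OF k enk[OF k]] by simp
  qed
  have JK: "lc (fm H L) sg p0 v \<in> ?K" if v: "v \<in> J" for v
  proof -
    obtain c where c: "c \<in> carrier (fm H nb)" "v = lc (fm H p0) B nb c" using v B(2) by blast
    have "lc (fm H L) sg p0 v = lc (fm H L) (\<lambda>k. lc (fm H L) sg p0 (B k)) nb c"
      unfolding c(2) using Bc(1) c(1) by (intro module_hom_lc[OF F0.module_axioms FL.module_axioms hsg]) auto
    also have "\<dots> \<in> ?K" by (rule FL.lc_in_submodule[OF K], rule FL.submoduleD(3)[OF K H.mem_fm_closed[OF c(1)] BK])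
    finally show ?thesis .
  qed
  obtain s where s: "s \<in> module_hom H M ?E" "\<And>v. v \<in> carrier (fm H p0) \<Longrightarrow> s (lc M g p0 v) = ?\<rho> (lc (fm H L) sg p0 v)"
  proof (rule factor_hom[OF F0.module_axioms M E hg gen module_hom_comp[OF hsg \<rho>]])
    fix x assume "x \<in> carrier (fm H p0)" "lc M g p0 x = \<zero>\<^bsub>M\<^esub>"
    then have "lc (fm H L) sg p0 x \<in> ?K" by (intro JK) (simp add: J_def)
    then show "?\<rho> (lc (fm H L) sg p0 x) = \<zero>\<^bsub>?E\<^esub>"
      using coset_eq_zero_iff[OF FL.module_axioms K] FL.submoduleD(1)[OF K] by blast
  qed (rule that)
  have hm: "lc M m L \<in> module_hom H (fm H L) M" by (rule lc_module_hom[OF M mc])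
  obtain p where p: "p \<in> module_hom H ?E M" "\<And>v. v \<in> carrier (fm H L) \<Longrightarrow> p (?\<rho> v) = lc M m L v"
  proof (rule factor_hom[OF FL.module_axioms E M \<rho> carrier_quot_module[OF FL.module_axioms K, symmetric] hm])
    fix x assume "x \<in> carrier (fm H L)" "?\<rho> x = \<zero>\<^bsub>?E\<^esub>"
    then have "x \<in> ?K" using coset_eq_zero_iff[OF FL.module_axioms K] by blast
    then show "lc M m L x = \<zero>\<^bsub>M\<^esub>" by (intro ext_vec_ker[OF M mc])
  qed (rule that)
  \<comment> \<open>Here the normalisation of the separator enters: the sum of all
    \<open>u v\<close> is \<open>1\<close>.\<close>
  have gj: "lc M m L (sg j) = g j" if j: "j < p0" for j
  proof -
    have "lc M m L (sg j) = lsum M (\<lambda>q. lc M m L (restr m L (case q of (u, v) \<Rightarrow> single (v \<odot>\<^bsub>M\<^esub> g j) u))) e"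
      unfolding sg_def S_def using uc
      by (intro module_hom_lsum[OF funs_module M module_hom_comp[OF restr_module_hom hm]]) (auto simp: split_def)
    also have "\<dots> = lsum M (\<lambda>q. fst q \<odot>\<^bsub>M\<^esub> (snd q \<odot>\<^bsub>M\<^esub> g j)) e"
    proof (rule lsum_cong)
      fix q assume q: "q \<in> set e"
      have "snd q \<odot>\<^bsub>M\<^esub> g j \<in> A0" unfolding A0_def using q j by force
      then show "lc M m L (restr m L (case q of (u, v) \<Rightarrow> single (v \<odot>\<^bsub>M\<^esub> g j) u)) = fst q \<odot>\<^bsub>M\<^esub> (snd q \<odot>\<^bsub>M\<^esub> g j)"
        using lc_restr_single[OF M en _ uc(1)[OF q]] by (simp add: split_def)
    qed
    also have "\<dots> = lsum M (\<lambda>q. (case q of (u, v) \<Rightarrow> u \<otimes>\<^bsub>H\<^esub> v) \<odot>\<^bsub>M\<^esub> g j) e"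
      using uc g[OF j] by (intro lsum_cong) (auto simp: split_def M.smult_assoc1)
    also have "\<dots> = lsum H (\<lambda>(u, v). u \<otimes>\<^bsub>H\<^esub> v) e \<odot>\<^bsub>M\<^esub> g j"
      using uc g[OF j] by (intro M.lsum_smult_left[symmetric]) (auto simp: split_def)
    finally show ?thesis using e1 g[OF j] by simp
  qed
  have "p (s x) = x" if x: "x \<in> carrier M" for x
  proof -
    obtain v where v: "v \<in> carrier (fm H p0)" "x = lc M g p0 v" using x gen by blast
    have "p (s x) = lc M m L (lc (fm H L) sg p0 v)"
      unfolding v(2) s(2)[OF v(1)] by (rule p(2)[OF module_homD(1)[OF hsg v(1)]])
    also have "\<dots> = lc M (\<lambda>j. lc M m L (sg j)) p0 v"
      using sgc v(1) by (intro module_hom_lc[OF FL.module_axioms M hm]) auto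
    also have "\<dots> = x" unfolding v(2) using gj by (intro lc_cong) auto
    finally show ?thesis .
  qed
  then show ?thesis using that[OF mc s(1) p(1)] by blast
qed

end

section \<open>Resolutions and the comparison theorem\<close>

lemma module_hom_restrict: "restrict f (carrier M) \<in> module_hom R M N \<longleftrightarrow> f \<in> module_hom R M N" if "module R M"
proof -
  interpret module R M by fact
  show ?thesis by (auto simp: module_hom_def Pi_iff)
qed

lemma module_hom_plus:
  assumes "module R N" "f \<in> module_hom R M N" "g \<in> module_hom R M N"
  shows "(\<lambda>x. f x \<oplus>\<^bsub>N\<^esub> g x) \<in> module_hom R M N"
proof -
  interpret N: module R N by fact
  show ?thesis using assms(2,3) by (auto simp: module_hom_def Pi_iff N.smult_r_distr N.M.a_ac)
qed

lemma module_hom_uminus: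
  assumes "module R N" "f \<in> module_hom R M N"
  shows "(\<lambda>x. \<ominus>\<^bsub>N\<^esub> f x) \<in> module_hom R M N"
proof -
  interpret N: module R N by fact
  show ?thesis using assms(2) by (auto simp: module_hom_def Pi_iff N.smult_r_minus N.M.minus_add)
qed

lemma module_hom_smult:
  assumes "module R N" "f \<in> module_hom R M N" "a \<in> carrier R"
  shows "(\<lambda>x. a \<odot>\<^bsub>N\<^esub> f x) \<in> module_hom R M N"
proof -
  interpret N: module R N by fact
  show ?thesis using assms(2,3)
    by (auto simp: module_hom_def Pi_iff N.smult_r_distr N.smult_assoc1[symmetric] N.R.m_comm)
qed

lemma module_hom_id: "(\<lambda>x. x) \<in> module_hom R M M"
  by (simp add: module_hom_def)

text \<open>Exactness alone, for modules in arbitrary types. It covers the projective resolution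
  behind \<open>Ext\<close> as well as the free ones, whose terms are vectors.\<close>

definition resolution ::
  "('a, 'm) ring_scheme \<Rightarrow> ('a, 'c) module \<Rightarrow> (nat \<Rightarrow> ('a, 'b) module) \<Rightarrow> (nat \<Rightarrow> 'b \<Rightarrow> 'b) \<Rightarrow> ('b \<Rightarrow> 'c) \<Rightarrow> bool" where
  "resolution R M P d e \<longleftrightarrow> module R M \<and> (\<forall>n. module R (P n)) \<and> e \<in> module_hom R (P 0) M \<and>
     (\<forall>n. d n \<in> module_hom R (P (Suc n)) (P n)) \<and> e ` carrier (P 0) = carrier M \<and>
     d 0 ` carrier (P (Suc 0)) = {x \<in> carrier (P 0). e x = \<zero>\<^bsub>M\<^esub>} \<and>
     (\<forall>n. d (Suc n) ` carrier (P (Suc (Suc n))) = {x \<in> carrier (P (Suc n)). d n x = \<zero>\<^bsub>P n\<^esub>})"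

lemma resolutionD:
  assumes "resolution R M P d e"
  shows "module R M" "\<And>n. module R (P n)" "e \<in> module_hom R (P 0) M" "\<And>n. d n \<in> module_hom R (P (Suc n)) (P n)"
    "e ` carrier (P 0) = carrier M" "d 0 ` carrier (P (Suc 0)) = {x \<in> carrier (P 0). e x = \<zero>\<^bsub>M\<^esub>}"
    "\<And>n. d (Suc n) ` carrier (P (Suc (Suc n))) = {x \<in> carrier (P (Suc n)). d n x = \<zero>\<^bsub>P n\<^esub>}"
  using assms by (simp_all add: resolution_def)

lemma resolution_zero:
  assumes "resolution R M P d e"
  shows "x \<in> carrier (P (Suc 0)) \<Longrightarrow> e (d 0 x) = \<zero>\<^bsub>M\<^esub>" "y \<in> carrier (P (Suc (Suc n))) \<Longrightarrow> d n (d (Suc n) y) = \<zero>\<^bsub>P n\<^esub>"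
proof -
  note r = resolutionD(6,7)[OF assms]
  show "e (d 0 x) = \<zero>\<^bsub>M\<^esub>" if "x \<in> carrier (P (Suc 0))" using imageI[OF that, of "d 0"] unfolding r by blast
  show "d n (d (Suc n) y) = \<zero>\<^bsub>P n\<^esub>" if "y \<in> carrier (P (Suc (Suc n)))"
    using imageI[OF that, of "d (Suc n)"] unfolding r by blast
qed

text \<open>Projectivity relative to a single map \<open>g\<close>. The comparison theorem involves
  modules of several types, so each lifting problem becomes a separate hypothesis.\<close>

definition lifts ::
  "('a, 'm) ring_scheme \<Rightarrow> ('a, 'p) module \<Rightarrow> ('a, 'b) module \<Rightarrow> ('a, 'c) module \<Rightarrow> ('b \<Rightarrow> 'c) \<Rightarrow> bool" where
  "lifts R P A C g \<longleftrightarrow> (\<forall>f \<in> module_hom R P C. f ` carrier P \<subseteq> g ` carrier A \<longrightarrow>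
     (\<exists>h \<in> module_hom R P A. \<forall>x\<in>carrier P. g (h x) = f x))"

lemma liftsE:
  assumes "lifts R P A C g" "f \<in> module_hom R P C" "\<And>x. x \<in> carrier P \<Longrightarrow> f x \<in> g ` carrier A"
  obtains h where "h \<in> module_hom R P A" "\<And>x. x \<in> carrier P \<Longrightarrow> g (h x) = f x"
proof -
  have "f ` carrier P \<subseteq> g ` carrier A" using assms(3) by (rule image_subsetI)
  then show ?thesis using assms(1,2) that unfolding lifts_def by metis
qed

lemma chain_map:
  fixes P :: "nat \<Rightarrow> ('a, 'b) module" and F :: "nat \<Rightarrow> ('a, 'c) module"
  assumes P: "resolution R M P d e" and F: "resolution R E F D r" and s: "s \<in> module_hom R M E"
    and l0: "lifts R (P 0) (F 0) E r" and l: "\<And>n. lifts R (P (Suc n)) (F (Suc n)) (F n) (D n)"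
  obtains \<sigma> where "\<And>n. \<sigma> n \<in> module_hom R (P n) (F n)" "\<And>x. x \<in> carrier (P 0) \<Longrightarrow> r (\<sigma> 0 x) = s (e x)"
    "\<And>n x. x \<in> carrier (P (Suc n)) \<Longrightarrow> D n (\<sigma> (Suc n) x) = \<sigma> n (d n x)"
proof -
  note p = resolutionD[OF P] and f = resolutionD[OF F] and pz = resolution_zero[OF P]
  note pd = module_homD(1)[OF p(4)]
  \<comment> \<open>The middle condition is the solvability of the next lifting problem; it has to
    be carried along in the dependent choice.\<close>
  define I where "I n \<sigma> \<longleftrightarrow> \<sigma> \<in> module_hom R (P n) (F n) \<and>
      (\<forall>x\<in>carrier (P (Suc n)). \<sigma> (d n x) \<in> D n ` carrier (F (Suc n))) \<and>
      (n = 0 \<longrightarrow> (\<forall>x\<in>carrier (P 0). r (\<sigma> x) = s (e x)))" for n \<sigma>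
  have "\<exists>\<sigma>. \<forall>n. I n (\<sigma> n) \<and> (\<forall>x\<in>carrier (P (Suc n)). D n (\<sigma> (Suc n) x) = \<sigma> n (d n x))"
  proof (rule dependent_nat_choice)
    obtain h where h: "h \<in> module_hom R (P 0) (F 0)" "\<And>x. x \<in> carrier (P 0) \<Longrightarrow> r (h x) = s (e x)"
    proof (rule liftsE[OF l0 module_hom_comp[OF p(3) s]])
      fix x assume "x \<in> carrier (P 0)"
      then show "s (e x) \<in> r ` carrier (F 0)" unfolding f(5) by (intro module_homD(1)[OF s] module_homD(1)[OF p(3)])
    qed (rule that)
    have "h (d 0 x) \<in> D 0 ` carrier (F (Suc 0))" if x: "x \<in> carrier (P (Suc 0))" for x
    proof -
      have "r (h (d 0 x)) = s \<zero>\<^bsub>M\<^esub>" unfolding h(2)[OF pd[OF x]] pz(1)[OF x] ..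
      then have "r (h (d 0 x)) = \<zero>\<^bsub>E\<^esub>" unfolding module_hom_zero[OF p(1) f(1) s] .
      then show ?thesis unfolding f(6) using module_homD(1)[OF h(1) pd[OF x]] by blast
    qed
    then show "\<exists>\<sigma>. I 0 \<sigma>" unfolding I_def using h by blast
  next
    fix \<sigma> n assume \<sigma>: "I n \<sigma>"
    have s1: "\<sigma> \<in> module_hom R (P n) (F n)" using \<sigma> unfolding I_def by (rule conjunct1)
    have s2: "\<sigma> (d n x) \<in> D n ` carrier (F (Suc n))" if "x \<in> carrier (P (Suc n))" for x
      using \<sigma> that unfolding I_def by blast
    obtain h where h: "h \<in> module_hom R (P (Suc n)) (F (Suc n))"
      "\<And>x. x \<in> carrier (P (Suc n)) \<Longrightarrow> D n (h x) = \<sigma> (d n x)"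
      by (rule liftsE[OF l module_hom_comp[OF p(4) s1] s2]) (assumption, rule that)
    have "h (d (Suc n) x) \<in> D (Suc n) ` carrier (F (Suc (Suc n)))" if x: "x \<in> carrier (P (Suc (Suc n)))" for x
    proof -
      have "D n (h (d (Suc n) x)) = \<sigma> \<zero>\<^bsub>P n\<^esub>" unfolding h(2)[OF pd[OF x]] pz(2)[OF x] ..
      then have "D n (h (d (Suc n) x)) = \<zero>\<^bsub>F n\<^esub>" unfolding module_hom_zero[OF p(2) f(2) s1] .
      then show ?thesis unfolding f(7) using module_homD(1)[OF h(1) pd[OF x]] by blast
    qed
    then show "\<exists>\<tau>. I (Suc n) \<tau> \<and> (\<forall>x\<in>carrier (P (Suc n)). D n (\<tau> x) = \<sigma> (d n x))"
      unfolding I_def using h by blast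
  qed
  then obtain \<sigma> where \<sigma>: "\<And>n. I n (\<sigma> n)" "\<And>n x. x \<in> carrier (P (Suc n)) \<Longrightarrow> D n (\<sigma> (Suc n) x) = \<sigma> n (d n x)"
    by blast
  have "\<sigma> n \<in> module_hom R (P n) (F n)" for n using \<sigma>(1) unfolding I_def by blast
  moreover have "r (\<sigma> 0 x) = s (e x)" if "x \<in> carrier (P 0)" for x using \<sigma>(1)[of 0] that unfolding I_def by blast
  ultimately show ?thesis using that \<sigma>(2) by blast
qed

lemma chain_homotopy:
  assumes P: "resolution R M P d e" and l: "\<And>n. lifts R (P n) (P (Suc n)) (P n) (d n)"
    and \<tau>: "\<And>n. \<tau> n \<in> module_hom R (P n) (P n)" "\<And>x. x \<in> carrier (P 0) \<Longrightarrow> e (\<tau> 0 x) = e x"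
      "\<And>n x. x \<in> carrier (P (Suc n)) \<Longrightarrow> d n (\<tau> (Suc n) x) = \<tau> n (d n x)"
  obtains h where "\<And>n. h n \<in> module_hom R (P n) (P (Suc n))"
    "\<And>n x. x \<in> carrier (P (Suc n)) \<Longrightarrow>
       \<tau> (Suc n) x = x \<oplus>\<^bsub>P (Suc n)\<^esub> h n (d n x) \<oplus>\<^bsub>P (Suc n)\<^esub> d (Suc n) (h (Suc n) x)"
proof -
  note p = resolutionD[OF P] and pz = resolution_zero[OF P]
  note dh = module_homD[OF p(4)] and th = module_homD[OF \<tau>(1)]
  \<comment> \<open>The obstruction \<open>\<tau> - id - g d\<close>. It is a cycle by the equation
    one degree below, hence a boundary, and so can be lifted to the next component of the
    homotopy.\<close>
  define u where "u n g x = \<tau> (Suc n) x \<oplus>\<^bsub>P (Suc n)\<^esub> \<ominus>\<^bsub>P (Suc n)\<^esub> (x \<oplus>\<^bsub>P (Suc n)\<^esub> g (d n x))" for n g x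
  have u: "u n g \<in> module_hom R (P (Suc n)) (P (Suc n))" if "g \<in> module_hom R (P n) (P (Suc n))" for n g
    unfolding u_def
    by (intro module_hom_plus module_hom_uminus p(2) \<tau>(1) module_hom_id module_hom_comp[OF p(4) that])
  define I where "I n g \<longleftrightarrow> g \<in> module_hom R (P n) (P (Suc n)) \<and>
      (\<forall>x\<in>carrier (P (Suc n)). u n g x \<in> d (Suc n) ` carrier (P (Suc (Suc n))))" for n g
  have "\<exists>h. \<forall>n. I n (h n) \<and> (\<forall>x\<in>carrier (P (Suc n)). d (Suc n) (h (Suc n) x) = u n (h n) x)"
  proof (rule dependent_nat_choice)
    interpret P0: module R "P 0" by (rule p(2))
    interpret P1: module R "P (Suc 0)" by (rule p(2))
    interpret M: module R M by (rule p(1))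
    note eh = module_homD[OF p(3)]
    have v: "(\<lambda>x. \<tau> 0 x \<oplus>\<^bsub>P 0\<^esub> \<ominus>\<^bsub>P 0\<^esub> x) \<in> module_hom R (P 0) (P 0)"
      by (intro module_hom_plus module_hom_uminus p(2) \<tau>(1) module_hom_id)
    obtain g where g: "g \<in> module_hom R (P 0) (P (Suc 0))" "\<And>x. x \<in> carrier (P 0) \<Longrightarrow> d 0 (g x) = \<tau> 0 x \<oplus>\<^bsub>P 0\<^esub> \<ominus>\<^bsub>P 0\<^esub> x"
    proof (rule liftsE[OF l v])
      fix x assume x: "x \<in> carrier (P 0)"
      have "e (\<tau> 0 x \<oplus>\<^bsub>P 0\<^esub> \<ominus>\<^bsub>P 0\<^esub> x) = \<zero>\<^bsub>M\<^esub>"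
        using x eh(1)[OF x] th(1)[OF x] by (simp add: eh(2) module_hom_minus[OF p(2,1,3)] \<tau>(2) M.M.r_neg)
      then show "\<tau> 0 x \<oplus>\<^bsub>P 0\<^esub> \<ominus>\<^bsub>P 0\<^esub> x \<in> d 0 ` carrier (P (Suc 0))"
        unfolding p(6) using module_homD(1)[OF v x] by blast
    qed (rule that)
    have "u 0 g x \<in> d (Suc 0) ` carrier (P (Suc (Suc 0)))" if x: "x \<in> carrier (P (Suc 0))" for x
    proof -
      have c: "d 0 x \<in> carrier (P 0)" "\<tau> (Suc 0) x \<in> carrier (P (Suc 0))" "g (d 0 x) \<in> carrier (P (Suc 0))"
        "\<tau> 0 (d 0 x) \<in> carrier (P 0)"
        using dh(1)[OF x] th(1)[OF x] module_homD(1)[OF g(1) dh(1)[OF x]] th(1)[OF dh(1)[OF x]] by auto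
      have "d 0 (u 0 g x) = \<tau> 0 (d 0 x) \<oplus>\<^bsub>P 0\<^esub> \<ominus>\<^bsub>P 0\<^esub> (d 0 x \<oplus>\<^bsub>P 0\<^esub> (\<tau> 0 (d 0 x) \<oplus>\<^bsub>P 0\<^esub> \<ominus>\<^bsub>P 0\<^esub> d 0 x))"
        unfolding u_def using x c by (simp add: dh(2) module_hom_minus[OF p(2,2,4)] \<tau>(3) g(2))
      also have "\<dots> = \<zero>\<^bsub>P 0\<^esub>" using c by (simp add: P0.M.minus_add P0.M.a_ac P0.M.r_neg P0.M.r_neg2)
      finally show ?thesis unfolding p(7) using module_homD(1)[OF u[OF g(1)] x] by blast
    qed
    then show "\<exists>g. I 0 g" unfolding I_def using g by blast
  next
    fix h n assume "I n h"
    then have h: "h \<in> module_hom R (P n) (P (Suc n))"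
      "\<And>x. x \<in> carrier (P (Suc n)) \<Longrightarrow> u n h x \<in> d (Suc n) ` carrier (P (Suc (Suc n)))"
      unfolding I_def by blast+
    interpret P0: module R "P n" by (rule p(2))
    interpret P1: module R "P (Suc n)" by (rule p(2))
    interpret P2: module R "P (Suc (Suc n))" by (rule p(2))
    obtain g where g: "g \<in> module_hom R (P (Suc n)) (P (Suc (Suc n)))"
      "\<And>x. x \<in> carrier (P (Suc n)) \<Longrightarrow> d (Suc n) (g x) = u n h x"
      by (rule liftsE[OF l u[OF h(1)] h(2)]) (assumption, rule that)
    have "u (Suc n) g x \<in> d (Suc (Suc n)) ` carrier (P (Suc (Suc (Suc n))))" if x: "x \<in> carrier (P (Suc (Suc n)))" for x
    proof -
      have c: "d (Suc n) x \<in> carrier (P (Suc n))" "\<tau> (Suc (Suc n)) x \<in> carrier (P (Suc (Suc n)))"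
        "g (d (Suc n) x) \<in> carrier (P (Suc (Suc n)))" "\<tau> (Suc n) (d (Suc n) x) \<in> carrier (P (Suc n))"
        using dh(1)[OF x] th(1)[OF x] module_homD(1)[OF g(1) dh(1)[OF x]] th(1)[OF dh(1)[OF x]] by auto
      have "u n h (d (Suc n) x) = \<tau> (Suc n) (d (Suc n) x) \<oplus>\<^bsub>P (Suc n)\<^esub> \<ominus>\<^bsub>P (Suc n)\<^esub> d (Suc n) x"
        unfolding u_def pz(2)[OF x] module_hom_zero[OF p(2,2) h(1)] using c by simp
      then have "d (Suc n) (u (Suc n) g x) = \<tau> (Suc n) (d (Suc n) x) \<oplus>\<^bsub>P (Suc n)\<^esub>
          \<ominus>\<^bsub>P (Suc n)\<^esub> (d (Suc n) x \<oplus>\<^bsub>P (Suc n)\<^esub> (\<tau> (Suc n) (d (Suc n) x) \<oplus>\<^bsub>P (Suc n)\<^esub> \<ominus>\<^bsub>P (Suc n)\<^esub> d (Suc n) x))"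
        unfolding u_def[of "Suc n"] using x c by (simp add: dh(2) module_hom_minus[OF p(2,2,4)] \<tau>(3) g(2))
      also have "\<dots> = \<zero>\<^bsub>P (Suc n)\<^esub>" using c by (simp add: P1.M.minus_add P1.M.a_ac P1.M.r_neg P1.M.r_neg2)
      finally show ?thesis unfolding p(7) using module_homD(1)[OF u[OF g(1)] x] by blast
    qed
    then show "\<exists>g. I (Suc n) g \<and> (\<forall>x\<in>carrier (P (Suc n)). d (Suc n) (g x) = u n h x)"
      unfolding I_def using g by blast
  qed
  then obtain h where h: "\<And>n. I n (h n)" "\<And>n x. x \<in> carrier (P (Suc n)) \<Longrightarrow> d (Suc n) (h (Suc n) x) = u n (h n) x"
    by blast
  have hh: "h n \<in> module_hom R (P n) (P (Suc n))" for n using h(1) unfolding I_def by blast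
  have "\<tau> (Suc n) x = x \<oplus>\<^bsub>P (Suc n)\<^esub> h n (d n x) \<oplus>\<^bsub>P (Suc n)\<^esub> d (Suc n) (h (Suc n) x)"
    if x: "x \<in> carrier (P (Suc n))" for n x
  proof -
    interpret P1: module R "P (Suc n)" by (rule p(2))
    have c: "\<tau> (Suc n) x \<in> carrier (P (Suc n))" "h n (d n x) \<in> carrier (P (Suc n))"
      using th(1)[OF x] module_homD(1)[OF hh dh(1)[OF x]] by auto
    have "x \<oplus>\<^bsub>P (Suc n)\<^esub> h n (d n x) \<oplus>\<^bsub>P (Suc n)\<^esub> u n (h n) x = \<tau> (Suc n) x"
      unfolding u_def using c x by (simp add: P1.M.minus_add P1.M.a_ac P1.M.r_neg P1.M.r_neg2)
    then show ?thesis unfolding h(2)[OF x] by simp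
  qed
  then show ?thesis using that hh by blast
qed

text \<open>Annihilation of the cohomology of Hom into \<open>N\<close> in degree
  \<open>Suc k\<close>, freed of cosets and of extensional functions. Degree 0 is treated
  separately.\<close>

definition kills ::
  "('a, 'm) ring_scheme \<Rightarrow> (nat \<Rightarrow> ('a, 'b) module) \<Rightarrow> (nat \<Rightarrow> 'b \<Rightarrow> 'b) \<Rightarrow> ('a, 'c) module \<Rightarrow> nat \<Rightarrow> 'a \<Rightarrow> bool" where
  "kills R P d N k a \<longleftrightarrow> (\<forall>z \<in> module_hom R (P (Suc k)) N.
     (\<forall>x\<in>carrier (P (Suc (Suc k))). z (d (Suc k) x) = \<zero>\<^bsub>N\<^esub>) \<longrightarrow>
     (\<exists>w \<in> module_hom R (P k) N. \<forall>x\<in>carrier (P (Suc k)). w (d k x) = a \<odot>\<^bsub>N\<^esub> z x))"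

text \<open>The composite of the chain maps over \<open>s\<close> and \<open>p\<close> lifts the
  identity of \<open>M\<close>, so it is homotopic to the identity. A cocycle on \<open>P\<close> is
  pulled back to \<open>F\<close>, bounded there after multiplication by \<open>a\<close>, and
  brought back. With identities for \<open>s\<close> and \<open>p\<close> this is independence of
  the resolution.\<close>

lemma kills_retract:
  fixes P :: "nat \<Rightarrow> ('a, 'b) module" and F :: "nat \<Rightarrow> ('a, 'c) module"
  assumes P: "resolution R M P d e" and F: "resolution R E F D r"
    and s: "s \<in> module_hom R M E" and p: "p \<in> module_hom R E M" and ps: "\<And>x. x \<in> carrier M \<Longrightarrow> p (s x) = x"
    and lPP: "\<And>n. lifts R (P n) (P (Suc n)) (P n) (d n)"
    and lPF: "lifts R (P 0) (F 0) E r" "\<And>n. lifts R (P (Suc n)) (F (Suc n)) (F n) (D n)"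
    and lFP: "lifts R (F 0) (P 0) M e" "\<And>n. lifts R (F (Suc n)) (P (Suc n)) (P n) (d n)"
    and N: "module R N" and a: "a \<in> carrier R" and k: "kills R F D N k a"
  shows "kills R P d N k a"
  unfolding kills_def
proof (intro ballI impI)
  interpret N: module R N by fact
  fix z assume z: "z \<in> module_hom R (P (Suc k)) N" and zd: "\<forall>x\<in>carrier (P (Suc (Suc k))). z (d (Suc k) x) = \<zero>\<^bsub>N\<^esub>"
  note pr = resolutionD[OF P] and fr = resolutionD[OF F]
  obtain \<sigma> where \<sigma>: "\<And>n. \<sigma> n \<in> module_hom R (P n) (F n)" "\<And>x. x \<in> carrier (P 0) \<Longrightarrow> r (\<sigma> 0 x) = s (e x)"
    "\<And>n x. x \<in> carrier (P (Suc n)) \<Longrightarrow> D n (\<sigma> (Suc n) x) = \<sigma> n (d n x)"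
    by (rule chain_map[OF P F s lPF]) (rule that)
  obtain \<pi> where \<pi>: "\<And>n. \<pi> n \<in> module_hom R (F n) (P n)" "\<And>x. x \<in> carrier (F 0) \<Longrightarrow> e (\<pi> 0 x) = p (r x)"
    "\<And>n x. x \<in> carrier (F (Suc n)) \<Longrightarrow> d n (\<pi> (Suc n) x) = \<pi> n (D n x)"
    by (rule chain_map[OF F P p lFP]) (rule that)
  note sc = module_homD(1)[OF \<sigma>(1)] and pc = module_homD(1)[OF \<pi>(1)] and zh = module_homD[OF z]
    and dc = module_homD(1)[OF pr(4)] and Dc = module_homD(1)[OF fr(4)]
  have e1: "e (\<pi> 0 (\<sigma> 0 x)) = e x" if x: "x \<in> carrier (P 0)" for x
    unfolding \<pi>(2)[OF sc[OF x]] \<sigma>(2)[OF x] by (rule ps[OF module_homD(1)[OF pr(3) x]])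
  have d1: "d n (\<pi> (Suc n) (\<sigma> (Suc n) x)) = \<pi> n (\<sigma> n (d n x))" if x: "x \<in> carrier (P (Suc n))" for n x
    unfolding \<pi>(3)[OF sc[OF x]] \<sigma>(3)[OF x] ..
  obtain h where h: "\<And>n. h n \<in> module_hom R (P n) (P (Suc n))" "\<And>n x. x \<in> carrier (P (Suc n)) \<Longrightarrow>
      \<pi> (Suc n) (\<sigma> (Suc n) x) = x \<oplus>\<^bsub>P (Suc n)\<^esub> h n (d n x) \<oplus>\<^bsub>P (Suc n)\<^esub> d (Suc n) (h (Suc n) x)"
    by (rule chain_homotopy[OF P lPP module_hom_comp[OF \<sigma>(1) \<pi>(1)] e1 d1]) (assumption+, rule that)
  note hc = module_homD(1)[OF h(1)]
  have z2: "(\<lambda>y. z (\<pi> (Suc k) y)) \<in> module_hom R (F (Suc k)) N" by (rule module_hom_comp[OF \<pi>(1) z])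
  have "\<forall>y\<in>carrier (F (Suc (Suc k))). z (\<pi> (Suc k) (D (Suc k) y)) = \<zero>\<^bsub>N\<^esub>"
    using \<pi>(3)[symmetric] zd pc by metis
  then obtain w where w: "w \<in> module_hom R (F k) N" "\<And>y. y \<in> carrier (F (Suc k)) \<Longrightarrow> w (D k y) = a \<odot>\<^bsub>N\<^esub> z (\<pi> (Suc k) y)"
    using bspec[OF k[unfolded kills_def] z2] by blast
  show "\<exists>w\<in>module_hom R (P k) N. \<forall>x\<in>carrier (P (Suc k)). w (d k x) = a \<odot>\<^bsub>N\<^esub> z x"
  \<comment> \<open>The cocycle \<open>z\<close> vanishes on boundaries, so the homotopy contributes
    only \<open>z h d\<close>; subtracting \<open>a z h\<close> removes it.\<close>
  proof (intro bexI[of _ "\<lambda>x. w (\<sigma> k x) \<oplus>\<^bsub>N\<^esub> \<ominus>\<^bsub>N\<^esub> (a \<odot>\<^bsub>N\<^esub> z (h k x))"] ballI)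
    show "(\<lambda>x. w (\<sigma> k x) \<oplus>\<^bsub>N\<^esub> \<ominus>\<^bsub>N\<^esub> (a \<odot>\<^bsub>N\<^esub> z (h k x))) \<in> module_hom R (P k) N"
      by (intro module_hom_plus module_hom_uminus module_hom_smult N a module_hom_comp[OF \<sigma>(1) w(1)] module_hom_comp[OF h(1) z])
    fix x assume x: "x \<in> carrier (P (Suc k))"
    interpret P1: module R "P (Suc k)" by (rule pr(2))
    have c: "h k (d k x) \<in> carrier (P (Suc k))" "d (Suc k) (h (Suc k) x) \<in> carrier (P (Suc k))"
      using hc[OF dc[OF x]] dc[OF hc[OF x]] by auto
    have zc: "z x \<in> carrier N" "z (h k (d k x)) \<in> carrier N" using zh(1) x c by auto
    have "z (\<pi> (Suc k) (\<sigma> (Suc k) x)) = z x \<oplus>\<^bsub>N\<^esub> z (h k (d k x))"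
      unfolding h(2)[OF x] using x c zc hc[OF x] zd by (simp add: zh(2))
    then have "w (\<sigma> k (d k x)) = a \<odot>\<^bsub>N\<^esub> z x \<oplus>\<^bsub>N\<^esub> a \<odot>\<^bsub>N\<^esub> z (h k (d k x))"
      unfolding \<sigma>(3)[OF x, symmetric] w(2)[OF sc[OF x]] using a zc by (simp add: N.smult_r_distr)
    then show "w (\<sigma> k (d k x)) \<oplus>\<^bsub>N\<^esub> \<ominus>\<^bsub>N\<^esub> (a \<odot>\<^bsub>N\<^esub> z (h k (d k x))) = a \<odot>\<^bsub>N\<^esub> z x"
      using a zc by (simp add: N.M.a_assoc N.M.r_neg)
  qed
qed

section \<open>Lifting properties of projective and free modules\<close>

lemma submodule_restrict:
  fixes M :: "('a, 'b) module"
  assumes M: "module R M" and Z: "submodule Z R M" and K: "submodule K R M" "K \<subseteq> Z"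
  shows "submodule K R (M\<lparr>carrier := Z\<rparr>)"
proof -
  interpret Z: module R "M\<lparr>carrier := Z\<rparr>" by (rule submodule.submodule_is_module[OF Z M])
  show ?thesis
    using K(2) submodule.submodule_is_module[OF K(1) M] by (intro Z.module_incl_imp_submodule) simp_all
qed

lemma module_hom_image:
  fixes A :: "('a, 'b) module" and C :: "('a, 'c) module"
  assumes A: "module R A" and C: "module R C" and g: "g \<in> module_hom R A C"
  shows "module R (C\<lparr>carrier := g ` carrier A\<rparr>)" "g \<in> module_hom R A (C\<lparr>carrier := g ` carrier A\<rparr>)"
proof -
  show "module R (C\<lparr>carrier := g ` carrier A\<rparr>)"
    by (rule submodule.submodule_is_module[OF image_submodule[OF C A g module.carrier_is_submodule[OF A]] C])
  show "g \<in> module_hom R A (C\<lparr>carrier := g ` carrier A\<rparr>)"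
    using g by (simp add: module_hom_def)
qed

lemma module_hom_into_image:
  "f \<in> module_hom R P C \<Longrightarrow> f ` carrier P \<subseteq> S \<Longrightarrow> f \<in> module_hom R P (C\<lparr>carrier := S\<rparr>)"
  by (auto simp: module_hom_def)

text \<open>\<open>projective_module\<close> speaks of surjections, so \<open>C\<close> is cut down
  to the image of \<open>g\<close>.\<close>

lemma projective_lifts:
  fixes A C :: "('a, 'a univ) module"
  assumes P: "projective_module R P" and A: "module R A" and C: "module R C" and g: "g \<in> module_hom R A C"
  shows "lifts R P A C g"
  unfolding lifts_def
proof (intro ballI impI)
  fix f assume f: "f \<in> module_hom R P C" "f ` carrier P \<subseteq> g ` carrier A"
  let ?B = "C\<lparr>carrier := g ` carrier A\<rparr>"
  have "module R A \<and> module R ?B \<and> g \<in> module_hom R A ?B \<and> g ` carrier A = carrier ?B \<and> f \<in> module_hom R P ?B"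
    using A module_hom_image[OF A C g] module_hom_into_image[OF f] by simp
  with P show "\<exists>h\<in>module_hom R P A. \<forall>x\<in>carrier P. g (h x) = f x" unfolding projective_module_def by blast
qed

text \<open>\<open>projective_module\<close> tests only modules of type \<open>'a univ\<close>.
  Vectors embed there as singletons, which gives a copy \<open>T\<close> of \<open>A\<close>. The
  image of \<open>g\<close> may live in any type, but it is isomorphic to the quotient of
  \<open>A\<close> by the kernel of \<open>g\<close>, whose elements are sets of vectors and hence
  of type \<open>'a univ\<close>.\<close>

lemma projective_lifts_vec:
  fixes A :: "('a, nat \<Rightarrow> 'a) module" and C :: "('a, 'c) module"
  assumes P: "projective_module R P" and A: "module R A" and C: "module R C" and g: "g \<in> module_hom R A C"
  shows "lifts R P A C g"
  unfolding lifts_def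
proof (intro ballI impI)
  fix f assume f: "f \<in> module_hom R P C" "f ` carrier P \<subseteq> g ` carrier A"
  interpret A: module R A by fact
  interpret C: module R C by fact
  let ?B = "C\<lparr>carrier := g ` carrier A\<rparr>" and ?K = "{x \<in> carrier A. g x \<in> {\<zero>\<^bsub>C\<^esub>}}"
  note B = module_hom_image[OF A C g]
  have K: "submodule ?K R A" by (rule vimage_submodule[OF A C g C.zero_submodule])
  let ?Q = "quot_module A ?K"
  have Q: "module R ?Q" by (rule quot_module_module[OF A K])
  have c: "(\<lambda>x. ?K +>\<^bsub>A\<^esub> x) \<in> module_hom R A ?Q" by (rule coset_module_hom[OF A K])
  obtain T :: "('a, 'a univ) module" and t where t: "module R T" "t \<in> module_hom R A T" "bij_betw t (carrier A) (carrier T)"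
    using module_transport[OF A, of "\<lambda>v. {v}"] by auto
  have ts: "t ` carrier A = carrier T" and ti: "inj_on t (carrier A)"
    using t(3) by (auto simp: bij_betw_def)
  have t0: "x = \<zero>\<^bsub>A\<^esub>" if "x \<in> carrier A" "t x = \<zero>\<^bsub>T\<^esub>" for x
    using inj_onD[OF ti, of x "\<zero>\<^bsub>A\<^esub>"] that module_hom_zero[OF A t(1,2)] by simp
  obtain t' where t': "t' \<in> module_hom R T A" "\<And>x. x \<in> carrier A \<Longrightarrow> t' (t x) = x"
    by (rule factor_hom[OF A t(1) A t(2) ts module_hom_id t0]) (assumption+, rule that)
  obtain c' where c': "c' \<in> module_hom R T ?Q" "\<And>x. x \<in> carrier A \<Longrightarrow> c' (t x) = ?K +>\<^bsub>A\<^esub> x"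
    by (rule factor_hom[OF A t(1) Q t(2) ts c])
      (use t0 module_hom_zero[OF A Q c] in blast, rule that)
  obtain b where b: "b \<in> module_hom R ?B ?Q" "\<And>x. x \<in> carrier A \<Longrightarrow> b (g x) = ?K +>\<^bsub>A\<^esub> x"
  proof (rule factor_hom[OF A B(1) Q B(2) _ c])
    fix x assume "x \<in> carrier A" "g x = \<zero>\<^bsub>?B\<^esub>"
    then show "?K +>\<^bsub>A\<^esub> x = \<zero>\<^bsub>?Q\<^esub>" using coset_eq_zero_iff[OF A K] by simp
  qed (simp, rule that)
  have "c' ` carrier T = carrier ?Q"
    unfolding ts[symmetric] image_image carrier_quot_module[OF A K] using c'(2) by (intro image_cong) auto
  then have "\<exists>h\<in>module_hom R P T. \<forall>x\<in>carrier P. c' (h x) = b (f x)"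
    using conjunct2[OF P[unfolded projective_module_def], rule_format, of T ?Q c' "\<lambda>x. b (f x)"]
      t(1) Q c'(1) module_hom_comp[OF module_hom_into_image[OF f] b(1)] by fast
  then obtain h where h: "h \<in> module_hom R P T" "\<forall>x\<in>carrier P. c' (h x) = b (f x)" by fast
  show "\<exists>h\<in>module_hom R P A. \<forall>x\<in>carrier P. g (h x) = f x"
  proof (intro bexI[of _ "\<lambda>x. t' (h x)"] ballI)
    show "(\<lambda>x. t' (h x)) \<in> module_hom R P A" by (rule module_hom_comp[OF h(1) t'(1)])
    fix x assume x: "x \<in> carrier P"
    obtain y where y: "y \<in> carrier A" "h x = t y" using module_homD(1)[OF h(1) x] ts by (metis imageE)
    obtain y' where y': "y' \<in> carrier A" "f x = g y'" using f(2) x by blast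
    have "?K +>\<^bsub>A\<^esub> y = ?K +>\<^bsub>A\<^esub> y'" using bspec[OF h(2) x] unfolding y(2) y'(2) c'(2)[OF y(1)] b(2)[OF y'(1)] .
    then have "y \<oplus>\<^bsub>A\<^esub> \<ominus>\<^bsub>A\<^esub> y' \<in> ?K" unfolding coset_eq_iff[OF A K y(1) y'(1)] .
    then have "g y \<oplus>\<^bsub>C\<^esub> \<ominus>\<^bsub>C\<^esub> g y' = \<zero>\<^bsub>C\<^esub>"
      using y(1) y'(1) by (simp add: module_homD(2)[OF g] module_hom_minus[OF A C g])
    then have "g y = g y'" using C.M.minus_equality[of "g y" "\<ominus>\<^bsub>C\<^esub> g y'"] module_homD(1)[OF g y(1)] module_homD(1)[OF g y'(1)] by simp
    then show "g (t' (h x)) = f x" unfolding y(2) t'(2)[OF y(1)] y'(2) .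
  qed
qed

text \<open>The values on unit vectors are lifted and extended linearly, so \<open>A\<close> and
  \<open>C\<close> may have any types.\<close>

lemma free_lifts:
  assumes A: "module R A" and C: "module R C" and g: "g \<in> module_hom R A C"
  shows "lifts R (fm R p) A C g"
  unfolding lifts_def
proof (intro ballI impI)
  interpret A: module R A by fact
  fix f assume f: "f \<in> module_hom R (fm R p) C" "f ` carrier (fm R p) \<subseteq> g ` carrier A"
  have "\<forall>i\<in>{..<p}. \<exists>y. y \<in> carrier A \<and> g y = f (unit_vec R i)"
  proof
    fix i assume "i \<in> {..<p}"
    then have "f (unit_vec R i) \<in> g ` carrier A" by (intro subsetD[OF f(2)] imageI A.R.unit_vec_closed) simp
    then show "\<exists>y. y \<in> carrier A \<and> g y = f (unit_vec R i)" by (metis imageE)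
  qed
  from bchoice[OF this] obtain y where "\<forall>i\<in>{..<p}. y i \<in> carrier A \<and> g (y i) = f (unit_vec R i)" by (rule exE)
  then have y: "\<And>i. i < p \<Longrightarrow> y i \<in> carrier A" "\<And>i. i < p \<Longrightarrow> g (y i) = f (unit_vec R i)" by auto
  show "\<exists>h\<in>module_hom R (fm R p) A. \<forall>x\<in>carrier (fm R p). g (h x) = f x"
  proof (intro bexI[of _ "lc A y p"] ballI)
    show "lc A y p \<in> module_hom R (fm R p) A" by (rule lc_module_hom[OF A y(1)])
    fix v assume v: "v \<in> carrier (fm R p)"
    have "g (lc A y p v) = lc C (\<lambda>i. g (y i)) p v" using v y(1) by (intro module_hom_lc[OF A C g]) auto
    also have "\<dots> = lc C (\<lambda>i. f (unit_vec R i)) p v" using y(2) by (intro lc_cong) auto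
    also have "\<dots> = f v" by (rule fm_hom_eq_lc[OF C f(1) v, symmetric])
    finally show "g (lc A y p v) = f v" .
  qed
qed

section \<open>Construction of free and projective resolutions\<close>

lemma free_resolution_exists:
  fixes R :: "('a, 'm) ring_scheme"
  assumes R: "cring R" "noetherian_ring R" and K: "submodule K R (fm R q)"
  obtains p D where "p 0 = q" "\<And>i. D i \<in> module_hom R (fm R (p (Suc i))) (fm R (p i))"
    "D 0 ` carrier (fm R (p (Suc 0))) = K"
    "\<And>i. D (Suc i) ` carrier (fm R (p (Suc (Suc i)))) = {v \<in> carrier (fm R (p (Suc i))). D i v = \<zero>\<^bsub>fm R (p i)\<^esub>}"
proof -
  interpret cring R by fact
  have ex: "\<exists>p f. f \<in> module_hom R (fm R p) (fm R r) \<and> f ` carrier (fm R p) = N" if N: "submodule N R (fm R r)" for r N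
  proof -
    interpret F: module R "fm R r" by (rule fm_module)
    obtain p x where x: "\<And>i. i < p \<Longrightarrow> x i \<in> N" "N = lc (fm R r) x p ` carrier (fm R p)"
      by (rule noeth_submodule_image_lc[OF fm_module fm_noeth[OF R(2)] N]) (rule that)
    have xc: "x i \<in> carrier (fm R r)" if "i < p" for i using F.submoduleD(1)[OF N] x(1)[OF that] by (rule subsetD)
    show ?thesis using lc_module_hom[OF fm_module xc, of p "\<lambda>i. i"] x(2) by blast
  qed
  \<comment> \<open>A state is a differential with the ranks of its source and target; the condition
    at \<open>n = 0\<close> makes the first one map onto \<open>K\<close>.\<close>
  define I where "I n s \<longleftrightarrow> (case s of (p, r, f) \<Rightarrow> f \<in> module_hom R (fm R p) (fm R r) \<and>
      (n = 0 \<longrightarrow> r = q \<and> f ` carrier (fm R p) = K))" for n :: nat and s :: "nat \<times> nat \<times> ((nat \<Rightarrow> 'a) \<Rightarrow> nat \<Rightarrow> 'a)"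
  have "\<exists>s. \<forall>n. I n (s n) \<and> (fst (snd (s (Suc n))) = fst (s n) \<and>
      snd (snd (s (Suc n))) ` carrier (fm R (fst (s (Suc n)))) =
        {v \<in> carrier (fm R (fst (s n))). snd (snd (s n)) v \<in> {\<zero>\<^bsub>fm R (fst (snd (s n)))\<^esub>}})"
  proof (rule dependent_nat_choice)
    show "\<exists>s. I 0 s" using ex[OF K] unfolding I_def by auto
  next
    fix s n assume "I n s"
    then obtain p r f where s: "s = (p, r, f)" "f \<in> module_hom R (fm R p) (fm R r)" unfolding I_def by (cases s) auto
    interpret F: module R "fm R r" by (rule fm_module)
    obtain p' f' where "f' \<in> module_hom R (fm R p') (fm R p)"
      "f' ` carrier (fm R p') = {v \<in> carrier (fm R p). f v \<in> {\<zero>\<^bsub>fm R r\<^esub>}}"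
      using ex[OF vimage_submodule[OF fm_module fm_module s(2) F.zero_submodule]] by blast
    then show "\<exists>s'. I (Suc n) s' \<and> (fst (snd s') = fst s \<and> snd (snd s') ` carrier (fm R (fst s')) =
        {v \<in> carrier (fm R (fst s)). snd (snd s) v \<in> {\<zero>\<^bsub>fm R (fst (snd s))\<^esub>}})"
      unfolding I_def s(1) by (intro exI[of _ "(p', p, f')"]) simp
  qed
  then obtain s where s: "\<And>n. I n (s n)" "\<And>n. fst (snd (s (Suc n))) = fst (s n)"
      "\<And>n. snd (snd (s (Suc n))) ` carrier (fm R (fst (s (Suc n)))) =
        {v \<in> carrier (fm R (fst (s n))). snd (snd (s n)) v \<in> {\<zero>\<^bsub>fm R (fst (snd (s n)))\<^esub>}}" by blast
  define p where "p n = fst (snd (s n))" for n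
  have p: "fst (s n) = p (Suc n)" for n unfolding p_def s(2) ..
  have D: "snd (snd (s i)) \<in> module_hom R (fm R (p (Suc i))) (fm R (p i))" for i
    using s(1)[of i] unfolding I_def p[symmetric] by (simp add: split_def p_def)
  have D0: "p 0 = q" "snd (snd (s 0)) ` carrier (fm R (p (Suc 0))) = K"
    using s(1)[of 0] unfolding I_def p[symmetric] by (simp_all add: split_def p_def)
  have DS: "snd (snd (s (Suc i))) ` carrier (fm R (p (Suc (Suc i)))) =
      {v \<in> carrier (fm R (p (Suc i))). snd (snd (s i)) v = \<zero>\<^bsub>fm R (p i)\<^esub>}" for i
    using s(3)[of i] unfolding p singleton_iff p_def[symmetric] .
  show ?thesis by (rule that[OF D0(1) D D0(2) DS])
qed

text \<open>The cosets of the zero submodule are singletons of vectors, so this quotient is a copy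
  of the free module in the type that \<open>projective_module\<close> prescribes.\<close>

lemma quot_module_fm_zero:
  fixes R :: "('a, 'm) ring_scheme" and p :: nat
  assumes "cring R"
  defines "q \<equiv> (\<lambda>v. {\<lambda>_. \<zero>\<^bsub>R\<^esub>} +>\<^bsub>fm R p\<^esub> v)" and "Q \<equiv> quot_module (fm R p) {\<lambda>_. \<zero>\<^bsub>R\<^esub>}"
  shows "module R Q" "q \<in> module_hom R (fm R p) Q" "q ` carrier (fm R p) = carrier Q"
    "v \<in> carrier (fm R p) \<Longrightarrow> q v = \<zero>\<^bsub>Q\<^esub> \<Longrightarrow> v = \<zero>\<^bsub>fm R p\<^esub>" "projective_module R Q"
proof -
  interpret cring R by fact
  interpret F: module R "fm R p" by (rule fm_module)
  have Z: "submodule {\<lambda>_. \<zero>\<^bsub>R\<^esub>} R (fm R p)" using F.zero_submodule by simp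
  show Q: "module R Q" unfolding Q_def by (rule quot_module_module[OF fm_module Z])
  show q: "q \<in> module_hom R (fm R p) Q" unfolding q_def Q_def by (rule coset_module_hom[OF fm_module Z])
  show qs: "q ` carrier (fm R p) = carrier Q" unfolding q_def Q_def by (rule carrier_quot_module[OF fm_module Z, symmetric])
  show q0: "v = \<zero>\<^bsub>fm R p\<^esub>" if "v \<in> carrier (fm R p)" "q v = \<zero>\<^bsub>Q\<^esub>" for v
    using coset_eq_zero_iff[OF fm_module Z that(1)] that(2) unfolding q_def Q_def by simp
  show "projective_module R Q"
    unfolding projective_module_def
  proof (intro conjI allI impI; (elim conjE)?)
    fix A B :: "('a, 'a univ) module" and g f
    assume A: "module R A" and B: "module R B" and g: "g \<in> module_hom R A B" "g ` carrier A = carrier B"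
      and f: "f \<in> module_hom R Q B"
    obtain h where h: "h \<in> module_hom R (fm R p) A" "\<And>v. v \<in> carrier (fm R p) \<Longrightarrow> g (h v) = f (q v)"
    proof (rule liftsE[OF free_lifts[OF A B g(1)] module_hom_comp[OF q f]])
      fix v assume "v \<in> carrier (fm R p)"
      then show "f (q v) \<in> g ` carrier A" unfolding g(2) by (intro module_homD(1)[OF f] module_homD(1)[OF q])
    qed (rule that)
    have k: "h v = \<zero>\<^bsub>A\<^esub>" if "v \<in> carrier (fm R p)" "q v = \<zero>\<^bsub>Q\<^esub>" for v
      unfolding q0[OF that] by (rule module_hom_zero[OF fm_module A h(1)])
    obtain h' where h': "h' \<in> module_hom R Q A" "\<And>v. v \<in> carrier (fm R p) \<Longrightarrow> h' (q v) = h v"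
      by (rule factor_hom[OF fm_module Q A q qs h(1) k]) (assumption+, rule that)
    have "g (h' x) = f x" if xQ: "x \<in> carrier Q" for x
    proof -
      obtain v where v: "v \<in> carrier (fm R p)" "x = q v" using xQ unfolding qs[symmetric] by (rule imageE)
      show ?thesis unfolding v(2) h'(2)[OF v(1)] by (rule h(2)[OF v(1)])
    qed
    then show "\<exists>h\<in>module_hom R Q A. \<forall>x\<in>carrier Q. g (h x) = f x" by (intro bexI[OF _ h'(1)] ballI)
  qed (rule Q)
qed

text \<open>\<open>Ext\<close> takes a resolution by \<open>SOME\<close>, which says nothing until
  one exists in exactly that type. A free resolution is therefore moved term by term to the copies
  of \<open>quot_module_fm_zero\<close>.\<close>

lemma projective_resolution_exists:
  fixes R :: "('a, 'm) ring_scheme"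
  assumes R: "noetherian_ring R" and fg: "fg_module R M"
  shows "\<exists>P d e. projective_resolution R M P d e"
proof -
  have M: "module R M" using fg by (simp add: fg_module_def)
  interpret M: module R M by (rule M)
  obtain r g where g: "\<And>i. i < r \<Longrightarrow> g i \<in> carrier M" "lc M g r ` carrier (fm R r) = carrier M"
    by (rule fg_module_generators[OF fg]) (rule that)
  have lg: "lc M g r \<in> module_hom R (fm R r) M" by (rule lc_module_hom[OF M g(1)])
  have K: "submodule {v \<in> carrier (fm R r). lc M g r v \<in> {\<zero>\<^bsub>M\<^esub>}} R (fm R r)"
    by (rule vimage_submodule[OF M.R.fm_module M lg M.zero_submodule])
  obtain p D where p0: "p 0 = r" and D: "\<And>i. D i \<in> module_hom R (fm R (p (Suc i))) (fm R (p i))"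
    "D 0 ` carrier (fm R (p (Suc 0))) = {v \<in> carrier (fm R r). lc M g r v \<in> {\<zero>\<^bsub>M\<^esub>}}"
    "\<And>i. D (Suc i) ` carrier (fm R (p (Suc (Suc i)))) = {v \<in> carrier (fm R (p (Suc i))). D i v = \<zero>\<^bsub>fm R (p i)\<^esub>}"
    by (rule free_resolution_exists[OF M.R.is_cring R K]) (rule that)
  define P where "P i = quot_module (fm R (p i)) {\<lambda>_. \<zero>\<^bsub>R\<^esub>}" for i
  define q where "q i v = {\<lambda>_. \<zero>\<^bsub>R\<^esub>} +>\<^bsub>fm R (p i)\<^esub> v" for i v
  have q: "module R (P i)" "q i \<in> module_hom R (fm R (p i)) (P i)" "q i ` carrier (fm R (p i)) = carrier (P i)"
    "\<And>v. v \<in> carrier (fm R (p i)) \<Longrightarrow> q i v = \<zero>\<^bsub>P i\<^esub> \<Longrightarrow> v = \<zero>\<^bsub>fm R (p i)\<^esub>" "projective_module R (P i)" for i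
    unfolding q_def P_def using quot_module_fm_zero[OF M.R.is_cring, where p = "p i"] by blast+
  note F = M.R.fm_module
  have "\<exists>d. d \<in> module_hom R (P (Suc i)) (P i) \<and> (\<forall>v\<in>carrier (fm R (p (Suc i))). d (q (Suc i) v) = q i (D i v))" for i
  proof -
    have k: "q i (D i v) = \<zero>\<^bsub>P i\<^esub>" if "v \<in> carrier (fm R (p (Suc i)))" "q (Suc i) v = \<zero>\<^bsub>P (Suc i)\<^esub>" for v
      unfolding q(4)[OF that] module_hom_zero[OF F F D(1)] by (rule module_hom_zero[OF F q(1,2)])
    obtain d where "d \<in> module_hom R (P (Suc i)) (P i)"
      "\<And>v. v \<in> carrier (fm R (p (Suc i))) \<Longrightarrow> d (q (Suc i) v) = q i (D i v)"
      by (rule factor_hom[OF F q(1,1,2,3) module_hom_comp[OF D(1) q(2)] k]) (assumption+, rule that)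
    then show ?thesis by blast
  qed
  then obtain d where d: "\<And>i. d i \<in> module_hom R (P (Suc i)) (P i)"
    "\<And>i v. v \<in> carrier (fm R (p (Suc i))) \<Longrightarrow> d i (q (Suc i) v) = q i (D i v)" by metis
  have lg': "lc M g r \<in> module_hom R (fm R (p 0)) M" unfolding p0 by (rule lg)
  have k0: "lc M g r v = \<zero>\<^bsub>M\<^esub>" if "v \<in> carrier (fm R (p 0))" "q 0 v = \<zero>\<^bsub>P 0\<^esub>" for v
    unfolding q(4)[OF that] p0 by (rule module_hom_zero[OF F M lg])
  obtain e where e: "e \<in> module_hom R (P 0) M" "\<And>v. v \<in> carrier (fm R (p 0)) \<Longrightarrow> e (q 0 v) = lc M g r v"
    by (rule factor_hom[OF F q(1) M q(2,3) lg' k0]) (assumption+, rule that)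
  have es: "e ` carrier (P 0) = carrier M"
    using image_cong[OF refl e(2), of "carrier (fm R (p 0))"] unfolding q(3)[symmetric] image_image g(2)[symmetric] p0 by simp
  have im: "d i ` carrier (P (Suc i)) = q i ` (D i ` carrier (fm R (p (Suc i))))" for i
    unfolding q(3)[symmetric] image_image by (rule image_cong[OF refl d(2)])
  have ker: "q i ` {v \<in> carrier (fm R (p i)). f v = z} = {x \<in> carrier (P i). f' x = z'}"
    if "\<And>v. v \<in> carrier (fm R (p i)) \<Longrightarrow> f' (q i v) = z' \<longleftrightarrow> f v = z" for i f z and f' :: "'a univ \<Rightarrow> 'd" and z'
    unfolding q(3)[symmetric] using that by blast
  have qz: "q i v = \<zero>\<^bsub>P i\<^esub> \<longleftrightarrow> v = \<zero>\<^bsub>fm R (p i)\<^esub>" if "v \<in> carrier (fm R (p i))" for i v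
    using q(4)[OF that] module_hom_zero[OF F q(1,2)] by blast
  have "D 0 ` carrier (fm R (p (Suc 0))) = {v \<in> carrier (fm R (p 0)). lc M g r v = \<zero>\<^bsub>M\<^esub>}"
    unfolding D(2) p0 singleton_iff ..
  then have "d 0 ` carrier (P (Suc 0)) = {x \<in> carrier (P 0). e x = \<zero>\<^bsub>M\<^esub>}"
    unfolding im by (elim ssubst) (rule ker, simp only: e(2))
  moreover have "d (Suc n) ` carrier (P (Suc (Suc n))) = {x \<in> carrier (P (Suc n)). d n x = \<zero>\<^bsub>P n\<^esub>}" for n
    unfolding im D(3) by (rule ker) (simp only: d(2) qz module_homD(1)[OF D(1)])
  ultimately have "projective_resolution R M P d e"
    unfolding projective_resolution_def a_kernel_def' using q(5) e(1) d(1) es by simp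
  then show ?thesis by blast
qed

lemma projective_resolution_imp_resolution:
  assumes "module R M" "projective_resolution R M P d e"
  shows "resolution R M P d e"
  using assms unfolding projective_resolution_def resolution_def a_kernel_def' projective_module_def by simp

section \<open>Annihilators of Ext\<close>

lemma annihilator_quot_module:
  fixes M :: "('a, 'b) module"
  assumes M: "module R M" and K: "submodule K R M"
  shows "a \<in> annihilator R (quot_module M K) \<longleftrightarrow> a \<in> carrier R \<and> (\<forall>x\<in>carrier M. a \<odot>\<^bsub>M\<^esub> x \<in> K)"
proof (cases "a \<in> carrier R")
  case True
  interpret module R M by fact
  have "a \<odot>\<^bsub>quot_module M K\<^esub> (K +>\<^bsub>M\<^esub> x) = \<zero>\<^bsub>quot_module M K\<^esub> \<longleftrightarrow> a \<odot>\<^bsub>M\<^esub> x \<in> K" if x: "x \<in> carrier M" for x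
    using coset_eq_zero_iff[OF M K smult_closed[OF True x]] module_homD(3)[OF coset_module_hom[OF M K] True x] by simp
  then show ?thesis using True unfolding annihilator_def carrier_quot_module[OF M K] by simp
qed (simp add: annihilator_def)

context
  fixes R :: "('a, 'm) ring_scheme" and P :: "nat \<Rightarrow> ('a, 'b) module" and N :: "('a, 'c) module" and d
  assumes P: "\<And>n. module R (P n)" and N: "module R N" and d: "\<And>n. d n \<in> module_hom R (P (Suc n)) (P n)"
begin

interpretation N: module R N by (rule N)

lemma coboundary_module_hom:
  "coboundary P d n \<in> module_hom R (hom_module R (P n) N) (hom_module R (P (Suc n)) N)"
proof -
  interpret P: module R "P n" by (rule P)
  interpret P': module R "P (Suc n)" by (rule P)
  note dc = module_homD(1)[OF d]
  have "restrict (\<lambda>x. f (d n x)) (carrier (P (Suc n))) \<in> module_hom R (P (Suc n)) N" if "f \<in> module_hom R (P n) N" for f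
    unfolding module_hom_restrict[OF P] by (rule module_hom_comp[OF d that])
  then show ?thesis
    using dc unfolding module_hom_def[of R "hom_module R (P n) N"] coboundary_def
    by (auto simp: hom_module_def fun_eq_iff)
qed

lemma cocycles_submodule: "submodule (cocycles R P d N n) R (hom_module R (P n) N)"
proof -
  interpret H: module R "hom_module R (P (Suc n)) N" by (rule hom_module_module[OF P N])
  have "cocycles R P d N n = {f \<in> carrier (hom_module R (P n) N). coboundary P d n f \<in> {\<zero>\<^bsub>hom_module R (P (Suc n)) N\<^esub>}}"
    by (simp add: cocycles_def a_kernel_def')
  then show ?thesis
    using vimage_submodule[OF hom_module_module[OF P N] hom_module_module[OF P N] coboundary_module_hom H.zero_submodule]
    by simp
qed

lemma mem_cocycles:
  "f \<in> cocycles R P d N n \<longleftrightarrow> f \<in> module_hom R (P n) N \<and> f \<in> extensional (carrier (P n)) \<and>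
     (\<forall>x\<in>carrier (P (Suc n)). f (d n x) = \<zero>\<^bsub>N\<^esub>)"
  by (auto simp: cocycles_def a_kernel_def' coboundary_def hom_module_def fun_eq_iff restrict_def)

lemma annihilator_hom_cohomology_Suc:
  assumes dd: "\<And>x. x \<in> carrier (P (Suc (Suc k))) \<Longrightarrow> d k (d (Suc k) x) = \<zero>\<^bsub>P k\<^esub>"
  shows "a \<in> annihilator R (hom_cohomology R P d N (Suc k)) \<longleftrightarrow> a \<in> carrier R \<and> kills R P d N k a"
proof -
  let ?H = "\<lambda>n. hom_module R (P n) N"
  note H = hom_module_module[OF P N]
  have B: "submodule (coboundary P d k ` carrier (?H k)) R (?H (Suc k))"
    by (rule image_submodule[OF H H coboundary_module_hom module.carrier_is_submodule[OF H]])
  have "coboundary P d k f \<in> cocycles R P d N (Suc k)" if f: "f \<in> carrier (?H k)" for f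
  proof -
    have "f \<zero>\<^bsub>P k\<^esub> = \<zero>\<^bsub>N\<^esub>" using f by (intro module_hom_zero[OF P N]) (simp add: hom_module_def)
    moreover have "coboundary P d k f \<in> carrier (?H (Suc k))" by (rule module_homD(1)[OF coboundary_module_hom f])
    ultimately show ?thesis
      unfolding mem_cocycles using module_homD(1)[OF d] dd by (simp add: hom_module_def coboundary_def)
  qed
  then have B': "submodule (coboundary P d k ` carrier (?H k)) R (?H (Suc k)\<lparr>carrier := cocycles R P d N (Suc k)\<rparr>)"
    by (intro submodule_restrict[OF H cocycles_submodule B] image_subsetI)
  \<comment> \<open>\<open>hom_module\<close> contains only maps that are extensional on the domain;
    the passage to arbitrary homomorphisms is by \<open>restrict\<close>.\<close>
  have iff: "(\<exists>f\<in>carrier (?H k). a \<odot>\<^bsub>?H (Suc k)\<^esub> z = coboundary P d k f) \<longleftrightarrow>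
      (\<exists>w\<in>module_hom R (P k) N. \<forall>x\<in>carrier (P (Suc k)). w (d k x) = a \<odot>\<^bsub>N\<^esub> z x)" for z
  proof
    assume "\<exists>f\<in>carrier (?H k). a \<odot>\<^bsub>?H (Suc k)\<^esub> z = coboundary P d k f"
    then obtain f where f: "f \<in> carrier (?H k)" "a \<odot>\<^bsub>?H (Suc k)\<^esub> z = coboundary P d k f" by blast
    have "f (d k x) = a \<odot>\<^bsub>N\<^esub> z x" if "x \<in> carrier (P (Suc k))" for x
      using fun_cong[OF f(2), of x] that by (simp add: hom_module_def coboundary_def)
    then show "\<exists>w\<in>module_hom R (P k) N. \<forall>x\<in>carrier (P (Suc k)). w (d k x) = a \<odot>\<^bsub>N\<^esub> z x"
      using f(1) by (intro bexI[of _ f]) (auto simp: hom_module_def)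
  next
    assume "\<exists>w\<in>module_hom R (P k) N. \<forall>x\<in>carrier (P (Suc k)). w (d k x) = a \<odot>\<^bsub>N\<^esub> z x"
    then obtain w where w: "w \<in> module_hom R (P k) N" "\<And>x. x \<in> carrier (P (Suc k)) \<Longrightarrow> w (d k x) = a \<odot>\<^bsub>N\<^esub> z x" by blast
    have "restrict w (carrier (P k)) \<in> carrier (?H k)"
      using iffD2[OF module_hom_restrict[OF P] w(1)] by (simp add: hom_module_def)
    moreover have "a \<odot>\<^bsub>?H (Suc k)\<^esub> z = coboundary P d k (restrict w (carrier (P k)))"
      using w(2) module_homD(1)[OF d] by (auto simp: hom_module_def coboundary_def fun_eq_iff)
    ultimately show "\<exists>f\<in>carrier (?H k). a \<odot>\<^bsub>?H (Suc k)\<^esub> z = coboundary P d k f" by blast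
  qed
  have ann: "a \<in> annihilator R (hom_cohomology R P d N (Suc k)) \<longleftrightarrow> a \<in> carrier R \<and>
      (\<forall>z\<in>cocycles R P d N (Suc k). a \<odot>\<^bsub>?H (Suc k)\<^esub> z \<in> coboundary P d k ` carrier (?H k))"
    using annihilator_quot_module[OF submodule.submodule_is_module[OF cocycles_submodule H] B', of a]
    unfolding hom_cohomology_def coboundaries.simps by simp
  show ?thesis
  proof (intro iffI conjI)
    assume "a \<in> annihilator R (hom_cohomology R P d N (Suc k))"
    then have a: "a \<in> carrier R" and *: "\<And>z. z \<in> cocycles R P d N (Suc k) \<Longrightarrow> a \<odot>\<^bsub>?H (Suc k)\<^esub> z \<in> coboundary P d k ` carrier (?H k)"
      unfolding ann by blast+
    show "a \<in> carrier R" by (rule a)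
    show "kills R P d N k a"
      unfolding kills_def
    proof (intro ballI impI)
      fix z assume z: "z \<in> module_hom R (P (Suc k)) N" "\<forall>x\<in>carrier (P (Suc (Suc k))). z (d (Suc k) x) = \<zero>\<^bsub>N\<^esub>"
      let ?z = "restrict z (carrier (P (Suc k)))"
      have "?z \<in> cocycles R P d N (Suc k)"
        unfolding mem_cocycles module_hom_restrict[OF P] using z module_homD(1)[OF d] by simp
      from *[OF this] have "\<exists>f\<in>carrier (?H k). a \<odot>\<^bsub>?H (Suc k)\<^esub> ?z = coboundary P d k f" by (simp only: image_iff)
      then show "\<exists>w\<in>module_hom R (P k) N. \<forall>x\<in>carrier (P (Suc k)). w (d k x) = a \<odot>\<^bsub>N\<^esub> z x" unfolding iff by simp
    qed
  next
    assume a: "a \<in> carrier R \<and> kills R P d N k a"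
    show "a \<in> annihilator R (hom_cohomology R P d N (Suc k))"
      unfolding ann
    proof (intro conjI ballI)
      show "a \<in> carrier R" using a by (rule conjunct1)
      fix z assume z: "z \<in> cocycles R P d N (Suc k)"
      show "a \<odot>\<^bsub>?H (Suc k)\<^esub> z \<in> coboundary P d k ` carrier (?H k)"
        unfolding image_iff iff using conjunct2[OF a] z unfolding kills_def mem_cocycles by blast
    qed
  qed
qed

text \<open>Degree 0 cocycles are the homomorphisms that vanish on boundaries, and the only
  coboundary is zero. It is applied to the augmentation.\<close>

lemma annihilator_hom_cohomology_0:
  assumes a: "a \<in> annihilator R (hom_cohomology R P d N 0)" and f: "f \<in> module_hom R (P 0) N"
    "\<And>x. x \<in> carrier (P (Suc 0)) \<Longrightarrow> f (d 0 x) = \<zero>\<^bsub>N\<^esub>" and x: "x \<in> carrier (P 0)"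
  shows "a \<odot>\<^bsub>N\<^esub> f x = \<zero>\<^bsub>N\<^esub>"
proof -
  let ?H = "hom_module R (P 0) N" and ?f = "restrict f (carrier (P 0))"
  note H = hom_module_module[OF P N]
  note Z = submodule.submodule_is_module[OF cocycles_submodule[of 0] H]
  have S: "submodule {\<zero>\<^bsub>?H\<^esub>} R (?H\<lparr>carrier := cocycles R P d N 0\<rparr>)"
    using module.zero_submodule[OF Z] by simp
  have "?f \<in> cocycles R P d N 0"
    unfolding mem_cocycles module_hom_restrict[OF P] using f module_homD(1)[OF d] by simp
  then have "a \<odot>\<^bsub>?H\<^esub> ?f = \<zero>\<^bsub>?H\<^esub>"
    using a annihilator_quot_module[OF Z S, of a] unfolding hom_cohomology_def coboundaries.simps by simp
  from fun_cong[OF this, of x] show ?thesis using x by (simp add: hom_module_def)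
qed

end

section \<open>From annihilators of Ext to homotopies\<close>

lemma Ext_eq:
  assumes R: "noetherian_ring R" and fg: "fg_module R M"
  obtains P d e where "projective_resolution R M P d e" "resolution R M P d e"
    "\<And>n. Ext R n M N = hom_cohomology R P d N n"
proof -
  let ?s = "SOME (P, d, e). projective_resolution R M P d e"
  obtain P d e where s: "?s = (P, d, e)" by (cases ?s) auto
  have "\<exists>s. case s of (P, d, e) \<Rightarrow> projective_resolution R M P d e"
    using projective_resolution_exists[OF R fg] by auto
  from someI_ex[OF this] have p: "projective_resolution R M P d e" unfolding s by simp
  then show ?thesis
    using that[OF p] projective_resolution_imp_resolution[of R M P d e] fg s by (simp add: Ext_def fg_module_def)
qed

lemma annihilator_Ext_Suc:
  assumes R: "noetherian_ring R" and fg: "fg_module R M" and N: "module R N"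
  obtains P d e where "projective_resolution R M P d e" "resolution R M P d e"
    "\<And>k a. a \<in> annihilator R (Ext R (Suc k) M N) \<longleftrightarrow> a \<in> carrier R \<and> kills R P d N k a"
proof -
  obtain P d e where P: "projective_resolution R M P d e" "resolution R M P d e"
    "\<And>n. Ext R n M N = hom_cohomology R P d N n"
    by (rule Ext_eq[OF R fg]) (rule that)
  note r = resolutionD[OF P(2)]
  show ?thesis
    by (rule that[OF P(1,2)], unfold P(3))
      (rule annihilator_hom_cohomology_Suc[where P = P and d = d, OF r(2) N r(4) resolution_zero(2)[OF P(2)]], assumption)
qed

lemma kills_zero:
  assumes "module R N" shows "kills R P d N k \<zero>\<^bsub>R\<^esub>"
proof -
  interpret N: module R N by fact
  have "(\<lambda>x. \<zero>\<^bsub>N\<^esub>) \<in> module_hom R (P k) N" by (simp add: module_hom_def)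
  moreover have "\<zero>\<^bsub>N\<^esub> = \<zero>\<^bsub>R\<^esub> \<odot>\<^bsub>N\<^esub> z x" if "z \<in> module_hom R (P (Suc k)) N" "x \<in> carrier (P (Suc k))" for z x
    using module_homD(1)[OF that] by simp
  ultimately show ?thesis unfolding kills_def by (intro ballI impI bexI[of _ "\<lambda>x. \<zero>\<^bsub>N\<^esub>"])
qed

text \<open>Serves degree 0, where an annihilator is zero and its image has to be found in some
  \<open>ca_n\<close> of the Henselization.\<close>

lemma zero_in_ca_n:
  assumes "cring R" "noetherian_ring R" shows "\<zero>\<^bsub>R\<^esub> \<in> ca_n R (Suc k)"
proof -
  interpret cring R by fact
  have "\<zero>\<^bsub>R\<^esub> \<in> annihilator R (Ext R (Suc k) M N)" if fg: "fg_module R M" "fg_module R N" for M N :: "('a, 'a univ) module"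
  proof -
    have N: "module R N" using fg(2) by (simp add: fg_module_def)
    obtain P d e where "projective_resolution R M P d e" "resolution R M P d e" "\<And>k a. a \<in> annihilator R (Ext R (Suc k) M N) \<longleftrightarrow> a \<in> carrier R \<and> kills R P d N k a"
      by (rule annihilator_Ext_Suc[OF assms(2) fg(1) N]) (rule that)
    then show ?thesis using kills_zero[OF N] by simp
  qed
  then show ?thesis unfolding ca_n_def by simp
qed

lemma fg_quot_module:
  assumes "cring R" and K: "submodule K R (fm R p)"
  shows "fg_module R (quot_module (fm R p) K)"
proof -
  interpret cring R by fact
  interpret F: module R "fm R p" by (rule fm_module)
  let ?Q = "quot_module (fm R p) K" and ?q = "\<lambda>v. K +>\<^bsub>fm R p\<^esub> v"
  have Q: "module R ?Q" by (rule quot_module_module[OF fm_module K])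
  have q: "?q \<in> module_hom R (fm R p) ?Q" by (rule coset_module_hom[OF fm_module K])
  interpret Q: module R ?Q by (rule Q)
  have "H = carrier ?Q" if H: "submodule H R ?Q" "(\<lambda>j. ?q (unit_vec R j)) ` {..<p} \<subseteq> H" for H
  proof
    show "H \<subseteq> carrier ?Q" by (rule Q.submoduleD(1)[OF H(1)])
    show "carrier ?Q \<subseteq> H"
      unfolding carrier_quot_module[OF fm_module K]
    proof (rule image_subsetI)
      fix v assume v: "v \<in> carrier (fm R p)"
      have "?q v = lc ?Q (\<lambda>i. ?q (unit_vec R i)) p v" by (rule fm_hom_eq_lc[OF Q q v])
      also have "\<dots> \<in> H" using H(2) v by (intro Q.lc_in_submodule[OF H(1)] Q.submoduleD(3)[OF H(1)]) auto
      finally show "?q v \<in> H" .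
    qed
  qed
  moreover have "(\<lambda>j. ?q (unit_vec R j)) ` {..<p} \<subseteq> carrier ?Q"
    using module_homD(1)[OF q] by auto
  ultimately show ?thesis unfolding fg_module_def using Q by (intro conjI exI[of _ "(\<lambda>j. ?q (unit_vec R j)) ` {..<p}"]) auto
qed

text \<open>Test on a copy of \<open>R\<close> for both arguments: the augmentation of its
  resolution is a degree 0 cocycle that attains the class of the unit vector.\<close>

lemma ca_0_eq_zero:
  assumes R: "cring R" "noetherian_ring R" and a: "a \<in> ca_n R 0"
  shows "a = \<zero>\<^bsub>R\<^esub>"
proof -
  interpret cring R by fact
  interpret F: module R "fm R 1" by (rule fm_module)
  let ?M = "quot_module (fm R 1) {\<lambda>_. \<zero>\<^bsub>R\<^esub>}" and ?q = "\<lambda>v. {\<lambda>_. \<zero>\<^bsub>R\<^esub>} +>\<^bsub>fm R 1\<^esub> v"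
  have K: "submodule {\<lambda>_. \<zero>\<^bsub>R\<^esub>} R (fm R 1)" using F.zero_submodule by simp
  note M = quot_module_fm_zero[OF R(1), where p = 1]
  have fg: "fg_module R ?M" by (rule fg_quot_module[OF R(1) K])
  have ac: "a \<in> carrier R" and an: "a \<in> annihilator R (Ext R 0 ?M ?M)" using a fg unfolding ca_n_def by auto
  obtain P d e where P: "resolution R ?M P d e" "\<And>n. Ext R n ?M ?M = hom_cohomology R P d ?M n"
    by (rule Ext_eq[OF R(2) fg]) (rule that)
  note r = resolutionD[OF P(1)]
  have u: "unit_vec R 0 \<in> carrier (fm R 1)" by simp
  obtain x where x: "x \<in> carrier (P 0)" "?q (unit_vec R 0) = e x"
    using module_homD(1)[OF M(2) u] unfolding r(5)[symmetric] by (rule imageE) (rule that)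
  have "a \<odot>\<^bsub>?M\<^esub> e x = \<zero>\<^bsub>?M\<^esub>"
    by (rule annihilator_hom_cohomology_0[OF r(2) M(1) r(4) an[unfolded P(2)] r(3) resolution_zero(1)[OF P(1)] x(1)])
  then have "?q (a \<odot>\<^bsub>fm R 1\<^esub> unit_vec R 0) = \<zero>\<^bsub>?M\<^esub>"
    unfolding x(2)[symmetric] module_homD(3)[OF M(2) ac u] .
  then have "a \<odot>\<^bsub>fm R 1\<^esub> unit_vec R 0 = \<zero>\<^bsub>fm R 1\<^esub>" by (rule M(4)[OF F.smult_closed[OF ac u]])
  from fun_cong[OF this, of 0] show ?thesis using ac by (simp add: unit_vec_def)
qed

lemma free_resolution:
  fixes R :: "('a, 'm) ring_scheme"
  assumes R: "cring R" and K: "submodule K R (fm R (q 0))"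
    and D: "\<And>i. D i \<in> module_hom R (fm R (q (Suc i))) (fm R (q i))" "D 0 ` carrier (fm R (q (Suc 0))) = K"
      "\<And>i. D (Suc i) ` carrier (fm R (q (Suc (Suc i)))) = {v \<in> carrier (fm R (q (Suc i))). D i v = \<zero>\<^bsub>fm R (q i)\<^esub>}"
  shows "resolution R (quot_module (fm R (q 0)) K) (\<lambda>i. fm R (q i)) D (\<lambda>v. K +>\<^bsub>fm R (q 0)\<^esub> v)"
proof -
  interpret cring R by fact
  interpret F: module R "fm R (q 0)" by (rule fm_module)
  have "K = {v \<in> carrier (fm R (q 0)). K +>\<^bsub>fm R (q 0)\<^esub> v = \<zero>\<^bsub>quot_module (fm R (q 0)) K\<^esub>}"
    using coset_eq_zero_iff[OF fm_module K] F.submoduleD(1)[OF K] by blast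
  then show ?thesis
    unfolding resolution_def using fm_module quot_module_module[OF fm_module K] coset_module_hom[OF fm_module K]
      carrier_quot_module[OF fm_module K] D by simp
qed

text \<open>A cocycle \<open>z\<close> kills the summand of \<open>a\<close> that ends in a
  boundary, so \<open>a z\<close> is the coboundary of \<open>z K1\<close>.\<close>

lemma kills_if_homotopy:
  assumes P: "\<And>n. module R (P n)" and N: "module R N" and d: "\<And>n. d n \<in> module_hom R (P (Suc n)) (P n)"
    and K: "K1 \<in> module_hom R (P k) (P (Suc k))" "K2 \<in> module_hom R (P (Suc k)) (P (Suc (Suc k)))"
    and a: "a \<in> carrier R" "\<And>x. x \<in> carrier (P (Suc k)) \<Longrightarrow> a \<odot>\<^bsub>P (Suc k)\<^esub> x = K1 (d k x) \<oplus>\<^bsub>P (Suc k)\<^esub> d (Suc k) (K2 x)"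
  shows "kills R P d N k a"
  unfolding kills_def
proof (intro ballI impI)
  interpret N: module R N by fact
  fix z assume z: "z \<in> module_hom R (P (Suc k)) N" "\<forall>x\<in>carrier (P (Suc (Suc k))). z (d (Suc k) x) = \<zero>\<^bsub>N\<^esub>"
  show "\<exists>w\<in>module_hom R (P k) N. \<forall>x\<in>carrier (P (Suc k)). w (d k x) = a \<odot>\<^bsub>N\<^esub> z x"
  proof (intro bexI[of _ "\<lambda>x. z (K1 x)"] ballI)
    show "(\<lambda>x. z (K1 x)) \<in> module_hom R (P k) N" by (rule module_hom_comp[OF K(1) z(1)])
    fix x assume x: "x \<in> carrier (P (Suc k))"
    have c: "K1 (d k x) \<in> carrier (P (Suc k))" "K2 x \<in> carrier (P (Suc (Suc k)))"
      using module_homD(1)[OF K(1) module_homD(1)[OF d x]] module_homD(1)[OF K(2) x] by auto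
    have "a \<odot>\<^bsub>N\<^esub> z x = z (K1 (d k x)) \<oplus>\<^bsub>N\<^esub> z (d (Suc k) (K2 x))"
      unfolding module_homD(3)[OF z(1) a(1) x, symmetric] a(2)[OF x]
      by (rule module_homD(2)[OF z(1) c(1) module_homD(1)[OF d c(2)]])
    then show "z (K1 (d k x)) = a \<odot>\<^bsub>N\<^esub> z x" using z(2) c module_homD(1)[OF z(1) c(1)] by simp
  qed
qed

text \<open>The homotopy comes from testing \<open>a\<close> on the class of the projection of the free module in degree
  \<open>Suc k\<close> onto the cokernel of the differential entering that degree.\<close>

lemma ca_n_homotopy:
  fixes R :: "('a, 'm) ring_scheme"
  assumes R: "cring R" "noetherian_ring R" and a: "a \<in> ca_n R (Suc k)" and K: "submodule K R (fm R (q 0))"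
    and D: "\<And>i. D i \<in> module_hom R (fm R (q (Suc i))) (fm R (q i))" "D 0 ` carrier (fm R (q (Suc 0))) = K"
      "\<And>i. D (Suc i) ` carrier (fm R (q (Suc (Suc i)))) = {v \<in> carrier (fm R (q (Suc i))). D i v = \<zero>\<^bsub>fm R (q i)\<^esub>}"
  obtains K1 K2 where "K1 \<in> module_hom R (fm R (q k)) (fm R (q (Suc k)))"
    "K2 \<in> module_hom R (fm R (q (Suc k))) (fm R (q (Suc (Suc k))))"
    "\<And>x. x \<in> carrier (fm R (q (Suc k))) \<Longrightarrow>
       a \<odot>\<^bsub>fm R (q (Suc k))\<^esub> x = K1 (D k x) \<oplus>\<^bsub>fm R (q (Suc k))\<^esub> D (Suc k) (K2 x)"
proof -
  interpret cring R by fact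
  let ?M = "quot_module (fm R (q 0)) K" and ?F = "\<lambda>i. fm R (q i)" and ?r = "\<lambda>v. K +>\<^bsub>fm R (q 0)\<^esub> v"
  let ?I = "D (Suc k) ` carrier (?F (Suc (Suc k)))"
  let ?N = "quot_module (?F (Suc k)) ?I" and ?z = "\<lambda>v. ?I +>\<^bsub>?F (Suc k)\<^esub> v"
  note F = fm_module
  interpret F1: module R "?F (Suc k)" by (rule F)
  have I: "submodule ?I R (?F (Suc k))" by (rule image_submodule[OF F F D(1) module.carrier_is_submodule[OF F]])
  have N: "module R ?N" by (rule quot_module_module[OF F I])
  have z: "?z \<in> module_hom R (?F (Suc k)) ?N" by (rule coset_module_hom[OF F I])
  have fr: "resolution R ?M ?F D ?r" by (rule free_resolution[OF R(1) K D])
  note f = resolutionD[OF fr]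
  note fg = fg_quot_module[OF R(1) K] fg_quot_module[OF R(1) I]
  have ac: "a \<in> carrier R" and an: "a \<in> annihilator R (Ext R (Suc k) ?M ?N)" using a fg unfolding ca_n_def by auto
  obtain P d e where P: "projective_resolution R ?M P d e" "resolution R ?M P d e"
    "\<And>k a. a \<in> annihilator R (Ext R (Suc k) ?M ?N) \<longleftrightarrow> a \<in> carrier R \<and> kills R P d ?N k a"
    by (rule annihilator_Ext_Suc[OF R(2) fg(1) N]) (rule that)
  note r = resolutionD[OF P(2)]
  have pr: "projective_module R (P n)" for n using conjunct1[OF P(1)[unfolded projective_resolution_def]] by (rule spec)
  have l1: "lifts R (?F n) (?F (Suc n)) (?F n) (D n)" for n by (rule free_lifts[OF F F D(1)])
  have l2: "lifts R (?F 0) (P 0) ?M e" by (rule free_lifts[OF r(2,1,3)])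
  have l3: "lifts R (?F (Suc n)) (P (Suc n)) (P n) (d n)" for n by (rule free_lifts[OF r(2,2,4)])
  have l4: "lifts R (P 0) (?F 0) ?M ?r" by (rule projective_lifts_vec[OF pr F f(1,3)])
  have l5: "lifts R (P (Suc n)) (?F (Suc n)) (?F n) (D n)" for n by (rule projective_lifts_vec[OF pr F F D(1)])
  have l6: "kills R P d ?N k a" by (rule conjunct2[OF iffD1[OF P(3) an]])
  \<comment> \<open>Transfer from the projective resolution behind \<open>Ext\<close> to the given
    free one.\<close>
  have kl: "kills R ?F D ?N k a"
    by (rule kills_retract[where s = "\<lambda>x. x" and p = "\<lambda>x. x" and P = ?F and d = D and F = P and D = d,
      OF fr P(2) module_hom_id module_hom_id refl l1 l2 l3 l4 l5 N ac l6])
  have "\<forall>x\<in>carrier (?F (Suc (Suc k))). ?z (D (Suc k) x) = \<zero>\<^bsub>?N\<^esub>"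
    using coset_eq_zero_iff[OF F I] module_homD(1)[OF D(1)] by blast
  then have "\<exists>w\<in>module_hom R (?F k) ?N. \<forall>x\<in>carrier (?F (Suc k)). w (D k x) = a \<odot>\<^bsub>?N\<^esub> ?z x"
    by (rule mp[OF bspec[OF kl[unfolded kills_def] z]])
  then obtain w where w: "w \<in> module_hom R (?F k) ?N" "\<And>x. x \<in> carrier (?F (Suc k)) \<Longrightarrow> w (D k x) = a \<odot>\<^bsub>?N\<^esub> ?z x"
    by fast
  \<comment> \<open>The cochain \<open>w\<close> takes values in a cokernel; it is lifted to a map
    between free modules.\<close>
  obtain K1 where K1: "K1 \<in> module_hom R (?F k) (?F (Suc k))" "\<And>x. x \<in> carrier (?F k) \<Longrightarrow> ?z (K1 x) = w x"
  proof (rule liftsE[OF free_lifts[OF F N z] w(1)])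
    fix x assume "x \<in> carrier (?F k)"
    then show "w x \<in> ?z ` carrier (?F (Suc k))"
      unfolding carrier_quot_module[OF F I, symmetric] by (rule module_homD(1)[OF w(1)])
  qed (rule that)
  \<comment> \<open>The difference \<open>a - K1 d\<close> vanishes in the cokernel because
    \<open>w d\<close> is \<open>a\<close> times the projection; so it factors through the next
    differential.\<close>
  let ?u = "\<lambda>x. a \<odot>\<^bsub>?F (Suc k)\<^esub> x \<oplus>\<^bsub>?F (Suc k)\<^esub> \<ominus>\<^bsub>?F (Suc k)\<^esub> K1 (D k x)"
  have u: "?u \<in> module_hom R (?F (Suc k)) (?F (Suc k))"
    by (intro module_hom_plus[OF F] module_hom_uminus[OF F] module_hom_smult[OF F] module_hom_id ac module_hom_comp[OF D(1) K1(1)])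
  have uI: "?u x \<in> ?I" if x: "x \<in> carrier (?F (Suc k))" for x
  proof -
    have "?z (K1 (D k x)) = ?z (a \<odot>\<^bsub>?F (Suc k)\<^esub> x)"
      unfolding K1(2)[OF module_homD(1)[OF D(1) x]] w(2)[OF x] by (rule module_homD(3)[OF z ac x, symmetric])
    then show ?thesis
      using coset_eq_iff[OF F I F1.smult_closed[OF ac x] module_homD(1)[OF K1(1) module_homD(1)[OF D(1) x]]] by blast
  qed
  obtain K2 where K2: "K2 \<in> module_hom R (?F (Suc k)) (?F (Suc (Suc k)))"
    "\<And>x. x \<in> carrier (?F (Suc k)) \<Longrightarrow> D (Suc k) (K2 x) = ?u x"
    by (rule liftsE[OF free_lifts[OF F F D(1)] u uI]) (assumption, rule that)
  have "a \<odot>\<^bsub>?F (Suc k)\<^esub> x = K1 (D k x) \<oplus>\<^bsub>?F (Suc k)\<^esub> D (Suc k) (K2 x)" if x: "x \<in> carrier (?F (Suc k))" for x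
  proof -
    have c: "a \<odot>\<^bsub>?F (Suc k)\<^esub> x \<in> carrier (?F (Suc k))" "K1 (D k x) \<in> carrier (?F (Suc k))"
      by (rule F1.smult_closed[OF ac x], rule module_homD(1)[OF K1(1) module_homD(1)[OF D(1) x]])
    have "b = c \<oplus>\<^bsub>?F (Suc k)\<^esub> (b \<oplus>\<^bsub>?F (Suc k)\<^esub> \<ominus>\<^bsub>?F (Suc k)\<^esub> c)"
      if "b \<in> carrier (?F (Suc k))" "c \<in> carrier (?F (Suc k))" for b c
      using that F1.M.a_lcomm[of c b "\<ominus>\<^bsub>?F (Suc k)\<^esub> c"] F1.M.r_neg[of c] F1.M.r_zero[of b] by (simp del: fm_simps)
    from this[OF c] show ?thesis unfolding K2(2)[OF x] .
  qed
  then show ?thesis using that K1(1) K2(1) by blast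
qed

section \<open>Base change of free resolutions to the Henselization\<close>

context henselization begin

text \<open>The base change of \<open>f\<close>: its matrix with the entries sent to
  \<open>H\<close>.\<close>

definition ext_hom :: "nat \<Rightarrow> nat \<Rightarrow> ((nat \<Rightarrow> 'a) \<Rightarrow> nat \<Rightarrow> 'a) \<Rightarrow> (nat \<Rightarrow> 'b) \<Rightarrow> nat \<Rightarrow> 'b" where
  "ext_hom q p f = lc (fm H q) (\<lambda>j i. \<phi> (f (unit_vec R j) i)) p"

context
  fixes f p q
  assumes f: "f \<in> module_hom R (fm R p) (fm R q)"
begin

lemma ext_hom: "ext_hom q p f \<in> module_hom H (fm H p) (fm H q)"
  unfolding ext_hom_def using module_homD(1)[OF f] by (intro lc_module_hom[OF H.fm_module]) simp

lemma ext_hom_\<phi>: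
  assumes v: "v \<in> carrier (fm R p)"
  shows "ext_hom q p f (\<lambda>i. \<phi> (v i)) = (\<lambda>i. \<phi> (f v i))"
proof -
  have "(\<lambda>i. \<phi> (lc (fm R q) (\<lambda>j. f (unit_vec R j)) p v i)) = ext_hom q p f (\<lambda>i. \<phi> (v i))"
    unfolding ext_hom_def using v module_homD(1)[OF f] by (intro \<phi>_lc) auto
  then show ?thesis unfolding fm_hom_eq_lc[OF R.fm_module f v] ..
qed

lemma image_ext_hom: "ext_hom q p f ` carrier (fm H p) = ext_vec q (f ` carrier (fm R p))"
proof
  interpret F: module H "fm H q" by (rule H.fm_module)
  have s: "(\<lambda>v i. \<phi> (v i)) ` f ` carrier (fm R p) \<subseteq> carrier (fm H q)" using module_homD(1)[OF f] by auto
  have E: "submodule (ext_vec q (f ` carrier (fm R p))) H (fm H q)"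
    using module_homD(1)[OF f] by (intro ext_vec_submodule) auto
  show "ext_hom q p f ` carrier (fm H p) \<subseteq> ext_vec q (f ` carrier (fm R p))"
  proof (rule image_subsetI)
    fix v assume v: "v \<in> carrier (fm H p)"
    have "(\<lambda>i. \<phi> (f (unit_vec R j) i)) \<in> ext_vec q (f ` carrier (fm R p))" if "j < p" for j
      unfolding ext_vec_def using R.unit_vec_closed[OF that] by (intro subsetD[OF F.mspan_superset[OF s]] imageI)
    then show "ext_hom q p f v \<in> ext_vec q (f ` carrier (fm R p))"
      unfolding ext_hom_def using H.mem_fm_closed[OF v]
      by (intro F.lc_in_submodule[OF E] F.submoduleD(3)[OF E])
  qed
  show "ext_vec q (f ` carrier (fm R p)) \<subseteq> ext_hom q p f ` carrier (fm H p)"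
    unfolding ext_vec_def
  proof (rule F.mspan_subset[OF image_submodule[OF H.fm_module H.fm_module ext_hom module.carrier_is_submodule[OF H.fm_module]]])
    show "(\<lambda>v i. \<phi> (v i)) ` f ` carrier (fm R p) \<subseteq> ext_hom q p f ` carrier (fm H p)"
      unfolding image_image using ext_hom_\<phi>[symmetric] by (intro image_subsetI) (simp add: image_eqI)
  qed
qed

text \<open>This is where flatness enters: \<open>flatness\<close>, applied to the columns of the
  matrix, gives one inclusion. Together with \<open>image_ext_hom\<close> it carries exactness from
  \<open>R\<close> to \<open>H\<close>.\<close>

lemma kernel_ext_hom:
  assumes "noetherian_ring R"
  shows "{y \<in> carrier (fm H p). ext_hom q p f y = \<zero>\<^bsub>fm H q\<^esub>} = ext_vec p {v \<in> carrier (fm R p). f v = \<zero>\<^bsub>fm R q\<^esub>}"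
proof
  interpret F: module H "fm H p" by (rule H.fm_module)
  have "f v = lc (fm R q) (\<lambda>j. f (unit_vec R j)) p v" if "v \<in> carrier (fm R p)" for v
    by (rule fm_hom_eq_lc[OF R.fm_module f that])
  then have eq: "{v \<in> carrier (fm R p). f v = \<zero>\<^bsub>fm R q\<^esub>} =
      {v \<in> carrier (fm R p). lc (fm R q) (\<lambda>j. f (unit_vec R j)) p v = \<zero>\<^bsub>fm R q\<^esub>}" by auto
  show "{y \<in> carrier (fm H p). ext_hom q p f y = \<zero>\<^bsub>fm H q\<^esub>} \<subseteq> ext_vec p {v \<in> carrier (fm R p). f v = \<zero>\<^bsub>fm R q\<^esub>}"
    unfolding eq ext_vec_def ext_hom_def using module_homD(1)[OF f] by (auto intro!: flatness assms simp del: fm_simps)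
  interpret G: module H "fm H q" by (rule H.fm_module)
  have "ext_vec p {v \<in> carrier (fm R p). f v = \<zero>\<^bsub>fm R q\<^esub>} \<subseteq> {y \<in> carrier (fm H p). ext_hom q p f y \<in> {\<zero>\<^bsub>fm H q\<^esub>}}"
    unfolding ext_vec_def
    by (rule F.mspan_subset[OF vimage_submodule[OF H.fm_module H.fm_module ext_hom G.zero_submodule]])
      (auto simp: ext_hom_\<phi>)
  then show "ext_vec p {v \<in> carrier (fm R p). f v = \<zero>\<^bsub>fm R q\<^esub>} \<subseteq> {y \<in> carrier (fm H p). ext_hom q p f y = \<zero>\<^bsub>fm H q\<^esub>}"
    by simp
qed

end

lemma unit_vec_\<phi>: "unit_vec H j = (\<lambda>i. \<phi> (unit_vec R j i))"
  by (simp add: unit_vec_def fun_eq_iff)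

text \<open>The unit vectors over \<open>H\<close> come from \<open>R\<close>, so identities between
  base changed maps can be checked over \<open>R\<close>.\<close>

lemma hom_eqI:
  assumes "module H M" "f \<in> module_hom H (fm H p) M" "g \<in> module_hom H (fm H p) M"
    and "\<And>j. j < p \<Longrightarrow> f (\<lambda>i. \<phi> (unit_vec R j i)) = g (\<lambda>i. \<phi> (unit_vec R j i))" and v: "v \<in> carrier (fm H p)"
  shows "f v = g v"
  unfolding fm_hom_eq_lc[OF assms(1,2) v] fm_hom_eq_lc[OF assms(1,3) v] unit_vec_\<phi> by (rule lc_cong[OF assms(4) refl])

lemma \<phi>_ca_n_Suc:
  assumes R: "noetherian_ring R" and a: "a \<in> ca_n R (Suc k)"
  shows "\<phi> a \<in> ca_n H (Suc k)"
proof -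
  have ac: "a \<in> carrier R" using a by (simp add: ca_n_def)
  then have \<phi>a: "\<phi> a \<in> carrier H" by simp
  have "\<phi> a \<in> annihilator H (Ext H (Suc k) M N)" if fg: "fg_module H M" "fg_module H N" for M N :: "('b, 'b univ) module"
  proof -
    have M: "module H M" and N: "module H N" using fg by (simp_all add: fg_module_def)
    obtain m L s p where m: "\<And>i. i < L \<Longrightarrow> m i \<in> carrier M"
      and s: "s \<in> module_hom H M (quot_module (fm H L) (ext_vec L (ker_vec M m L)))"
      and p: "p \<in> module_hom H (quot_module (fm H L) (ext_vec L (ker_vec M m L))) M"
      and ps: "\<And>x. x \<in> carrier M \<Longrightarrow> p (s x) = x"
      by (rule retract_of_extended[OF R fg(1)]) (rule that)
    let ?K = "ker_vec M m L"
    have K: "submodule ?K R (fm R L)" by (rule ker_vec_submodule[OF M m])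
    obtain q D where q: "q 0 = L" and D: "\<And>i. D i \<in> module_hom R (fm R (q (Suc i))) (fm R (q i))"
      "D 0 ` carrier (fm R (q (Suc 0))) = ?K"
      "\<And>i. D (Suc i) ` carrier (fm R (q (Suc (Suc i)))) = {v \<in> carrier (fm R (q (Suc i))). D i v = \<zero>\<^bsub>fm R (q i)\<^esub>}"
      by (rule free_resolution_exists[OF R.is_cring R K]) (rule that)
    have K': "submodule ?K R (fm R (q 0))" unfolding q by (rule K)
    obtain K1 K2 where K1: "K1 \<in> module_hom R (fm R (q k)) (fm R (q (Suc k)))"
      and K2: "K2 \<in> module_hom R (fm R (q (Suc k))) (fm R (q (Suc (Suc k))))"
      and K12: "\<And>x. x \<in> carrier (fm R (q (Suc k))) \<Longrightarrow>
         a \<odot>\<^bsub>fm R (q (Suc k))\<^esub> x = K1 (D k x) \<oplus>\<^bsub>fm R (q (Suc k))\<^esub> D (Suc k) (K2 x)"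
      by (rule ca_n_homotopy[OF R.is_cring R a K' D]) (rule that)
    let ?F = "\<lambda>i. fm H (q i)" and ?D = "\<lambda>i. ext_hom (q i) (q (Suc i)) (D i)"
    let ?K1 = "ext_hom (q (Suc k)) (q k) K1" and ?K2 = "ext_hom (q (Suc (Suc k))) (q (Suc k)) K2"
    let ?E = "quot_module (fm H (q 0)) (ext_vec (q 0) ?K)" and ?r = "\<lambda>v. ext_vec (q 0) ?K +>\<^bsub>fm H (q 0)\<^esub> v"
    note F = H.fm_module and Dh = ext_hom[OF D(1)]
    have "submodule (ext_vec (q 0) ?K) H (fm H (q 0))" by (rule ext_vec_submodule) (auto simp: ker_vec_def q)
    then have fr: "resolution H ?E ?F ?D ?r"
    proof (rule free_resolution[where q = q and D = ?D, OF H.is_cring _ Dh])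
      show "?D 0 ` carrier (?F (Suc 0)) = ext_vec (q 0) ?K" unfolding image_ext_hom[OF D(1)] D(2) ..
      show "?D (Suc i) ` carrier (?F (Suc (Suc i))) = {v \<in> carrier (?F (Suc i)). ?D i v = \<zero>\<^bsub>?F i\<^esub>}" for i
        unfolding image_ext_hom[OF D(1)] kernel_ext_hom[OF D(1) R] D(3) ..
    qed
    note f = resolutionD[OF fr]
    have s': "s \<in> module_hom H M ?E" and p': "p \<in> module_hom H ?E M" using s p unfolding q by blast+
    \<comment> \<open>Both sides are \<open>H\<close>-linear in \<open>x\<close>, and on unit
      vectors the identity is the image of \<open>K12\<close>.\<close>
    have h: "\<phi> a \<odot>\<^bsub>?F (Suc k)\<^esub> x = ?K1 (?D k x) \<oplus>\<^bsub>?F (Suc k)\<^esub> ?D (Suc k) (?K2 x)" if x: "x \<in> carrier (?F (Suc k))" for x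
    proof (rule hom_eqI[OF F _ _ _ x])
      show "(\<lambda>x. \<phi> a \<odot>\<^bsub>?F (Suc k)\<^esub> x) \<in> module_hom H (?F (Suc k)) (?F (Suc k))"
        by (rule module_hom_smult[OF F module_hom_id \<phi>a])
      show "(\<lambda>x. ?K1 (?D k x) \<oplus>\<^bsub>?F (Suc k)\<^esub> ?D (Suc k) (?K2 x)) \<in> module_hom H (?F (Suc k)) (?F (Suc k))"
        by (intro module_hom_plus[OF F] module_hom_comp[OF Dh ext_hom[OF K1]] module_hom_comp[OF ext_hom[OF K2] Dh])
      fix j assume "j < q (Suc k)"
      then have u: "unit_vec R j \<in> carrier (fm R (q (Suc k)))" by simp
      note d1 = module_homD(1)[OF D(1) u] and d2 = module_homD(1)[OF K2 u]
      note c = R.mem_fm_closed[OF module_homD(1)[OF K1 d1]] R.mem_fm_closed[OF module_homD(1)[OF D(1) d2]]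
      have "\<phi> (K1 (D k (unit_vec R j)) i) \<oplus>\<^bsub>H\<^esub> \<phi> (D (Suc k) (K2 (unit_vec R j)) i) = \<phi> a \<otimes>\<^bsub>H\<^esub> \<phi> (unit_vec R j i)" for i
        using fun_cong[OF K12[OF u], of i] c[of i] ac R.mem_fm_closed[OF u, of i] by (simp flip: \<phi>.hom_add \<phi>.hom_mult)
      then show "\<phi> a \<odot>\<^bsub>?F (Suc k)\<^esub> (\<lambda>i. \<phi> (unit_vec R j i)) =
          ?K1 (?D k (\<lambda>i. \<phi> (unit_vec R j i))) \<oplus>\<^bsub>?F (Suc k)\<^esub> ?D (Suc k) (?K2 (\<lambda>i. \<phi> (unit_vec R j i)))"
        unfolding ext_hom_\<phi>[OF D(1) u] ext_hom_\<phi>[OF K1 d1] ext_hom_\<phi>[OF K2 u] ext_hom_\<phi>[OF D(1) d2] by simp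
    qed
    have kf: "kills H ?F ?D N k (\<phi> a)"
      by (rule kills_if_homotopy[OF F N Dh ext_hom[OF K1] ext_hom[OF K2] \<phi>a h])
    obtain P d e where P: "projective_resolution H M P d e" "resolution H M P d e"
      "\<And>k a. a \<in> annihilator H (Ext H (Suc k) M N) \<longleftrightarrow> a \<in> carrier H \<and> kills H P d N k a"
      by (rule annihilator_Ext_Suc[OF noetherian_H[OF R] fg(1) N]) (rule that)
    note r = resolutionD[OF P(2)]
    have pr: "projective_module H (P n)" for n using conjunct1[OF P(1)[unfolded projective_resolution_def]] by (rule spec)
    \<comment> \<open>The base changed resolution belongs to \<open>?E\<close>. The retraction
      transfers the annihilation to the projective resolution of \<open>M\<close> behind
      \<open>Ext\<close>.\<close>
    have "kills H P d N k (\<phi> a)"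
    proof (rule kills_retract[OF P(2) fr s' p' ps _ _ _ _ _ N \<phi>a kf])
      show "lifts H (P n) (P (Suc n)) (P n) (d n)" for n by (rule projective_lifts[OF pr r(2,2,4)])
      show "lifts H (P 0) (?F 0) ?E ?r" by (rule projective_lifts_vec[OF pr F f(1,3)])
      show "lifts H (P (Suc n)) (?F (Suc n)) (?F n) (?D n)" for n by (rule projective_lifts_vec[OF pr F F Dh])
      show "lifts H (?F 0) (P 0) M e" by (rule free_lifts[OF r(2,1,3)])
      show "lifts H (?F (Suc n)) (P (Suc n)) (P n) (d n)" for n by (rule free_lifts[OF r(2,2,4)])
    qed
    then show ?thesis using P(3) \<phi>a by blast
  qed
  then show ?thesis using \<phi>a unfolding ca_n_def by simp
qed

lemma \<phi>_ca: "noetherian_ring R \<Longrightarrow> \<phi> ` ca R \<subseteq> ca H"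
proof (rule image_subsetI)
  fix a assume R: "noetherian_ring R" and "a \<in> ca R"
  then obtain n where n: "a \<in> ca_n R n" unfolding ca_def by blast
  show "\<phi> a \<in> ca H"
  proof (cases n)
    case 0
    have "\<phi> a = \<zero>\<^bsub>H\<^esub>" using ca_0_eq_zero[OF R.is_cring R n[unfolded 0]] by simp
    then show ?thesis using zero_in_ca_n[OF H.is_cring noetherian_H[OF R]] unfolding ca_def by auto
  next
    case (Suc k)
    then show ?thesis using \<phi>_ca_n_Suc[OF R] n unfolding ca_def by blast
  qed
qed

end

theorem theorem5p12:
  fixes R :: "('a, 'm) ring_scheme"
    and Rh :: "('b, 'n) ring_scheme"
    and \<phi> :: "'a \<Rightarrow> 'b"
  assumes "local_ring R"
    and "gorenstein_ring R"
    and "is_henselization R Rh \<phi>"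
  shows "\<phi> ` ca R \<subseteq> ca Rh"
  proof -
  interpret henselization R Rh \<phi> by (rule henselization.intro) fact
  show ?thesis using assms(2) by (intro \<phi>_ca) (simp add: gorenstein_ring_def)
qed

end
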